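(* Let $D$ be a finitely generated commutative $\mathsf{k}$-algebra which is a domain, $A=D(a,\sigma)$ a rank $1$ generalized Weyl algebra with $\sigma$ of infinite order, and $D(a,\sigma)^n:=A^{\otimes n}$. Let $F=\operatorname{Frac}D^{\otimes n}$. Let $G\leq S_n$, acting on $D(a,\sigma)^n$ by algebra automorphisms permuting the tensor factors. Then $(D(a,\sigma)^n)^G$ is a principal Galois order over $\Gamma=(D^{\otimes n})^G$ in $(F*\mathbb{Z}^n)^G$.
   Context: $\mathsf{k}$ is an algebraically closed field of characteristic zero; $\otimes=\otimes_{\mathsf{k}}$. A rank $1$ generalized Weyl algebra $D(a,\sigma)$ ($\sigma\in\operatorname{Aut}_{\mathsf{k}}D$, $a\in D$ regular) is generated over $D$ by $X^+,X^-$ with relations $X^+d=\sigma(d)X^+$, $X^-d=\sigma^{-1}(d)X^-$, $X^-X^+=a$, $X^+X^-=\sigma(a)$. Let $X_i^\pm\in A^{\otimes n}$, $a_i\in D^{\otimes n}$, $\sigma_i\in\operatorname{Aut}(D^{\otimes n})$ denote $X^\pm$, $a$, $\sigma$ placed in the $i$-th tensor factor. $\pi\in S_n$ acts by $\pi X_i^\pm=X_{\pi(i)}^\pm$ and by the corresponding permutation of the tensor factors of $D^{\otimes n}$ (the $i$-th factor is moved to position $\pi(i)$). $\mathbb{Z}^n$, with basis $\varepsilon_1,\ldots,\varepsilon_n$, acts on $F$ by $\varepsilon_i=\sigma_i$, $F*\mathbb{Z}^n$ is the skew group ring, and $D(a,\sigma)^n$ is embedded in $F*\mathbb{Z}^n$,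 $S_n$-equivariantly, by $X_i^+\mapsto\varepsilon_i$, $X_i^-\mapsto a_i\varepsilon_i^{-1}$ and the identity on $D^{\otimes n}$. Galois rings: let $U$ be an associative algebra, $\Gamma\subset U$ a commutative Noetherian domain with $U$ finitely generated as a $\Gamma$-algebra; $K=\operatorname{Frac}\Gamma$; $L/K$ finite Galois with group $G$; $\mathcal{M}\subset\operatorname{Aut}_{\mathsf{k}}L$ a submonoid which is separating (elements with the same restriction to $K$ coincide) and stable under conjugation by $G$. $L*\mathcal{M}$ is the skew monoid ring ($m\,l=m(l)m$), $G$ acts by $g(lm)=g(l)\,gmg^{-1}$, $\mathcal{K}=(L*\mathcal{M})^G$. $U$ is a Galois $\Gamma$-ring in $\mathcal{K}$ if $\Gamma\subset U\subset\mathcal{K}$ and $UK=KU=\mathcal{K}$. For $u=\sum_ma_mm$ and $b\in L$ put $u(b)=\sum_ma_mm(b)$. $U$ is a principal Galois order over $\Gamma$ if it is a Galois $\Gamma$-ring and $u(\gamma)\in\Gamma$ for all $u\in U$, $\gamma\in\Gamma$. Here $L=F$, $\mathcal{M}=\mathbb{Z}^n$. *)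

theory Defs
  imports "HOL-Algebra.Algebra" "HOL-Algebra.Product_Groups" "HOL-Algebra.Elementary_Groups"
    "HOL-Algebra.Sym_Groups" "HOL-Algebra.Bij" "HOL-Algebra.Algebraic_Closure"
begin

section \<open>Algebras over a base ring\<close>

text \<open>
  Algebras, commutative or not, are records of type \<^typ>\<open>('k, 'r) module\<close>.
\<close>

definition regular_algebra :: "('k, 'x) ring_scheme \<Rightarrow> ('k, 'k) module" where
  "regular_algebra k =
     \<lparr>carrier = carrier k, monoid.mult = monoid.mult k, one = \<one>\<^bsub>k\<^esub>, ring.zero = \<zero>\<^bsub>k\<^esub>,
      ring.add = ring.add k, smult = monoid.mult k\<rparr>"

definition scalars :: "('k, 'x) ring_scheme \<Rightarrow> ('k, 'r, 'y) module_scheme \<Rightarrow> 'r set" where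
  "scalars k R = (\<lambda>c. c \<odot>\<^bsub>R\<^esub> \<one>\<^bsub>R\<^esub>) ` carrier k"

definition fin_gen_ring_over :: "('r, 'x) ring_scheme \<Rightarrow> 'r set \<Rightarrow> 'r set \<Rightarrow> bool" where
  "fin_gen_ring_over R B U \<longleftrightarrow> (\<exists>S. finite S \<and> S \<subseteq> U \<and> generate_ring R (B \<union> S) = U)"

definition quot_algebra :: "('k, 'r, 'x) module_scheme \<Rightarrow> 'r set \<Rightarrow> ('k, 'r set) module" where
  "quot_algebra R I =
     \<lparr>carrier = carrier (R Quot I), monoid.mult = monoid.mult (R Quot I), one = \<one>\<^bsub>R Quot I\<^esub>,
      ring.zero = \<zero>\<^bsub>R Quot I\<^esub>, ring.add = ring.add (R Quot I),
      smult = (\<lambda>c V. \<Union>x\<in>V. I +>\<^bsub>R\<^esub> (c \<odot>\<^bsub>R\<^esub> x))\<rparr>"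

definition alg_aut :: "('k, 'x) ring_scheme \<Rightarrow> ('k, 'r, 'y) module_scheme \<Rightarrow> ('r \<Rightarrow> 'r) monoid" where
  "alg_aut k R = BijGroup (carrier R)
     \<lparr>carrier := {f \<in> Bij (carrier R). f \<in> ring_hom R R \<and>
        (\<forall>c\<in>carrier k. \<forall>x\<in>carrier R. f (c \<odot>\<^bsub>R\<^esub> x) = c \<odot>\<^bsub>R\<^esub> f x)}\<rparr>"

section \<open>Skew monoid rings\<close>

text \<open>
  An element $\sum_m u_m m$ is the function $m \mapsto u_m$, which is zero outside the monoid.
\<close>

definition skew_monoid_ring ::
  "('k, 'l, 'x) module_scheme \<Rightarrow> ('m, 'y) monoid_scheme \<Rightarrow> ('m \<Rightarrow> 'l \<Rightarrow> 'l) \<Rightarrow> ('k, 'm \<Rightarrow> 'l) module"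
where
  "skew_monoid_ring L M act =
     \<lparr>carrier = {u. (\<forall>m\<in>carrier M. u m \<in> carrier L) \<and> (\<forall>m. m \<notin> carrier M \<longrightarrow> u m = \<zero>\<^bsub>L\<^esub>) \<and>
                    finite {m. u m \<noteq> \<zero>\<^bsub>L\<^esub>}},
      monoid.mult = (\<lambda>u v x. finsum L (\<lambda>(p, q). u p \<otimes>\<^bsub>L\<^esub> act p (v q))
        {(p, q). u p \<noteq> \<zero>\<^bsub>L\<^esub> \<and> v q \<noteq> \<zero>\<^bsub>L\<^esub> \<and> p \<otimes>\<^bsub>M\<^esub> q = x}),
      one = (\<lambda>m. if m = \<one>\<^bsub>M\<^esub> then \<one>\<^bsub>L\<^esub> else \<zero>\<^bsub>L\<^esub>),
      ring.zero = (\<lambda>m. \<zero>\<^bsub>L\<^esub>),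
      ring.add = (\<lambda>u v m. u m \<oplus>\<^bsub>L\<^esub> v m),
      smult = (\<lambda>c u m. c \<odot>\<^bsub>L\<^esub> u m)\<rparr>"

definition single :: "('l, 'x) ring_scheme \<Rightarrow> 'm \<Rightarrow> 'l \<Rightarrow> 'm \<Rightarrow> 'l" where
  "single L m x = (\<lambda>m'. if m' = m then x else \<zero>\<^bsub>L\<^esub>)"

definition monoid_algebra ::
  "('k, 'x) ring_scheme \<Rightarrow> ('m, 'y) monoid_scheme \<Rightarrow> ('k, 'm \<Rightarrow> 'k) module" where
  "monoid_algebra k M = skew_monoid_ring (regular_algebra k) M (\<lambda>_ x. x)"

text \<open>The linear map of monoid algebras that sends a basis element $x$ to $h(x)$.\<close>

definition push :: "('k, 'x) ring_scheme \<Rightarrow> ('m \<Rightarrow> 'n) \<Rightarrow> ('m \<Rightarrow> 'k) \<Rightarrow> 'n \<Rightarrow> 'k" where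
  "push k h u = (\<lambda>y. \<Oplus>\<^bsub>k\<^esub>x \<in> {x. u x \<noteq> \<zero>\<^bsub>k\<^esub> \<and> h x = y}. u x)"

text \<open>$u(b) = \sum_m u_m\, m(b)$\<close>

definition skew_eval ::
  "('l, 'x) ring_scheme \<Rightarrow> ('m \<Rightarrow> 'l \<Rightarrow> 'l) \<Rightarrow> ('m \<Rightarrow> 'l) \<Rightarrow> 'l \<Rightarrow> 'l" where
  "skew_eval L act u b = (\<Oplus>\<^bsub>L\<^esub>m \<in> {m. u m \<noteq> \<zero>\<^bsub>L\<^esub>}. u m \<otimes>\<^bsub>L\<^esub> act m b)"

text \<open>
  The action $g(lm) = g(l)\, g m g^{-1}$ of $g \in \mathrm{Aut}_k L$. The monoid is regarded as a
  submonoid of $\mathrm{Aut}_k L$ through \<open>act\<close>, so $g^{-1} m g$ is the element of the monoid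
  acting as $g^{-1} \circ m \circ g$; the coefficient of $g u$ at $m$ is $g(u_{g^{-1} m g})$.
\<close>

definition skew_conj ::
  "('k, 'x) ring_scheme \<Rightarrow> ('k, 'l, 'y) module_scheme \<Rightarrow> ('m, 'z) monoid_scheme \<Rightarrow>
     ('m \<Rightarrow> 'l \<Rightarrow> 'l) \<Rightarrow> ('l \<Rightarrow> 'l) \<Rightarrow> ('m \<Rightarrow> 'l) \<Rightarrow> 'm \<Rightarrow> 'l" where
  "skew_conj k L M act g u = (\<lambda>m. if m \<in> carrier M
     then g (u (the_inv_into (carrier M) act
                  (inv\<^bsub>alg_aut k L\<^esub> g \<otimes>\<^bsub>alg_aut k L\<^esub> act m \<otimes>\<^bsub>alg_aut k L\<^esub> g)))
     else \<zero>\<^bsub>L\<^esub>)"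

definition skew_invariants ::
  "('k, 'x) ring_scheme \<Rightarrow> ('k, 'l, 'y) module_scheme \<Rightarrow> ('m, 'z) monoid_scheme \<Rightarrow>
     ('m \<Rightarrow> 'l \<Rightarrow> 'l) \<Rightarrow> ('l \<Rightarrow> 'l) set \<Rightarrow> ('m \<Rightarrow> 'l) set" where
  "skew_invariants k L M act G =
     {u \<in> carrier (skew_monoid_ring L M act). \<forall>g\<in>G. skew_conj k L M act g u = u}"

section \<open>Galois rings\<close>

definition fractions_in :: "('l, 'x) ring_scheme \<Rightarrow> 'l set \<Rightarrow> 'l set" where
  "fractions_in L \<Gamma> = {x \<otimes>\<^bsub>L\<^esub> inv\<^bsub>L\<^esub> y | x y. x \<in> \<Gamma> \<and> y \<in> \<Gamma> - {\<zero>\<^bsub>L\<^esub>}}"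

definition finite_galois_extension :: "('l, 'x) ring_scheme \<Rightarrow> 'l set \<Rightarrow> ('l \<Rightarrow> 'l) set \<Rightarrow> bool" where
  "finite_galois_extension L K G \<longleftrightarrow>
     field L \<and> subfield K L \<and> ring.finite_dimension L K (carrier L) \<and>
     G = {g \<in> ring_iso L L \<inter> extensional (carrier L). \<forall>x\<in>K. g x = x} \<and>
     {x \<in> carrier L. \<forall>g\<in>G. g x = x} = K"

text \<open>
  The monoid $\mathcal M \subset \mathrm{Aut}_k L$ is an abstract monoid \<open>M\<close> with an injective
  homomorphism \<open>act\<close> to $\mathrm{Aut}_k L$. The ring $\Gamma$ is a subset of $L$, and the elements
  of $L$ are identified with the multiples of the identity of \<open>M\<close> in $L * \mathcal M$.
\<close>

locale galois_ring =
  fixes k :: "('k, 'x) ring_scheme"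
    and L :: "('k, 'l, 'y) module_scheme"
    and G :: "('l \<Rightarrow> 'l) set"
    and M :: "('m, 'z) monoid_scheme"
    and act :: "'m \<Rightarrow> 'l \<Rightarrow> 'l"
    and \<Gamma> :: "'l set"
    and U :: "('m \<Rightarrow> 'l) set"
  assumes algebra_L: "field k" "algebra k L"
    and \<Gamma>_subalgebra: "subring \<Gamma> L" "scalars k L \<subseteq> \<Gamma>"
    and \<Gamma>_noetherian: "noetherian_domain (L\<lparr>carrier := \<Gamma>\<rparr>)"
    and galois: "finite_galois_extension L (fractions_in L \<Gamma>) G"
    and monoid_M: "monoid M"
    and act_hom: "act \<in> hom M (alg_aut k L)"
    and act_inj: "inj_on act (carrier M)"
    and separating: "\<And>m m'. \<lbrakk>m \<in> carrier M; m' \<in> carrier M;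
          \<And>x. x \<in> fractions_in L \<Gamma> \<Longrightarrow> act m x = act m' x\<rbrakk> \<Longrightarrow> m = m'"
    and conj_stable: "\<And>g m. \<lbrakk>g \<in> G; m \<in> carrier M\<rbrakk> \<Longrightarrow>
          g \<otimes>\<^bsub>alg_aut k L\<^esub> act m \<otimes>\<^bsub>alg_aut k L\<^esub> inv\<^bsub>alg_aut k L\<^esub> g \<in> act ` carrier M"
    and U_subring: "subring U (skew_monoid_ring L M act)"
    and \<Gamma>_sub_U: "single L \<one>\<^bsub>M\<^esub> ` \<Gamma> \<subseteq> U"
    and U_fin_gen: "fin_gen_ring_over (skew_monoid_ring L M act) (single L \<one>\<^bsub>M\<^esub> ` \<Gamma>) U"
    and U_invariant: "U \<subseteq> skew_invariants k L M act G"
    and UK: "generate (add_monoid (skew_monoid_ring L M act))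
          (U <#>\<^bsub>skew_monoid_ring L M act\<^esub> single L \<one>\<^bsub>M\<^esub> ` fractions_in L \<Gamma>)
        = skew_invariants k L M act G"
    and KU: "generate (add_monoid (skew_monoid_ring L M act))
          (single L \<one>\<^bsub>M\<^esub> ` fractions_in L \<Gamma> <#>\<^bsub>skew_monoid_ring L M act\<^esub> U)
        = skew_invariants k L M act G"

locale principal_galois_order = galois_ring +
  assumes principal: "\<And>u \<gamma>. \<lbrakk>u \<in> U; \<gamma> \<in> \<Gamma>\<rbrakk> \<Longrightarrow> skew_eval L act u \<gamma> \<in> \<Gamma>"

section \<open>Fields of fractions\<close>

definition frac_rel :: "('r, 'x) ring_scheme \<Rightarrow> (('r \<times> 'r) \<times> ('r \<times> 'r)) set" where
  "frac_rel R = {((x, y), (x', y')).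
     x \<in> carrier R \<and> y \<in> carrier R - {\<zero>\<^bsub>R\<^esub>} \<and> x' \<in> carrier R \<and> y' \<in> carrier R - {\<zero>\<^bsub>R\<^esub>} \<and>
     x \<otimes>\<^bsub>R\<^esub> y' = x' \<otimes>\<^bsub>R\<^esub> y}"

definition frac :: "('r, 'x) ring_scheme \<Rightarrow> 'r \<Rightarrow> 'r \<Rightarrow> ('r \<times> 'r) set" where
  "frac R x y = frac_rel R `` {(x, y)}"

definition frac_algebra :: "('k, 'r, 'x) module_scheme \<Rightarrow> ('k, ('r \<times> 'r) set) module" where
  "frac_algebra R =
     \<lparr>carrier = (carrier R \<times> (carrier R - {\<zero>\<^bsub>R\<^esub>})) // frac_rel R,
      monoid.mult = (\<lambda>V V'. \<Union>(x, y)\<in>V. \<Union>(x', y')\<in>V'. frac R (x \<otimes>\<^bsub>R\<^esub> x') (y \<otimes>\<^bsub>R\<^esub> y')),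
      one = frac R \<one>\<^bsub>R\<^esub> \<one>\<^bsub>R\<^esub>,
      ring.zero = frac R \<zero>\<^bsub>R\<^esub> \<one>\<^bsub>R\<^esub>,
      ring.add = (\<lambda>V V'. \<Union>(x, y)\<in>V. \<Union>(x', y')\<in>V'.
               frac R (x \<otimes>\<^bsub>R\<^esub> y' \<oplus>\<^bsub>R\<^esub> x' \<otimes>\<^bsub>R\<^esub> y) (y \<otimes>\<^bsub>R\<^esub> y')),
      smult = (\<lambda>c V. \<Union>(x, y)\<in>V. frac R (c \<odot>\<^bsub>R\<^esub> x) y)\<rparr>"

definition of_base :: "('r, 'x) ring_scheme \<Rightarrow> 'r \<Rightarrow> ('r \<times> 'r) set" where
  "of_base R x = frac R x \<one>\<^bsub>R\<^esub>"

definition frac_map :: "('r, 'x) ring_scheme \<Rightarrow> ('r \<Rightarrow> 'r) \<Rightarrow> ('r \<times> 'r) set \<Rightarrow> ('r \<times> 'r) set" where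
  "frac_map R f V = (\<Union>(x, y)\<in>V. frac R (f x) (f y))"

section \<open>Tensor powers of an algebra\<close>

text \<open>
  The positions of $A^{\otimes n}$ are $1, \dots, n$. The monoid algebra of the multiplicative
  monoid $A^n$ is the free module on $A^n$ with componentwise multiplication of basis elements;
  the submodule generated by the multilinearity relations is a two-sided ideal of it, so the
  ideal below is that submodule.
\<close>

definition tuples :: "nat \<Rightarrow> ('k, 'r, 'x) module_scheme \<Rightarrow> (nat \<Rightarrow> 'r) monoid" where
  "tuples n A = product_group {1..n} (\<lambda>_. A)"

abbreviation tuple_algebra where
  "tuple_algebra k n A \<equiv> monoid_algebra k (tuples n A)"

definition tensor_relations ::
  "('k, 'x) ring_scheme \<Rightarrow> nat \<Rightarrow> ('k, 'r, 'y) module_scheme \<Rightarrow> ((nat \<Rightarrow> 'r) \<Rightarrow> 'k) set" where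
  "tensor_relations k n A =
     (let T = tuple_algebra k n A; e = (\<lambda>x. single k x \<one>\<^bsub>k\<^esub>) in
      {e (x(i := b \<oplus>\<^bsub>A\<^esub> c)) \<ominus>\<^bsub>T\<^esub> (e (x(i := b)) \<oplus>\<^bsub>T\<^esub> e (x(i := c))) | x i b c.
         x \<in> carrier (tuples n A) \<and> i \<in> {1..n} \<and> b \<in> carrier A \<and> c \<in> carrier A} \<union>
      {e (x(i := s \<odot>\<^bsub>A\<^esub> b)) \<ominus>\<^bsub>T\<^esub> s \<odot>\<^bsub>T\<^esub> e (x(i := b)) | x i s b.
         x \<in> carrier (tuples n A) \<and> i \<in> {1..n} \<and> s \<in> carrier k \<and> b \<in> carrier A})"

definition tensor_ideal ::
  "('k, 'x) ring_scheme \<Rightarrow> nat \<Rightarrow> ('k, 'r, 'y) module_scheme \<Rightarrow> ((nat \<Rightarrow> 'r) \<Rightarrow> 'k) set" where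
  "tensor_ideal k n A = Idl\<^bsub>tuple_algebra k n A\<^esub> (tensor_relations k n A)"

definition tensor_power ::
  "('k, 'x) ring_scheme \<Rightarrow> nat \<Rightarrow> ('k, 'r, 'y) module_scheme \<Rightarrow> ('k, ((nat \<Rightarrow> 'r) \<Rightarrow> 'k) set) module"
where
  "tensor_power k n A = quot_algebra (tuple_algebra k n A) (tensor_ideal k n A)"

text \<open>$1 \otimes \dots \otimes b \otimes \dots \otimes 1$ with $b$ in position $i$\<close>

definition in_factor ::
  "('k, 'x) ring_scheme \<Rightarrow> nat \<Rightarrow> ('k, 'r, 'y) module_scheme \<Rightarrow> nat \<Rightarrow> 'r \<Rightarrow> ((nat \<Rightarrow> 'r) \<Rightarrow> 'k) set"
where
  "in_factor k n A i b = tensor_ideal k n A +>\<^bsub>tuple_algebra k n A\<^esub>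
     single k (\<lambda>j\<in>{1..n}. if j = i then b else \<one>\<^bsub>A\<^esub>) \<one>\<^bsub>k\<^esub>"

text \<open>
  The map to $B^{\otimes n}$ that sends the pure tensor of a tuple $x$ to the pure tensor of $h(x)$;
  it is meaningful if \<open>h\<close> respects the multilinearity relations.
\<close>

definition tensor_map ::
  "('k, 'x) ring_scheme \<Rightarrow> nat \<Rightarrow> ('k, 'b, 'y) module_scheme \<Rightarrow> ((nat \<Rightarrow> 'a) \<Rightarrow> (nat \<Rightarrow> 'b)) \<Rightarrow>
     ((nat \<Rightarrow> 'a) \<Rightarrow> 'k) set \<Rightarrow> ((nat \<Rightarrow> 'b) \<Rightarrow> 'k) set" where
  "tensor_map k n B h V =
     (\<Union>u\<in>V. tensor_ideal k n B +>\<^bsub>tuple_algebra k n B\<^esub> push k h u)"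

text \<open>$\pi$ moves the factor in position $i$ to position $\pi(i)$.\<close>

definition tensor_perm ::
  "('k, 'x) ring_scheme \<Rightarrow> nat \<Rightarrow> ('k, 'r, 'y) module_scheme \<Rightarrow> (nat \<Rightarrow> nat) \<Rightarrow>
     ((nat \<Rightarrow> 'r) \<Rightarrow> 'k) set \<Rightarrow> ((nat \<Rightarrow> 'r) \<Rightarrow> 'k) set" where
  "tensor_perm k n A \<pi> = tensor_map k n A (\<lambda>x. x \<circ> inv_into UNIV \<pi>)"

definition tensor_invariants ::
  "('k, 'x) ring_scheme \<Rightarrow> nat \<Rightarrow> ('k, 'r, 'y) module_scheme \<Rightarrow> (nat \<Rightarrow> nat) set \<Rightarrow>
     ((nat \<Rightarrow> 'r) \<Rightarrow> 'k) set set" where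
  "tensor_invariants k n A G =
     {t \<in> carrier (tensor_power k n A). \<forall>\<pi>\<in>G. tensor_perm k n A \<pi> t = t}"

section \<open>Generalized Weyl algebras of rank one\<close>

datatype 'd gwa_gen = Coef 'd | XPlus | XMinus

definition words :: "'d set \<Rightarrow> 'd gwa_gen list monoid" where
  "words S = \<lparr>carrier = lists (Coef ` S \<union> {XPlus, XMinus}), monoid.mult = (@), one = []\<rparr>"

text \<open>
  The first four families of relations identify the subalgebra generated by the letters
  \<open>Coef d\<close> with a homomorphic image of $D$.
\<close>

definition gwa_relations ::
  "('k, 'x) ring_scheme \<Rightarrow> ('k, 'd, 'y) module_scheme \<Rightarrow> 'd \<Rightarrow> ('d \<Rightarrow> 'd) \<Rightarrow> ('d gwa_gen list \<Rightarrow> 'k) set"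
where
  "gwa_relations k D a \<sigma> =
     (let W = monoid_algebra k (words (carrier D)); e = (\<lambda>w. single k w \<one>\<^bsub>k\<^esub>) in
      {e [Coef (b \<oplus>\<^bsub>D\<^esub> c)] \<ominus>\<^bsub>W\<^esub> (e [Coef b] \<oplus>\<^bsub>W\<^esub> e [Coef c]) | b c. b \<in> carrier D \<and> c \<in> carrier D} \<union>
      {e [Coef (s \<odot>\<^bsub>D\<^esub> b)] \<ominus>\<^bsub>W\<^esub> s \<odot>\<^bsub>W\<^esub> e [Coef b] | s b. s \<in> carrier k \<and> b \<in> carrier D} \<union>
      {e [Coef (b \<otimes>\<^bsub>D\<^esub> c)] \<ominus>\<^bsub>W\<^esub> e [Coef b, Coef c] | b c. b \<in> carrier D \<and> c \<in> carrier D} \<union>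
      {e [Coef \<one>\<^bsub>D\<^esub>] \<ominus>\<^bsub>W\<^esub> e []} \<union>
      {e [XPlus, Coef d] \<ominus>\<^bsub>W\<^esub> e [Coef (\<sigma> d), XPlus] | d. d \<in> carrier D} \<union>
      {e [XMinus, Coef d] \<ominus>\<^bsub>W\<^esub> e [Coef ((inv\<^bsub>alg_aut k D\<^esub> \<sigma>) d), XMinus] | d. d \<in> carrier D} \<union>
      {e [XMinus, XPlus] \<ominus>\<^bsub>W\<^esub> e [Coef a], e [XPlus, XMinus] \<ominus>\<^bsub>W\<^esub> e [Coef (\<sigma> a)]})"

definition gwa_ideal ::
  "('k, 'x) ring_scheme \<Rightarrow> ('k, 'd, 'y) module_scheme \<Rightarrow> 'd \<Rightarrow> ('d \<Rightarrow> 'd) \<Rightarrow> ('d gwa_gen list \<Rightarrow> 'k) set"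
where
  "gwa_ideal k D a \<sigma> = Idl\<^bsub>monoid_algebra k (words (carrier D))\<^esub> (gwa_relations k D a \<sigma>)"

definition gwa ::
  "('k, 'x) ring_scheme \<Rightarrow> ('k, 'd, 'y) module_scheme \<Rightarrow> 'd \<Rightarrow> ('d \<Rightarrow> 'd) \<Rightarrow>
     ('k, ('d gwa_gen list \<Rightarrow> 'k) set) module"
where
  "gwa k D a \<sigma> = quot_algebra (monoid_algebra k (words (carrier D))) (gwa_ideal k D a \<sigma>)"

definition gwa_gen ::
  "('k, 'x) ring_scheme \<Rightarrow> ('k, 'd, 'y) module_scheme \<Rightarrow> 'd \<Rightarrow> ('d \<Rightarrow> 'd) \<Rightarrow> 'd gwa_gen \<Rightarrow>
     ('d gwa_gen list \<Rightarrow> 'k) set"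
where
  "gwa_gen k D a \<sigma> g =
     gwa_ideal k D a \<sigma> +>\<^bsub>monoid_algebra k (words (carrier D))\<^esub> single k [g] \<one>\<^bsub>k\<^esub>"

section \<open>The embedding of the tensor power in the skew group ring\<close>

definition int_vectors :: "nat \<Rightarrow> (nat \<Rightarrow> int) monoid" where
  "int_vectors n = product_group {1..n} (\<lambda>_. integer_group)"

abbreviation tensor_field where
  "tensor_field k n D \<equiv> frac_algebra (tensor_power k n D)"

text \<open>
  The homomorphism $\mathbb Z^n \to \mathrm{Aut}_k F$ with $\varepsilon_i \mapsto \sigma_i$: the vector
  $\alpha$ acts as $\sigma_1^{\alpha_1} \cdots \sigma_n^{\alpha_n}$, which is induced by
  $\sigma^{\alpha_1} \otimes \dots \otimes \sigma^{\alpha_n}$ on $D^{\otimes n}$.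
\<close>

definition shift_act ::
  "('k, 'x) ring_scheme \<Rightarrow> nat \<Rightarrow> ('k, 'd, 'y) module_scheme \<Rightarrow> ('d \<Rightarrow> 'd) \<Rightarrow> (nat \<Rightarrow> int) \<Rightarrow>
     (((nat \<Rightarrow> 'd) \<Rightarrow> 'k) set \<times> ((nat \<Rightarrow> 'd) \<Rightarrow> 'k) set) set \<Rightarrow>
     (((nat \<Rightarrow> 'd) \<Rightarrow> 'k) set \<times> ((nat \<Rightarrow> 'd) \<Rightarrow> 'k) set) set"
where
  "shift_act k n D \<sigma> \<alpha> = restrict
     (frac_map (tensor_power k n D)
        (tensor_map k n D (\<lambda>x. \<lambda>i\<in>{1..n}. (\<sigma> [^]\<^bsub>alg_aut k D\<^esub> \<alpha> i) (x i))))
     (carrier (tensor_field k n D))"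

definition perm_act ::
  "('k, 'x) ring_scheme \<Rightarrow> nat \<Rightarrow> ('k, 'd, 'y) module_scheme \<Rightarrow> (nat \<Rightarrow> nat) \<Rightarrow>
     (((nat \<Rightarrow> 'd) \<Rightarrow> 'k) set \<times> ((nat \<Rightarrow> 'd) \<Rightarrow> 'k) set) set \<Rightarrow>
     (((nat \<Rightarrow> 'd) \<Rightarrow> 'k) set \<times> ((nat \<Rightarrow> 'd) \<Rightarrow> 'k) set) set"
where
  "perm_act k n D \<pi> = restrict
     (frac_map (tensor_power k n D) (tensor_perm k n D \<pi>)) (carrier (tensor_field k n D))"

definition shift_ring ::
  "('k, 'x) ring_scheme \<Rightarrow> nat \<Rightarrow> ('k, 'd, 'y) module_scheme \<Rightarrow> ('d \<Rightarrow> 'd) \<Rightarrow>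
     ('k, (nat \<Rightarrow> int) \<Rightarrow> (((nat \<Rightarrow> 'd) \<Rightarrow> 'k) set \<times> ((nat \<Rightarrow> 'd) \<Rightarrow> 'k) set) set) module"
where
  "shift_ring k n D \<sigma> = skew_monoid_ring (tensor_field k n D) (int_vectors n) (shift_act k n D \<sigma>)"

definition unit_vector :: "nat \<Rightarrow> nat \<Rightarrow> nat \<Rightarrow> int" where
  "unit_vector n i = (\<lambda>j\<in>{1..n}. if j = i then 1 else 0)"

locale gwa_power_embedding =
  fixes k :: "('k, 'x) ring_scheme"
    and n :: nat
    and D :: "('k, 'd, 'y) module_scheme"
    and a :: 'd
    and \<sigma> :: "'d \<Rightarrow> 'd"
    and \<phi> :: "((nat \<Rightarrow> ('d gwa_gen list \<Rightarrow> 'k) set) \<Rightarrow> 'k) set \<Rightarrow>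
        (nat \<Rightarrow> int) \<Rightarrow> (((nat \<Rightarrow> 'd) \<Rightarrow> 'k) set \<times> ((nat \<Rightarrow> 'd) \<Rightarrow> 'k) set) set"
  assumes hom: "\<phi> \<in> ring_hom (tensor_power k n (gwa k D a \<sigma>)) (shift_ring k n D \<sigma>)"
    and linear: "\<And>c t. \<lbrakk>c \<in> carrier k; t \<in> carrier (tensor_power k n (gwa k D a \<sigma>))\<rbrakk> \<Longrightarrow>
        \<phi> (c \<odot>\<^bsub>tensor_power k n (gwa k D a \<sigma>)\<^esub> t) = c \<odot>\<^bsub>shift_ring k n D \<sigma>\<^esub> \<phi> t"
    and inj: "inj_on \<phi> (carrier (tensor_power k n (gwa k D a \<sigma>)))"
    and on_base: "\<And>t. t \<in> carrier (tensor_power k n D) \<Longrightarrow>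
        \<phi> (tensor_map k n (gwa k D a \<sigma>) (\<lambda>x. \<lambda>i\<in>{1..n}. gwa_gen k D a \<sigma> (Coef (x i))) t) =
        single (tensor_field k n D) \<one>\<^bsub>int_vectors n\<^esub> (of_base (tensor_power k n D) t)"
    and on_XPlus: "\<And>i. i \<in> {1..n} \<Longrightarrow>
        \<phi> (in_factor k n (gwa k D a \<sigma>) i (gwa_gen k D a \<sigma> XPlus)) =
        single (tensor_field k n D) (unit_vector n i) \<one>\<^bsub>tensor_field k n D\<^esub>"
    and on_XMinus: "\<And>i. i \<in> {1..n} \<Longrightarrow>
        \<phi> (in_factor k n (gwa k D a \<sigma>) i (gwa_gen k D a \<sigma> XMinus)) =
        single (tensor_field k n D) (inv\<^bsub>int_vectors n\<^esub> unit_vector n i)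
          (of_base (tensor_power k n D) (in_factor k n D i a))"
    and equivariant: "\<And>\<pi> t. \<lbrakk>\<pi> permutes {1..n}; t \<in> carrier (tensor_power k n (gwa k D a \<sigma>))\<rbrakk> \<Longrightarrow>
        \<phi> (tensor_perm k n (gwa k D a \<sigma>) \<pi> t) =
        skew_conj k (tensor_field k n D) (int_vectors n) (shift_act k n D \<sigma>) (perm_act k n D \<pi>) (\<phi> t)"

end

theory Submission
  imports Defs
begin

text \<open>
  Since characters separate the points of \<open>D\<close>, the tensor power $T = D^{\otimes n}$ is a domain.
  Each factor of $A^{\otimes n}$ maps to $F * \mathbb{Z}^n$; the product of these maps is injective
  because $A^{\otimes n}$ is spanned by elements $t\, E_\alpha$ with $t \in T$, where $E_\alpha$ goes to
  $s_\alpha \alpha$ with $s_\alpha \neq 0$. Its image \<open>B\<close> is a subring of $F * \mathbb{Z}^n$, stable under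
  \<open>G\<close>, with coefficients in \<open>T\<close>.

  Every element of $F * \mathbb{Z}^n$ gets into \<open>B\<close> after multiplication by a nonzero element of
  $\Gamma = T^G$; this gives $UK = KU = (F * \mathbb{Z}^n)^G$ for $U = B^G$. Elements of \<open>U\<close> have
  invariant coefficients in \<open>T\<close> and hence preserve $\Gamma$. Finally, \<open>B\<close> is a finite sum of
  $C w C$ over a subring $C \subseteq U$ generated by $\Gamma$ and symmetric functions of the
  $X_i^+$ and of the $X_i^-$, so \<open>U\<close> is generated by \<open>C\<close> and the traces of the \<open>w\<close>.
\<close>

\<comment> \<open>\<open>D\<close> comes without a basis and \<open>A\<close> only with generators
  and relations. The first gap is met by characters: a nonzero element of \<open>D\<close> survives
  some character, found by adjoining the generators of \<open>D\<close> one at a time, so tensors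
  can be tested by evaluating their factors. The second is met by proving only that the words d X^j
  span; their independence is read off in F * Z^n, where different exponents have different
  supports. The hypotheses enter at separate places: closedness of k gives the characters, infinite
  order of \<sigma> makes Z^n act faithfully, regularity of a keeps every s_\<alpha> nonzero, and
  characteristic zero permits averaging over G. Z^n is separating because two of its elements that
  agree on K differ by an element of the finite group G, while Z^n is torsion-free. Finite
  generation of \<open>U\<close> needs coefficients on two sides: the X_i^+ commute with each other,
  and so do the X_i^-, but not one family with the other, so their symmetric functions are collected
  at opposite ends of w.\<close>
syntax (input)
  "_ring_mult" :: "['a, 'b, 'a] \<Rightarrow> 'a"  ("_ *\<^sub>_ _" [70, 1000, 71] 70)
  "_ring_add" :: "['a, 'b, 'a] \<Rightarrow> 'a"  ("_ +\<^sub>_ _" [65, 1000, 66] 65)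
  "_ring_zero" :: "'b \<Rightarrow> 'a"  ("0\<^sub>_" [1000] 1000)
  "_ring_one" :: "'b \<Rightarrow> 'a"  ("1\<^sub>_" [1000] 1000)
  "_index" :: "logic \<Rightarrow> index"  ("\<^sub>_" [1000])

translations
  "_ring_mult x R y" \<rightharpoonup> "CONST monoid.mult R x y"
  "_ring_add x R y" \<rightharpoonup> "CONST ring.add R x y"
  "_ring_zero R" \<rightharpoonup> "CONST ring.zero R"
  "_ring_one R" \<rightharpoonup> "CONST monoid.one R"

abbreviation (input) car where "car \<equiv> carrier"

text \<open>Operations on cosets, fractions and tensors are unions over representatives. Their
  well-definedness always takes this form, with one representative supplied so that the union is not
  empty.\<close>

lemma UN_eq_const: "a : A ==> (\<And>y. y : A ==> f y = c) ==> (\<Union>y\<in>A. f y) = c"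
 by (rule SUP_eq_const) auto

section \<open>Homomorphisms and noncommutative algebras\<close>

definition alg_hom ::
 "('k, 'x) ring_scheme => ('k, 'r, 'y) module_scheme => ('k, 's, 'z) module_scheme => ('r => 's) set"
where
 "alg_hom k R S =
  {f \<in> ring_hom R S. ALL c:car k. ALL x:car R. f (c \<odot>\<^bsub>R\<^esub> x) = c \<odot>\<^sub>S f x}"

lemma alg_homD:
 assumes "f : alg_hom k R S"
 shows "f : ring_hom R S"
  and "x : car R ==> f x : car S"
  and "[|x : car R; y : car R|] ==> f (x \<otimes>\<^bsub>R\<^esub> y) = f x *\<^sub>S f y"
  and "[|x : car R; y : car R|] ==> f (x \<oplus>\<^bsub>R\<^esub> y) = f x +\<^sub>S f y"
  and "f \<one>\<^bsub>R\<^esub> = 1\<^sub>S"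
  and "[|c : car k; x : car R|] ==> f (c \<odot>\<^bsub>R\<^esub> x) = c \<odot>\<^sub>S f x"
 using assms by (auto simp: alg_hom_def ring_hom_def)

lemma alg_homI:
 assumes "\<And>x. x : car R ==> f x : car S"
  and "\<And>x y. [|x : car R; y : car R|] ==> f (x \<otimes>\<^bsub>R\<^esub> y) = f x *\<^sub>S f y"
  and "\<And>x y. [|x : car R; y : car R|] ==> f (x \<oplus>\<^bsub>R\<^esub> y) = f x +\<^sub>S f y"
  and "f \<one>\<^bsub>R\<^esub> = 1\<^sub>S"
  and "\<And>c x. [|c : car k; x : car R|] ==> f (c \<odot>\<^bsub>R\<^esub> x) = c \<odot>\<^sub>S f x"
 shows "f : alg_hom k R S"
 using assms by (auto simp: alg_hom_def ring_hom_def)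

lemma ring_hom_zero_neg:
 assumes "f : ring_hom R S" "ring R" "ring S"
 shows "f \<zero>\<^bsub>R\<^esub> = 0\<^sub>S" and "x : car R ==> f (\<ominus>\<^bsub>R\<^esub> x) = \<ominus>\<^sub>S f x"
  and "[|x : car R; y : car R|] ==> f (x \<ominus>\<^bsub>R\<^esub> y) = f x \<ominus>\<^sub>S f y"
  and "h : I \<rightarrow> car R ==> f (finsum R h I) = finsum S (%i. f (h i)) I"
proof -
 interpret ring_hom_ring R S f using assms by (simp add: ring_hom_ringI2)
 show "f \<zero>\<^bsub>R\<^esub> = 0\<^sub>S" "x : car R ==> f (\<ominus>\<^bsub>R\<^esub> x) = \<ominus>\<^sub>S f x" by simp_all
 show "[|x : car R; y : car R|] ==> f (x \<ominus>\<^bsub>R\<^esub> y) = f x \<ominus>\<^sub>S f y"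
  by (simp add: a_minus_def)
 show "h : I \<rightarrow> car R ==> f (finsum R h I) = finsum S (%i. f (h i)) I"
  by (simp add: o_def)
qed

text \<open>The generalized Weyl algebra, its tensor powers and the skew rings are not commutative,
  so scalars are required to pass through either factor of a product. A commutative
  \<open>algebra\<close> is an instance.\<close>

locale nc_algebra = A: ring A + module k A
 for k :: "('k, 'x) ring_scheme" and A :: "('k, 'r, 'y) module_scheme" +
 assumes smult_mult_left:
   "[|c : car k; x : car A; y : car A|] ==> (c \<odot>\<^sub>A x) *\<^sub>A y = c \<odot>\<^sub>A (x *\<^sub>A y)"
  and smult_mult_right:
   "[|c : car k; x : car A; y : car A|] ==> x *\<^sub>A (c \<odot>\<^sub>A y) = c \<odot>\<^sub>A (x *\<^sub>A y)"

lemma (in algebra) nc_algebra: "nc_algebra R M"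
proof (intro nc_algebra.intro nc_algebra_axioms.intro)
 show "module R M" "ring M" by unfold_locales
 fix c x y assume a: "c : car R" "x : car M" "y : car M"
 then show "(c \<odot>\<^sub>M x) *\<^sub>M y = c \<odot>\<^sub>M (x *\<^sub>M y)" by (rule smult_assoc2)
 show "x *\<^sub>M (c \<odot>\<^sub>M y) = c \<odot>\<^sub>M (x *\<^sub>M y)"
  using a by (metis m_comm smult_assoc2 smult_closed)
qed

lemma nc_algebra_imp_algebra:
 assumes "nc_algebra k A" and "cring A" shows "algebra k A"
proof -
 interpret nc_algebra k A by fact
 interpret cring A by fact
 show ?thesis by unfold_locales (simp add: smult_mult_left)
qed

lemma (in nc_algebra) scalars_subring: "subring (scalars k A) A"
proof (rule A.subringI)
 show "scalars k A \<subseteq> car A" by (auto simp: scalars_def)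
 show "1\<^sub>A : scalars k A" by (force simp: scalars_def)
 show "\<ominus>\<^sub>A x : scalars k A" if "x : scalars k A" for x
  using that by (auto simp: scalars_def smult_l_minus[symmetric])
 show "x *\<^sub>A y : scalars k A" if "x : scalars k A" "y : scalars k A" for x y
  using that by (auto simp: scalars_def smult_mult_left smult_mult_right smult_assoc1[symmetric])
 show "x +\<^sub>A y : scalars k A" if "x : scalars k A" "y : scalars k A" for x y
  using that by (auto simp: scalars_def smult_l_distr[symmetric])
qed

section \<open>Skew monoid rings\<close>

locale skew_ring = L: nc_algebra k L + M: monoid M
 for k :: "('k, 'x) ring_scheme" and L :: "('k, 'l, 'y) module_scheme"
  and M :: "('m, 'z) monoid_scheme" +
 fixes act :: "'m => 'l => 'l"
 assumes act_hom: "m : car M ==> act m : alg_hom k L L"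
  and act_mult: "[|m : car M; m' : car M; x : car L|] ==>
   act (m *\<^sub>M m') x = act m (act m' x)"
  and act_one: "x : car L ==> act 1\<^sub>M x = x"
begin

abbreviation S where "S \<equiv> skew_monoid_ring L M act"

lemma act_simps [simp]:
 assumes "m : car M"
 shows "x : car L ==> act m x : car L"
  and "[|x : car L; y : car L|] ==> act m (x *\<^sub>L y) = act m x *\<^sub>L act m y"
  and "[|x : car L; y : car L|] ==> act m (x +\<^sub>L y) = act m x +\<^sub>L act m y"
  and "act m 1\<^sub>L = 1\<^sub>L"
  and "[|c : car k; x : car L|] ==> act m (c \<odot>\<^sub>L x) = c \<odot>\<^sub>L act m x"
  and "act m 0\<^sub>L = 0\<^sub>L"
 using alg_homD[OF act_hom[OF assms]] ring_hom_zero_neg(1)[OF _ L.A.ring_axioms L.A.ring_axioms]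
 by auto

lemma carrierD:
 assumes "u : car S"
 shows "m : car M ==> u m : car L" and "u m : car L"
  and "m \<notin> car M ==> u m = 0\<^sub>L" and "finite {m. u m ~= 0\<^sub>L}" and "{m. u m ~= 0\<^sub>L} \<subseteq> car M"
 using assms unfolding skew_monoid_ring_def by auto

lemma carrierI:
 assumes "\<And>m. m : car M ==> u m : car L" "\<And>m. m \<notin> car M ==> u m = 0\<^sub>L"
  "finite {m. u m ~= 0\<^sub>L}"
 shows "u : car S"
 using assms unfolding skew_monoid_ring_def by auto

lemma add_apply: "(u +\<^sub>S v) m = u m +\<^sub>L v m" and zero_apply: "0\<^sub>S m = 0\<^sub>L"
 and smult_apply: "(c \<odot>\<^sub>S u) m = c \<odot>\<^sub>L u m"
 and one_eq: "1\<^sub>S = single L 1\<^sub>M 1\<^sub>L" and zero_eq: "0\<^sub>S = (%m. 0\<^sub>L)"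
 by (simp_all add: skew_monoid_ring_def single_def)

lemma single_closed [simp]:
 "[|m : car M; x : car L|] ==> single L m x : car S"
 by (rule carrierI) (auto simp: single_def)

lemma abelian_group_S: "abelian_group S"
proof (rule abelian_groupI)
 fix u v assume u: "u : car S" and v: "v : car S"
 show "u +\<^sub>S v : car S"
 proof (rule carrierI)
  show "finite {m. (u +\<^sub>S v) m ~= 0\<^sub>L}"
  proof (rule finite_subset)
   show "{m. (u +\<^sub>S v) m ~= 0\<^sub>L} \<subseteq> {m. u m ~= 0\<^sub>L} \<union> {m. v m ~= 0\<^sub>L}"
    by (auto simp: add_apply)
  qed (use carrierD(4) u v in auto)
 qed (use carrierD(2,3)[OF u] carrierD(2,3)[OF v] in "auto simp: add_apply")
 show "u +\<^sub>S v = v +\<^sub>S u"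
  using carrierD(2) u v by (auto simp: add_apply L.A.a_comm)
next
 fix u v w assume "u : car S" "v : car S" "w : car S"
 then show "u +\<^sub>S v +\<^sub>S w = u +\<^sub>S (v +\<^sub>S w)"
  using carrierD(2) by (auto simp: add_apply L.A.a_assoc)
next
 show "0\<^sub>S : car S" by (rule carrierI) (auto simp: zero_apply)
next
 fix u assume u: "u : car S"
 then show "0\<^sub>S +\<^sub>S u = u" using carrierD(2) by (auto simp: add_apply zero_apply)
 show "EX v:car S. v +\<^sub>S u = 0\<^sub>S"
 proof
  show "(%m. \<ominus>\<^sub>L u m) +\<^sub>S u = 0\<^sub>S"
   using carrierD(2)[OF u] by (auto simp: add_apply zero_apply L.A.l_neg)
  have "{m. \<ominus>\<^sub>L u m ~= 0\<^sub>L} \<subseteq> {m. u m ~= 0\<^sub>L}" by auto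
  then show "(%m. \<ominus>\<^sub>L u m) : car S"
   using carrierD[OF u] finite_subset by (intro carrierI) auto
 qed
qed

sublocale Sa: abelian_group S by (rule abelian_group_S)

lemma single_add:
 "[|m : car M; x : car L; y : car L|] ==>
  single L m (x +\<^sub>L y) = single L m x +\<^sub>S single L m y"
 by (auto simp: single_def add_apply)

lemma finsum_apply:
 assumes "f : I \<rightarrow> car S" shows "finsum S f I m = (\<Oplus>\<^sub>L i\<in>I. f i m)"
proof -
 from assms show ?thesis
 proof (induction I rule: infinite_finite_induct)
  case (insert i I)
  then have "f i m : car L" "\<And>j. j : I ==> f j m : car L" using carrierD(2) by auto
  with insert show ?case by (simp add: add_apply Pi_def)
 qed (auto simp: zero_apply)
qed

text \<open>Splitting off one point of the support leaves a smaller support. Bilinear identities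
  thereby reduce to \<open>single\<close> elements, where \<open>single_mult\<close> computes the
  product.\<close>

lemma skew_induct [consumes 1, case_names zero single add]:
 assumes "u : car S" and "P 0\<^sub>S"
  and "\<And>m x. [|m : car M; x : car L|] ==> P (single L m x)"
  and "\<And>u v. [|u : car S; v : car S; P u; P v|] ==> P (u +\<^sub>S v)"
 shows "P u"
 using assms(1)
proof (induction "card {m. u m ~= 0\<^sub>L}" arbitrary: u rule: less_induct)
 case less
 note u = less.prems
 show ?case
 proof (cases "\<exists>m. u m ~= 0\<^sub>L")
  case False
  then have "u = 0\<^sub>S" by (auto simp: zero_apply)
  then show ?thesis using assms(2) by simp
 next
  case True
  then obtain n where n: "u n ~= 0\<^sub>L" by blast
  then have nM: "n : car M" using carrierD(3)[OF u] by blast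
  obtain v where v_def: "v = (%m. if m = n then 0\<^sub>L else u m)" by simp
  have sv: "{m. v m ~= 0\<^sub>L} \<subset> {m. u m ~= 0\<^sub>L}" using n by (auto simp: v_def)
  have v: "v : car S"
   by (rule carrierI)
    (use carrierD(2,3)[OF u] finite_subset[OF psubset_imp_subset[OF sv] carrierD(4)[OF u]] in "auto simp: v_def")
  have "u = single L n (u n) +\<^sub>S v"
   using carrierD(2)[OF u] by (auto simp: add_apply single_def v_def)
  moreover have "P (single L n (u n))" using assms(3) nM carrierD(2)[OF u] by auto
  moreover have "P v" using less.hyps[OF psubset_card_mono[OF carrierD(4)[OF u] sv] v] .
  ultimately show ?thesis
   using assms(4)[of "single L n (u n)" v] v nM carrierD(2)[OF u] by simp
 qed
qed

text \<open>The defining sum runs over pairs of nonzero coefficients and so depends on the factors.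
  A fixed rectangle \<open>P \<times> Q\<close>, padded with zeros, allows the sums for different
  factors to be added.\<close>

lemma mult_eq:
 assumes u: "u : car S" and v: "v : car S"
  and P: "finite P" "P \<subseteq> car M" "{m. u m ~= 0\<^sub>L} \<subseteq> P"
  and Q: "finite Q" "Q \<subseteq> car M" "{m. v m ~= 0\<^sub>L} \<subseteq> Q"
 shows "(u *\<^sub>S v) x =
  (\<Oplus>\<^sub>L r\<in>P \<times> Q. if fst r *\<^sub>M snd r = x then u (fst r) *\<^sub>L act (fst r) (v (snd r)) else 0\<^sub>L)"
proof -
 have "(u *\<^sub>S v) x = finsum L (%(p, q). u p *\<^sub>L act p (v q))
    {(p, q). u p ~= 0\<^sub>L & v q ~= 0\<^sub>L & p *\<^sub>M q = x}"
  by (simp add: skew_monoid_ring_def)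
 also have "\<dots> = (\<Oplus>\<^sub>L r\<in>P \<times> Q. if fst r *\<^sub>M snd r = x
   then u (fst r) *\<^sub>L act (fst r) (v (snd r)) else 0\<^sub>L)"
 proof (rule L.A.add.finprod_mono_neutral_cong_left)
  show "finite (P \<times> Q)" using P Q by simp
  show "{(p, q). u p ~= 0\<^sub>L & v q ~= 0\<^sub>L & p *\<^sub>M q = x} \<subseteq> P \<times> Q" using P Q by auto
  fix i assume "i : P \<times> Q - {(p, q). u p ~= 0\<^sub>L & v q ~= 0\<^sub>L & p *\<^sub>M q = x}"
  then show "(if fst i *\<^sub>M snd i = x then u (fst i) *\<^sub>L act (fst i) (v (snd i)) else 0\<^sub>L) = 0\<^sub>L"
   using carrierD(2)[OF u] carrierD(2)[OF v] P Q by (cases i) auto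
 qed (use carrierD(2)[OF u] carrierD(2)[OF v] P Q in auto)
 finally show ?thesis .
qed

lemma single_mult:
 assumes "p : car M" "q : car M" "a : car L" "b : car L"
 shows "single L p a *\<^sub>S single L q b = single L (p *\<^sub>M q) (a *\<^sub>L act p b)"
proof
 fix x
 have "(single L p a *\<^sub>S single L q b) x =
  (\<Oplus>\<^sub>L r\<in>{p} \<times> {q}. if fst r *\<^sub>M snd r = x
   then single L p a (fst r) *\<^sub>L act (fst r) (single L q b (snd r)) else 0\<^sub>L)"
  by (intro mult_eq single_closed) (use assms in "auto simp: single_def")
 then show "(single L p a *\<^sub>S single L q b) x = single L (p *\<^sub>M q) (a *\<^sub>L act p b) x"
  using assms by (auto simp: single_def)
qed

lemma mult_distr:
 assumes u: "u : car S" and v: "v : car S" and w: "w : car S"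
 shows "(u +\<^sub>S v) *\<^sub>S w = u *\<^sub>S w +\<^sub>S v *\<^sub>S w"
  and "w *\<^sub>S (u +\<^sub>S v) = w *\<^sub>S u +\<^sub>S w *\<^sub>S v"
proof -
 let ?P = "{m. u m ~= 0\<^sub>L} \<union> {m. v m ~= 0\<^sub>L}" and ?Q = "{m. w m ~= 0\<^sub>L}"
 have P: "finite ?P" "?P \<subseteq> car M" "{m. u m ~= 0\<^sub>L} \<subseteq> ?P" "{m. v m ~= 0\<^sub>L} \<subseteq> ?P"
  "{m. (u +\<^sub>S v) m ~= 0\<^sub>L} \<subseteq> ?P"
  using carrierD[OF u] carrierD[OF v] by (auto simp: add_apply)
 have Q: "finite ?Q" "?Q \<subseteq> car M" "{m. w m ~= 0\<^sub>L} \<subseteq> ?Q"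
  using carrierD[OF w] by auto
 note c = carrierD(2)[OF u] carrierD(2)[OF v] carrierD(2)[OF w]
 show "(u +\<^sub>S v) *\<^sub>S w = u *\<^sub>S w +\<^sub>S v *\<^sub>S w"
 proof
  fix x
  show "((u +\<^sub>S v) *\<^sub>S w) x = (u *\<^sub>S w +\<^sub>S v *\<^sub>S w) x"
   unfolding add_apply mult_eq[OF Sa.a_closed[OF u v] w P(1,2,5) Q] mult_eq[OF u w P(1,2,3) Q]
    mult_eq[OF v w P(1,2,4) Q]
   using P(2) Q(2) c
   by (subst L.A.finsum_addf[symmetric])
    (auto simp: add_apply L.A.l_distr subset_iff intro!: L.A.finsum_cong')
 qed
 show "w *\<^sub>S (u +\<^sub>S v) = w *\<^sub>S u +\<^sub>S w *\<^sub>S v"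
 proof
  fix x
  show "(w *\<^sub>S (u +\<^sub>S v)) x = (w *\<^sub>S u +\<^sub>S w *\<^sub>S v) x"
   unfolding add_apply mult_eq[OF w Sa.a_closed[OF u v] Q P(1,2,5)] mult_eq[OF w u Q P(1,2,3)]
    mult_eq[OF w v Q P(1,2,4)]
   using P(2) Q(2) c
   by (subst L.A.finsum_addf[symmetric])
    (auto simp: add_apply L.A.r_distr subset_iff intro!: L.A.finsum_cong')
 qed
qed

lemma mult_zero:
 assumes "u : car S" shows "0\<^sub>S *\<^sub>S u = 0\<^sub>S" "u *\<^sub>S 0\<^sub>S = 0\<^sub>S"
 by (auto simp: skew_monoid_ring_def)

lemma mult_closed:
 assumes "u : car S" "v : car S" shows "u *\<^sub>S v : car S"
 using assms
proof (induction u rule: skew_induct)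
 case (single m x)
 from single(3) show ?case
  by (induction v rule: skew_induct) (use single in "auto simp: mult_zero mult_distr single_mult")
qed (auto simp: mult_zero mult_distr)

lemma mult_assoc:
 assumes "u : car S" "v : car S" "w : car S"
 shows "(u *\<^sub>S v) *\<^sub>S w = u *\<^sub>S (v *\<^sub>S w)"
 using assms
proof (induction u rule: skew_induct)
 case (single p a)
 note p = single(1,2)
 from single(3,4) show ?case
 proof (induction v rule: skew_induct)
  case (single q b)
  note q = single(1,2)
  from single(3) show ?case
  proof (induction w rule: skew_induct)
   case (single r c)
   with p q show ?case by (simp add: single_mult M.m_assoc L.A.m_assoc act_mult)
  qed (use p q in "auto simp: mult_zero mult_distr mult_closed")
 qed (use p in "auto simp: mult_zero mult_distr mult_closed")
qed (auto simp: mult_zero mult_distr mult_closed)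

lemma mult_one:
 assumes "u : car S" shows "1\<^sub>S *\<^sub>S u = u" "u *\<^sub>S 1\<^sub>S = u"
 using assms by (induction u rule: skew_induct)
  (auto simp: one_eq mult_zero mult_distr single_mult act_one)

lemma smult_S:
 assumes "c : car k" "u : car S" shows "c \<odot>\<^sub>S u : car S"
proof (rule carrierI)
 have "{m. (c \<odot>\<^sub>S u) m ~= 0\<^sub>L} \<subseteq> {m. u m ~= 0\<^sub>L}" using assms by (auto simp: smult_apply)
 then show "finite {m. (c \<odot>\<^sub>S u) m ~= 0\<^sub>L}" using carrierD(4)[OF assms(2)] finite_subset by blast
qed (use assms carrierD[OF assms(2)] in "auto simp: smult_apply")

lemma smult_single: "[|c : car k; x : car L|] ==> c \<odot>\<^sub>S single L m x = single L m (c \<odot>\<^sub>L x)"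
 by (auto simp: smult_apply single_def)

lemma smult_add:
 "[|c : car k; u : car S; v : car S|] ==> c \<odot>\<^sub>S (u +\<^sub>S v) = c \<odot>\<^sub>S u +\<^sub>S c \<odot>\<^sub>S v"
 using carrierD(2) by (auto simp: smult_apply add_apply L.smult_r_distr)

lemma smult_zero: "c : car k ==> c \<odot>\<^sub>S 0\<^sub>S = 0\<^sub>S"
 by (auto simp: smult_apply zero_apply)

lemma smult_mult_S:
 assumes "c : car k" "u : car S" "v : car S"
 shows "(c \<odot>\<^sub>S u) *\<^sub>S v = c \<odot>\<^sub>S (u *\<^sub>S v)" "u *\<^sub>S (c \<odot>\<^sub>S v) = c \<odot>\<^sub>S (u *\<^sub>S v)"
proof -
 have "(c \<odot>\<^sub>S u) *\<^sub>S v = c \<odot>\<^sub>S (u *\<^sub>S v) & u *\<^sub>S (c \<odot>\<^sub>S v) = c \<odot>\<^sub>S (u *\<^sub>S v)"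
  using assms(2,3)
 proof (induction u rule: skew_induct)
  case (single p a)
  from single(3) show ?case
  proof (induction v rule: skew_induct)
   case (single q b)
   then show ?case using \<open>p : car M\<close> \<open>a : car L\<close> assms(1)
    by (simp add: smult_single single_mult L.smult_mult_left L.smult_mult_right)
  qed (use single assms(1) in "auto simp: mult_zero mult_distr mult_closed smult_zero smult_add smult_S smult_single")
 qed (use assms(1) in "auto simp: mult_zero mult_distr mult_closed smult_zero smult_add smult_S")
 then show "(c \<odot>\<^sub>S u) *\<^sub>S v = c \<odot>\<^sub>S (u *\<^sub>S v)" "u *\<^sub>S (c \<odot>\<^sub>S v) = c \<odot>\<^sub>S (u *\<^sub>S v)" by auto
qed

lemma ring_S: "ring S"
 by (intro ringI monoidI abelian_group_S)
  (auto simp: mult_closed mult_assoc mult_distr mult_one one_eq[symmetric],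
  auto simp: one_eq)

lemma nc_algebra_S: "nc_algebra k S"
proof (intro nc_algebra.intro nc_algebra_axioms.intro moduleI ring_S abelian_group_S)
 show "cring k" by (rule L.R.cring_axioms)
qed (use carrierD(2) in "auto simp: smult_S smult_mult_S smult_add smult_apply add_apply
  L.smult_l_distr L.smult_assoc1")

sublocale SA: nc_algebra k S by (rule nc_algebra_S)

lemma single_ring_hom: "single L 1\<^sub>M : ring_hom L S"
 by (rule ring_hom_memI) (auto simp: single_mult single_add act_one one_eq)

text \<open>Both sides of the multiplicative law are biadditive, so \<open>single\<close> elements
  decide. It serves for maps out of monoid algebras and for conjugation on skew rings.\<close>

lemma additive_hom_mult:
 assumes "ring R"
  and f: "\<And>u. u : car S ==> f u : car R"
  and add: "\<And>u v. [|u : car S; v : car S|] ==> f (u +\<^sub>S v) = f u \<oplus>\<^bsub>R\<^esub> f v"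
  and mult: "\<And>p q a b. [|p : car M; q : car M; a : car L; b : car L|] ==>
   f (single L (p *\<^sub>M q) (a *\<^sub>L act p b)) = f (single L p a) \<otimes>\<^bsub>R\<^esub> f (single L q b)"
  and one: "f 1\<^sub>S = \<one>\<^bsub>R\<^esub>"
 shows "f : ring_hom S R"
proof (rule ring_hom_memI)
 interpret R: ring R by fact
 have "f 0\<^sub>S \<oplus>\<^bsub>R\<^esub> f 0\<^sub>S = f 0\<^sub>S" using add[of "0\<^sub>S" "0\<^sub>S"] by simp
 then have zero: "f 0\<^sub>S = \<zero>\<^bsub>R\<^esub>" using f[OF Sa.zero_closed]
  by (metis R.add.r_cancel_one')
 show "f (u *\<^sub>S v) = f u \<otimes>\<^bsub>R\<^esub> f v" if "u : car S" "v : car S" for u v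
  using that
 proof (induction u rule: skew_induct)
  case (single p a)
  from single(3) show ?case
  proof (induction v rule: skew_induct)
   case (single q b)
   then show ?case using \<open>p : car M\<close> \<open>a : car L\<close> by (simp add: single_mult mult)
  qed (use single in "auto simp: mult_distr mult_zero mult_closed zero f add R.r_distr")
 qed (auto simp: mult_distr mult_zero mult_closed zero f add R.l_distr)
qed (use f add one in auto)

lemma comm:
 assumes "cring L" "comm_monoid M" "\<And>m x. [|m : car M; x : car L|] ==> act m x = x"
 shows "cring S"
proof (intro cring.intro ring_S comm_monoid.intro comm_monoid_axioms.intro)
 interpret L': cring L by fact
 interpret M': comm_monoid M by fact
 show "monoid S" using ring_S ring.is_monoid by auto
 show "u *\<^sub>S v = v *\<^sub>S u" if "u : car S" "v : car S" for u v
  using that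
 proof (induction u rule: skew_induct)
  case (single p a)
  from single(3) show ?case
  proof (induction v rule: skew_induct)
   case (single q b)
   then show ?case using \<open>p : car M\<close> \<open>a : car L\<close> assms(3)
    by (simp add: single_mult L'.m_comm M'.m_comm)
  qed (use single in "auto simp: mult_distr mult_zero")
 qed (auto simp: mult_distr mult_zero)
qed

lemma skew_eval_eq:
 assumes "u : car S" "b : car L" "finite P" "P \<subseteq> car M" "{m. u m ~= 0\<^sub>L} \<subseteq> P"
 shows "skew_eval L act u b = (\<Oplus>\<^sub>L m\<in>P. u m *\<^sub>L act m b)"
 unfolding skew_eval_def
 by (rule L.A.add.finprod_mono_neutral_cong_left)
  (use assms carrierD(2)[OF assms(1)] in "auto simp: Pi_def subset_iff")

end

section \<open>Monoid algebras\<close>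

lemma regular_algebra_simps [simp]:
 "car (regular_algebra k) = car k" "\<one>\<^bsub>regular_algebra k\<^esub> = 1\<^sub>k" "\<zero>\<^bsub>regular_algebra k\<^esub> = 0\<^sub>k"
 "x \<otimes>\<^bsub>regular_algebra k\<^esub> y = x *\<^sub>k y" "x \<oplus>\<^bsub>regular_algebra k\<^esub> y = x +\<^sub>k y"
 "x \<odot>\<^bsub>regular_algebra k\<^esub> y = x *\<^sub>k y"
 by (simp_all add: regular_algebra_def)

lemma single_regular [simp]: "single (regular_algebra k) = single k"
 by (simp add: single_def fun_eq_iff)

lemma cring_regular_algebra: assumes "cring k" shows "cring (regular_algebra k)"
proof -
 interpret cring k by fact
 show ?thesis
  by (intro cringI abelian_groupI comm_monoidI)
   (auto simp: m_assoc a_assoc l_distr intro: add.l_inv_ex m_comm a_comm)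
qed

lemma nc_algebra_regular: assumes "cring k" shows "nc_algebra k (regular_algebra k)"
proof -
 interpret cring k by fact
 have "algebra k (regular_algebra k)"
  by (intro algebraI assms cring_regular_algebra) (auto simp: m_assoc l_distr r_distr)
 then show ?thesis by (rule algebra.nc_algebra)
qed

lemma skew_ring_monoid_algebra:
 assumes "cring k" "monoid M" shows "skew_ring k (regular_algebra k) M (%_ x. x)"
 by (intro skew_ring.intro skew_ring_axioms.intro nc_algebra_regular assms) (auto intro: alg_homI)

text \<open>Linear extension of \<open>h\<close>, with multiplicativity tested on
  \<open>single\<close> elements. Every map out of a tensor power or out of a generalized Weyl
  algebra starts from this universal property.\<close>

lemma monoid_algebra_hom:
 fixes k :: "('k, 'x) ring_scheme" and M :: "('m, 'z) monoid_scheme"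
  and R :: "('k, 'r, 'y) module_scheme"
 assumes "cring k" "monoid M" "nc_algebra k R" and h: "h : hom M R" "h 1\<^sub>M = \<one>\<^bsub>R\<^esub>"
 shows "EX f:alg_hom k (monoid_algebra k M) R. ALL m:car M. f (single k m 1\<^sub>k) = h m"
proof -
 interpret skew_ring k "regular_algebra k" M "%_ x. x"
  by (intro skew_ring_monoid_algebra assms)
 interpret R: nc_algebra k R by fact
 interpret k: cring k by fact
 have hc: "m : car M ==> h m : car R" for m using h(1) by (auto simp: hom_def)
 define f where "f u = (\<Oplus>\<^bsub>R\<^esub>m\<in>{m. u m ~= 0\<^sub>k}. u m \<odot>\<^bsub>R\<^esub> h m)" for u
 have cD: "u m : car k" if "u : car S" for u m using carrierD(2)[OF that] by simp
 have f_eq: "f u = (\<Oplus>\<^bsub>R\<^esub>m\<in>P. u m \<odot>\<^bsub>R\<^esub> h m)"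
  if "u : car S" "finite P" "{m. u m ~= 0\<^sub>k} \<subseteq> P" "P \<subseteq> car M" for u P
  unfolding f_def
  by (rule R.A.add.finprod_mono_neutral_cong_left) (use that cD hc in "auto simp: Pi_def subset_iff")
 have fs: "f (single k m c) = c \<odot>\<^bsub>R\<^esub> h m" if "m : car M" "c : car k" for m c
 proof -
  have "f (single k m c) = (\<Oplus>\<^bsub>R\<^esub>m'\<in>{m}. single k m c m' \<odot>\<^bsub>R\<^esub> h m')"
   by (rule f_eq) (use that single_closed[of m c] in "auto simp: single_def")
  then show ?thesis using that hc[of m] by (simp add: single_def)
 qed
 have add: "f (u +\<^sub>S v) = f u \<oplus>\<^bsub>R\<^esub> f v" if u: "u : car S" and v: "v : car S" for u v
 proof -
  let ?P = "{m. u m ~= 0\<^sub>k} \<union> {m. v m ~= 0\<^sub>k}"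
  have P: "finite ?P" "?P \<subseteq> car M" using carrierD[OF u] carrierD[OF v] by auto
  have "f (u +\<^sub>S v) = (\<Oplus>\<^bsub>R\<^esub>m\<in>?P. (u +\<^sub>S v) m \<odot>\<^bsub>R\<^esub> h m)"
   by (rule f_eq) (use P u v in "auto simp: add_apply")
  also have "\<dots> = (\<Oplus>\<^bsub>R\<^esub>m\<in>?P. u m \<odot>\<^bsub>R\<^esub> h m \<oplus>\<^bsub>R\<^esub> v m \<odot>\<^bsub>R\<^esub> h m)"
   by (rule R.A.finsum_cong') (use P u v cD hc in "auto simp: add_apply R.smult_l_distr subset_iff")
  also have "\<dots> = f u \<oplus>\<^bsub>R\<^esub> f v"
   using P u v cD hc f_eq[OF u P(1) Un_upper1 P(2)] f_eq[OF v P(1) Un_upper2 P(2)]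
   by (subst R.A.finsum_addf) (auto simp: subset_iff)
  finally show ?thesis .
 qed
 have closed: "f u : car R" if u: "u : car S" for u
  unfolding f_def using carrierD[OF u] hc by (intro R.A.finsum_closed) (auto simp: subset_iff)
 have "f : ring_hom S R"
 proof (rule additive_hom_mult[OF R.A.ring_axioms closed add])
  fix p q a b
  assume "p : car M" "q : car M" "a : car (regular_algebra k)"
   "b : car (regular_algebra k)"
  then show "f (single (regular_algebra k) (p *\<^sub>M q) (a \<otimes>\<^bsub>regular_algebra k\<^esub> b)) =
     f (single (regular_algebra k) p a) \<otimes>\<^bsub>R\<^esub> f (single (regular_algebra k) q b)"
   using hom_mult[OF h(1), of p q] hc
   by (simp add: fs R.smult_mult_left R.smult_mult_right R.smult_assoc1[symmetric] L.R.m_comm)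
 next
  show "f 1\<^sub>S = \<one>\<^bsub>R\<^esub>" using h(2) by (simp add: one_eq fs)
 qed
 moreover have "f (c \<odot>\<^sub>S u) = c \<odot>\<^bsub>R\<^esub> f u" if c: "c : car k" and "u : car S" for u c
  using that(2)
 proof (induction u rule: skew_induct)
  case zero
  then show ?case using c add[of "0\<^sub>S" "0\<^sub>S"] closed[of "0\<^sub>S"]
   by (simp add: smult_zero)
 next
  case (single m x)
  with c smult_single[of c x m] show ?case by (simp add: fs R.smult_assoc1 hc)
 next
  case (add u v)
  then show ?case using c by (simp add: smult_add \<open>\<And>u v. [|u : car S; v : car S|] ==> f (u +\<^sub>S v) = f u \<oplus>\<^bsub>R\<^esub> f v\<close> smult_S closed R.smult_r_distr)
 qed
 ultimately have "f : alg_hom k (monoid_algebra k M) R"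
  by (simp add: alg_hom_def monoid_algebra_def)
 moreover have "ALL m:car M. f (single k m 1\<^sub>k) = h m" using fs hc by simp
 ultimately show ?thesis by blast
qed

lemma nc_algebra_monoid_algebra:
 assumes "cring k" "monoid M" shows "nc_algebra k (monoid_algebra k M)"
 unfolding monoid_algebra_def
 by (rule skew_ring.nc_algebra_S[OF skew_ring_monoid_algebra[OF assms]])

lemma monoid_algebra_simps:
 assumes "cring k" "monoid M"
 shows "[|m : car M; x : car k|] ==> single k m x : car (monoid_algebra k M)"
  and "\<one>\<^bsub>monoid_algebra k M\<^esub> = single k 1\<^sub>M 1\<^sub>k"
  and "[|m : car M; m' : car M|] ==>
   single k m 1\<^sub>k \<otimes>\<^bsub>monoid_algebra k M\<^esub> single k m' 1\<^sub>k = single k (m *\<^sub>M m') 1\<^sub>k"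
  and "[|m : car M; x : car k|] ==> x \<odot>\<^bsub>monoid_algebra k M\<^esub> single k m 1\<^sub>k = single k m x"
proof -
 interpret skew_ring k "regular_algebra k" M "%_ x. x"
  by (intro skew_ring_monoid_algebra assms)
 interpret k: cring k by fact
 show "[|m : car M; x : car k|] ==> single k m x : car (monoid_algebra k M)"
  "\<one>\<^bsub>monoid_algebra k M\<^esub> = single k 1\<^sub>M 1\<^sub>k"
  "[|m : car M; m' : car M|] ==>
   single k m 1\<^sub>k \<otimes>\<^bsub>monoid_algebra k M\<^esub> single k m' 1\<^sub>k = single k (m *\<^sub>M m') 1\<^sub>k"
  "[|m : car M; x : car k|] ==> x \<odot>\<^bsub>monoid_algebra k M\<^esub> single k m 1\<^sub>k = single k m x"
  using single_closed[of m x] one_eq single_mult[of m m' "1\<^sub>k" "1\<^sub>k"] smult_single[of x "1\<^sub>k" m]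
  by (simp_all add: monoid_algebra_def)
qed

lemma monoid_algebra_induct [consumes 3, case_names zero single add]:
 assumes "cring k" "monoid M" "u : car (monoid_algebra k M)" "P \<zero>\<^bsub>monoid_algebra k M\<^esub>"
  and "\<And>m x. [|m : car M; x : car k|] ==> P (single k m x)"
  and "\<And>u v. [|u : car (monoid_algebra k M); v : car (monoid_algebra k M); P u; P v|] ==>
   P (u \<oplus>\<^bsub>monoid_algebra k M\<^esub> v)"
 shows "P u"
proof -
 interpret skew_ring k "regular_algebra k" M "%_ x. x"
  by (intro skew_ring_monoid_algebra assms)
 show ?thesis using assms(3-) unfolding monoid_algebra_def
  by (induction u rule: skew_induct) auto
qed

section \<open>Quotient algebras\<close>

lemma quot_algebra_simps:
 "car (quot_algebra R I) = car (R Quot I)"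
 "\<one>\<^bsub>quot_algebra R I\<^esub> = \<one>\<^bsub>R Quot I\<^esub>" "\<zero>\<^bsub>quot_algebra R I\<^esub> = \<zero>\<^bsub>R Quot I\<^esub>"
 "x \<otimes>\<^bsub>quot_algebra R I\<^esub> y = x \<otimes>\<^bsub>R Quot I\<^esub> y" "x \<oplus>\<^bsub>quot_algebra R I\<^esub> y = x \<oplus>\<^bsub>R Quot I\<^esub> y"
 by (simp_all add: quot_algebra_def)

lemma ring_cong:
 assumes "ring R" "car R' = car R" "monoid.mult R' = monoid.mult R" "\<one>\<^bsub>R'\<^esub> = \<one>\<^bsub>R\<^esub>"
  "\<zero>\<^bsub>R'\<^esub> = \<zero>\<^bsub>R\<^esub>" "ring.add R' = ring.add R"
 shows "ring R'"
proof -
 interpret ring R by fact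
 show ?thesis
  by (intro ringI abelian_groupI monoidI)
   (use assms in "auto simp: m_assoc a_assoc l_distr r_distr intro: a_comm add.l_inv_ex")
qed

lemma ring_quot_algebra: assumes "ideal I R" shows "ring (quot_algebra R I)"
 by (rule ring_cong[OF ideal.quotient_is_ring[OF assms]]) (auto simp: quot_algebra_def)

context nc_algebra
begin

text \<open>A scalar acts as multiplication by its multiple of 1, so a ring ideal is automatically a
  subspace. Dividing by the \<open>Idl\<close> of some relations therefore gives an algebra.\<close>

lemma ideal_smult:
 assumes "ideal I A" "c : car k" "x : I" shows "c \<odot>\<^sub>A x : I"
proof -
 interpret ideal I A by fact
 have "c \<odot>\<^sub>A x = (c \<odot>\<^sub>A 1\<^sub>A) *\<^sub>A x" using assms by (simp add: smult_mult_left)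
 then show ?thesis using assms by (simp add: I_l_closed)
qed

lemma quot_surj:
 assumes "ideal I A" "V : car (quot_algebra A I)"
 obtains x where "x : car A" "V = I +>\<^sub>A x"
 using assms(2) by (auto simp: quot_algebra_simps FactRing_simps)

lemma coset_eq_iff:
 assumes "ideal I A" "x : car A" "y : car A"
 shows "I +>\<^sub>A x = I +>\<^sub>A y \<longleftrightarrow> x \<ominus>\<^sub>A y : I"
 using assms by (metis A.quotient_eq_iff_same_a_r_cos)

lemma smult_coset:
 assumes I: "ideal I A" and "c : car k" "x : car A"
 shows "c \<odot>\<^bsub>quot_algebra A I\<^esub> (I +>\<^sub>A x) = I +>\<^sub>A (c \<odot>\<^sub>A x)"
proof -
 interpret I: ideal I A by fact
 have "(\<Union>y\<in>I +>\<^sub>A x. I +>\<^sub>A (c \<odot>\<^sub>A y)) = I +>\<^sub>A (c \<odot>\<^sub>A x)"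
 proof (rule UN_eq_const)
  show "x : I +>\<^sub>A x" using assms by (simp add: I.a_rcos_self)
  fix y assume y: "y : I +>\<^sub>A x"
  then have yc: "y : car A" using assms I.a_rcos_const I.a_elemrcos_carrier by blast
  have "I +>\<^sub>A y = I +>\<^sub>A x" using y assms(3) I.a_repr_independence' by blast
  then have "y \<ominus>\<^sub>A x : I" using yc assms coset_eq_iff by blast
  then have "c \<odot>\<^sub>A (y \<ominus>\<^sub>A x) : I" using ideal_smult assms by blast
  moreover have "c \<odot>\<^sub>A (y \<ominus>\<^sub>A x) = c \<odot>\<^sub>A y \<ominus>\<^sub>A c \<odot>\<^sub>A x"
   using assms yc by (simp add: a_minus_def smult_r_distr smult_r_minus)
  ultimately show "I +>\<^sub>A (c \<odot>\<^sub>A y) = I +>\<^sub>A (c \<odot>\<^sub>A x)"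
   using coset_eq_iff[OF I] assms yc by simp
 qed
 then show ?thesis by (simp add: quot_algebra_def)
qed

lemma quot_proj: assumes "ideal I A" shows "(+>\<^sub>A) I : alg_hom k A (quot_algebra A I)"
 using ideal.rcos_ring_hom[OF assms] smult_coset[OF assms]
 by (auto simp: alg_hom_def ring_hom_def quot_algebra_simps)

lemma nc_algebra_quot: assumes I: "ideal I A" shows "nc_algebra k (quot_algebra A I)"
proof -
 interpret Q: ring "quot_algebra A I" by (rule ring_quot_algebra[OF I])
 note p = alg_homD[OF quot_proj[OF I]]
 note s = p(3,4,6)[symmetric]
 show ?thesis
 proof (intro nc_algebra.intro nc_algebra_axioms.intro moduleI)
  show "ring (quot_algebra A I)" "abelian_group (quot_algebra A I)" "cring k" by unfold_locales
 next
  fix c x assume c: "c : car k" and "x : car (quot_algebra A I)"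
  then obtain u where u: "u : car A" "x = I +>\<^sub>A u" using quot_surj[OF I] by metis
  show "c \<odot>\<^bsub>quot_algebra A I\<^esub> x : car (quot_algebra A I)" using c u by (simp add: s p(2))
  fix d assume d: "d : car k"
  show "(c +\<^sub>k d) \<odot>\<^bsub>quot_algebra A I\<^esub> x = c \<odot>\<^bsub>quot_algebra A I\<^esub> x \<oplus>\<^bsub>quot_algebra A I\<^esub> d \<odot>\<^bsub>quot_algebra A I\<^esub> x"
   "(c *\<^sub>k d) \<odot>\<^bsub>quot_algebra A I\<^esub> x = c \<odot>\<^bsub>quot_algebra A I\<^esub> (d \<odot>\<^bsub>quot_algebra A I\<^esub> x)"
   using c d u by (simp_all add: s smult_l_distr smult_assoc1)
 next
  fix c x y
  assume c: "c : car k" and "x : car (quot_algebra A I)" "y : car (quot_algebra A I)"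
  then obtain u v where u: "u : car A" "x = I +>\<^sub>A u" and v: "v : car A" "y = I +>\<^sub>A v"
   using quot_surj[OF I] by metis
  show "c \<odot>\<^bsub>quot_algebra A I\<^esub> (x \<oplus>\<^bsub>quot_algebra A I\<^esub> y) = c \<odot>\<^bsub>quot_algebra A I\<^esub> x \<oplus>\<^bsub>quot_algebra A I\<^esub> c \<odot>\<^bsub>quot_algebra A I\<^esub> y"
   "(c \<odot>\<^bsub>quot_algebra A I\<^esub> x) \<otimes>\<^bsub>quot_algebra A I\<^esub> y = c \<odot>\<^bsub>quot_algebra A I\<^esub> (x \<otimes>\<^bsub>quot_algebra A I\<^esub> y)"
   "x \<otimes>\<^bsub>quot_algebra A I\<^esub> (c \<odot>\<^bsub>quot_algebra A I\<^esub> y) = c \<odot>\<^bsub>quot_algebra A I\<^esub> (x \<otimes>\<^bsub>quot_algebra A I\<^esub> y)"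
   using c u v by (simp_all add: s smult_r_distr smult_mult_left smult_mult_right)
 next
  fix x assume "x : car (quot_algebra A I)"
  then obtain u where u: "u : car A" "x = I +>\<^sub>A u" using quot_surj[OF I] by metis
  show "1\<^sub>k \<odot>\<^bsub>quot_algebra A I\<^esub> x = x" using u by (simp add: s)
 qed
qed

text \<open>The kernel of \<open>f\<close> is an ideal containing \<open>Rel\<close>, hence contains
  the ideal that \<open>Rel\<close> generates, and \<open>f\<close> is constant on cosets. The value
  of \<open>g\<close> on a coset is the only element of its image under \<open>f\<close>.\<close>

lemma quot_hom:
 assumes B: "nc_algebra k B" and f: "f : alg_hom k A B" and rel: "Rel \<subseteq> car A"
  and kill: "\<And>r. r : Rel ==> f r = 0\<^sub>B"
 defines "I \<equiv> Idl\<^bsub>A\<^esub> Rel"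
 shows "EX g:alg_hom k (quot_algebra A I) B. ALL x:car A. g (I +>\<^sub>A x) = f x"
proof -
 interpret B: nc_algebra k B by fact
 note fD = alg_homD[OF f]
 interpret f: ring_hom_ring A B f using fD(1) by (simp add: ring_hom_ringI2 A.ring_axioms B.A.ring_axioms)
 have I: "ideal I A" unfolding I_def by (rule A.genideal_ideal[OF rel])
 interpret I: ideal I A by (rule I)
 have "Rel \<subseteq> a_kernel A B f" unfolding a_kernel_def' using kill rel by blast
 then have sub: "I \<subseteq> a_kernel A B f"
  unfolding I_def by (rule A.genideal_minimal[OF f.kernel_is_ideal])
 have const: "f y = f x" if "x : car A" "y : I +>\<^sub>A x" for x y
 proof -
  from that obtain i where i: "i : I" "y = i +\<^sub>A x" by (auto simp: a_r_coset_def')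
  moreover from this have "i : car A" "f i = 0\<^sub>B" using sub unfolding a_kernel_def' by auto
  ultimately show ?thesis using that(1) by (simp add: fD)
 qed
 have img: "f ` (I +>\<^sub>A x) = {f x}" if "x : car A" for x
  using const[OF that] I.a_rcos_self[OF that] by blast
 define g where "g V = the_elem (f ` V)" for V
 have g: "g (I +>\<^sub>A x) = f x" if "x : car A" for x using img[OF that] by (simp add: g_def)
 note s = alg_homD(3-6)[OF quot_proj[OF I], symmetric]
 have "g : alg_hom k (quot_algebra A I) B"
 proof (rule alg_homI)
  show "g \<one>\<^bsub>quot_algebra A I\<^esub> = 1\<^sub>B" by (simp add: s(3) g fD(5))
 next
  fix c x assume c: "c : car k" and "x : car (quot_algebra A I)"
  then obtain u where u: "u : car A" "x = I +>\<^sub>A u" using quot_surj[OF I] by metis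
  show "g (c \<odot>\<^bsub>quot_algebra A I\<^esub> x) = c \<odot>\<^sub>B g x" using c u by (simp add: s g fD)
 next
  fix x assume "x : car (quot_algebra A I)"
  then show "g x : car B" using quot_surj[OF I] g fD(2) by metis
 next
  fix x y assume "x : car (quot_algebra A I)" "y : car (quot_algebra A I)"
  then obtain u v where u: "u : car A" "x = I +>\<^sub>A u" and v: "v : car A" "y = I +>\<^sub>A v"
   using quot_surj[OF I] by metis
  show "g (x \<otimes>\<^bsub>quot_algebra A I\<^esub> y) = g x *\<^sub>B g y" "g (x \<oplus>\<^bsub>quot_algebra A I\<^esub> y) = g x +\<^sub>B g y"
   using u v by (simp_all add: s g fD)
 qed
 then show ?thesis using g by blast
qed

end

section \<open>Tensor powers\<close>

lemma tuples_simps [simp]: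
 "car (tuples n A) = (\<Pi>\<^sub>E i\<in>{1..n}. car A)"
 "\<one>\<^bsub>tuples n A\<^esub> = (\<lambda>i\<in>{1..n}. 1\<^sub>A)"
 "x \<otimes>\<^bsub>tuples n A\<^esub> y = (\<lambda>i\<in>{1..n}. x i *\<^sub>A y i)"
 by (simp_all add: tuples_def)

lemma monoid_tuples: assumes "monoid A" shows "monoid (tuples n A)"
proof -
 interpret monoid A by fact
 show ?thesis
  by (rule monoidI) (auto simp: PiE_iff m_assoc extensional_def intro!: restrict_ext ext)
qed

text \<open>What a map on tuples needs in order to induce an algebra homomorphism on the tensor
  power: the monoid law on tuples and linearity at each position. The updates
  \<open>x(i := b)\<close> mirror \<open>tensor_relations\<close>.\<close>

definition multilinear_hom where
 "multilinear_hom k n A R h \<longleftrightarrow>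
  (ALL x:car (tuples n A). h x : car R) & h \<one>\<^bsub>tuples n A\<^esub> = \<one>\<^bsub>R\<^esub> &
  (ALL x:car (tuples n A). ALL y:car (tuples n A). h (x \<otimes>\<^bsub>tuples n A\<^esub> y) = h x \<otimes>\<^bsub>R\<^esub> h y) &
  (ALL x:car (tuples n A). ALL i:{1..n}. ALL b:car A. ALL c:car A.
    h (x(i := b +\<^sub>A c)) = h (x(i := b)) \<oplus>\<^bsub>R\<^esub> h (x(i := c))) &
  (ALL x:car (tuples n A). ALL i:{1..n}. ALL s:car k. ALL b:car A.
    h (x(i := s \<odot>\<^sub>A b)) = s \<odot>\<^bsub>R\<^esub> h (x(i := b)))"

lemma multilinear_homD:
 assumes "multilinear_hom k n A R h"
 shows "x : car (tuples n A) ==> h x : car R"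
  and "h (\<lambda>i\<in>{1..n}. 1\<^sub>A) = \<one>\<^bsub>R\<^esub>"
  and "[|x : car (tuples n A); y : car (tuples n A)|] ==> h (x \<otimes>\<^bsub>tuples n A\<^esub> y) = h x \<otimes>\<^bsub>R\<^esub> h y"
  and "[|x : car (tuples n A); i : {1..n}; b : car A; c : car A|] ==>
   h (x(i := b +\<^sub>A c)) = h (x(i := b)) \<oplus>\<^bsub>R\<^esub> h (x(i := c))"
  and "[|x : car (tuples n A); i : {1..n}; s : car k; b : car A|] ==>
   h (x(i := s \<odot>\<^sub>A b)) = s \<odot>\<^bsub>R\<^esub> h (x(i := b))"
 using assms unfolding multilinear_hom_def by (blast, simp, blast, blast, blast)

lemma tuple_upd: "[|x : car (tuples n A); i : {1..n}; b : car A|] ==> x(i := b) : car (tuples n A)"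
 by (auto simp: PiE_iff extensional_def)

definition pure ::
 "('k, 'x) ring_scheme => nat => ('k, 'r, 'y) module_scheme => (nat => 'r) => ((nat => 'r) => 'k) set"
where
 "pure k n A x = tensor_ideal k n A +>\<^bsub>tuple_algebra k n A\<^esub> single k x 1\<^sub>k"

lemma in_factor_pure: "in_factor k n A i b = pure k n A (\<lambda>j\<in>{1..n}. if j = i then b else 1\<^sub>A)"
 by (simp add: in_factor_def pure_def)

context nc_algebra
begin

context
 fixes n :: nat
begin

abbreviation T where "T \<equiv> tensor_power k n A"
abbreviation TA where "TA \<equiv> tuple_algebra k n A"

lemma nc_algebra_TA: "nc_algebra k TA"
 by (rule nc_algebra_monoid_algebra) (use R.cring_axioms monoid_tuples A.is_monoid in auto)

lemma single_TA: "[|x : car (tuples n A); c : car k|] ==> single k x c : car TA"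
 by (rule monoid_algebra_simps) (use R.cring_axioms monoid_tuples A.is_monoid in auto)

lemma tensor_relations_carrier: "tensor_relations k n A \<subseteq> car TA"
proof -
 interpret TA: nc_algebra k TA by (rule nc_algebra_TA)
 show ?thesis
  unfolding tensor_relations_def Let_def
  by (auto intro!: TA.A.minus_closed TA.A.a_closed single_TA TA.smult_closed tuple_upd simp del: tuples_simps)
qed

lemma ideal_tensor: "ideal (tensor_ideal k n A) TA"
 unfolding tensor_ideal_def
 by (rule ring.genideal_ideal) (use nc_algebra_TA tensor_relations_carrier in "auto simp: nc_algebra_def")

lemma nc_algebra_T: "nc_algebra k T"
 unfolding tensor_power_def by (rule nc_algebra.nc_algebra_quot[OF nc_algebra_TA ideal_tensor])

lemma pure_multilinear: "multilinear_hom k n A T (pure k n A)"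
proof -
 interpret TA: nc_algebra k TA by (rule nc_algebra_TA)
 interpret I: ideal "tensor_ideal k n A" TA by (rule ideal_tensor)
 note p = alg_homD[OF TA.quot_proj[OF ideal_tensor], folded tensor_power_def]
 note s = p(3-6)[symmetric]
 have c: "cring k" "monoid (tuples n A)" using R.cring_axioms monoid_tuples A.is_monoid by auto
 have mem: "r : tensor_relations k n A ==> r : tensor_ideal k n A" for r
  unfolding tensor_ideal_def using TA.A.genideal_self[OF tensor_relations_carrier] by blast
 show ?thesis
  unfolding multilinear_hom_def
 proof (intro conjI ballI)
  fix x assume x: "x : car (tuples n A)"
  show "pure k n A x : car T" unfolding pure_def by (rule p(2)[OF single_TA[OF x]]) simp
  fix y assume y: "y : car (tuples n A)"
  show "pure k n A (x \<otimes>\<^bsub>tuples n A\<^esub> y) = pure k n A x *\<^sub>T pure k n A y"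
   unfolding pure_def using x y single_TA[of x "1\<^sub>k"] single_TA[of y "1\<^sub>k"]
   by (simp add: s monoid_algebra_simps(3)[OF c] del: tuples_simps)
 next
  show "pure k n A \<one>\<^bsub>tuples n A\<^esub> = 1\<^sub>T" unfolding pure_def
   by (simp add: s(3)[symmetric] monoid_algebra_simps(2)[OF c, symmetric] p(5) del: tuples_simps)
 next
  fix x i b d assume x: "x : car (tuples n A)" "i : {1..n}" "b : car A" "d : car A"
  let ?e = "%x. single k x 1\<^sub>k"
  have "?e (x(i := b +\<^sub>A d)) \<ominus>\<^bsub>TA\<^esub> (?e (x(i := b)) \<oplus>\<^bsub>TA\<^esub> ?e (x(i := d))) : tensor_ideal k n A"
   by (rule mem) (use x in "auto simp: tensor_relations_def Let_def simp del: tuples_simps")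
  then have "tensor_ideal k n A +>\<^bsub>TA\<^esub> ?e (x(i := b +\<^sub>A d)) =
   tensor_ideal k n A +>\<^bsub>TA\<^esub> (?e (x(i := b)) \<oplus>\<^bsub>TA\<^esub> ?e (x(i := d)))"
   using TA.coset_eq_iff[OF ideal_tensor] x by (simp add: single_TA tuple_upd del: tuples_simps)
  also have "\<dots> = pure k n A (x(i := b)) +\<^sub>T pure k n A (x(i := d))"
   unfolding pure_def using x by (simp add: s(2) single_TA tuple_upd del: tuples_simps)
  finally show "pure k n A (x(i := b +\<^sub>A d)) = pure k n A (x(i := b)) +\<^sub>T pure k n A (x(i := d))"
   unfolding pure_def .
 next
  fix x i c b assume x: "x : car (tuples n A)" "i : {1..n}" "c : car k" "b : car A"
  let ?e = "%x. single k x 1\<^sub>k"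
  have "?e (x(i := c \<odot>\<^sub>A b)) \<ominus>\<^bsub>TA\<^esub> c \<odot>\<^bsub>TA\<^esub> ?e (x(i := b)) : tensor_ideal k n A"
   by (rule mem) (use x in "auto simp: tensor_relations_def Let_def simp del: tuples_simps")
  then have "tensor_ideal k n A +>\<^bsub>TA\<^esub> ?e (x(i := c \<odot>\<^sub>A b)) =
   tensor_ideal k n A +>\<^bsub>TA\<^esub> (c \<odot>\<^bsub>TA\<^esub> ?e (x(i := b)))"
   using TA.coset_eq_iff[OF ideal_tensor] x by (simp add: single_TA tuple_upd del: tuples_simps)
  also have "\<dots> = c \<odot>\<^sub>T pure k n A (x(i := b))"
   unfolding pure_def using x by (simp add: s(4) single_TA tuple_upd del: tuples_simps)
  finally show "pure k n A (x(i := c \<odot>\<^sub>A b)) = c \<odot>\<^sub>T pure k n A (x(i := b))"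
   unfolding pure_def .
 qed
qed

lemmas pureD = multilinear_homD[OF pure_multilinear]

text \<open>Multiplicativity extends \<open>h\<close> to the tuple algebra, and multilinearity is
  exactly the vanishing of this extension on \<open>tensor_relations\<close>.\<close>

lemma tensor_lift:
 assumes R: "nc_algebra k B" and h: "multilinear_hom k n A B h"
 shows "EX f:alg_hom k T B. ALL x:car (tuples n A). f (pure k n A x) = h x"
proof -
 interpret TA: nc_algebra k TA by (rule nc_algebra_TA)
 interpret B: nc_algebra k B by fact
 have c: "cring k" "monoid (tuples n A)" using R.cring_axioms monoid_tuples A.is_monoid by auto
 have "h : hom (tuples n A) B" using multilinear_homD[OF h] by (auto intro!: homI simp del: tuples_simps)
 then obtain f where f: "f : alg_hom k TA B"
  "\<And>x. x : car (tuples n A) ==> f (single k x 1\<^sub>k) = h x"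
  using monoid_algebra_hom[OF c R, of h] multilinear_homD(2)[OF h] by auto
 note fD = alg_homD[OF f(1)]
 have kill: "f r = 0\<^sub>B" if "r : tensor_relations k n A" for r
 proof -
  have minus: "f (x \<ominus>\<^bsub>TA\<^esub> y) = f x \<ominus>\<^sub>B f y" if "x : car TA" "y : car TA" for x y
   using ring_hom_zero_neg(3)[OF fD(1) TA.A.ring_axioms B.A.ring_axioms that] .
  have mm: "x \<ominus>\<^sub>B x = 0\<^sub>B" if "x : car B" for x using that by (simp add: B.A.r_neg a_minus_def)
  from that show ?thesis
   unfolding tensor_relations_def Let_def
   by (elim UnE CollectE exE conjE)
    (simp_all add: minus fD f(2) single_TA tuple_upd multilinear_homD[OF h] mm del: tuples_simps)
 qed
 from TA.quot_hom[OF R f(1) tensor_relations_carrier kill, folded tensor_ideal_def, folded tensor_power_def]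
 obtain g where g: "g : alg_hom k T B"
  "\<And>x. x : car TA ==> g (tensor_ideal k n A +>\<^bsub>TA\<^esub> x) = f x" by blast
 have "g (pure k n A x) = h x" if "x : car (tuples n A)" for x
  unfolding pure_def using g(2)[OF single_TA[OF that]] f(2)[OF that] by simp
 then show ?thesis using g by blast
qed

text \<open>The scalar is kept outside the pure tensor: for \<open>n = 0\<close> there is no factor
  that could absorb it.\<close>

lemma tensor_induct [consumes 1, case_names pure add]:
 assumes t: "t : car T"
  and pure: "\<And>c x. [|c : car k; x : car (tuples n A)|] ==> P (c \<odot>\<^sub>T pure k n A x)"
  and add: "\<And>s t. [|s : car T; t : car T; P s; P t|] ==> P (s +\<^sub>T t)"
 shows "P t"
proof -
 interpret TA: nc_algebra k TA by (rule nc_algebra_TA)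
 interpret T: nc_algebra k T by (rule nc_algebra_T)
 have c: "cring k" "monoid (tuples n A)" using R.cring_axioms monoid_tuples A.is_monoid by auto
 note p = alg_homD[OF TA.quot_proj[OF ideal_tensor], folded tensor_power_def]
 have single: "P (tensor_ideal k n A +>\<^bsub>TA\<^esub> single k x c)"
  if "x : car (tuples n A)" "c : car k" for x c
  using pure[OF that(2,1)] that p(6)[of c "single k x 1\<^sub>k"]
  by (simp add: pure_def monoid_algebra_simps[OF c] del: tuples_simps)
 have "P (tensor_ideal k n A +>\<^bsub>TA\<^esub> u)" if "u : car TA" for u
  using c that
 proof (induction u rule: monoid_algebra_induct)
  case zero
  have "single k \<one>\<^bsub>tuples n A\<^esub> 0\<^sub>k = \<zero>\<^bsub>TA\<^esub>"
   by (simp add: single_def monoid_algebra_def skew_monoid_ring_def fun_eq_iff)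
  then show ?case using single[of "\<one>\<^bsub>tuples n A\<^esub>" "0\<^sub>k"] monoid.one_closed[OF c(2)]
   by (simp del: tuples_simps)
 next
  case (single m x)
  then show ?case using \<open>\<And>x c. [|x : car (tuples n A); c : car k|] ==> P (tensor_ideal k n A +>\<^bsub>TA\<^esub> single k x c)\<close> by blast
 next
  case (add u v)
  then show ?case using p(4)[of u v] p(2) assms(3) by metis
 qed
 then show ?thesis using TA.quot_surj[OF ideal_tensor] t unfolding tensor_power_def by metis
qed

lemma pure_zero:
 assumes "x : car (tuples n A)" "i : {1..n}" shows "pure k n A (x(i := 0\<^sub>A)) = 0\<^sub>T"
proof -
 interpret T: nc_algebra k T by (rule nc_algebra_T)
 have "pure k n A (x(i := 0\<^sub>k \<odot>\<^sub>A 0\<^sub>A)) = 0\<^sub>k \<odot>\<^sub>T pure k n A (x(i := 0\<^sub>A))"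
  by (rule pureD(5)) (use assms in auto)
 then show ?thesis using pureD(1)[OF tuple_upd[OF assms A.zero_closed]] by simp
qed

text \<open>Multilinearity expands one position after another. Negatives cause no trouble because -1
  can be pulled out of a factor as a scalar.\<close>

lemma pure_span:
 assumes V: "V \<subseteq> car A" and x: "x : car (tuples n A)"
  and "\<And>i. i : {1..n} ==> x i : generate (add_monoid A) V"
 shows "pure k n A x : generate (add_monoid T) (pure k n A ` (\<Pi>\<^sub>E i\<in>{1..n}. V))"
proof -
 interpret T: nc_algebra k T by (rule nc_algebra_T)
 let ?P = "pure k n A ` (\<Pi>\<^sub>E i\<in>{1..n}. V)"
 have Pc: "?P \<subseteq> car T"
 proof
  fix t assume "t : ?P"
  then obtain y where "y : (\<Pi>\<^sub>E i\<in>{1..n}. V)" "t = pure k n A y" by blast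
  moreover from this have "y : car (tuples n A)" using V by (auto simp: PiE_iff)
  ultimately show "t : car T" using pureD(1) by blast
 qed
 have gen: "subgroup (generate (add_monoid T) ?P) (add_monoid T)"
  by (rule T.A.add.generate_is_subgroup) (use Pc in auto)
 \<comment> \<open>Positions in \<open>J\<close> already range over the additive span of
   \<open>V\<close>; the others are still confined to \<open>V\<close> itself.\<close>
 have *: "ALL x:car (tuples n A). (ALL i:J. x i : generate (add_monoid A) V) -->
   (ALL i:{1..n} - J. x i : V) --> pure k n A x : generate (add_monoid T) ?P"
  if "finite J" "J \<subseteq> {1..n}" for J
  using that
 proof (induction J)
  case empty
  have "x : (\<Pi>\<^sub>E i\<in>{1..n}. V)" if "x : car (tuples n A)" "ALL i:{1..n}. x i : V" for x
   using that by (auto simp: PiE_iff)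
  then show ?case by (auto intro!: generate.incl simp del: tuples_simps)
 next
  case (insert j J)
  show ?case
  proof (intro ballI impI)
   fix x assume x: "x : car (tuples n A)" "ALL i:insert j J. x i : generate (add_monoid A) V"
    "ALL i:{1..n} - insert j J. x i : V"
   have j: "j : {1..n}" using insert by auto
   have "pure k n A (x(j := b)) : generate (add_monoid T) ?P & b : car A"
    if "b : generate (add_monoid A) V" for b
    using that
   proof (induction b rule: generate.induct)
    case one
    have "\<one>\<^bsub>add_monoid A\<^esub> = 0\<^sub>A" "\<one>\<^bsub>add_monoid T\<^esub> = 0\<^sub>T" by simp_all
    then show ?case using generate.one[of "add_monoid T"] pure_zero[OF x(1) j] A.zero_closed by metis
   next
    case (incl b)
    then have "x(j := b) : car (tuples n A)" using tuple_upd[OF x(1) j] V by blast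
    moreover have "ALL i:J. (x(j := b)) i : generate (add_monoid A) V"
     using x(2) insert(2) by auto
    moreover have "ALL i:{1..n} - J. (x(j := b)) i : V" using x(3) incl by auto
    ultimately have "pure k n A (x(j := b)) : generate (add_monoid T) ?P" using insert by blast
    then show ?case using V incl by blast
   next
    case (inv b)
    have b: "b : car A" using V inv by blast
    have "x(j := b) : car (tuples n A)" using tuple_upd[OF x(1) j] b by blast
    moreover have "ALL i:J. (x(j := b)) i : generate (add_monoid A) V"
     using x(2) insert(2) by auto
    moreover have "ALL i:{1..n} - J. (x(j := b)) i : V" using x(3) inv by auto
    ultimately have p: "pure k n A (x(j := b)) : generate (add_monoid T) ?P" using insert by blast
    have "\<ominus>\<^sub>A b = (\<ominus>\<^sub>k 1\<^sub>k) \<odot>\<^sub>A b" using b by (simp add: smult_l_minus)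
    then have "pure k n A (x(j := \<ominus>\<^sub>A b)) = \<ominus>\<^sub>T pure k n A (x(j := b))"
     using pureD(5)[OF x(1) j, of "\<ominus>\<^sub>k 1\<^sub>k" b] b pureD(1)[OF tuple_upd[OF x(1) j b]]
     by (simp add: T.smult_l_minus)
    moreover have "\<ominus>\<^sub>T pure k n A (x(j := b)) : generate (add_monoid T) ?P"
     using subgroup.m_inv_closed[OF gen p] by (simp add: a_inv_def)
    ultimately have "pure k n A (x(j := \<ominus>\<^sub>A b)) : generate (add_monoid T) ?P" by metis
    then show ?case unfolding a_inv_def[symmetric] using A.a_inv_closed[OF b] by blast
   next
    case (eng b c)
    have m: "x \<otimes>\<^bsub>add_monoid T\<^esub> y = x +\<^sub>T y" for x y by simp
    have m': "x \<otimes>\<^bsub>add_monoid A\<^esub> y = x +\<^sub>A y" for x y by simp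
    have "pure k n A (x(j := b)) +\<^sub>T pure k n A (x(j := c)) : generate (add_monoid T) ?P"
     using generate.eng[OF eng.IH(1)[THEN conjunct1] eng.IH(2)[THEN conjunct1]] unfolding m .
    moreover from eng have "pure k n A (x(j := b +\<^sub>A c)) = pure k n A (x(j := b)) +\<^sub>T pure k n A (x(j := c))"
     using pureD(4)[OF x(1) j] by blast
    ultimately show ?case unfolding m' using eng.IH A.a_closed by metis
   qed
   from this[of "x j"] show "pure k n A x : generate (add_monoid T) ?P" using x(2) by simp
  qed
 qed
 show ?thesis using *[of "{1..n}"] x assms(3) by (auto simp del: tuples_simps)
qed

end

end

section \<open>Maps of tensor powers\<close>

text \<open>The fibre sums that define \<open>push\<close> are taken over the union of both
  supports, so that all three of them have the same index set.\<close>

lemma push_add: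
 fixes h :: "'m => 'n"
 assumes "cring k" "monoid M" "u : car (monoid_algebra k M)" "v : car (monoid_algebra k M)"
 shows "push k h (u \<oplus>\<^bsub>monoid_algebra k M\<^esub> v) = push k h u \<oplus>\<^bsub>monoid_algebra k N\<^esub> push k h v"
proof
 fix y
 interpret skew_ring k "regular_algebra k" M "%_ x. x"
  by (intro skew_ring_monoid_algebra assms)
 have cD: "u m : car k" "finite {m. u m ~= 0\<^sub>k}" if "u : car (monoid_algebra k M)" for u m
  using carrierD[of u] that by (auto simp: monoid_algebra_def)
 let ?P = "{m. u m ~= 0\<^sub>k} \<union> {m. v m ~= 0\<^sub>k}"
 have fin: "finite ?P" using cD assms by auto
 have add: "(u \<oplus>\<^bsub>monoid_algebra k M\<^esub> v) = (%m. u m +\<^sub>k v m)" for M :: "('q,'z2) monoid_scheme" and u v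
  by (simp add: monoid_algebra_def skew_monoid_ring_def)
 have c2: "u m +\<^sub>k v m : car k" for m using cD assms by auto
 have push: "push k h w y = (\<Oplus>\<^sub>k x\<in>?P. if h x = y then w x else 0\<^sub>k)"
  if "{m. w m ~= 0\<^sub>k} \<subseteq> ?P" "\<And>m. w m : car k" for w
  unfolding push_def by (rule L.R.add.finprod_mono_neutral_cong_left) (use that fin in auto)
 have "push k h (%m. u m +\<^sub>k v m) y = (\<Oplus>\<^sub>k x\<in>?P. if h x = y then u x +\<^sub>k v x else 0\<^sub>k)"
  by (rule push) (use cD assms c2 in auto)
 also have "\<dots> = (\<Oplus>\<^sub>k x\<in>?P. (if h x = y then u x else 0\<^sub>k) +\<^sub>k (if h x = y then v x else 0\<^sub>k))"
  by (rule L.R.finsum_cong') (use cD assms in auto)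
 also have "\<dots> = push k h u y +\<^sub>k push k h v y"
  using push[of u] push[of v] cD assms by (subst L.R.finsum_addf) auto
 finally show "push k h (u \<oplus>\<^bsub>monoid_algebra k M\<^esub> v) y = (push k h u \<oplus>\<^bsub>monoid_algebra k N\<^esub> push k h v) y"
  by (simp add: add)
qed

lemma push_single:
 assumes "cring k" "c : car k" shows "push k h (single k m c) = single k (h m) c"
proof
 fix y
 interpret cring k by fact
 show "push k h (single k m c) y = single k (h m) c y"
 proof (cases "c = 0\<^sub>k \<or> h m ~= y")
  case True
  then have "{x. single k m c x ~= 0\<^sub>k & h x = y} = {}" by (auto simp: single_def)
  then show ?thesis using True unfolding push_def by (auto simp: single_def)
 next
  case False
  then have "{x. single k m c x ~= 0\<^sub>k & h x = y} = {m}" by (auto simp: single_def)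
  then show ?thesis using False assms unfolding push_def by (auto simp: single_def)
 qed
qed

text \<open>\<open>tensor_map\<close> is a union over representatives, and nothing in it shows a
  homomorphism. Comparing it on \<open>single\<close> elements with the map \<open>f\<close> from
  \<open>tensor_lift\<close> yields well-definedness and the homomorphism laws together.\<close>

lemma tensor_map_hom:
 assumes A: "nc_algebra k A" and B: "nc_algebra k B"
  and hc: "\<And>x. x : car (tuples n A) ==> h x : car (tuples n B)"
  and h: "multilinear_hom k n A (tensor_power k n B) (%x. pure k n B (h x))"
 shows "tensor_map k n B h : alg_hom k (tensor_power k n A) (tensor_power k n B)"
  and "x : car (tuples n A) ==> tensor_map k n B h (pure k n A x) = pure k n B (h x)"
proof -
 interpret A: nc_algebra k A by fact
 interpret B: nc_algebra k B by fact
 interpret TA: nc_algebra k "tuple_algebra k n A" by (rule A.nc_algebra_TA)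
 interpret TB: nc_algebra k "tuple_algebra k n B" by (rule B.nc_algebra_TA)
 have k: "cring k" by (rule A.R.cring_axioms)
 have mA: "monoid (tuples n A)" and mB: "monoid (tuples n B)"
  using monoid_tuples A.A.is_monoid B.A.is_monoid by auto
 let ?TA = "tuple_algebra k n A" and ?TB = "tuple_algebra k n B"
 let ?I = "tensor_ideal k n A" and ?J = "tensor_ideal k n B"
 interpret I: ideal ?I ?TA by (rule A.ideal_tensor)
 obtain f where f: "f : alg_hom k (tensor_power k n A) (tensor_power k n B)"
  "\<And>x. x : car (tuples n A) ==> f (pure k n A x) = pure k n B (h x)"
  using A.tensor_lift[OF B.nc_algebra_T h] by blast
 note fD = alg_homD[OF f(1)]
 note pA = alg_homD[OF TA.quot_proj[OF A.ideal_tensor], folded tensor_power_def]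
 note pB = alg_homD[OF TB.quot_proj[OF B.ideal_tensor], folded tensor_power_def]
 \<comment> \<open>Both descriptions are additive in \<open>u\<close>, so induction on
   \<open>u\<close> applies. That \<open>push\<close> stays in the carrier is carried along because
   the coset laws ask for it.\<close>
 have key: "push k h u : car ?TB & ?J +>\<^bsub>?TB\<^esub> push k h u = f (?I +>\<^bsub>?TA\<^esub> u)" if "u : car ?TA" for u
  using k mA that
 proof (induction u rule: monoid_algebra_induct)
  case zero
  have "push k h \<zero>\<^bsub>?TA\<^esub> = \<zero>\<^bsub>?TB\<^esub>"
   by (simp add: push_def monoid_algebra_def skew_monoid_ring_def A.R.finsum_empty)
  moreover have "?I +>\<^bsub>?TA\<^esub> \<zero>\<^bsub>?TA\<^esub> = \<zero>\<^bsub>tensor_power k n A\<^esub>" "?J +>\<^bsub>?TB\<^esub> \<zero>\<^bsub>?TB\<^esub> = \<zero>\<^bsub>tensor_power k n B\<^esub>"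
   using ring_hom_zero_neg(1)[OF pA(1)] ring_hom_zero_neg(1)[OF pB(1)] A.nc_algebra_T B.nc_algebra_T
    TA.A.ring_axioms TB.A.ring_axioms by (auto simp: nc_algebra_def)
  moreover have "f \<zero>\<^bsub>tensor_power k n A\<^esub> = \<zero>\<^bsub>tensor_power k n B\<^esub>"
   using ring_hom_zero_neg(1)[OF fD(1)] A.nc_algebra_T B.nc_algebra_T by (auto simp: nc_algebra_def)
  ultimately show ?case using TB.A.zero_closed by simp
 next
  case (single x c)
  have "?J +>\<^bsub>?TB\<^esub> single k (h x) c = c \<odot>\<^bsub>tensor_power k n B\<^esub> pure k n B (h x)"
   unfolding pure_def using pB(6)[of c "single k (h x) 1\<^sub>k"] single hc[of x]
   by (simp add: monoid_algebra_simps[OF k mB] del: tuples_simps)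
  moreover have "f (?I +>\<^bsub>?TA\<^esub> single k x c) = c \<odot>\<^bsub>tensor_power k n B\<^esub> pure k n B (h x)"
   using f(2)[of x] fD(6)[of c "pure k n A x"] A.pureD(1)[of x n] pA(6)[of c "single k x 1\<^sub>k"] single
   unfolding pure_def by (simp add: monoid_algebra_simps[OF k mA] del: tuples_simps)
  ultimately show ?case using single hc by (simp add: push_single[OF k] B.single_TA del: tuples_simps)
 next
  case (add u v)
  then show ?case
   by (simp add: push_add[OF k mA, where N = "tuples n B"] pA(2,4) pB(2,4) fD(4) TB.A.a_closed)
 qed
 have tm: "tensor_map k n B h V = f V" if "V : car (tensor_power k n A)" for V
 proof -
  from that obtain u where u: "u : car ?TA" "V = ?I +>\<^bsub>?TA\<^esub> u"
   unfolding tensor_power_def by (rule TA.quot_surj[OF A.ideal_tensor])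
  show ?thesis unfolding tensor_map_def
  proof (rule UN_eq_const)
   show "u : V" using u by (simp add: I.a_rcos_self)
   fix v assume v: "v : V"
   then have "v : car ?TA" using u I.a_elemrcos_carrier by blast
   moreover have "?I +>\<^bsub>?TA\<^esub> v = V" using I.a_repr_independence'[of v u] v u by simp
   ultimately show "?J +>\<^bsub>?TB\<^esub> push k h v = f V" using key by metis
  qed
 qed
 interpret T: nc_algebra k "tensor_power k n A" by (rule A.nc_algebra_T)
 show "tensor_map k n B h : alg_hom k (tensor_power k n A) (tensor_power k n B)"
  by (rule alg_homI) (simp_all add: tm fD)
 show "x : car (tuples n A) ==> tensor_map k n B h (pure k n A x) = pure k n B (h x)"
  using tm A.pureD(1) f(2) by simp
qed

text \<open>The homomorphism may vary with the position: a vector in Z^n acts by a different power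
  of \<sigma> on each factor.\<close>

lemma multilinear_factorwise:
 assumes A: "nc_algebra k A" and B: "nc_algebra k B"
  and f: "\<And>i. i : {1..n} ==> f i : alg_hom k A B"
 shows "multilinear_hom k n A (tensor_power k n B) (%x. pure k n B (\<lambda>i\<in>{1..n}. f i (x i)))"
  and "x : car (tuples n A) ==> (\<lambda>i\<in>{1..n}. f i (x i)) : car (tuples n B)"
proof -
 interpret A: nc_algebra k A by fact
 interpret B: nc_algebra k B by fact
 let ?h = "%x. \<lambda>i\<in>{1..n}. f i (x i)"
 show hc: "?h x : car (tuples n B)" if "x : car (tuples n A)" for x
  using that alg_homD(2)[OF f] by (auto simp: PiE_iff)
 have upd: "?h (x(i := b)) = (?h x)(i := f i b)" if "i : {1..n}" for x i b
  using that by (auto simp: fun_eq_iff)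
 show "multilinear_hom k n A (tensor_power k n B) (%x. pure k n B (?h x))"
  unfolding multilinear_hom_def
 proof (intro conjI ballI)
  fix x y assume x: "x : car (tuples n A)" and y: "y : car (tuples n A)"
  have "?h (x \<otimes>\<^bsub>tuples n A\<^esub> y) = ?h x \<otimes>\<^bsub>tuples n B\<^esub> ?h y"
   using x y alg_homD(3)[OF f] by (auto simp: PiE_iff intro!: restrict_ext)
  then show "pure k n B (?h (x \<otimes>\<^bsub>tuples n A\<^esub> y)) = pure k n B (?h x) \<otimes>\<^bsub>tensor_power k n B\<^esub> pure k n B (?h y)"
   using B.pureD(3)[OF hc hc, OF x y] by simp
 next
  have "?h \<one>\<^bsub>tuples n A\<^esub> = (\<lambda>i\<in>{1..n}. 1\<^sub>B)" using alg_homD(5)[OF f] by (auto intro!: restrict_ext)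
  then show "pure k n B (?h \<one>\<^bsub>tuples n A\<^esub>) = \<one>\<^bsub>tensor_power k n B\<^esub>" using B.pureD(2)[of n] by simp
 next
  fix x i b c assume x: "x : car (tuples n A)" "i : {1..n}" "b : car A" "c : car A"
  show "pure k n B (?h (x(i := b +\<^sub>A c))) =
   pure k n B (?h (x(i := b))) \<oplus>\<^bsub>tensor_power k n B\<^esub> pure k n B (?h (x(i := c)))"
   unfolding upd[OF x(2)] alg_homD(4)[OF f[OF x(2)] x(3,4)]
   by (rule B.pureD(4)[OF hc[OF x(1)] x(2)]) (use x alg_homD(2)[OF f] in auto)
 next
  fix x i s b assume x: "x : car (tuples n A)" "i : {1..n}" "s : car k" "b : car A"
  show "pure k n B (?h (x(i := s \<odot>\<^sub>A b))) = s \<odot>\<^bsub>tensor_power k n B\<^esub> pure k n B (?h (x(i := b)))"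
   unfolding upd[OF x(2)] alg_homD(6)[OF f[OF x(2)] x(3,4)]
   by (rule B.pureD(5)[OF hc[OF x(1)] x(2,3)]) (use x alg_homD(2)[OF f] in auto)
 qed (use hc B.pureD(1) in blast)
qed

text \<open>Composition with the inverse of \<open>p\<close> turns an update at position
  \<open>i\<close> into an update at position \<open>p i\<close>, which carries linearity from one
  position to the other.\<close>

lemma multilinear_perm:
 assumes A: "nc_algebra k A" and p: "p permutes {1..n}"
 shows "multilinear_hom k n A (tensor_power k n A) (%x. pure k n A (x \<circ> inv_into UNIV p))"
  and "x : car (tuples n A) ==> x \<circ> inv_into UNIV p : car (tuples n A)"
proof -
 interpret A: nc_algebra k A by fact
 let ?q = "inv_into UNIV p"
 have q: "?q permutes {1..n}" using p by (rule permutes_inv)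
 have qi: "?q i : {1..n} \<longleftrightarrow> i : {1..n}" for i using permutes_in_image[OF q] .
 show hc: "x \<circ> ?q : car (tuples n A)" if "x : car (tuples n A)" for x
  using that qi unfolding tuples_simps PiE_iff extensional_def by (auto simp del: atLeastAtMost_iff)
 have upd: "x(i := b) \<circ> ?q = (x \<circ> ?q)(p i := b)" "i : {1..n} ==> p i : {1..n}" for x i b
  using permutes_inverses[OF p] permutes_in_image[OF p, of i] by (auto simp: fun_eq_iff)
 show "multilinear_hom k n A (tensor_power k n A) (%x. pure k n A (x \<circ> ?q))"
  unfolding multilinear_hom_def
 proof (intro conjI ballI)
  fix x y assume x: "x : car (tuples n A)" and y: "y : car (tuples n A)"
  have "(x \<otimes>\<^bsub>tuples n A\<^esub> y) \<circ> ?q = (x \<circ> ?q) \<otimes>\<^bsub>tuples n A\<^esub> (y \<circ> ?q)"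
   using qi by (auto simp: fun_eq_iff restrict_def)
  then show "pure k n A ((x \<otimes>\<^bsub>tuples n A\<^esub> y) \<circ> ?q) = pure k n A (x \<circ> ?q) \<otimes>\<^bsub>tensor_power k n A\<^esub> pure k n A (y \<circ> ?q)"
   using A.pureD(3)[OF hc hc, OF x y] by simp
 next
  have "\<one>\<^bsub>tuples n A\<^esub> \<circ> ?q = (\<lambda>i\<in>{1..n}. 1\<^sub>A)" using qi by (auto simp: fun_eq_iff restrict_def)
  then show "pure k n A (\<one>\<^bsub>tuples n A\<^esub> \<circ> ?q) = \<one>\<^bsub>tensor_power k n A\<^esub>" using A.pureD(2)[of n] by simp
 next
  fix x i b c assume x: "x : car (tuples n A)" "i : {1..n}" "b : car A" "c : car A"
  show "pure k n A (x(i := b +\<^sub>A c) \<circ> ?q) =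
   pure k n A (x(i := b) \<circ> ?q) \<oplus>\<^bsub>tensor_power k n A\<^esub> pure k n A (x(i := c) \<circ> ?q)"
   unfolding upd by (rule A.pureD(4)[OF hc[OF x(1)] upd(2)[OF x(2)] x(3,4)])
 next
  fix x i s b assume x: "x : car (tuples n A)" "i : {1..n}" "s : car k" "b : car A"
  show "pure k n A (x(i := s \<odot>\<^sub>A b) \<circ> ?q) = s \<odot>\<^bsub>tensor_power k n A\<^esub> pure k n A (x(i := b) \<circ> ?q)"
   unfolding upd by (rule A.pureD(5)[OF hc[OF x(1)] upd(2)[OF x(2)] x(3,4)])
 qed (use hc A.pureD(1) in blast)
qed

section \<open>Products of commuting homomorphisms\<close>

text \<open>An ordered product, since the factors need not commute.\<close>

definition list_prod :: "('r, 'x) ring_scheme => 'i list => ('i => 'r) => 'r" where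
 "list_prod R xs f = foldr (%i r. f i \<otimes>\<^bsub>R\<^esub> r) xs \<one>\<^bsub>R\<^esub>"

lemma list_prod_simps [simp]:
 "list_prod R [] f = \<one>\<^bsub>R\<^esub>" "list_prod R (i # xs) f = f i \<otimes>\<^bsub>R\<^esub> list_prod R xs f"
 by (simp_all add: list_prod_def)

lemma list_prod_cong: "(\<And>i. i : set xs ==> f i = g i) ==> list_prod R xs f = list_prod R xs g"
 by (induction xs) auto

context ring
begin

lemma list_prod_closed: "(\<And>i. i : set xs ==> f i : car R) ==> list_prod R xs f : car R"
 by (induction xs) auto

lemma list_prod_commute:
 assumes "\<And>i. i : set xs ==> f i : car R" "y : car R"
  and "\<And>i. i : set xs ==> y \<otimes> f i = f i \<otimes> y"
 shows "y \<otimes> list_prod R xs f = list_prod R xs f \<otimes> y"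
 using assms
proof (induction xs)
 case (Cons i xs)
 have c: "f i : car R" "list_prod R xs f : car R" using Cons.prems by (auto intro!: list_prod_closed)
 have "y \<otimes> (f i \<otimes> list_prod R xs f) = f i \<otimes> (y \<otimes> list_prod R xs f)"
  using Cons.prems c by (simp flip: m_assoc)
 then show ?case using Cons c by (simp add: m_assoc)
qed auto

text \<open>Only factors at different positions have to be exchanged: \<open>g i\<close> moves past
  the factors \<open>f j\<close> of the remaining list.\<close>

lemma list_prod_mult:
 assumes "distinct xs" "\<And>i. i : set xs ==> f i : car R" "\<And>i. i : set xs ==> g i : car R"
  and "\<And>i j. [|i : set xs; j : set xs; i ~= j|] ==> f i \<otimes> g j = g j \<otimes> f i"
 shows "list_prod R xs (%i. f i \<otimes> g i) = list_prod R xs f \<otimes> list_prod R xs g"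
 using assms
proof (induction xs)
 case (Cons i xs)
 have c: "f i : car R" "g i : car R" "list_prod R xs f : car R" "list_prod R xs g : car R"
  using Cons.prems by (auto intro!: list_prod_closed)
 have "g i \<otimes> list_prod R xs f = list_prod R xs f \<otimes> g i"
  by (rule list_prod_commute) (use Cons.prems in "auto simp: eq_commute")
 then have "f i \<otimes> g i \<otimes> (list_prod R xs f \<otimes> list_prod R xs g) = f i \<otimes> (list_prod R xs f \<otimes> g i) \<otimes> list_prod R xs g"
  using c by (simp add: m_assoc flip: m_assoc[of "g i"])
 then show ?case using Cons c by (simp add: m_assoc)
qed auto

lemma list_prod_one: "(\<And>i. i : set xs ==> f i = \<one>) ==> list_prod R xs f = \<one>"
 by (induction xs) auto

lemma list_prod_add:
 assumes "distinct xs" "i : set xs" "\<And>j. j : set xs ==> f j : car R" "b : car R" "c : car R"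
 shows "list_prod R xs (f(i := b \<oplus> c)) = list_prod R xs (f(i := b)) \<oplus> list_prod R xs (f(i := c))"
 using assms
proof (induction xs)
 case (Cons j js)
 have c: "list_prod R js (f(i := d)) : car R" if "d : car R" for d
  using Cons.prems that by (intro list_prod_closed) auto
 show ?case
 proof (cases "i = j")
  case True
  then have "list_prod R js (f(i := d)) = list_prod R js f" for d
   using Cons.prems by (intro list_prod_cong) auto
  then show ?thesis using True Cons.prems list_prod_closed[of js f]
   by (simp add: l_distr del: fun_upd_apply add: fun_upd_same)
 next
  case False
  then show ?thesis using Cons c by (simp add: r_distr del: fun_upd_apply add: fun_upd_other)
 qed
qed auto

end

lemma (in nc_algebra) list_prod_smult:
 assumes "distinct xs" "i : set xs" "\<And>j. j : set xs ==> f j : car A" "b : car A" "c : car k"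
 shows "list_prod A xs (f(i := c \<odot>\<^sub>A b)) = c \<odot>\<^sub>A list_prod A xs (f(i := b))"
 using assms
proof (induction xs)
 case (Cons j js)
 have c: "list_prod A js (f(i := d)) : car A" if "d : car A" for d
  using Cons.prems that by (intro A.list_prod_closed) auto
 show ?case
 proof (cases "i = j")
  case True
  then have "list_prod A js (f(i := d)) = list_prod A js f" for d
   using Cons.prems by (intro list_prod_cong) auto
  then show ?thesis using True Cons.prems A.list_prod_closed[of js f]
   by (simp add: smult_mult_left del: fun_upd_apply add: fun_upd_same)
 next
  case False
  then show ?thesis using Cons c by (simp add: smult_mult_right del: fun_upd_apply add: fun_upd_other)
 qed
qed auto

text \<open>Images that commute at different positions make the ordered product multiplicative in
  the tuple. This is how \<open>n\<close> maps out of \<open>A\<close> become one map out of its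
  tensor power.\<close>

lemma multilinear_list_prod:
 assumes A: "nc_algebra k A" and B: "nc_algebra k B"
  and f: "\<And>i. i : {1..n} ==> f i : alg_hom k A B"
  and comm: "\<And>i j x y. [|i : {1..n}; j : {1..n}; i ~= j; x : car A; y : car A|] ==>
   f i x *\<^sub>B f j y = f j y *\<^sub>B f i x"
 shows "multilinear_hom k n A B (%x. list_prod B [1..<Suc n] (%i. f i (x i)))"
proof -
 interpret A: nc_algebra k A by fact
 interpret B: nc_algebra k B by fact
 have set: "set [1..<Suc n] = {1..n}" by auto
 have c: "f i (x i) : car B" if "x : car (tuples n A)" "i : {1..n}" for x i
  using that alg_homD(2)[OF f] by (auto simp: PiE_iff)
 have upd: "list_prod B [1..<Suc n] (%j. f j ((x(i := b)) j)) =
  list_prod B [1..<Suc n] ((%j. f j (x j))(i := f i b))" for x i b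
  by (rule list_prod_cong) auto
 show ?thesis
  unfolding multilinear_hom_def
 proof (intro conjI ballI)
  fix x assume x: "x : car (tuples n A)"
  show "list_prod B [1..<Suc n] (%i. f i (x i)) : car B"
   by (rule B.A.list_prod_closed) (use c[OF x] in "auto simp: set simp del: upt_Suc")
  fix y assume y: "y : car (tuples n A)"
  have "list_prod B [1..<Suc n] (%i. f i ((x \<otimes>\<^bsub>tuples n A\<^esub> y) i)) =
   list_prod B [1..<Suc n] (%i. f i (x i) *\<^sub>B f i (y i))"
   by (rule list_prod_cong) (use x y alg_homD(3)[OF f] in "auto simp: set PiE_iff simp del: upt_Suc")
  also have "\<dots> = list_prod B [1..<Suc n] (%i. f i (x i)) *\<^sub>B list_prod B [1..<Suc n] (%i. f i (y i))"
   by (rule B.A.list_prod_mult)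
    (use c x y comm in "auto simp: set PiE_iff simp del: upt_Suc")
  finally show "list_prod B [1..<Suc n] (%i. f i ((x \<otimes>\<^bsub>tuples n A\<^esub> y) i)) =
   list_prod B [1..<Suc n] (%i. f i (x i)) *\<^sub>B list_prod B [1..<Suc n] (%i. f i (y i))" .
 next
  show "list_prod B [1..<Suc n] (%i. f i (\<one>\<^bsub>tuples n A\<^esub> i)) = 1\<^sub>B"
   by (rule B.A.list_prod_one) (use alg_homD(5)[OF f] in "auto simp: set simp del: upt_Suc")
 next
  fix x i b d assume x: "x : car (tuples n A)" "i : {1..n}" "b : car A" "d : car A"
  show "list_prod B [1..<Suc n] (%j. f j ((x(i := b +\<^sub>A d)) j)) =
   list_prod B [1..<Suc n] (%j. f j ((x(i := b)) j)) +\<^sub>B list_prod B [1..<Suc n] (%j. f j ((x(i := d)) j))"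
   unfolding upd alg_homD(4)[OF f[OF x(2)] x(3,4)]
   by (rule B.A.list_prod_add) (use x c alg_homD(2)[OF f] in "auto simp: set simp del: upt_Suc tuples_simps")
 next
  fix x i b s assume x: "x : car (tuples n A)" "i : {1..n}" "s : car k" "b : car A"
  show "list_prod B [1..<Suc n] (%j. f j ((x(i := s \<odot>\<^sub>A b)) j)) =
   s \<odot>\<^sub>B list_prod B [1..<Suc n] (%j. f j ((x(i := b)) j))"
   unfolding upd alg_homD(6)[OF f[OF x(2)] x(3,4)]
   by (rule B.list_prod_smult) (use x c alg_homD(2)[OF f] in "auto simp: set simp del: upt_Suc tuples_simps")
 qed
qed

section \<open>Characters of finitely generated domains\<close>

text \<open>Coefficient lists begin with the leading coefficient, hence the reversal.\<close>

lemma (in field) eval_map_rev: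
 assumes "f : UNIV \<rightarrow> car R" "x : car R"
 shows "eval (map f (rev [0..<n])) x = (\<Oplus>i\<in>{..<n}. f i \<otimes> x [^] i)"
proof (induction n)
 case (Suc n)
 have "f n : car R" "(%i. f i \<otimes> x [^] i) : {..<n} \<rightarrow> car R" using assms by auto
 with Suc assms show ?case by (simp add: lessThan_Suc)
qed simp

text \<open>A split polynomial has as many roots, with multiplicity, as its degree, and
  \<open>d > 0\<close>. Coefficients are given as a function because evaluation in \<open>UP\<close>
  produces sums of this shape.\<close>

lemma algebraically_closed_root:
 fixes d :: nat
 assumes k: "algebraically_closed k" and f: "f : UNIV \<rightarrow> car k" and "d > 0" "f d ~= 0\<^sub>k"
 shows "EX x:car k. (\<Oplus>\<^sub>k i\<in>{..d}. f i *\<^sub>k x [^]\<^sub>k i) = 0\<^sub>k"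
proof -
 interpret algebraically_closed k by fact
 let ?p = "map f (rev [0..<Suc d])"
 have p: "?p = f d # map f (rev [0..<d])" by simp
 have "polynomial\<^bsub>k\<^esub> (car k) ?p"
  unfolding polynomial_def p using f assms(4) by auto
 then have c: "?p : car (poly_ring k)" by (simp add: univ_poly_carrier)
 then have "size (roots ?p) = d" using roots_over_carrier[OF c] unfolding splitted_def by simp
 then obtain x where "x \<in># roots ?p" using assms(3) by (metis gr0_conv_Suc size_eq_Suc_imp_elem)
 then have "is_root ?p x" using roots_mem_iff_is_root[OF c] by simp
 then have "x : car k" "eval ?p x = 0\<^sub>k" unfolding is_root_def by auto
 then show ?thesis using eval_map_rev[OF f, of x "Suc d"] by (auto simp: lessThan_Suc_atMost)
qed

lemma ring_hom_factor:
 assumes "ring P" "ring D" "ring K" and e: "e : ring_hom P D" and f: "f : ring_hom P K"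
  and ker: "\<And>p. p : car P ==> e p = 0\<^sub>D ==> f p = 0\<^sub>K"
 shows "EX g:ring_hom (D\<lparr>carrier := e ` car P\<rparr>) K. ALL p:car P. g (e p) = f p"
proof -
 interpret P: ring P by fact
 interpret e: ring_hom_ring P D e using assms by (simp add: ring_hom_ringI2)
 interpret f: ring_hom_ring P K f using assms by (simp add: ring_hom_ringI2)
 have eq: "f p = f q" if "p : car P" "q : car P" "e p = e q" for p q
 proof -
  have "e (p \<ominus>\<^sub>P q) = 0\<^sub>D" using that by (simp add: a_minus_def e.S.r_neg)
  then have "f (p \<ominus>\<^sub>P q) = 0\<^sub>K" using ker that by simp
  then have "f p \<ominus>\<^sub>K f q = 0\<^sub>K" using that by (simp add: a_minus_def)
  then show ?thesis using that by simp
 qed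
 define g where "g y = f (SOME p. p : car P & e p = y)" for y
 have g: "g (e p) = f p" if "p : car P" for p
 proof -
  have "\<exists>q. q : car P & e q = e p" using that by blast
  then show ?thesis unfolding g_def using eq that by (metis (mono_tags, lifting) someI_ex)
 qed
 have "g : ring_hom (D\<lparr>carrier := e ` car P\<rparr>) K"
 proof (rule ring_hom_memI; simp)
  show "g x : car K" if "x : e ` car P" for x using that g by auto
  show "g (x *\<^sub>D y) = g x *\<^sub>K g y" if "x : e ` car P" "y : e ` car P" for x y
   using that by (auto simp: g simp flip: e.hom_mult)
  show "g (x +\<^sub>D y) = g x +\<^sub>K g y" if "x : e ` car P" "y : e ` car P" for x y
   using that by (auto simp: g simp flip: e.hom_add)
  show "g 1\<^sub>D = 1\<^sub>K" using g[OF P.one_closed] by simp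
 qed
 then show ?thesis using g by blast
qed

text \<open>A form of Chevalley's theorem for adjoining one element \<open>x\<close>: the
  obstruction to extending a character with \<open>s\<close> kept nonzero is a single element
  \<open>r\<close> of \<open>R\<close>, chosen before the character. If \<open>x\<close> is
  transcendental over \<open>R\<close>, a leading coefficient serves as \<open>r\<close>; otherwise
  two conditions, one from a minimal relation of \<open>x\<close> and one from \<open>s\<close>, are
  multiplied.\<close>

lemma extend_character:
 fixes D :: "('d, 'y) ring_scheme" and k :: "('k, 'x) ring_scheme"
 assumes "domain D" "subring R D" and x: "x : car D" and k: "algebraically_closed k"
 defines "B \<equiv> D\<lparr>carrier := R\<rparr>"
 defines "Q \<equiv> eval B D id x ` car (UP B)"
 assumes s: "s : Q" "s ~= 0\<^sub>D"
 shows "EX r:R. r ~= 0\<^sub>D & (ALL \<chi>:ring_hom B k. \<chi> r ~= 0\<^sub>k -->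
  (\<exists>\<chi>'\<in>ring_hom (D\<lparr>carrier := Q\<rparr>) k. (ALL y:R. \<chi>' y = \<chi> y) & \<chi>' s ~= 0\<^sub>k))"
proof -
 interpret D: domain D by fact
 interpret k: algebraically_closed k by fact
 interpret B: domain B unfolding B_def by (rule D.subring_is_domain) fact
 have RD: "R \<subseteq> car D" using assms(2) by (rule subringE)
 have B_simps [simp]: "car B = R" "0\<^sub>B = 0\<^sub>D" "1\<^sub>B = 1\<^sub>D" "a *\<^sub>B b = a *\<^sub>D b"
  "a +\<^sub>B b = a +\<^sub>D b" for a b by (auto simp: B_def)
 define P where "P = UP B"
 interpret U: UP_domain B P by unfold_locales (simp add: P_def)
 have idh: "id : ring_hom B D" using RD by (auto simp: ring_hom_def)
 interpret E: UP_pre_univ_prop B D id P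
  by (intro UP_pre_univ_prop.intro ring_hom_cring.intro ring_hom_cring_axioms.intro UP_cring.intro
    B.is_cring D.is_cring idh) (simp only: P_def)
 define e where "e = eval B D id x"
 interpret e: ring_hom_ring P D e
  unfolding e_def using E.eval_ring_hom[OF x] by (simp add: ring_hom_ringI2 U.UP_ring D.ring_axioms)
 have e_const: "e (monom P c 0) = c" if "c : R" for c
  using E.eval_const[OF x, of c] that by (simp add: e_def)
 have e_smult: "e (c \<odot>\<^sub>P p) = c *\<^sub>D e p" if "c : R" "p : car P" for c p
  using that by (simp add: U.monom_mult_is_smult[symmetric] e_const)
 have const: "EX c:R. p = monom P c 0 & e p = c" if "p : car P" "deg B p = 0" for p
  using U.deg_zero_impl_monom[OF that] e_const U.coeff_closed[OF that(1), of 0] B_simps(1) by metis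
 have Q: "Q = e ` car P" by (simp add: Q_def e_def P_def)
 have ring_P: "ring P" by (rule U.UP_ring)
 obtain h where h: "h : car P" "s = e h" using s Q by blast
 \<comment> \<open>A value \<xi> for \<open>x\<close> is admissible as soon as all relations of
   \<open>x\<close> over \<open>R\<close>, transported by \<chi>, vanish at \<xi>.\<close>
 have extend: "\<exists>\<chi>'\<in>ring_hom (D\<lparr>carrier := Q\<rparr>) k. (ALL y:R. \<chi>' y = \<chi> y) &
   (ALL p:car P. \<chi>' (e p) = eval B k \<chi> \<xi> p)"
  if \<chi>: "\<chi> : ring_hom B k" and \<xi>: "\<xi> : car k"
   and ker: "\<And>p. p : car P ==> e p = 0\<^sub>D ==> eval B k \<chi> \<xi> p = 0\<^sub>k" for \<chi> \<xi>
 proof -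
  interpret X: UP_pre_univ_prop B k \<chi> P
   by (intro UP_pre_univ_prop.intro ring_hom_cring.intro ring_hom_cring_axioms.intro UP_cring.intro
    B.is_cring k.is_cring \<chi>) (simp only: P_def)
  obtain g where g: "g : ring_hom (D\<lparr>carrier := Q\<rparr>) k" "\<And>p. p : car P ==> g (e p) = eval B k \<chi> \<xi> p"
   using ring_hom_factor[OF ring_P D.ring_axioms k.ring_axioms e.homh X.eval_ring_hom[OF \<xi>] ker]
   unfolding Q by blast
  have "g y = \<chi> y" if "y : R" for y
   using g(2)[of "monom P y 0"] X.eval_const[OF \<xi>, of y] that by (simp add: e_const)
  then show ?thesis using g by blast
 qed
 have eval_sum: "eval B k \<chi> \<xi> p = (\<Oplus>\<^sub>k i\<in>{..deg B p}. \<chi> (coeff P p i) *\<^sub>k \<xi> [^]\<^sub>k i)"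
  if "p : car P" for \<chi> \<xi> p
  by (rule U.eval_on_carrier[OF that])
 show ?thesis
 proof (cases "EX p:car P. p ~= 0\<^sub>P & e p = 0\<^sub>D")
  \<comment> \<open>Here \<open>x\<close> is transcendental over \<open>R\<close>: there are no
    relations, every \<xi> is admissible, and it only has to avoid the roots of the transported
    \<open>h\<close>.\<close>
  case False
  then have inj: "p = 0\<^sub>P" if "p : car P" "e p = 0\<^sub>D" for p using that by blast
  have h0: "h ~= 0\<^sub>P" using s h e.hom_zero by auto
  let ?r = "coeff P h (deg B h)"
  have r: "?r : R" "?r ~= 0\<^sub>D" using U.lcoeff_nonzero[OF h0 h(1)] U.coeff_closed[OF h(1)] by auto
  show ?thesis
  proof (intro bexI[of _ ?r] conjI ballI impI r)
   fix \<chi> assume \<chi>: "\<chi> : ring_hom B k" "\<chi> ?r ~= 0\<^sub>k"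
   interpret X: UP_pre_univ_prop B k \<chi> P
    by (intro UP_pre_univ_prop.intro ring_hom_cring.intro ring_hom_cring_axioms.intro UP_cring.intro
    B.is_cring k.is_cring \<chi>) (simp only: P_def)
   have \<chi>c: "\<chi> (coeff P h i) : car k" for i using U.coeff_closed[OF h(1)] by (rule X.hom_closed)
   have "\<exists>\<xi>\<in>car k. eval B k \<chi> \<xi> h ~= 0\<^sub>k"
   proof (cases "deg B h = 0")
    case True
    then have "eval B k \<chi> 1\<^sub>k h = \<chi> ?r" using \<chi>c by (simp add: eval_sum[OF h(1)])
    then show ?thesis using \<chi>(2) k.one_closed by metis
   next
    case False
    let ?d = "deg B h"
    \<comment> \<open>The constant term is lowered by 1: a root of the new polynomial is a point
      where the transported \<open>h\<close> takes the value 1. The degree is positive here, so the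
      leading coefficient is untouched.\<close>
    define f where "f i = (if i = 0 then \<chi> (coeff P h 0) \<ominus>\<^sub>k 1\<^sub>k else \<chi> (coeff P h i))" for i
    have fc: "f i : car k" for i using \<chi>c by (simp add: f_def)
    have fd: "f ?d ~= 0\<^sub>k" using False \<chi>(2) by (simp add: f_def)
    obtain \<xi> where \<xi>: "\<xi> : car k" "(\<Oplus>\<^sub>k i\<in>{..?d}. f i *\<^sub>k \<xi> [^]\<^sub>k i) = 0\<^sub>k"
     using algebraically_closed_root[OF k, of f ?d] fc fd False by auto
    have "eval B k \<chi> \<xi> h =
     (\<Oplus>\<^sub>k i\<in>{..?d}. f i *\<^sub>k \<xi> [^]\<^sub>k i +\<^sub>k (if i = 0 then 1\<^sub>k else 0\<^sub>k))"
     unfolding eval_sum[OF h(1)]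
     by (rule k.finsum_cong') (use \<chi>c fc \<xi> in "auto simp: f_def a_minus_def k.a_assoc k.l_neg")
    also have "\<dots> = 0\<^sub>k +\<^sub>k (\<Oplus>\<^sub>k i\<in>{..?d}. if i = 0 then 1\<^sub>k else 0\<^sub>k)"
     using fc \<xi> by (subst k.finsum_addf) auto
    also have "(\<Oplus>\<^sub>k i\<in>{..?d}. if i = 0 then 1\<^sub>k else 0\<^sub>k) = 1\<^sub>k"
     using k.add.finprod_singleton_swap[of 0 "{..?d}" "%_. 1\<^sub>k"] by simp
    finally have "eval B k \<chi> \<xi> h ~= 0\<^sub>k" by simp
    then show ?thesis using \<xi> by blast
   qed
   then obtain \<xi> where \<xi>: "\<xi> : car k" "eval B k \<chi> \<xi> h ~= 0\<^sub>k" by blast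
   have "eval B k \<chi> \<xi> 0\<^sub>P = 0\<^sub>k"
    using ring_hom_zero_neg(1)[OF X.eval_ring_hom[OF \<xi>(1)] ring_P k.ring_axioms] .
   then obtain \<chi>' where "\<chi>' : ring_hom (D\<lparr>carrier := Q\<rparr>) k" "ALL y:R. \<chi>' y = \<chi> y"
    "ALL p:car P. \<chi>' (e p) = eval B k \<chi> \<xi> p"
    using extend[OF \<chi>(1) \<xi>(1)] inj by metis
   then show "\<exists>\<chi>'\<in>ring_hom (D\<lparr>carrier := Q\<rparr>) k. (ALL y:R. \<chi>' y = \<chi> y) & \<chi>' s ~= 0\<^sub>k"
    using h \<xi>(2) by auto
  qed
 next
  case True
  \<comment> \<open>Here \<open>x\<close> is algebraic over \<open>R\<close>. A relation of least
    degree need not be monic, so the divisions below are pseudo-divisions, which introduce powers of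
    leading coefficients.\<close>
  define N where "N p \<longleftrightarrow> p : car P & p ~= 0\<^sub>P & e p = 0\<^sub>D" for p
  obtain p where "N p" and p_min: "\<And>q. N q ==> deg B p \<le> deg B q"
   using True arg_min_nat_lemma[of N _ "deg B"] unfolding N_def by (metis (no_types, lifting))
  then have p: "p : car P" "p ~= 0\<^sub>P" "e p = 0\<^sub>D" by (auto simp: N_def)
  have zero: "q = 0\<^sub>P" if "q : car P" "e q = 0\<^sub>D" "deg B q < deg B p" for q
   using p_min[of q] that by (auto simp: N_def)
  let ?d = "deg B p"
  have d: "?d > 0"
  proof (rule ccontr)
   assume "\<not> ?d > 0"
   then obtain c where "c : R" "p = monom P c 0" "e p = c" using const[OF p(1)] by auto
   then show False using p U.monom_zero[of 0] by simp
  qed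
  let ?c = "coeff P p ?d"
  have c: "?c : R" "?c ~= 0\<^sub>D" using U.lcoeff_nonzero[OF p(2,1)] U.coeff_closed[OF p(1)] by auto
  have pow: "a [^]\<^sub>B (m::nat) : R" "a ~= 0\<^sub>D ==> a [^]\<^sub>B m ~= 0\<^sub>D" if "a : R" for a m
  proof -
   show R: "a [^]\<^sub>B m : R" for m :: nat using that B.nat_pow_closed[of a m] by simp
   show "a [^]\<^sub>B m ~= 0\<^sub>D" if "a ~= 0\<^sub>D"
   proof (induction m)
    case (Suc m)
    then show ?case
     using D.integral[of "a [^]\<^sub>B m" a] R[of m] \<open>a : R\<close> that RD by (auto simp: subset_iff)
   qed simp
  qed
  \<comment> \<open>Polynomials whose value at \<open>x\<close> is a nonzero multiple of
    \<open>s\<close> in \<open>R[x]\<close>. One of least degree will turn out to be constant, which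
    gives a nonzero multiple of \<open>s\<close> inside \<open>R\<close>.\<close>
  define S where "S g \<longleftrightarrow> g : car P & e g ~= 0\<^sub>D & (EX u:car P. e g = e u *\<^sub>D s)" for g
  have sD: "s : car D" using h by simp
  have "S h" unfolding S_def using h s by (auto intro!: bexI[of _ "1\<^sub>P"])
  then obtain g where "S g" and g_min: "\<And>q. S q ==> deg B g \<le> deg B q"
   using arg_min_nat_lemma[of S h "deg B"] by metis
  then obtain u where g: "g : car P" "e g ~= 0\<^sub>D" and u: "u : car P" "e g = e u *\<^sub>D s"
   by (auto simp: S_def)
  have g0: "g ~= 0\<^sub>P" using g e.hom_zero by auto
  \<comment> \<open>The remainder of \<open>g\<close> modulo \<open>p\<close> has as value again a
    nonzero multiple of \<open>s\<close>, so minimality forces the degree of \<open>g\<close> below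
    that of \<open>p\<close>.\<close>
  have g_lt: "deg B g < ?d"
  proof -
   obtain q r m where q: "q : car P" "r : car P" and
    div: "?c [^]\<^sub>B (m::nat) \<odot>\<^sub>P g = p *\<^sub>P q +\<^sub>P r" "r = 0\<^sub>P \<or> deg B r < ?d"
    using U.long_div_theorem[OF p(1) g(1) p(2)] by blast
   have "e r = ?c [^]\<^sub>B m *\<^sub>D e g"
    using arg_cong[OF div(1), of e] q p pow c g by (simp add: e_smult)
   moreover from this have "e r ~= 0\<^sub>D"
    using pow[OF c(1)] c(2) g RD D.integral by (metis e.hom_closed subsetD)
   moreover have "?c [^]\<^sub>B m *\<^sub>D e g = e (?c [^]\<^sub>B m \<odot>\<^sub>P u) *\<^sub>D s"
    using u pow[OF c(1), of m] sD RD by (simp add: e_smult D.m_assoc subset_iff)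
   moreover have "?c [^]\<^sub>B m \<odot>\<^sub>P u : car P" using u pow[OF c(1)] by simp
   ultimately have "S r" using q unfolding S_def by metis
   then have "deg B g \<le> deg B r" by (rule g_min)
   moreover have "r ~= 0\<^sub>P" using \<open>e r ~= 0\<^sub>D\<close> e.hom_zero by auto
   ultimately show ?thesis using div(2) by simp
  qed
  \<comment> \<open>Dividing \<open>p\<close> by \<open>g\<close>: a remainder with nonzero value
    would be a multiple of \<open>s\<close> of degree below that of \<open>g\<close>. So the
    remainder vanishes, \<open>q\<close> is a relation of \<open>x\<close>, and since its degree is
    at least that of \<open>p\<close>, degree 0 is left for \<open>g\<close>.\<close>
  obtain q r m where q: "q : car P" "r : car P" and
   div: "coeff P g (deg B g) [^]\<^sub>B (m::nat) \<odot>\<^sub>P p = g *\<^sub>P q +\<^sub>P r" "r = 0\<^sub>P \<or> deg B r < deg B g"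
   using U.long_div_theorem[OF g(1) p(1) g0] by blast
  let ?l = "coeff P g (deg B g) [^]\<^sub>B m"
  have l: "?l : R" "?l ~= 0\<^sub>D"
   using pow[of "coeff P g (deg B g)"] U.lcoeff_nonzero[OF g0 g(1)] U.coeff_closed[OF g(1)] by auto
  have sum0: "e g *\<^sub>D e q +\<^sub>D e r = 0\<^sub>D"
   using arg_cong[OF div(1), of e] q p l g RD by (simp add: e_smult subset_iff)
  have er: "e r = 0\<^sub>D"
  proof (rule ccontr)
   assume ne: "e r ~= 0\<^sub>D"
   have "e r = \<ominus>\<^sub>D (e g *\<^sub>D e q)"
    using sum0 q g by (metis D.minus_equality D.m_closed e.hom_closed D.a_comm)
   also have "\<dots> = e (\<ominus>\<^sub>P (u *\<^sub>P q)) *\<^sub>D s"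
    using u q sD by (simp add: D.l_minus D.r_minus D.m_ac)
   finally have "S r" unfolding S_def using ne q u U.P.a_inv_closed U.P.m_closed by metis
   then have "deg B g \<le> deg B r" by (rule g_min)
   then show False using div(2) ne e.hom_zero by auto
  qed
  then have r0: "r = 0\<^sub>P" using zero[OF q(2)] div(2) g_lt by auto
  have eq: "e q = 0\<^sub>D" using sum0 er q g D.integral[of "e g" "e q"] by simp
  have lp: "?l \<odot>\<^sub>P p = g *\<^sub>P q" using div(1) r0 q g by simp
  have degs: "deg B (?l \<odot>\<^sub>P p) = ?d" using l p by (simp add: U.deg_smult)
  have q0: "q ~= 0\<^sub>P" using lp g degs d by auto
  have "deg B g + deg B q = ?d" using U.deg_mult[OF g0 q0 g(1) q(1)] lp degs by simp
  moreover have "?d \<le> deg B q" using p_min[of q] q q0 eq by (simp add: N_def)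
  ultimately have "deg B g = 0" by simp
  then obtain r' where r': "r' : R" "g = monom P r' 0" "e g = r'" using const[OF g(1)] by blast
  show ?thesis
  proof (intro bexI[of _ "?c *\<^sub>D r'"] conjI ballI impI)
   show "?c *\<^sub>D r' : R" using c r' B.m_closed by simp
   show "?c *\<^sub>D r' ~= 0\<^sub>D" using c r' g RD D.integral by auto
   fix \<chi> assume \<chi>: "\<chi> : ring_hom B k" "\<chi> (?c *\<^sub>D r') ~= 0\<^sub>k"
   interpret X: UP_pre_univ_prop B k \<chi> P
    by (intro UP_pre_univ_prop.intro ring_hom_cring.intro ring_hom_cring_axioms.intro UP_cring.intro
    B.is_cring k.is_cring \<chi>) (simp only: P_def)
   have \<chi>R: "\<chi> y : car k" if "y : R" for y using X.hom_closed that by simp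
   have "\<chi> (?c *\<^sub>D r') = \<chi> ?c *\<^sub>k \<chi> r'" using X.hom_mult[of ?c r'] c r' by simp
   then have \<chi>0: "\<chi> ?c ~= 0\<^sub>k" "\<chi> r' ~= 0\<^sub>k" using \<chi>(2) \<chi>R c r' by auto
   \<comment> \<open>A root of the transported \<open>p\<close> kills every relation of
     \<open>x\<close>: such a relation becomes a multiple of \<open>p\<close> after multiplication
     by a power of the leading coefficient, on which \<chi> does not vanish.\<close>
   obtain \<xi> where \<xi>: "\<xi> : car k" "eval B k \<chi> \<xi> p = 0\<^sub>k"
    using algebraically_closed_root[OF k, of "%i. \<chi> (coeff P p i)" ?d] d \<chi>0 \<chi>R U.coeff_closed[OF p(1)]
    unfolding eval_sum[OF p(1)] by auto
   define f where "f = eval B k \<chi> \<xi>"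
   interpret f: ring_hom_ring P k f
    unfolding f_def using X.eval_ring_hom[OF \<xi>(1)] by (simp add: ring_hom_ringI2 ring_P k.ring_axioms)
   have f_smult: "f (a \<odot>\<^sub>P q) = \<chi> a *\<^sub>k f q" if "a : R" "q : car P" for a q
    using that X.eval_const[OF \<xi>(1), of a] by (simp add: U.monom_mult_is_smult[symmetric] f_def[symmetric])
   have "f q = 0\<^sub>k" if q: "q : car P" "e q = 0\<^sub>D" for q
   proof -
    obtain w r m where w: "w : car P" "r : car P" and
     div: "?c [^]\<^sub>B (m::nat) \<odot>\<^sub>P q = p *\<^sub>P w +\<^sub>P r" "r = 0\<^sub>P \<or> deg B r < ?d"
     using U.long_div_theorem[OF p(1) q(1) p(2)] by blast
    have "e r = 0\<^sub>D"
     using arg_cong[OF div(1), of e] w p pow[OF c(1), of m] q RD by (simp add: e_smult subset_iff)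
    then have "r = 0\<^sub>P" using zero[OF w(2)] div(2) by auto
    moreover have "f p = 0\<^sub>k" using \<xi>(2) by (simp add: f_def)
    ultimately have "\<chi> (?c [^]\<^sub>B m) *\<^sub>k f q = 0\<^sub>k"
     using arg_cong[OF div(1), of f] w p pow[OF c(1), of m] q by (simp add: f_smult)
    moreover have "\<chi> (?c [^]\<^sub>B m) ~= 0\<^sub>k"
    proof (induction m)
     case (Suc m)
     have "\<chi> (?c [^]\<^sub>B Suc m) = \<chi> (?c [^]\<^sub>B m) *\<^sub>k \<chi> ?c"
      using X.hom_mult[of "?c [^]\<^sub>B m" ?c] c pow[OF c(1), of m] by simp
     then show ?case using Suc \<chi>0 \<chi>R c pow[OF c(1), of m] k.integral by metis
    qed (use X.hom_one in simp)
    ultimately show ?thesis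
     using k.integral[of "\<chi> (?c [^]\<^sub>B m)" "f q"] \<chi>R pow[OF c(1), of m] q by auto
   qed
   then obtain \<chi>' where \<chi>': "\<chi>' : ring_hom (D\<lparr>carrier := Q\<rparr>) k" "ALL y:R. \<chi>' y = \<chi> y"
    "ALL p:car P. \<chi>' (e p) = f p"
    using extend[OF \<chi>(1) \<xi>(1)] unfolding f_def by metis
   have "f g = f u *\<^sub>k f h"
   proof -
    have "e g = e (u *\<^sub>P h)" using u h by simp
    then show ?thesis using \<chi>'(3) g(1) u(1) h(1) f.hom_mult[OF u(1) h(1)] U.P.m_closed[OF u(1) h(1)]
     by metis
   qed
   moreover have "f g = \<chi> r'" using \<chi>'(2,3) g(1) r' by metis
   ultimately have "f h ~= 0\<^sub>k" using \<chi>0 u h by auto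
   then show "\<exists>\<chi>'\<in>ring_hom (D\<lparr>carrier := Q\<rparr>) k. (ALL y:R. \<chi>' y = \<chi> y) & \<chi>' s ~= 0\<^sub>k"
    using \<chi>' h by auto
  qed
 qed
qed

text \<open>Generators of \<open>D\<close> are adjoined one at a time, beginning with the scalars,
  where the character is the inverse of c \<mapsto> c 1. The claim covers every nonzero
  \<open>s\<close> of the subring because each extension asks for a new element \<open>r\<close> one
  stage below.\<close>

lemma exists_character:
 assumes k: "algebraically_closed k" and D: "algebra k D" "domain D"
  and fg: "fin_gen_ring_over D (scalars k D) (car D)"
  and s: "s : car D" "s ~= 0\<^sub>D"
 shows "EX \<chi>:ring_hom D k. (ALL c:car k. \<chi> (c \<odot>\<^sub>D 1\<^sub>D) = c) & \<chi> s ~= 0\<^sub>k"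
proof -
 interpret k: algebraically_closed k by fact
 interpret D: algebra k D by fact
 interpret D: domain D by fact
 interpret N: nc_algebra k D by (rule D.nc_algebra)
 let ?K = "scalars k D"
 have K: "subring ?K D" "?K \<subseteq> car D" using N.scalars_subring subringE(1)[OF N.scalars_subring] by auto
 have key: "ALL s:generate_ring D (?K \<union> Y). s ~= 0\<^sub>D -->
   (EX \<chi>:ring_hom (D\<lparr>carrier := generate_ring D (?K \<union> Y)\<rparr>) k. (ALL c:car k. \<chi> (c \<odot>\<^sub>D 1\<^sub>D) = c) & \<chi> s ~= 0\<^sub>k)"
  if "finite Y" "Y \<subseteq> car D" for Y
  using that
 proof (induction Y)
  case empty
  have gen: "generate_ring D (?K \<union> {}) = ?K"
   using D.generate_ringI[OF K(2,1)] by auto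
  \<comment> \<open>If c 1 = d 1 with c - d invertible in \<open>k\<close>, then 1 = 0 in
    \<open>D\<close>.\<close>
  have inj: "c = d" if "c \<odot>\<^sub>D 1\<^sub>D = d \<odot>\<^sub>D 1\<^sub>D" and cd: "c : car k" "d : car k" for c d
  proof (rule ccontr)
   assume "c ~= d"
   then have "c \<ominus>\<^sub>k d : Units k" using cd k.field_Units by auto
   then obtain e where e: "e : car k" "e *\<^sub>k (c \<ominus>\<^sub>k d) = 1\<^sub>k"
    using k.Units_l_inv_ex by blast
   have "(c \<ominus>\<^sub>k d) \<odot>\<^sub>D 1\<^sub>D = 0\<^sub>D"
    using that by (simp add: a_minus_def D.smult_l_distr D.smult_l_minus D.r_neg)
   then have "e \<odot>\<^sub>D ((c \<ominus>\<^sub>k d) \<odot>\<^sub>D 1\<^sub>D) = 0\<^sub>D" using e by simp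
   then have "1\<^sub>k \<odot>\<^sub>D 1\<^sub>D = 0\<^sub>D" using e cd D.smult_assoc1[of e "c \<ominus>\<^sub>k d" "1\<^sub>D"] by simp
   then show False by simp
  qed
  define \<chi> where "\<chi> y = (THE c. c : car k & y = c \<odot>\<^sub>D 1\<^sub>D)" for y
  have \<chi>: "\<chi> (c \<odot>\<^sub>D 1\<^sub>D) = c" if "c : car k" for c
   unfolding \<chi>_def by (rule the_equality) (use that inj in auto)
  have "\<chi> : ring_hom (D\<lparr>carrier := ?K\<rparr>) k"
  proof (rule ring_hom_memI; simp)
   show "\<chi> x : car k" if "x : ?K" for x using that \<chi> by (auto simp: scalars_def)
   fix x y assume "x : ?K" "y : ?K"
   then obtain c d where cd: "c : car k" "d : car k" "x = c \<odot>\<^sub>D 1\<^sub>D" "y = d \<odot>\<^sub>D 1\<^sub>D"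
    by (auto simp: scalars_def)
   have "x *\<^sub>D y = (c *\<^sub>k d) \<odot>\<^sub>D 1\<^sub>D" "x +\<^sub>D y = (c +\<^sub>k d) \<odot>\<^sub>D 1\<^sub>D"
    using cd by (simp_all add: D.smult_assoc1 D.smult_assoc2 D.smult_l_distr)
   then show "\<chi> (x *\<^sub>D y) = \<chi> x *\<^sub>k \<chi> y" "\<chi> (x +\<^sub>D y) = \<chi> x +\<^sub>k \<chi> y"
    using cd \<chi> by simp_all
  next
   show "\<chi> 1\<^sub>D = 1\<^sub>k" using \<chi>[of "1\<^sub>k"] by simp
  qed
  moreover have "\<chi> s ~= 0\<^sub>k" if "s : ?K" "s ~= 0\<^sub>D" for s
   using that \<chi> by (auto simp: scalars_def)
  ultimately show ?case unfolding gen using \<chi> by blast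
 next
  case (insert x Y)
  let ?R = "generate_ring D (?K \<union> Y)" and ?R' = "generate_ring D (?K \<union> insert x Y)"
  let ?B = "D\<lparr>carrier := ?R\<rparr>"
  let ?Q = "eval ?B D id x ` car (UP ?B)"
  have x: "x : car D" and Y: "?K \<union> Y \<subseteq> car D" using insert K by auto
  have R: "subring ?R D" by (rule D.generate_ring_is_subring[OF Y])
  have RD: "?R \<subseteq> car D" using subringE(1)[OF R] .
  interpret B: cring ?B using D.subring_is_domain[OF R] by (simp add: domain_def)
  have idh: "id : ring_hom ?B D" using RD by (auto simp: ring_hom_def)
  define P where "P = UP ?B"
  interpret E: UP_pre_univ_prop ?B D id P
   by (intro UP_pre_univ_prop.intro ring_hom_cring.intro ring_hom_cring_axioms.intro UP_cring.intro
    B.is_cring D.is_cring idh) (simp only: P_def)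
  have e: "eval ?B D id x : ring_hom P D" by (rule E.eval_ring_hom[OF x])
  interpret e: ring_hom_ring P D "eval ?B D id x"
   using e by (simp add: ring_hom_ringI2 E.UP_ring D.ring_axioms)
  have Q: "subring ?Q D" using e.img_is_subring[OF ring.carrier_is_subring[OF E.UP_ring]] by (simp add: P_def)
  have Rsub: "y : ?Q" if "y : ?R" for y
  proof (rule image_eqI)
   show "y = eval ?B D id x (monom P y 0)" using E.eval_const[OF x, of y] that by simp
   show "monom P y 0 : car (UP ?B)" using E.monom_closed[of y 0] that by (simp add: P_def)
  qed
  have xQ: "x : ?Q"
  proof (rule image_eqI)
   show "x = eval ?B D id x (monom P \<one>\<^bsub>?B\<^esub> 1)" using E.eval_monom1[OF x] by simp
   show "monom P \<one>\<^bsub>?B\<^esub> 1 : car (UP ?B)"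
    using E.monom_closed[of "\<one>\<^bsub>?B\<^esub>" 1] B.one_closed by (simp add: P_def)
  qed
  have "?K \<union> Y \<subseteq> ?R" using D.generate_ringE(2)[OF Y refl] .
  \<comment> \<open>A character on the image of evaluation thus restricts to the subring generated
    with the new element.\<close>
  then have sub: "?R' \<subseteq> ?Q"
   by (intro D.generate_ring_min_subring1 Q) (use Y x xQ Rsub in auto)
  show ?case
  proof (intro ballI impI)
   fix s assume "s : ?R'" "s ~= 0\<^sub>D"
   then obtain r where r: "r : ?R" "r ~= 0\<^sub>D" "ALL \<chi>:ring_hom ?B k. \<chi> r ~= 0\<^sub>k -->
     (\<exists>\<chi>'\<in>ring_hom (D\<lparr>carrier := ?Q\<rparr>) k. (ALL y:?R. \<chi>' y = \<chi> y) & \<chi>' s ~= 0\<^sub>k)"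
    using extend_character[OF D.domain_axioms R x k, of s] sub by blast
   obtain \<chi> where \<chi>: "\<chi> : ring_hom ?B k" "ALL c:car k. \<chi> (c \<odot>\<^sub>D 1\<^sub>D) = c" "\<chi> r ~= 0\<^sub>k"
    using insert r by blast
   obtain \<chi>' where \<chi>': "\<chi>' : ring_hom (D\<lparr>carrier := ?Q\<rparr>) k" "ALL y:?R. \<chi>' y = \<chi> y" "\<chi>' s ~= 0\<^sub>k"
    using r(3) \<chi> by blast
   have "\<chi>' : ring_hom (D\<lparr>carrier := ?R'\<rparr>) k"
    using \<chi>'(1) sub by (auto simp: ring_hom_def subset_iff Pi_def)
   moreover have "\<chi>' (c \<odot>\<^sub>D 1\<^sub>D) = c" if "c : car k" for c
   proof -
    have "c \<odot>\<^sub>D 1\<^sub>D : ?R" using that \<open>?K \<union> Y \<subseteq> ?R\<close> by (auto simp: scalars_def)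
    then show ?thesis using \<chi>'(2) \<chi>(2) that by simp
   qed
   ultimately show "EX \<chi>:ring_hom (D\<lparr>carrier := ?R'\<rparr>) k. (ALL c:car k. \<chi> (c \<odot>\<^sub>D 1\<^sub>D) = c) & \<chi> s ~= 0\<^sub>k"
    using \<chi>'(3) by blast
  qed
 qed
 from fg obtain Y where Y: "finite Y" "Y \<subseteq> car D" "generate_ring D (?K \<union> Y) = car D"
  by (auto simp: fin_gen_ring_over_def)
 have "D\<lparr>carrier := car D\<rparr> = D" by simp
 then show ?thesis using key[OF Y(1,2)] Y(3) s by auto
qed

section \<open>Tensor powers of domains\<close>

definition characters :: "('k, 'x) ring_scheme => ('k, 'r, 'y) module_scheme => ('r => 'k) set" where
 "characters k D = {\<chi> : ring_hom D k. ALL c:car k. \<chi> (c \<odot>\<^sub>D 1\<^sub>D) = c}"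

locale affine_domain =
 fixes k :: "('k, 'x) ring_scheme" and D :: "('k, 'd, 'y) module_scheme" and n :: nat
 assumes closed: "algebraically_closed k"
  and algebra_D: "algebra k D" and domain_D: "domain D"
  and fin_gen: "fin_gen_ring_over D (scalars k D) (car D)"
begin

sublocale k: field k using closed by (simp add: algebraically_closed_def)
sublocale D: nc_algebra k D by (rule algebra.nc_algebra[OF algebra_D])
sublocale D: domain D by (rule domain_D)

abbreviation T where "T \<equiv> tensor_power k n D"

sublocale T: nc_algebra k T by (rule D.nc_algebra_T)

lemmas pure_simps = D.pureD[where n = n]

lemma separate: "[|s : car D; s ~= 0\<^sub>D|] ==> EX \<chi>:characters k D. \<chi> s ~= 0\<^sub>k"
 using exists_character[OF closed algebra_D domain_D fin_gen, of s]
 unfolding characters_def by blast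

lemma characterD:
 assumes "\<chi> : characters k D"
 shows "x : car D ==> \<chi> x : car k"
  and "[|x : car D; y : car D|] ==> \<chi> (x *\<^sub>D y) = \<chi> x *\<^sub>k \<chi> y"
  and "[|x : car D; y : car D|] ==> \<chi> (x +\<^sub>D y) = \<chi> x +\<^sub>k \<chi> y"
  and "\<chi> 1\<^sub>D = 1\<^sub>k" and "\<chi> 0\<^sub>D = 0\<^sub>k"
  and "[|c : car k; x : car D|] ==> \<chi> (c \<odot>\<^sub>D x) = c *\<^sub>k \<chi> x"
  and "f : I \<rightarrow> car D ==> \<chi> (finsum D f I) = (\<Oplus>\<^sub>k i\<in>I. \<chi> (f i))"
proof -
 have h: "\<chi> : ring_hom D k" and s: "c : car k ==> \<chi> (c \<odot>\<^sub>D 1\<^sub>D) = c" for c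
  using assms by (auto simp: characters_def)
 show "x : car D ==> \<chi> x : car k" "\<chi> 1\<^sub>D = 1\<^sub>k"
  "[|x : car D; y : car D|] ==> \<chi> (x +\<^sub>D y) = \<chi> x +\<^sub>k \<chi> y"
  using h by (auto simp: ring_hom_def)
 show m: "[|x : car D; y : car D|] ==> \<chi> (x *\<^sub>D y) = \<chi> x *\<^sub>k \<chi> y" for x y
  using h by (auto simp: ring_hom_def)
 show "\<chi> 0\<^sub>D = 0\<^sub>k" "f : I \<rightarrow> car D ==> \<chi> (finsum D f I) = (\<Oplus>\<^sub>k i\<in>I. \<chi> (f i))"
  using ring_hom_zero_neg(1,4)[OF h D.A.ring_axioms k.ring_axioms] by auto
 show "\<chi> (c \<odot>\<^sub>D x) = c *\<^sub>k \<chi> x" if "c : car k" "x : car D" for c x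
  using m[of "c \<odot>\<^sub>D 1\<^sub>D" x] s that by (simp add: D.smult_mult_left)
qed

text \<open>A character as an endomorphism of \<open>D\<close> with values in k 1, so that
  characters and the identity can occupy different positions in \<open>ev\<close>.\<close>

definition scalar_map :: "('d => 'k) => 'd => 'd" where
 "scalar_map \<chi> d = \<chi> d \<odot>\<^sub>D 1\<^sub>D"

lemma scalar_map_hom: "\<chi> : characters k D ==> scalar_map \<chi> : alg_hom k D D"
 unfolding scalar_map_def
 by (rule alg_homI)
  (simp_all add: characterD D.smult_l_distr D.smult_mult_left D.smult_mult_right D.smult_assoc1[symmetric] k.m_comm)

lemma id_hom: "(%d. d) : alg_hom k D D"
 by (rule alg_homI) auto

text \<open>\<open>ev f\<close> sends a pure tensor to the product of the images of its factors under the \<open>f i\<close>; if all but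
 one of the \<open>f i\<close> are characters, it is a partial evaluation.\<close>

definition ev :: "(nat => 'd => 'd) => ((nat => 'd) => 'k) set => 'd" where
 "ev f = (SOME e. e : alg_hom k T D &
  (ALL x:car (tuples n D). e (pure k n D x) = list_prod D [1..<Suc n] (%i. f i (x i))))"

lemma ev:
 assumes "ALL i:{1..n}. f i : alg_hom k D D"
 shows "ev f : alg_hom k T D"
  and "x : car (tuples n D) ==> ev f (pure k n D x) = list_prod D [1..<Suc n] (%i. f i (x i))"
proof -
 have "multilinear_hom k n D D (%x. list_prod D [1..<Suc n] (%i. f i (x i)))"
 proof (rule multilinear_list_prod[OF D.nc_algebra_axioms D.nc_algebra_axioms])
  show "f i : alg_hom k D D" if "i : {1..n}" for i using assms that by blast
  fix i j x y assume "i : {1..n}" "j : {1..n}" "x : car D" "y : car D"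
  then show "f i x *\<^sub>D f j y = f j y *\<^sub>D f i x"
   using alg_homD(2)[OF bspec[OF assms]] by (intro D.m_comm) auto
 qed
 from D.tensor_lift[OF D.nc_algebra_axioms this]
 have "\<exists>e. e : alg_hom k T D &
  (ALL x:car (tuples n D). e (pure k n D x) = list_prod D [1..<Suc n] (%i. f i (x i)))" by blast
 from someI_ex[OF this] show "ev f : alg_hom k T D"
  "x : car (tuples n D) ==> ev f (pure k n D x) = list_prod D [1..<Suc n] (%i. f i (x i))"
  unfolding ev_def by blast+
qed

lemma alg_hom_tensor_eqI:
 assumes B: "nc_algebra k B" and e: "e : alg_hom k T B" "e' : alg_hom k T B"
  and "\<And>x. x : car (tuples n D) ==> e (pure k n D x) = e' (pure k n D x)"
  and "t : car T"
 shows "e t = e' t"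
 using assms(5)
proof (induction t rule: D.tensor_induct)
 case (pure c x)
 then show ?case using assms(4) alg_homD(6)[OF e(1)] alg_homD(6)[OF e(2)] pure_simps(1) by simp
next
 case (add s t)
 then show ?case using alg_homD(4)[OF e(1)] alg_homD(4)[OF e(2)] by simp
qed

lemma list_prod_finprod:
 assumes "distinct xs" "f : set xs \<rightarrow> car D"
 shows "list_prod D xs f = finprod D f (set xs)"
 using assms by (induction xs) (auto simp: Pi_def)

lemma cring_T: "cring T"
proof (intro cring.intro T.A.ring_axioms comm_monoid.intro comm_monoid_axioms.intro)
 show "monoid T" by (rule T.A.is_monoid)
 have pp: "pure k n D x *\<^sub>T pure k n D y = pure k n D y *\<^sub>T pure k n D x"
  if "x : car (tuples n D)" "y : car (tuples n D)" for x y
 proof -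
  have "x \<otimes>\<^bsub>tuples n D\<^esub> y = y \<otimes>\<^bsub>tuples n D\<^esub> x" using that by (auto simp: PiE_iff D.m_comm intro!: restrict_ext)
  then show ?thesis using pure_simps(3) that by metis
 qed
 show "s *\<^sub>T t = t *\<^sub>T s" if "s : car T" "t : car T" for s t
  using that
 proof (induction s rule: D.tensor_induct)
  case (pure c x)
  from pure(3) show ?case
  proof (induction t rule: D.tensor_induct)
   case (pure d y)
   then show ?case using \<open>c : car k\<close> \<open>x : car (tuples n D)\<close> pp[of x y]
    by (simp add: T.smult_mult_left T.smult_mult_right pure_simps(1) T.smult_assoc1[symmetric] k.m_comm
      del: tuples_simps)
  next
   case (add s t)
   have "c \<odot>\<^sub>T pure k n D x : car T" using pure(1,2) pure_simps(1) by simp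
   with add show ?case by (simp add: T.A.l_distr T.A.r_distr)
  qed
 next
  case (add s t)
  then show ?case by (simp add: T.A.l_distr T.A.r_distr)
 qed
qed

section \<open>Tensors carried by finitely many independent vectors\<close>

definition rep :: "'d set => ((nat => 'd) => 'k) set set" where
 "rep W = generate (add_monoid T) {c \<odot>\<^sub>T pure k n D y | c y. c : car k & y : (\<Pi>\<^sub>E i\<in>{1..n}. W)}"

lemma PiE_tuple: "[|y : (\<Pi>\<^sub>E i\<in>{1..n}. W); W \<subseteq> car D|] ==> y : car (tuples n D)"
 by (auto simp: PiE_iff)

lemma rep_base:
 assumes "W \<subseteq> car D"
 shows "{c \<odot>\<^sub>T pure k n D y | c y. c : car k & y : (\<Pi>\<^sub>E i\<in>{1..n}. W)} \<subseteq> car T"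
 using assms pure_simps(1) PiE_tuple by blast

lemma rep_subgroup: "W \<subseteq> car D ==> subgroup (rep W) (add_monoid T)"
 unfolding rep_def by (rule T.A.add.generate_is_subgroup[OF rep_base])

lemma rep_mono: "W \<subseteq> W' ==> rep W \<subseteq> rep W'"
 unfolding rep_def by (rule T.A.add.mono_generate) (use PiE_mono[of "{1..n}" "%_. W" "%_. W'"] in blast)

lemma rep_smult:
 assumes W: "W \<subseteq> car D" and c: "c : car k" and t: "t : rep W"
 shows "c \<odot>\<^sub>T t : rep W & t : car T"
 using t unfolding rep_def
proof (induction t rule: generate.induct)
 case one
 then show ?case using c generate.one[of "add_monoid T"] by simp
next
 case (incl h)
 then obtain d y where h: "h = d \<odot>\<^sub>T pure k n D y" "d : car k" "y : (\<Pi>\<^sub>E i\<in>{1..n}. W)" by blast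
 have y: "pure k n D y : car T" using pure_simps(1) PiE_tuple h W by blast
 have "c \<odot>\<^sub>T h = (c *\<^sub>k d) \<odot>\<^sub>T pure k n D y" using h c y by (simp add: T.smult_assoc1)
 then show ?case using h c y by (auto intro!: generate.incl)
next
 case (inv h)
 then obtain d y where h: "h = d \<odot>\<^sub>T pure k n D y" "d : car k" "y : (\<Pi>\<^sub>E i\<in>{1..n}. W)" by blast
 have y: "pure k n D y : car T" using pure_simps(1) PiE_tuple h W by blast
 have "c \<odot>\<^sub>T (\<ominus>\<^sub>T h) = (\<ominus>\<^sub>k (c *\<^sub>k d)) \<odot>\<^sub>T pure k n D y"
  using h c y by (simp add: T.smult_assoc1 T.smult_l_minus T.smult_r_minus)
 moreover have "\<ominus>\<^sub>T h : car T" using h y by simp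
 ultimately show ?case using h c by (auto intro!: generate.incl simp: a_inv_def[symmetric])
next
 case (eng s t)
 then show ?case using c generate.eng[of _ "add_monoid T"] by (simp add: T.smult_r_distr)
qed

text \<open>Scalars leave the factors one position at a time and accumulate in front.\<close>

lemma pure_scalars:
 assumes W: "W \<subseteq> car D"
  and "y : car (tuples n D)" and "\<And>i. i : {1..n} ==> y i : {c \<odot>\<^sub>D w | c w. c : car k & w : W}"
 shows "EX c:car k. EX x:(\<Pi>\<^sub>E i\<in>{1..n}. W). pure k n D y = c \<odot>\<^sub>T pure k n D x"
proof -
 let ?kW = "{c \<odot>\<^sub>D w | c w. c : car k & w : W}"
 have "ALL y:car (tuples n D). (ALL i:J. y i : ?kW) --> (ALL i:{1..n} - J. y i : W) -->
  (EX c:car k. EX x:(\<Pi>\<^sub>E i\<in>{1..n}. W). pure k n D y = c \<odot>\<^sub>T pure k n D x)"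
  if "finite J" "J \<subseteq> {1..n}" for J
  using that
 proof (induction J)
  case empty
  show ?case
  proof (intro ballI impI)
   fix y assume y: "y : car (tuples n D)" "ALL i:{1..n} - {}. y i : W"
   then have "y : (\<Pi>\<^sub>E i\<in>{1..n}. W)" by (auto simp: PiE_iff)
   moreover have "pure k n D y = 1\<^sub>k \<odot>\<^sub>T pure k n D y" using pure_simps(1)[OF y(1)] by simp
   ultimately show "EX c:car k. EX x:(\<Pi>\<^sub>E i\<in>{1..n}. W). pure k n D y = c \<odot>\<^sub>T pure k n D x"
    using k.one_closed by blast
  qed
 next
  case (insert j J)
  show ?case
  proof (intro ballI impI)
   fix y assume y: "y : car (tuples n D)" "ALL i:insert j J. y i : ?kW" "ALL i:{1..n} - insert j J. y i : W"
   have j: "j : {1..n}" using insert by auto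
   obtain c w where c: "y j = c \<odot>\<^sub>D w" "c : car k" "w : W" using y(2) by blast
   have w: "w : car D" using c W by auto
   have "y(j := w) : car (tuples n D)" using tuple_upd[OF y(1) j w] .
   moreover have "ALL i:J. (y(j := w)) i : ?kW" using y(2) insert(2) by auto
   moreover have "ALL i:{1..n} - J. (y(j := w)) i : W" using y(3) c by auto
   ultimately obtain d x where d: "d : car k" "x : (\<Pi>\<^sub>E i\<in>{1..n}. W)"
    "pure k n D (y(j := w)) = d \<odot>\<^sub>T pure k n D x"
    using insert by blast
   have x: "pure k n D x : car T" using pure_simps(1) PiE_tuple d W by blast
   have "pure k n D y = pure k n D (y(j := c \<odot>\<^sub>D w))" using c(1) by (metis fun_upd_triv)
   also have "\<dots> = c \<odot>\<^sub>T (d \<odot>\<^sub>T pure k n D x)"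
    using pure_simps(5)[OF y(1) j c(2) w] d by simp
   also have "\<dots> = (c *\<^sub>k d) \<odot>\<^sub>T pure k n D x" using c d x by (simp add: T.smult_assoc1)
   finally show "EX c:car k. EX x:(\<Pi>\<^sub>E i\<in>{1..n}. W). pure k n D y = c \<odot>\<^sub>T pure k n D x"
    using c d by blast
  qed
 qed
 from this[of "{1..n}"] show ?thesis using assms(2,3) by auto
qed

text \<open>Finite sets of vectors take the place of coordinates: the factors that occur in a sum of
  pure tensors carry it.\<close>

lemma rep_ex:
 assumes "t : car T" shows "\<exists>W. finite W & W \<subseteq> car D & t : rep W"
 using assms
proof (induction t rule: D.tensor_induct)
 case (pure c x)
 have "x ` {1..n} \<subseteq> car D" "x : (\<Pi>\<^sub>E i\<in>{1..n}. x ` {1..n})" using pure(2) by (auto simp: PiE_iff)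
 moreover from this have "c \<odot>\<^sub>T pure k n D x : rep (x ` {1..n})"
  unfolding rep_def using pure(1) by (intro generate.incl) blast
 ultimately show ?case by blast
next
 case (add s t)
 then obtain W W' where W: "finite W" "W \<subseteq> car D" "s : rep W" "finite W'" "W' \<subseteq> car D" "t : rep W'"
  by blast
 then have "s : rep (W \<union> W')" "t : rep (W \<union> W')"
  using rep_mono[of W "W \<union> W'"] rep_mono[of W' "W \<union> W'"] by auto
 then have "s +\<^sub>T t : rep (W \<union> W')"
  using subgroup.m_closed[OF rep_subgroup, of "W \<union> W'" s t] W by auto
 then show ?case using W by (intro exI[of _ "W \<union> W'"]) auto
qed

definition independent where
 "independent W \<longleftrightarrow> (\<forall>C. C : W \<rightarrow> car k --> (\<Oplus>\<^sub>D w\<in>W. C w \<odot>\<^sub>D w) = 0\<^sub>D --> (ALL w:W. C w = 0\<^sub>k))"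

text \<open>Take \<open>W\<close> of least cardinality. A nontrivial relation would express some
  \<open>v\<close> in \<open>W\<close> by the others, and expanding every factor equal to
  \<open>v\<close> would write the tensor with \<open>W - {v}\<close>.\<close>

lemma rep_independent:
 assumes "t : car T"
 shows "\<exists>W. finite W & W \<subseteq> car D & t : rep W & independent W"
proof -
 let ?Q = "%W. finite W & W \<subseteq> car D & t : rep W"
 obtain W0 where "?Q W0" using rep_ex[OF assms] by blast
 then obtain W where W: "finite W" "W \<subseteq> car D" "t : rep W"
  and min: "\<And>W'. ?Q W' ==> card W \<le> card W'"
  using arg_min_nat_lemma[of ?Q W0 card] by blast
 have "independent W"
  unfolding independent_def
 proof (intro allI impI, rule ccontr)
  fix C assume C: "C : W \<rightarrow> car k" "(\<Oplus>\<^sub>D w\<in>W. C w \<odot>\<^sub>D w) = 0\<^sub>D" "\<not> (ALL w:W. C w = 0\<^sub>k)"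
  then obtain v where v: "v : W" "C v ~= 0\<^sub>k" by blast
  let ?W = "W - {v}"
  let ?kW = "{c \<odot>\<^sub>D w | c w. c : car k & w : ?W}"
  have vD: "v : car D" and WD: "?W \<subseteq> car D" and kWD: "?kW \<subseteq> car D" using v W by auto
  have Cv: "C v : car k" "C v : Units k" using v C k.field_Units by auto
  have gen: "subgroup (generate (add_monoid D) ?kW) (add_monoid D)"
   by (rule D.A.add.generate_is_subgroup[OF kWD])
  have fc: "(%w. C w \<odot>\<^sub>D w) : ?W \<rightarrow> car D" using C W by auto
  have "C v \<odot>\<^sub>D v +\<^sub>D (\<Oplus>\<^sub>D w\<in>?W. C w \<odot>\<^sub>D w) = (\<Oplus>\<^sub>D w\<in>insert v ?W. C w \<odot>\<^sub>D w)"
   by (rule D.A.finsum_insert[symmetric]) (use W C vD Cv in auto)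
  then have z: "C v \<odot>\<^sub>D v +\<^sub>D (\<Oplus>\<^sub>D w\<in>?W. C w \<odot>\<^sub>D w) = 0\<^sub>D" using C(2) v by (simp add: insert_absorb)
  let ?d = "inv\<^bsub>k\<^esub> (C v)"
  have d: "?d : car k" "?d *\<^sub>k C v = 1\<^sub>k" using Cv by auto
  have v_eq: "v = (\<Oplus>\<^sub>D w\<in>?W. (\<ominus>\<^sub>k (?d *\<^sub>k C w)) \<odot>\<^sub>D w)"
  proof -
   have fs: "(\<Oplus>\<^sub>D w\<in>?W. C w \<odot>\<^sub>D w) : car D" by (rule D.A.finsum_closed[OF fc])
   have "C v \<odot>\<^sub>D v = \<ominus>\<^sub>D (\<Oplus>\<^sub>D w\<in>?W. C w \<odot>\<^sub>D w)"
    using z fs vD Cv by (intro D.A.minus_equality[symmetric]) auto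
   then have "?d \<odot>\<^sub>D (C v \<odot>\<^sub>D v) = (\<ominus>\<^sub>k ?d) \<odot>\<^sub>D (\<Oplus>\<^sub>D w\<in>?W. C w \<odot>\<^sub>D w)"
    using d fs by (simp add: D.smult_l_minus D.smult_r_minus)
   then have "v = (\<ominus>\<^sub>k ?d) \<odot>\<^sub>D (\<Oplus>\<^sub>D w\<in>?W. C w \<odot>\<^sub>D w)"
    using d Cv vD by (simp add: D.smult_assoc1[symmetric])
   also have "\<dots> = (\<Oplus>\<^sub>D w\<in>?W. (\<ominus>\<^sub>k ?d) \<odot>\<^sub>D (C w \<odot>\<^sub>D w))"
    using d fc W by (intro D.finsum_smult_ldistr) auto
   also have "\<dots> = (\<Oplus>\<^sub>D w\<in>?W. (\<ominus>\<^sub>k (?d *\<^sub>k C w)) \<odot>\<^sub>D w)"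
   proof (rule D.A.finsum_cong')
    fix w assume "w : ?W"
    then have "C w : car k" "w : car D" using C W by auto
    then show "(\<ominus>\<^sub>k ?d) \<odot>\<^sub>D (C w \<odot>\<^sub>D w) = (\<ominus>\<^sub>k (?d *\<^sub>k C w)) \<odot>\<^sub>D w"
     using d by (simp add: D.smult_assoc1[symmetric] k.l_minus)
   qed (use d C W in "auto simp: Pi_def subset_iff")
   finally show ?thesis .
  qed
  have v_mem: "(\<Oplus>\<^sub>D w\<in>I. (\<ominus>\<^sub>k (?d *\<^sub>k C w)) \<odot>\<^sub>D w) : generate (add_monoid D) ?kW" if "finite I" "I \<subseteq> ?W" for I
   using that
  proof (induction I)
   case empty
   then show ?case using generate.one[of "add_monoid D"] by simp
  next
   case (insert w I)
   have "C w : car k" "w : ?W" using insert C by auto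
   then have w: "(\<ominus>\<^sub>k (?d *\<^sub>k C w)) \<odot>\<^sub>D w : ?kW" using d k.a_inv_closed k.m_closed by blast
   then have "(\<ominus>\<^sub>k (?d *\<^sub>k C w)) \<odot>\<^sub>D w : car D" using kWD by blast
   moreover have "(%w. (\<ominus>\<^sub>k (?d *\<^sub>k C w)) \<odot>\<^sub>D w) : I \<rightarrow> car D"
    using insert d C W by (auto simp: Pi_def subset_iff)
   ultimately show ?case
    using insert generate.eng[OF generate.incl[OF w, of "add_monoid D"]] by simp
  qed
  from v_mem[OF finite_Diff[OF W(1)] subset_refl] have v_gen: "v : generate (add_monoid D) ?kW"
   unfolding v_eq[symmetric] .
  \<comment> \<open>Factors are first written as sums of scalar multiples of vectors other than
    \<open>v\<close>; then \<open>pure_scalars\<close> returns the scalars to the front.\<close>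
  have "rep W \<subseteq> rep ?W"
   unfolding rep_def[of W]
  proof (rule T.A.add.generate_subgroup_incl[OF _ rep_subgroup[OF WD]], rule subsetI)
   fix s assume "s : {c \<odot>\<^sub>T pure k n D y | c y. c : car k & y : (\<Pi>\<^sub>E i\<in>{1..n}. W)}"
   then obtain c y where s: "s = c \<odot>\<^sub>T pure k n D y" "c : car k" "y : (\<Pi>\<^sub>E i\<in>{1..n}. W)" by blast
   have y: "y : car (tuples n D)" using PiE_tuple s W by blast
   have "y i : generate (add_monoid D) ?kW" if "i : {1..n}" for i
   proof (cases "y i = v")
    case False
    then have yi: "y i : ?W" using s(3) that by (auto simp: PiE_iff)
    then have "y i = 1\<^sub>k \<odot>\<^sub>D y i" using WD by auto
    then have "y i : ?kW" using yi k.one_closed by blast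
    then show ?thesis by (rule generate.incl)
   qed (use v_gen in simp)
   then have "pure k n D y : generate (add_monoid T) (pure k n D ` (\<Pi>\<^sub>E i\<in>{1..n}. ?kW))"
    by (rule D.pure_span[OF kWD y])
   moreover have "generate (add_monoid T) (pure k n D ` (\<Pi>\<^sub>E i\<in>{1..n}. ?kW)) \<subseteq> rep ?W"
   proof (rule T.A.add.generate_subgroup_incl[OF _ rep_subgroup[OF WD]], rule subsetI)
    fix r assume "r : pure k n D ` (\<Pi>\<^sub>E i\<in>{1..n}. ?kW)"
    then obtain z where z: "r = pure k n D z" "z : (\<Pi>\<^sub>E i\<in>{1..n}. ?kW)" by blast
    have "EX c:car k. EX x:(\<Pi>\<^sub>E i\<in>{1..n}. ?W). pure k n D z = c \<odot>\<^sub>T pure k n D x"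
     by (rule pure_scalars[OF WD PiE_tuple[OF z(2) kWD]]) (use z in "auto simp: PiE_iff")
    then show "r : rep ?W" unfolding rep_def z(1) by (auto intro!: generate.incl)
   qed
   ultimately show "s : rep ?W" using rep_smult[OF WD s(2)] s(1) by blast
  qed
  then have "?Q ?W" using W by auto
  then have "card W \<le> card ?W" by (rule min)
  then show False using card_Diff1_less[OF W(1) v(1)] by linarith
 qed
 then show ?thesis using W by blast
qed

lemma rep_sum:
 assumes W: "finite W" "W \<subseteq> car D" and t: "t : rep W"
 shows "\<exists>u. u : (\<Pi>\<^sub>E i\<in>{1..n}. W) \<rightarrow> car k & t = (\<Oplus>\<^sub>T x\<in>(\<Pi>\<^sub>E i\<in>{1..n}. W). u x \<odot>\<^sub>T pure k n D x)"
proof -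
 let ?P = "\<Pi>\<^sub>E i\<in>{1..n}. W"
 have fin: "finite ?P" using W by (intro finite_PiE) auto
 have pc: "pure k n D x : car T" if "x : ?P" for x using that pure_simps(1) PiE_tuple W by blast
 from t show ?thesis unfolding rep_def
 proof (induction t rule: generate.induct)
  case one
  have "(\<Oplus>\<^sub>T x\<in>?P. 0\<^sub>k \<odot>\<^sub>T pure k n D x) = (\<Oplus>\<^sub>T x\<in>?P. 0\<^sub>T)"
   by (rule T.A.finsum_cong') (use pc in auto)
  then show ?case by (intro exI[of _ "%_. 0\<^sub>k"]) simp
 next
  case (incl h)
  then obtain c y where h: "h = c \<odot>\<^sub>T pure k n D y" "c : car k" "y : ?P" by blast
  have "(\<Oplus>\<^sub>T x\<in>?P. (if x = y then c else 0\<^sub>k) \<odot>\<^sub>T pure k n D x) =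
   (\<Oplus>\<^sub>T x\<in>?P. if x = y then c \<odot>\<^sub>T pure k n D x else 0\<^sub>T)"
   by (rule T.A.finsum_cong') (use pc h in auto)
  also have "\<dots> = c \<odot>\<^sub>T pure k n D y"
   by (rule T.A.add.finprod_singleton_swap[OF h(3) fin]) (use pc h in auto)
  finally show ?case using h by (intro exI[of _ "%x. if x = y then c else 0\<^sub>k"]) auto
 next
  case (inv h)
  then obtain c y where h: "h = c \<odot>\<^sub>T pure k n D y" "c : car k" "y : ?P" by blast
  have "(\<Oplus>\<^sub>T x\<in>?P. (if x = y then \<ominus>\<^sub>k c else 0\<^sub>k) \<odot>\<^sub>T pure k n D x) =
   (\<Oplus>\<^sub>T x\<in>?P. if x = y then \<ominus>\<^sub>k c \<odot>\<^sub>T pure k n D x else 0\<^sub>T)"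
   by (rule T.A.finsum_cong') (use pc h in auto)
  also have "\<dots> = \<ominus>\<^sub>k c \<odot>\<^sub>T pure k n D y"
   by (rule T.A.add.finprod_singleton_swap[OF h(3) fin]) (use pc h in auto)
  also have "\<dots> = \<ominus>\<^sub>T h" using h pc by (simp add: T.smult_l_minus)
  finally show ?case using h
   by (intro exI[of _ "%x. if x = y then \<ominus>\<^sub>k c else 0\<^sub>k"]) (auto simp: a_inv_def[symmetric])
 next
  case (eng s t)
  then obtain u v where u: "u : ?P \<rightarrow> car k" "s = (\<Oplus>\<^sub>T x\<in>?P. u x \<odot>\<^sub>T pure k n D x)"
   and v: "v : ?P \<rightarrow> car k" "t = (\<Oplus>\<^sub>T x\<in>?P. v x \<odot>\<^sub>T pure k n D x)" by blast
  have "(\<Oplus>\<^sub>T x\<in>?P. (u x +\<^sub>k v x) \<odot>\<^sub>T pure k n D x) =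
   (\<Oplus>\<^sub>T x\<in>?P. u x \<odot>\<^sub>T pure k n D x +\<^sub>T v x \<odot>\<^sub>T pure k n D x)"
   by (rule T.A.finsum_cong') (use pc u v in "auto simp: T.smult_l_distr Pi_def")
  also have "\<dots> = s +\<^sub>T t"
   unfolding u(2) v(2) by (rule T.A.finsum_addf) (use pc u v in "auto simp: Pi_def")
  finally show ?case using u v by (intro exI[of _ "%x. u x +\<^sub>k v x"]) auto
 qed
qed

text \<open>Positions are settled one by one: varying the character at position \<open>j\<close>
  alone turns the sum into a character applied to a combination of \<open>W\<close>. Characters
  separate, so this combination is zero, and independence makes its coefficients zero.\<close>

lemma coefficients_vanish:
 assumes W: "finite W" "W \<subseteq> car D" "independent W"
  and u: "u : (\<Pi>\<^sub>E i\<in>{1..n}. W) \<rightarrow> car k"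
  and z: "\<And>p. (\<And>i. i : {1..n} ==> p i : characters k D) ==>
   (\<Oplus>\<^sub>k x\<in>(\<Pi>\<^sub>E i\<in>{1..n}. W). u x *\<^sub>k (\<Otimes>\<^sub>k i\<in>{1..n}. p i (x i))) = 0\<^sub>k"
  and y: "y : (\<Pi>\<^sub>E i\<in>{1..n}. W)"
 shows "u y = 0\<^sub>k"
proof -
 let ?P = "\<Pi>\<^sub>E i\<in>{1..n}. W"
 have fin: "finite ?P" using W by (intro finite_PiE) auto
 define pts where "pts = {p. ALL i:{1..n}. p i : characters k D}"
 have ptx: "p i (x i) : car k" if "p : pts" "x : ?P" "i : {1..n}" for p x i
  using that W(2) PiE_mem[OF that(2,3)] by (intro characterD(1)) (auto simp: pts_def)
 have prodc: "(\<Otimes>\<^sub>k i\<in>J. p i (x i)) : car k" if "p : pts" "x : ?P" "J \<subseteq> {1..n}" for p x J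
  using that by (intro k.finprod_closed funcsetI ptx) blast+
 have uc: "u x : car k" if "x : ?P" for x using u that by auto
 \<comment> \<open>Positions in \<open>J\<close> are settled: there the index agrees with
   \<open>y\<close>, and no character value is left in the product.\<close>
 have key: "ALL p:pts. ALL y:?P. (\<Oplus>\<^sub>k x\<in>{x \<in> ?P. ALL i:J. x i = y i}. u x *\<^sub>k (\<Otimes>\<^sub>k i\<in>{1..n} - J. p i (x i))) = 0\<^sub>k"
  if "finite J" "J \<subseteq> {1..n}" for J
  using that
 proof (induction J)
  case empty
  then show ?case using z by (simp add: pts_def)
 next
  case (insert j J)
  have j: "j : {1..n}" "j \<notin> J" using insert by auto
  show ?case
  proof (intro ballI)
   fix p y assume p: "p : pts" and y: "y : ?P"
   define A where "A w = {x \<in> ?P. (ALL i:J. x i = y i) & x j = w}" for w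
   define C where "C w = (\<Oplus>\<^sub>k x\<in>A w. u x *\<^sub>k (\<Otimes>\<^sub>k i\<in>{1..n} - insert j J. p i (x i)))" for w
   have AP: "A w \<subseteq> ?P" for w by (auto simp: A_def)
   have Cc: "C w : car k" for w
    unfolding C_def by (intro k.finsum_closed funcsetI k.m_closed uc prodc[OF p]) (use AP in blast)+
   have "\<chi> (\<Oplus>\<^sub>D w\<in>W. C w \<odot>\<^sub>D w) = 0\<^sub>k" if \<chi>: "\<chi> : characters k D" for \<chi>
   proof -
    have q: "p(j := \<chi>) : pts" using p \<chi> by (auto simp: pts_def)
    have \<chi>w: "\<chi> w : car k" if "w : W" for w using characterD(1)[OF \<chi>] that W by auto
    have "0\<^sub>k = (\<Oplus>\<^sub>k x\<in>{x \<in> ?P. ALL i:J. x i = y i}. u x *\<^sub>k (\<Otimes>\<^sub>k i\<in>{1..n} - J. (p(j := \<chi>)) i (x i)))"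
     using insert q y by auto
    also have "{x \<in> ?P. ALL i:J. x i = y i} = (\<Union>w\<in>W. A w)"
     using j by (auto simp: A_def PiE_iff)
    also have "(\<Oplus>\<^sub>k x\<in>(\<Union>w\<in>W. A w). u x *\<^sub>k (\<Otimes>\<^sub>k i\<in>{1..n} - J. (p(j := \<chi>)) i (x i))) =
     (\<Oplus>\<^sub>k w\<in>W. \<Oplus>\<^sub>k x\<in>A w. u x *\<^sub>k (\<Otimes>\<^sub>k i\<in>{1..n} - J. (p(j := \<chi>)) i (x i)))"
    proof (rule k.add.finprod_UN_disjoint[OF W(1)])
     show "finite (A w)" for w using AP fin finite_subset by blast
     show "pairwise (%i j. disjnt (A i) (A j)) W" by (auto simp: pairwise_def disjnt_def A_def)
     show "u x *\<^sub>k (\<Otimes>\<^sub>k i\<in>{1..n} - J. (p(j := \<chi>)) i (x i)) : car k" if "x : A w" for w x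
      by (intro k.m_closed uc prodc[OF q]) (use that AP in blast)+
    qed
    also have "\<dots> = (\<Oplus>\<^sub>k w\<in>W. C w *\<^sub>k \<chi> w)"
    proof (rule k.finsum_cong')
     fix w assume w: "w : W"
     have "(\<Oplus>\<^sub>k x\<in>A w. u x *\<^sub>k (\<Otimes>\<^sub>k i\<in>{1..n} - J. (p(j := \<chi>)) i (x i))) =
      (\<Oplus>\<^sub>k x\<in>A w. (u x *\<^sub>k (\<Otimes>\<^sub>k i\<in>{1..n} - insert j J. p i (x i))) *\<^sub>k \<chi> w)"
     proof (rule k.finsum_cong')
      fix x assume x: "x : A w"
      then have xP: "x : ?P" and xj: "x j = w" by (auto simp: A_def)
      have ins: "{1..n} - J = insert j ({1..n} - insert j J)" using j by auto
      have pc: "p i (x i) : car k" if "i : {1..n}" for i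
       using ptx[OF p xP that] .
      have "(\<Otimes>\<^sub>k i\<in>{1..n} - J. (p(j := \<chi>)) i (x i)) =
       (p(j := \<chi>)) j (x j) *\<^sub>k (\<Otimes>\<^sub>k i\<in>{1..n} - insert j J. (p(j := \<chi>)) i (x i))"
       unfolding ins by (rule k.finprod_insert) (use pc \<chi>w[OF w] xj in auto)
      also have "(\<Otimes>\<^sub>k i\<in>{1..n} - insert j J. (p(j := \<chi>)) i (x i)) = (\<Otimes>\<^sub>k i\<in>{1..n} - insert j J. p i (x i))"
       by (rule k.finprod_cong') (use pc in auto)
      finally show "u x *\<^sub>k (\<Otimes>\<^sub>k i\<in>{1..n} - J. (p(j := \<chi>)) i (x i)) =
       (u x *\<^sub>k (\<Otimes>\<^sub>k i\<in>{1..n} - insert j J. p i (x i))) *\<^sub>k \<chi> w"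
       using xj uc[OF xP] prodc[OF p xP, of "{1..n} - insert j J"] \<chi>w[OF w]
       by (simp add: k.m_ac)
     next
      show "(%x. (u x *\<^sub>k (\<Otimes>\<^sub>k i\<in>{1..n} - insert j J. p i (x i))) *\<^sub>k \<chi> w) : A w \<rightarrow> car k"
       by (intro funcsetI k.m_closed uc prodc[OF p] \<chi>w[OF w]) (use AP in blast)+
     qed simp
     also have "\<dots> = C w *\<^sub>k \<chi> w"
      unfolding C_def
     proof (rule k.finsum_ldistr[symmetric])
      show "finite (A w)" using AP fin finite_subset by blast
      show "(%x. u x *\<^sub>k (\<Otimes>\<^sub>k i\<in>{1..n} - insert j J. p i (x i))) : A w \<rightarrow> car k"
       by (intro funcsetI k.m_closed uc prodc[OF p]) (use AP in blast)+
     qed (rule \<chi>w[OF w])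
     finally show "(\<Oplus>\<^sub>k x\<in>A w. u x *\<^sub>k (\<Otimes>\<^sub>k i\<in>{1..n} - J. (p(j := \<chi>)) i (x i))) = C w *\<^sub>k \<chi> w" .
    qed (use Cc \<chi>w in auto)
    also have "\<dots> = (\<Oplus>\<^sub>k w\<in>W. \<chi> (C w \<odot>\<^sub>D w))"
     by (rule k.finsum_cong') (use Cc \<chi>w W characterD(6)[OF \<chi>] in "auto simp: subset_iff")
    also have "\<dots> = \<chi> (\<Oplus>\<^sub>D w\<in>W. C w \<odot>\<^sub>D w)"
     by (rule characterD(7)[OF \<chi>, symmetric]) (use Cc W in auto)
    finally show ?thesis by simp
   qed
   moreover have "(\<Oplus>\<^sub>D w\<in>W. C w \<odot>\<^sub>D w) : car D" using Cc W by (intro D.A.finsum_closed) auto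
   ultimately have "(\<Oplus>\<^sub>D w\<in>W. C w \<odot>\<^sub>D w) = 0\<^sub>D" using separate by blast
   then have "C w = 0\<^sub>k" if "w : W" for w using W(3) Cc that unfolding independent_def by blast
   then have "C (y j) = 0\<^sub>k" using y j by (auto simp: PiE_iff)
   moreover have "{x \<in> ?P. ALL i:insert j J. x i = y i} = A (y j)" by (auto simp: A_def)
   ultimately show "(\<Oplus>\<^sub>k x\<in>{x \<in> ?P. ALL i:insert j J. x i = y i}.
    u x *\<^sub>k (\<Otimes>\<^sub>k i\<in>{1..n} - insert j J. p i (x i))) = 0\<^sub>k"
    by (simp add: C_def)
  qed
 qed
 \<comment> \<open>Any character will do; it only supplies a point for \<open>key\<close>. With all
   positions settled the sum has the single term \<open>u y\<close>.\<close>
 obtain \<chi> where \<chi>: "\<chi> : characters k D" using separate[of "1\<^sub>D"] by auto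
 have "(%_. \<chi>) : pts" using \<chi> by (simp add: pts_def)
 from bspec[OF bspec[OF key[OF finite_atLeastAtMost subset_refl] this] y]
 have "(\<Oplus>\<^sub>k x\<in>{x \<in> ?P. ALL i:{1..n}. x i = y i}. u x *\<^sub>k (\<Otimes>\<^sub>k i\<in>{1..n} - {1..n}. \<chi> (x i))) = 0\<^sub>k" .
 moreover have "{x \<in> ?P. ALL i:{1..n}. x i = y i} = {y}"
  using y by (auto simp: PiE_iff intro: extensionalityI)
 ultimately show ?thesis using uc[OF y] by simp
qed

section \<open>Evaluation at points and the domain property\<close>

lemma list_prod_scalars:
 assumes "set xs \<subseteq> {1..n}" "distinct xs" "\<And>i. i : set xs ==> c i : car k"
 shows "list_prod D xs (%i. c i \<odot>\<^sub>D 1\<^sub>D) = (\<Otimes>\<^sub>k i\<in>set xs. c i) \<odot>\<^sub>D 1\<^sub>D"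
 using assms
proof (induction xs)
 case (Cons i xs)
 then have "(\<Otimes>\<^sub>k i\<in>set xs. c i) : car k" by (intro k.finprod_closed) auto
 with Cons show ?case
  by (simp add: Pi_def D.smult_mult_left D.smult_assoc1)
qed simp

text \<open>If every point annihilated the tensor, all its coefficients over an independent
  \<open>W\<close> would vanish by \<open>coefficients_vanish\<close>.\<close>

lemma exists_point:
 assumes t: "t : car T" "t ~= 0\<^sub>T"
 shows "\<exists>p. (ALL i:{1..n}. p i : characters k D) & ev (%i. scalar_map (p i)) t ~= 0\<^sub>D"
proof (rule ccontr)
 assume *: "\<not> ?thesis"
 obtain W where W: "finite W" "W \<subseteq> car D" "t : rep W" "independent W"
  using rep_independent[OF t(1)] by blast
 let ?P = "\<Pi>\<^sub>E i\<in>{1..n}. W"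
 obtain u where u: "u : ?P \<rightarrow> car k" "t = (\<Oplus>\<^sub>T x\<in>?P. u x \<odot>\<^sub>T pure k n D x)"
  using rep_sum[OF W(1-3)] by blast
 have pc: "x : car (tuples n D)" "pure k n D x : car T" if "x : ?P" for x
  using that pure_simps(1) PiE_tuple W by blast+
 have "u x = 0\<^sub>k" if "x : ?P" for x
 proof (rule coefficients_vanish[OF W(1,2,4) u(1) _ that])
  fix p assume p: "\<And>i. i : {1..n} ==> p i : characters k D"
  let ?f = "%i. scalar_map (p i)"
  have f: "ALL i:{1..n}. ?f i : alg_hom k D D" using scalar_map_hom p by blast
  note e = alg_homD[OF ev(1)[OF f]]
  have set: "set [1..<Suc n] = {1..n}" by auto
  have px: "p i (x i) : car k" if "x : ?P" "i : {1..n}" for x i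
   using characterD(1)[OF p[OF that(2)], of "x i"] pc(1)[OF that(1)] that(2) by (auto simp: PiE_iff)
  have prc: "(\<Otimes>\<^sub>k i\<in>{1..n}. p i (x i)) : car k" if "x : ?P" for x
   using px[OF that] by (intro k.finprod_closed) auto
  have evp: "ev ?f (pure k n D x) = (\<Otimes>\<^sub>k i\<in>{1..n}. p i (x i)) \<odot>\<^sub>D 1\<^sub>D" if "x : ?P" for x
  proof -
   have "ev ?f (pure k n D x) = list_prod D [1..<Suc n] (%i. p i (x i) \<odot>\<^sub>D 1\<^sub>D)"
    unfolding ev(2)[OF f pc(1)[OF that]] by (rule list_prod_cong) (simp add: scalar_map_def)
   also have "\<dots> = (\<Otimes>\<^sub>k i\<in>set [1..<Suc n]. p i (x i)) \<odot>\<^sub>D 1\<^sub>D"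
    by (rule list_prod_scalars) (use px[OF that] in "simp_all only: set, auto")
   finally show ?thesis by (simp only: set)
  qed
  have "ev ?f t = 0\<^sub>D" using * p by blast
  then have "0\<^sub>D = ev ?f t" by simp
  also have "\<dots> = (\<Oplus>\<^sub>D x\<in>?P. ev ?f (u x \<odot>\<^sub>T pure k n D x))"
   unfolding u(2) by (rule ring_hom_zero_neg(4)[OF e(1) T.A.ring_axioms D.A.ring_axioms]) (use u pc in auto)
  also have "\<dots> = (\<Oplus>\<^sub>D x\<in>?P. (u x *\<^sub>k (\<Otimes>\<^sub>k i\<in>{1..n}. p i (x i))) \<odot>\<^sub>D 1\<^sub>D)"
   by (rule D.A.finsum_cong') (use u pc prc e(6) evp in "auto simp: D.smult_assoc1 Pi_def")
  finally have z: "(\<Oplus>\<^sub>D x\<in>?P. (u x *\<^sub>k (\<Otimes>\<^sub>k i\<in>{1..n}. p i (x i))) \<odot>\<^sub>D 1\<^sub>D) = 0\<^sub>D" by simp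
  \<comment> \<open>The evaluations lie in k 1; a character brings the equation down to
    \<open>k\<close>.\<close>
  obtain \<chi> where \<chi>: "\<chi> : characters k D" using separate[of "1\<^sub>D"] by auto
  have "0\<^sub>k = (\<Oplus>\<^sub>k x\<in>?P. \<chi> ((u x *\<^sub>k (\<Otimes>\<^sub>k i\<in>{1..n}. p i (x i))) \<odot>\<^sub>D 1\<^sub>D))"
   using characterD(7)[OF \<chi>, of "%x. (u x *\<^sub>k (\<Otimes>\<^sub>k i\<in>{1..n}. p i (x i))) \<odot>\<^sub>D 1\<^sub>D" ?P] z characterD(5)[OF \<chi>]
    u prc by (auto simp: Pi_def)
  also have "\<dots> = (\<Oplus>\<^sub>k x\<in>?P. u x *\<^sub>k (\<Otimes>\<^sub>k i\<in>{1..n}. p i (x i)))"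
   by (rule k.finsum_cong') (use u prc characterD(4,6)[OF \<chi>] in "auto simp: Pi_def")
  finally show "(\<Oplus>\<^sub>k x\<in>?P. u x *\<^sub>k (\<Otimes>\<^sub>k i\<in>{1..n}. p i (x i))) = 0\<^sub>k" by simp
 qed
 then have "(\<Oplus>\<^sub>T x\<in>?P. u x \<odot>\<^sub>T pure k n D x) = (\<Oplus>\<^sub>T x\<in>?P. 0\<^sub>T)"
  by (intro T.A.finsum_cong') (use pc in auto)
 then show False using u(2) t(2) by simp
qed

text \<open>Composing a partial evaluation with a character fills the free position. This lets one
  coordinate of a point be changed while the others are kept.\<close>

lemma ev_character:
 assumes f: "ALL i:{1..n}. f i : alg_hom k D D" and \<chi>: "\<chi> : characters k D"
  and g: "\<And>i x. [|i : {1..n}; x : car D|] ==> g i x = scalar_map \<chi> (f i x)"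
  and t: "t : car T"
 shows "ev g t = scalar_map \<chi> (ev f t)"
proof -
 note s = alg_homD[OF scalar_map_hom[OF \<chi>]]
 have gh: "ALL i:{1..n}. g i : alg_hom k D D"
 proof
  fix i assume i: "i : {1..n}"
  show "g i : alg_hom k D D"
   by (rule alg_homI) (use g[OF i] alg_homD[OF bspec[OF f i]] s in auto)
 qed
 have set: "set [1..<Suc n] = {1..n}" by auto
 have lp: "scalar_map \<chi> (list_prod D xs h) = list_prod D xs (%i. scalar_map \<chi> (h i))"
  if "\<And>i. i : set xs ==> h i : car D" for xs :: "nat list" and h
  using that by (induction xs) (auto simp: s D.A.list_prod_closed)
 have "(%t. scalar_map \<chi> (ev f t)) : alg_hom k T D"
  by (rule alg_homI) (simp_all add: alg_homD[OF ev(1)[OF f]] s)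
 then show ?thesis
 proof (rule alg_hom_tensor_eqI[OF D.nc_algebra_axioms ev(1)[OF gh] _ _ t])
  fix x assume x: "x : car (tuples n D)"
  then have "x i : car D" if "i : {1..n}" for i using that by (auto simp: PiE_iff)
  then show "ev g (pure k n D x) = scalar_map \<chi> (ev f (pure k n D x))"
   unfolding ev(2)[OF gh x] ev(2)[OF f x]
   by (subst lp) (use alg_homD(2)[OF bspec[OF f]] g in "auto simp: set simp del: upt_Suc intro!: list_prod_cong")
 qed
qed

text \<open>Points at which \<open>s\<close> and \<open>t\<close> do not vanish are made to agree
  position by position. With one position left free, both become nonzero elements of the domain
  \<open>D\<close>, and one character can be chosen that does not vanish on their product. At a
  common point the product of the two values is nonzero, although the product of the tensors is
  zero.\<close>

lemma domain_T: "domain T"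
proof (intro domain.intro domain_axioms.intro cring_T)
 obtain \<chi> where \<chi>: "\<chi> : characters k D" using separate[of "1\<^sub>D"] by auto
 have h: "ev (%i. scalar_map \<chi>) : alg_hom k T D" by (intro ev(1) ballI scalar_map_hom[OF \<chi>])
 show "1\<^sub>T ~= 0\<^sub>T"
  using alg_homD(5)[OF h] ring_hom_zero_neg(1)[OF alg_homD(1)[OF h] T.A.ring_axioms D.A.ring_axioms]
  by auto
 fix s t assume st: "s *\<^sub>T t = 0\<^sub>T" and s: "s : car T" and t: "t : car T"
 show "s = 0\<^sub>T \<or> t = 0\<^sub>T"
 proof (rule ccontr)
  assume *: "\<not> (s = 0\<^sub>T \<or> t = 0\<^sub>T)"
  let ?sc = "%p i. scalar_map (p i)"
  define pts where "pts = {p. ALL i:{1..n}. p i : characters k D}"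
  have sc: "ALL i:{1..n}. ?sc p i : alg_hom k D D" if "p : pts" for p
   using that scalar_map_hom by (simp add: pts_def)
  have "EX p:pts. EX q:pts. (ALL i:{1..j}. p i = q i) & ev (?sc p) s ~= 0\<^sub>D & ev (?sc q) t ~= 0\<^sub>D"
   if "j \<le> n" for j
   using that
  proof (induction j)
   case 0
   then show ?case using exists_point s t * by (fastforce simp: pts_def)
  next
   case (Suc j)
   then obtain p q where pq: "p : pts" "q : pts" "ALL i:{1..j}. p i = q i"
    "ev (?sc p) s ~= 0\<^sub>D" "ev (?sc q) t ~= 0\<^sub>D" by auto
   let ?j = "Suc j"
   have j: "?j : {1..n}" using Suc by auto
   \<comment> \<open>Position \<open>Suc j\<close> is freed by putting the identity there.\<close>
   let ?fp = "(?sc p)(?j := %d. d)" and ?fq = "(?sc q)(?j := %d. d)"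
   have fp: "ALL i:{1..n}. ?fp i : alg_hom k D D" and fq: "ALL i:{1..n}. ?fq i : alg_hom k D D"
    using sc[OF pq(1)] sc[OF pq(2)] id_hom by auto
   have upd: "ev (?sc (r(?j := \<chi>))) v = scalar_map \<chi> (ev ((?sc r)(?j := %d. d)) v)"
    if r: "r : pts" and \<chi>: "\<chi> : characters k D" and v: "v : car T" for r \<chi> v
   proof (rule ev_character[OF _ \<chi> _ v])
    show "ALL i:{1..n}. ((?sc r)(?j := %d. d)) i : alg_hom k D D"
     using sc[OF r] id_hom by auto
    show "?sc (r(?j := \<chi>)) i x = scalar_map \<chi> (((?sc r)(?j := %d. d)) i x)"
     if "i : {1..n}" "x : car D" for i x
     using characterD[OF \<chi>] characterD(1)[of "r i" x] r that by (auto simp: scalar_map_def pts_def)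
   qed
   have char: "p ?j : characters k D" "q ?j : characters k D" using pq j by (auto simp: pts_def)
   have sc0: "scalar_map \<chi> 0\<^sub>D = 0\<^sub>D" if "\<chi> : characters k D" for \<chi>
    using characterD(5)[OF that] by (simp add: scalar_map_def)
   have nz: "ev ?fp s ~= 0\<^sub>D" "ev ?fq t ~= 0\<^sub>D"
    using upd[OF pq(1) char(1) s] upd[OF pq(2) char(2) t] pq(4,5) sc0[OF char(1)] sc0[OF char(2)]
    by (auto simp: fun_upd_triv)
   have c: "ev ?fp s : car D" "ev ?fq t : car D"
    by (rule alg_homD(2)[OF ev(1)[OF fp] s], rule alg_homD(2)[OF ev(1)[OF fq] t])
   then have "ev ?fp s *\<^sub>D ev ?fq t ~= 0\<^sub>D" using nz D.integral by blast
   then obtain \<chi> where \<chi>: "\<chi> : characters k D" "\<chi> (ev ?fp s *\<^sub>D ev ?fq t) ~= 0\<^sub>k"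
    using separate[of "ev ?fp s *\<^sub>D ev ?fq t"] c by auto
   then have "\<chi> (ev ?fp s) ~= 0\<^sub>k" "\<chi> (ev ?fq t) ~= 0\<^sub>k"
    using characterD(1,2)[OF \<chi>(1)] c by auto
   moreover have "scalar_map \<chi> d ~= 0\<^sub>D" if "\<chi> d ~= 0\<^sub>k" "d : car D" for d
   proof
    assume "scalar_map \<chi> d = 0\<^sub>D"
    then have "\<chi> (\<chi> d \<odot>\<^sub>D 1\<^sub>D) = 0\<^sub>k" using characterD(5)[OF \<chi>(1)] by (simp add: scalar_map_def)
    then show False using that characterD[OF \<chi>(1)] by simp
   qed
   ultimately have "ev (?sc (p(?j := \<chi>))) s ~= 0\<^sub>D" "ev (?sc (q(?j := \<chi>))) t ~= 0\<^sub>D"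
    using upd[OF pq(1) \<chi>(1) s] upd[OF pq(2) \<chi>(1) t] c by auto
   moreover have "p(?j := \<chi>) : pts" "q(?j := \<chi>) : pts" using pq \<chi> by (auto simp: pts_def)
   moreover have "ALL i:{1..Suc j}. (p(?j := \<chi>)) i = (q(?j := \<chi>)) i" using pq(3) by auto
   ultimately show ?case by blast
  qed
  from this[of n] obtain p q where pq: "p : pts" "q : pts" "ALL i:{1..n}. p i = q i"
   "ev (?sc p) s ~= 0\<^sub>D" "ev (?sc q) t ~= 0\<^sub>D" by auto
  have "ev (?sc p) t = ev (?sc q) t"
  proof (rule alg_hom_tensor_eqI[OF D.nc_algebra_axioms ev(1)[OF sc[OF pq(1)]] ev(1)[OF sc[OF pq(2)]] _ t])
   fix x assume x: "x : car (tuples n D)"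
   show "ev (?sc p) (pure k n D x) = ev (?sc q) (pure k n D x)"
    unfolding ev(2)[OF sc[OF pq(1)] x] ev(2)[OF sc[OF pq(2)] x]
    by (rule list_prod_cong) (use pq(3) in auto)
  qed
  then have "ev (?sc p) s *\<^sub>D ev (?sc p) t ~= 0\<^sub>D"
   using pq alg_homD(2)[OF ev(1)[OF sc[OF pq(1)]]] s t D.integral by metis
  moreover have "ev (?sc p) s *\<^sub>D ev (?sc p) t = ev (?sc p) 0\<^sub>T"
   using alg_homD(3)[OF ev(1)[OF sc[OF pq(1)]] s t] st by simp
  ultimately show False
   using ring_hom_zero_neg(1)[OF alg_homD(1)[OF ev(1)[OF sc[OF pq(1)]]] T.A.ring_axioms D.A.ring_axioms]
   by simp
 qed
qed

text \<open>The multiplication map, which is \<open>ev\<close> with the identity at every position,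
  is a left inverse.\<close>

lemma in_factor_inj:
 assumes "i : {1..n}" "d : car D" "d' : car D" "in_factor k n D i d = in_factor k n D i d'"
 shows "d = d'"
proof -
 have "ev (%_ d. d) (in_factor k n D i d) = d" if d: "d : car D" for d
 proof -
  let ?x = "\<lambda>j\<in>{1..n}. if j = i then d else 1\<^sub>D"
  have x: "?x : car (tuples n D)" using d by auto
  have "ev (%_ d. d) (in_factor k n D i d) = list_prod D [1..<Suc n] ?x"
   unfolding in_factor_pure using ev(2)[OF _ x, of "%_ d. d"] id_hom by blast
  also have "\<dots> = finprod D ?x (set [1..<Suc n])" by (rule list_prod_finprod) (use d in auto)
  also have "set [1..<Suc n] = {1..n}" by auto
  also have "finprod D ?x {1..n} = finprod D (%j. if j = i then d else 1\<^sub>D) {1..n}"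
   by (rule D.finprod_cong') (use d in auto)
  also have "\<dots> = d" using D.finprod_singleton_swap[of i "{1..n}" "%_. d"] assms(1) d by simp
  finally show ?thesis .
 qed
 then show ?thesis using assms by metis
qed

end

section \<open>Automorphism groups of algebras\<close>

lemma carrier_alg_aut:
 "f : car (alg_aut k R) \<longleftrightarrow> f : alg_hom k R R & bij_betw f (car R) (car R) & f : extensional (car R)"
 by (auto simp: alg_aut_def alg_hom_def Bij_def)

lemma alg_aut_mult:
 assumes "f : car (alg_aut k R)" "g : car (alg_aut k R)"
 shows "f *\<^sub>(alg_aut k R) g = compose (car R) f g"
proof -
 have "f : Bij (car R)" "g : Bij (car R)" using assms by (auto simp: alg_aut_def)
 then show ?thesis by (simp add: alg_aut_def BijGroup_def)
qed

lemma alg_aut_one: "\<one>\<^bsub>alg_aut k R\<^esub> = (\<lambda>x\<in>car R. x)"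
 by (simp add: alg_aut_def BijGroup_def)

context nc_algebra
begin

lemma group_alg_aut: "group (alg_aut k A)"
proof -
 let ?H = "{f \<in> Bij (car A). f : ring_hom A A &
    (ALL c:car k. ALL x:car A. f (c \<odot>\<^sub>A x) = c \<odot>\<^sub>A f x)}"
 interpret B: group "BijGroup (car A)" by (rule group_BijGroup)
 have BG: "car (BijGroup (car A)) = Bij (car A)"
  "f : Bij (car A) ==> g : Bij (car A) ==> f \<otimes>\<^bsub>BijGroup (car A)\<^esub> g = compose (car A) f g"
  "\<one>\<^bsub>BijGroup (car A)\<^esub> = (\<lambda>x\<in>car A. x)" for f g by (auto simp: BijGroup_def)
 have "subgroup ?H (BijGroup (car A))"
 proof (rule B.subgroupI)
  show "?H \<subseteq> car (BijGroup (car A))" by (auto simp: BG)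
  have "(\<lambda>x\<in>car A. x) : ?H" by (auto simp: id_Bij ring_hom_def)
  then show "?H ~= {}" by blast
 next
  fix f assume f: "f : ?H"
  then have fB: "f : Bij (car A)" by simp
  have fh: "f : alg_hom k A A" using f by (simp add: alg_hom_def)
  let ?g = "\<lambda>x\<in>car A. inv_into (car A) f x"
  have inv: "inv\<^bsub>BijGroup (car A)\<^esub> f = ?g" using fB by (rule inv_BijGroup)
  have inj: "inj_on f (car A)" and im: "f ` car A = car A"
   using fB by (auto simp: Bij_def bij_betw_def)
  have gc: "?g x : car A" "f (?g x) = x" if "x : car A" for x
   using that im by (auto simp: inv_into_into f_inv_into_f)
  have eq: "x = y" if "f x = f y" "x : car A" "y : car A" for x y
   using inj that by (auto dest: inj_onD)
  have "?g : alg_hom k A A"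
  proof (rule alg_homI)
   fix x y assume x: "x : car A" "y : car A"
   show "?g (x *\<^sub>A y) = ?g x *\<^sub>A ?g y"
    by (rule eq) (use x gc(1)[of x] gc(1)[of y] gc(1)[of "x *\<^sub>A y"] gc(2) in "simp_all add: alg_homD(3)[OF fh] del: restrict_apply")
   show "?g (x +\<^sub>A y) = ?g x +\<^sub>A ?g y"
    by (rule eq) (use x gc(1)[of x] gc(1)[of y] gc(1)[of "x +\<^sub>A y"] gc(2) in "simp_all add: alg_homD(4)[OF fh] del: restrict_apply")
  next
   show "?g 1\<^sub>A = 1\<^sub>A"
    by (rule eq[OF _ gc(1) A.one_closed]) (simp_all only: gc(2) alg_homD(5)[OF fh] A.one_closed)
  next
   fix c x assume x: "c : car k" "x : car A"
   show "?g (c \<odot>\<^sub>A x) = c \<odot>\<^sub>A ?g x"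
    by (rule eq) (use x gc(1)[of x] gc(1)[of "c \<odot>\<^sub>A x"] gc(2) in "simp_all add: alg_homD(6)[OF fh] del: restrict_apply")
  qed (rule gc(1))
  then show "inv\<^bsub>BijGroup (car A)\<^esub> f : ?H"
   unfolding inv using restrict_inv_into_Bij[OF fB] by (simp add: alg_hom_def)
 next
  fix f g assume f: "f : ?H" and g: "g : ?H"
  then have "f : alg_hom k A A" "g : alg_hom k A A" by (auto simp: alg_hom_def)
  note h = alg_homD[OF this(1)] alg_homD[OF this(2)]
  have "compose (car A) f g : alg_hom k A A"
   by (rule alg_homI) (simp_all add: h compose_def)
  then show "f \<otimes>\<^bsub>BijGroup (car A)\<^esub> g : ?H"
   using f g compose_Bij by (auto simp: BG alg_hom_def)
 qed
 then show ?thesis unfolding alg_aut_def by (rule B.subgroup_imp_group)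
qed

lemma alg_aut_mult_apply:
 assumes "f : car (alg_aut k A)" "g : car (alg_aut k A)" "x : car A"
 shows "(f *\<^sub>(alg_aut k A) g) x = f (g x)"
 using assms by (simp add: alg_aut_mult compose_def)

lemma alg_aut_inv_apply:
 assumes f: "f : car (alg_aut k A)" and x: "x : car A"
 shows "f ((inv\<^bsub>alg_aut k A\<^esub> f) x) = x" "(inv\<^bsub>alg_aut k A\<^esub> f) (f x) = x"
proof -
 interpret G: group "alg_aut k A" by (rule group_alg_aut)
 have "(f *\<^sub>(alg_aut k A) inv\<^bsub>alg_aut k A\<^esub> f) x = x" "(inv\<^bsub>alg_aut k A\<^esub> f *\<^sub>(alg_aut k A) f) x = x"
  unfolding G.r_inv[OF f] G.l_inv[OF f] using x by (simp_all add: alg_aut_one)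
 then show "f ((inv\<^bsub>alg_aut k A\<^esub> f) x) = x" "(inv\<^bsub>alg_aut k A\<^esub> f) (f x) = x"
  unfolding alg_aut_mult_apply[OF f G.inv_closed[OF f] x] alg_aut_mult_apply[OF G.inv_closed[OF f] f x] .
qed

lemma alg_aut_eqI:
 assumes "f : car (alg_aut k A)" "g : car (alg_aut k A)" "\<And>x. x : car A ==> f x = g x"
 shows "f = g"
 using assms by (auto simp: carrier_alg_aut intro: extensionalityI)

end

lemma alg_aut_memI:
 assumes "f : alg_hom k R R" "f : extensional (car R)"
  and "\<And>x. x : car R ==> g x : car R"
  and "\<And>x. x : car R ==> f (g x) = x" "\<And>x. x : car R ==> g (f x) = x"
 shows "f : car (alg_aut k R)"
 unfolding carrier_alg_aut
 using assms alg_homD(2)[OF assms(1)] by (auto intro!: bij_betwI[where g = g])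

section \<open>Fields of fractions\<close>

locale algebra_domain = algebra k R + domain R
 for k :: "('k, 'x) ring_scheme" and R :: "('k, 'r, 'y) module_scheme" (structure)
begin

abbreviation F where "F \<equiv> frac_algebra R"
abbreviation nz where "nz \<equiv> car R - {\<zero>}"

lemma nz_mult: "[|x : nz; y : nz|] ==> x \<otimes> y : nz"
 using integral by auto

lemma frac_rel_equiv: "equiv (car R \<times> nz) (frac_rel R)"
proof (rule equivI)
 show "frac_rel R \<subseteq> (car R \<times> nz) \<times> (car R \<times> nz)" by (auto simp: frac_rel_def)
 show "refl_on (car R \<times> nz) (frac_rel R)" by (auto simp: refl_on_def frac_rel_def)
 show "sym (frac_rel R)" by (auto simp: sym_def frac_rel_def)
 show "trans (frac_rel R)"
 proof (rule transI)
  fix p q r assume "(p, q) : frac_rel R" "(q, r) : frac_rel R"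
  then obtain x y x' y' x'' y'' where e: "p = (x, y)" "q = (x', y')" "r = (x'', y'')"
   and c: "x : car R" "y : nz" "x' : car R" "y' : nz" "x'' : car R" "y'' : nz"
   and eq: "x \<otimes> y' = x' \<otimes> y" "x' \<otimes> y'' = x'' \<otimes> y'"
   by (auto simp: frac_rel_def)
  have c': "y : car R" "y' : car R" "y'' : car R" "y' ~= \<zero>" using c by auto
  have "y' \<otimes> (x \<otimes> y'') = (x \<otimes> y') \<otimes> y''" using c c' by (simp add: m_ac)
  also have "\<dots> = y \<otimes> (x' \<otimes> y'')" using c c' by (simp add: eq(1) m_ac)
  also have "\<dots> = y' \<otimes> (x'' \<otimes> y)" using c c' by (simp add: eq(2) m_ac)
  finally have "x \<otimes> y'' = x'' \<otimes> y" using c c' m_lcancel[of y' "x \<otimes> y''" "x'' \<otimes> y"] by simp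
  then show "(p, r) : frac_rel R" using c e by (simp add: frac_rel_def)
 qed
qed

lemma frac_eq_iff:
 assumes "x : car R" "y : nz" "x' : car R" "y' : nz"
 shows "frac R x y = frac R x' y' \<longleftrightarrow> x \<otimes> y' = x' \<otimes> y"
proof -
 have "frac R x y = frac R x' y' \<longleftrightarrow> ((x, y), (x', y')) : frac_rel R"
  unfolding frac_def using eq_equiv_class_iff[OF frac_rel_equiv] assms by simp
 then show ?thesis using assms by (simp add: frac_rel_def)
qed

lemma mem_frac_iff:
 assumes "x : car R" "y : nz"
 shows "p : frac R x y \<longleftrightarrow> (\<exists>x' y'. p = (x', y') & x' : car R & y' : nz & x \<otimes> y' = x' \<otimes> y)"
 using assms by (auto simp: frac_def frac_rel_def)

lemma frac_self: "[|x : car R; y : nz|] ==> (x, y) : frac R x y"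
 by (simp add: mem_frac_iff)

lemma frac_closed: "[|x : car R; y : nz|] ==> frac R x y : car F"
 unfolding frac_algebra_def frac_def by (auto intro!: quotientI)

lemma carrier_frac:
 assumes "V : car F"
 obtains x y where "x : car R" "y : nz" "V = frac R x y"
proof -
 from assms have "V : (car R \<times> nz) // frac_rel R" by (simp add: frac_algebra_def)
 then obtain p where "p : car R \<times> nz" "V = frac_rel R `` {p}" by (rule quotientE)
 then show ?thesis using that by (cases p) (auto simp: frac_def)
qed

lemma frac_mult:
 assumes "x : car R" "y : nz" "x' : car R" "y' : nz"
 shows "frac R x y *\<^sub>F frac R x' y' = frac R (x \<otimes> x') (y \<otimes> y')"
proof -
 have "frac R u v *\<^sub>F frac R u' v' =
  (\<Union>p\<in>frac R u v. \<Union>q\<in>frac R u' v'. frac R (fst p \<otimes> fst q) (snd p \<otimes> snd q))" for u v u' v'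
  by (simp add: frac_algebra_def case_prod_unfold)
 also have "(\<Union>p\<in>frac R x y. \<Union>q\<in>frac R x' y'. frac R (fst p \<otimes> fst q) (snd p \<otimes> snd q)) =
  frac R (x \<otimes> x') (y \<otimes> y')"
 proof (rule UN_eq_const[OF frac_self[OF assms(1,2)]], rule UN_eq_const[OF frac_self[OF assms(3,4)]])
  fix p q assume "p : frac R x y" "q : frac R x' y'"
  then obtain u v u' v' where p: "p = (u, v)" "q = (u', v')"
   and c: "u : car R" "v : nz" "u' : car R" "v' : nz" and e: "x \<otimes> v = u \<otimes> y" "x' \<otimes> v' = u' \<otimes> y'"
   using assms by (auto simp: mem_frac_iff)
  have c': "v : car R" "v' : car R" "y : car R" "y' : car R" using c assms by auto
  have "x \<otimes> x' \<otimes> (v \<otimes> v') = (x \<otimes> v) \<otimes> (x' \<otimes> v')" using c c' assms by (simp add: m_ac)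
  also have "\<dots> = u \<otimes> u' \<otimes> (y \<otimes> y')" unfolding e using c c' assms by (simp add: m_ac)
  finally have "frac R (u \<otimes> u') (v \<otimes> v') = frac R (x \<otimes> x') (y \<otimes> y')"
   using c assms nz_mult by (subst frac_eq_iff) auto
  then show "frac R (fst p \<otimes> fst q) (snd p \<otimes> snd q) = frac R (x \<otimes> x') (y \<otimes> y')" by (simp add: p)
 qed
 finally show ?thesis .
qed

lemma frac_add:
 assumes "x : car R" "y : nz" "x' : car R" "y' : nz"
 shows "frac R x y +\<^sub>F frac R x' y' = frac R (x \<otimes> y' \<oplus> x' \<otimes> y) (y \<otimes> y')"
proof -
 have "frac R u v +\<^sub>F frac R u' v' =
  (\<Union>p\<in>frac R u v. \<Union>q\<in>frac R u' v'. frac R (fst p \<otimes> snd q \<oplus> fst q \<otimes> snd p) (snd p \<otimes> snd q))" for u v u' v'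
  by (simp add: frac_algebra_def case_prod_unfold)
 also have "(\<Union>p\<in>frac R x y. \<Union>q\<in>frac R x' y'. frac R (fst p \<otimes> snd q \<oplus> fst q \<otimes> snd p) (snd p \<otimes> snd q)) =
  frac R (x \<otimes> y' \<oplus> x' \<otimes> y) (y \<otimes> y')"
 proof (rule UN_eq_const[OF frac_self[OF assms(1,2)]], rule UN_eq_const[OF frac_self[OF assms(3,4)]])
  fix p q assume "p : frac R x y" "q : frac R x' y'"
  then obtain u v u' v' where p: "p = (u, v)" "q = (u', v')"
   and c: "u : car R" "v : nz" "u' : car R" "v' : nz" and e: "x \<otimes> v = u \<otimes> y" "x' \<otimes> v' = u' \<otimes> y'"
   using assms by (auto simp: mem_frac_iff)
  have c': "v : car R" "v' : car R" "y : car R" "y' : car R" using c assms by auto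
  have "(u \<otimes> v' \<oplus> u' \<otimes> v) \<otimes> (y \<otimes> y') = (u \<otimes> y) \<otimes> (v' \<otimes> y') \<oplus> (u' \<otimes> y') \<otimes> (v \<otimes> y)"
   using c c' assms by (simp add: l_distr r_distr m_ac)
  also have "\<dots> = (x \<otimes> y' \<oplus> x' \<otimes> y) \<otimes> (v \<otimes> v')"
   unfolding e[symmetric] using c c' assms by (simp add: l_distr r_distr m_ac)
  finally have "frac R (u \<otimes> v' \<oplus> u' \<otimes> v) (v \<otimes> v') = frac R (x \<otimes> y' \<oplus> x' \<otimes> y) (y \<otimes> y')"
   using c c' assms nz_mult by (subst frac_eq_iff) auto
  then show "frac R (fst p \<otimes> snd q \<oplus> fst q \<otimes> snd p) (snd p \<otimes> snd q) = frac R (x \<otimes> y' \<oplus> x' \<otimes> y) (y \<otimes> y')"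
   by (simp add: p)
 qed
 finally show ?thesis .
qed

lemma frac_smult:
 assumes "c : car k" "x : car R" "y : nz"
 shows "c \<odot>\<^sub>F frac R x y = frac R (c \<odot> x) y"
proof -
 have "c \<odot>\<^sub>F frac R u v = (\<Union>p\<in>frac R u v. frac R (c \<odot> fst p) (snd p))" for u v
  by (simp add: frac_algebra_def case_prod_unfold)
 also have "(\<Union>p\<in>frac R x y. frac R (c \<odot> fst p) (snd p)) = frac R (c \<odot> x) y"
 proof (rule UN_eq_const[OF frac_self[OF assms(2,3)]])
  fix p assume "p : frac R x y"
  then obtain u v where p: "p = (u, v)"
   and c: "u : car R" "v : nz" and e: "x \<otimes> v = u \<otimes> y"
   using assms by (auto simp: mem_frac_iff)
  have "frac R (c \<odot> u) v = frac R (c \<odot> x) y"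
   using c assms by (subst frac_eq_iff) (auto simp: smult_assoc2 e)
  then show "frac R (c \<odot> fst p) (snd p) = frac R (c \<odot> x) y" by (simp add: p)
 qed
 finally show ?thesis .
qed

lemma F_one: "1\<^sub>F = frac R \<one> \<one>" and F_zero: "0\<^sub>F = frac R \<zero> \<one>"
 by (simp_all add: frac_algebra_def)

lemma nz_one: "\<one> : nz" by simp

lemma frac_eq_zero_iff: "[|x : car R; y : nz|] ==> frac R x y = 0\<^sub>F \<longleftrightarrow> x = \<zero>"
 by (simp add: F_zero frac_eq_iff nz_one)

lemma abelian_group_F: "abelian_group F"
proof (rule abelian_groupI)
 fix U V assume "U : car F" "V : car F"
 then obtain x y u v where U: "U = frac R x y" "x : car R" "y : nz"
  and V: "V = frac R u v" "u : car R" "v : nz"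
  by (metis carrier_frac)
 show "U +\<^sub>F V : car F" using U V nz_mult[of y v] by (simp add: frac_add frac_closed)
 show "U +\<^sub>F V = V +\<^sub>F U" using U V by (simp add: frac_add m_comm a_comm)
next
 fix U V W assume "U : car F" "V : car F" "W : car F"
 then obtain x y u v z w where U: "U = frac R x y" "x : car R" "y : nz"
  and V: "V = frac R u v" "u : car R" "v : nz" and W: "W = frac R z w" "z : car R" "w : nz"
  by (metis carrier_frac)
 then have "(x \<otimes> v \<oplus> u \<otimes> y) \<otimes> w \<oplus> z \<otimes> (y \<otimes> v) = x \<otimes> (v \<otimes> w) \<oplus> (u \<otimes> w \<oplus> z \<otimes> v) \<otimes> y"
  by (simp add: l_distr r_distr m_ac a_ac)
 then show "U +\<^sub>F V +\<^sub>F W = U +\<^sub>F (V +\<^sub>F W)"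
  using U V W nz_mult[of y v] nz_mult[of v w] by (simp add: frac_add m_assoc)
next
 show "0\<^sub>F : car F" by (simp add: F_zero frac_closed)
next
 fix U assume "U : car F"
 then obtain x y where U: "U = frac R x y" "x : car R" "y : nz" by (metis carrier_frac)
 show "0\<^sub>F +\<^sub>F U = U" using U by (simp add: F_zero frac_add nz_one)
 have "frac R (\<ominus> x) y +\<^sub>F U = frac R (\<ominus> x \<otimes> y \<oplus> x \<otimes> y) (y \<otimes> y)" using U by (simp add: frac_add)
 also have "\<ominus> x \<otimes> y \<oplus> x \<otimes> y = \<zero>" using U by (simp add: l_minus l_neg)
 also have "frac R \<zero> (y \<otimes> y) = 0\<^sub>F" using frac_eq_zero_iff[of \<zero> "y \<otimes> y"] U nz_mult[of y y] by simp
 finally show "EX V:car F. V +\<^sub>F U = 0\<^sub>F" using U frac_closed[of "\<ominus> x" y] by auto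
qed

lemma frac_cancel:
 assumes "x : car R" "y : nz" "z : nz" shows "frac R (x \<otimes> z) (y \<otimes> z) = frac R x y"
 using assms nz_mult[of y z] by (subst frac_eq_iff) (auto simp: m_ac)

lemma cring_F: "cring F"
proof (rule cringI[OF abelian_group_F])
 show "comm_monoid F"
 proof (rule comm_monoidI)
  fix U V assume "U : car F" "V : car F"
  then obtain x y u v where U: "U = frac R x y" "x : car R" "y : nz"
   and V: "V = frac R u v" "u : car R" "v : nz"
   by (metis carrier_frac)
  show "U *\<^sub>F V : car F" using U V nz_mult[of y v] by (simp add: frac_mult frac_closed)
  show "U *\<^sub>F V = V *\<^sub>F U" using U V by (simp add: frac_mult m_comm)
 next
  fix U V W assume "U : car F" "V : car F" "W : car F"
  then obtain x y u v z w where U: "U = frac R x y" "x : car R" "y : nz"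
   and V: "V = frac R u v" "u : car R" "v : nz" and W: "W = frac R z w" "z : car R" "w : nz"
   by (metis carrier_frac)
  then show "U *\<^sub>F V *\<^sub>F W = U *\<^sub>F (V *\<^sub>F W)"
   using nz_mult[of y v] nz_mult[of v w] by (simp add: frac_mult m_assoc)
 next
  show "1\<^sub>F : car F" by (simp add: F_one frac_closed)
 next
  fix U assume "U : car F"
  then obtain x y where U: "U = frac R x y" "x : car R" "y : nz" by (metis carrier_frac)
  then show "1\<^sub>F *\<^sub>F U = U" by (simp add: F_one frac_mult)
 qed
next
 fix U V W assume "U : car F" "V : car F" "W : car F"
 then obtain x y u v z w where U: "U = frac R x y" "x : car R" "y : nz"
  and V: "V = frac R u v" "u : car R" "v : nz" and W: "W = frac R z w" "z : car R" "w : nz"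
  by (metis carrier_frac)
 have c: "y : car R" "v : car R" "w : car R" using U V W by auto
 have 1: "x \<otimes> z \<otimes> (v \<otimes> w) \<oplus> u \<otimes> z \<otimes> (y \<otimes> w) = ((x \<otimes> v \<oplus> u \<otimes> y) \<otimes> z) \<otimes> w"
  using U V W c by (simp add: l_distr r_distr m_ac a_ac)
 have 2: "y \<otimes> w \<otimes> (v \<otimes> w) = y \<otimes> v \<otimes> w \<otimes> w"
  using U V W c by (simp add: m_ac)
 have n: "y \<otimes> v : nz" "y \<otimes> w : nz" "v \<otimes> w : nz" "y \<otimes> v \<otimes> w : nz" using nz_mult U V W by auto
 have "U *\<^sub>F W +\<^sub>F V *\<^sub>F W = frac R (x \<otimes> z \<otimes> (v \<otimes> w) \<oplus> u \<otimes> z \<otimes> (y \<otimes> w)) (y \<otimes> w \<otimes> (v \<otimes> w))"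
  using U V W n c by (simp only: frac_mult frac_add m_closed)
 also have "\<dots> = frac R ((x \<otimes> v \<oplus> u \<otimes> y) \<otimes> z) (y \<otimes> v \<otimes> w)"
  unfolding 1 2 by (rule frac_cancel) (use U V W c n in auto)
 also have "\<dots> = (U +\<^sub>F V) *\<^sub>F W"
  using U V W n c by (simp only: frac_mult frac_add m_closed a_closed)
 finally show "(U +\<^sub>F V) *\<^sub>F W = U *\<^sub>F W +\<^sub>F V *\<^sub>F W" by simp
qed

lemma frac_inverse: "[|x : nz; y : nz|] ==> frac R x y *\<^sub>F frac R y x = 1\<^sub>F"
 using nz_mult[of x y] nz_mult[of y x] frac_eq_iff[of "x \<otimes> y" "y \<otimes> x" \<one> \<one>]
 by (simp add: frac_mult F_one m_comm)

lemma field_F: "field F"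
proof (rule cring.cring_fieldI[OF cring_F])
 interpret F: cring F by (rule cring_F)
 have 10: "1\<^sub>F ~= 0\<^sub>F" using frac_eq_zero_iff[of \<one> \<one>] by (simp add: F_one)
 show "Units F = car F - {0\<^sub>F}"
 proof (intro equalityI subsetI)
  fix U assume "U : Units F"
  then show "U : car F - {0\<^sub>F}" using 10 by (auto simp: Units_def)
 next
  fix U assume U: "U : car F - {0\<^sub>F}"
  then obtain x y where V: "U = frac R x y" "x : car R" "y : nz" by (metis carrier_frac DiffD1)
  then have "x : nz" using U frac_eq_zero_iff by auto
  then show "U : Units F" using V frac_inverse[of x y] frac_inverse[of y x] frac_closed[of y x] U
   by (auto simp: Units_def)
 qed
qed

lemma algebra_F: "algebra k F"
proof (rule algebraI)
 show "cring k" "cring F" using R.cring_axioms cring_F by auto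
next
 fix c U assume c: "c : car k" and "U : car F"
 then obtain x y where U: "U = frac R x y" "x : car R" "y : nz" by (metis carrier_frac)
 show "c \<odot>\<^sub>F U : car F" using c U by (simp add: frac_smult frac_closed)
 fix d assume d: "d : car k"
 show "(c *\<^sub>k d) \<odot>\<^sub>F U = c \<odot>\<^sub>F (d \<odot>\<^sub>F U)" using c d U by (simp add: frac_smult smult_assoc1)
 have "(c +\<^sub>k d) \<odot> x \<otimes> y = (c \<odot> x \<otimes> y \<oplus> d \<odot> x \<otimes> y)" using c d U by (simp add: smult_l_distr l_distr)
 then show "(c +\<^sub>k d) \<odot>\<^sub>F U = c \<odot>\<^sub>F U +\<^sub>F d \<odot>\<^sub>F U"
  using c d U nz_mult[of y y] frac_cancel[of "(c +\<^sub>k d) \<odot> x" y y] by (simp add: frac_smult frac_add)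
next
 fix c U V assume c: "c : car k" and "U : car F" "V : car F"
 then obtain x y u v where U: "U = frac R x y" "x : car R" "y : nz"
  and V: "V = frac R u v" "u : car R" "v : nz"
  by (metis carrier_frac)
 show "c \<odot>\<^sub>F (U +\<^sub>F V) = c \<odot>\<^sub>F U +\<^sub>F c \<odot>\<^sub>F V"
  using c U V nz_mult[of y v] by (simp add: frac_add frac_smult smult_r_distr smult_assoc2)
 show "(c \<odot>\<^sub>F U) *\<^sub>F V = c \<odot>\<^sub>F (U *\<^sub>F V)"
  using c U V nz_mult[of y v] by (simp add: frac_mult frac_smult smult_assoc2)
next
 fix U assume "U : car F"
 then obtain x y where U: "U = frac R x y" "x : car R" "y : nz" by (metis carrier_frac)
 then show "1\<^sub>k \<odot>\<^sub>F U = U" by (simp add: frac_smult)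
qed

lemma of_base_hom: "of_base R : alg_hom k R F"
 unfolding of_base_def
 by (rule alg_homI) (simp_all add: frac_closed frac_mult frac_add frac_smult F_one)

lemma of_base_inj: "inj_on (of_base R) (car R)"
 unfolding of_base_def by (rule inj_onI) (simp add: frac_eq_iff)

lemma frac_as_quotient:
 assumes "x : car R" "y : nz"
 shows "frac R x y = of_base R x *\<^sub>F inv\<^bsub>F\<^esub> (of_base R y)" "of_base R y ~= 0\<^sub>F"
proof -
 interpret F: field F by (rule field_F)
 show "of_base R y ~= 0\<^sub>F" using assms frac_eq_zero_iff[of y \<one>] by (simp add: of_base_def)
 have "inv\<^bsub>F\<^esub> (of_base R y) = frac R \<one> y"
  unfolding of_base_def
  by (rule F.comm_inv_char[OF frac_closed frac_closed[OF one_closed assms(2)] frac_inverse[OF assms(2) nz_one]])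
   (use assms in auto)
 then show "frac R x y = of_base R x *\<^sub>F inv\<^bsub>F\<^esub> (of_base R y)"
  using assms by (simp add: of_base_def frac_mult)
qed

lemma fractions_in_F: "fractions_in F (of_base R ` car R) = car F"
proof (intro equalityI subsetI)
 interpret F: field F by (rule field_F)
 fix U assume "U : fractions_in F (of_base R ` car R)"
 then obtain a b where "U = a *\<^sub>F inv\<^bsub>F\<^esub> b" "a : car F" "b : car F - {0\<^sub>F}"
  unfolding fractions_in_def using alg_homD(2)[OF of_base_hom] by blast
 then show "U : car F" using F.Units_inv_closed[of b] F.field_Units by simp
next
 fix U assume "U : car F"
 then obtain x y where U: "U = frac R x y" "x : car R" "y : nz" by (metis carrier_frac)
 then show "U : fractions_in F (of_base R ` car R)"
  unfolding fractions_in_def using frac_as_quotient[OF U(2,3)] by blast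
qed

text \<open>Injectivity of \<open>f\<close> keeps denominators nonzero.\<close>

lemma frac_map_frac:
 assumes "f : alg_hom k R R" "inj_on f (car R)" "x : car R" "y : nz"
 shows "frac_map R f (frac R x y) = frac R (f x) (f y)" "f y : nz"
proof -
 note fD = alg_homD[OF assms(1)]
 have f0: "f \<zero> = \<zero>" using ring_hom_zero_neg(1)[OF fD(1) ring_axioms ring_axioms] .
 have fnz: "f y : nz" if "y : nz" for y using that fD(2)[of y] f0 inj_onD[OF assms(2), of y \<zero>] by auto
 then show "f y : nz" using assms by blast
 have "frac_map R f V = (\<Union>p\<in>V. frac R (f (fst p)) (f (snd p)))" for V
  by (simp add: frac_map_def case_prod_unfold)
 moreover have "(\<Union>p\<in>frac R x y. frac R (f (fst p)) (f (snd p))) = frac R (f x) (f y)"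
 proof (rule UN_eq_const[OF frac_self[OF assms(3,4)]])
  fix p assume "p : frac R x y"
  then obtain u v where p: "p = (u, v)"
   and c: "u : car R" "v : nz" and e: "x \<otimes> v = u \<otimes> y"
   using assms by (auto simp: mem_frac_iff)
  have "f x \<otimes> f v = f u \<otimes> f y" using e c assms fD(3)[symmetric] by auto
  then have "frac R (f u) (f v) = frac R (f x) (f y)"
   using c assms fnz fD(2) by (subst frac_eq_iff) auto
  then show "frac R (f (fst p)) (f (snd p)) = frac R (f x) (f y)" by (simp add: p)
 qed
 ultimately show "frac_map R f (frac R x y) = frac R (f x) (f y)" by simp
qed

lemma frac_map_hom:
 assumes "f : alg_hom k R R" "inj_on f (car R)"
 shows "frac_map R f : alg_hom k F F"
proof -
 note fD = alg_homD[OF assms(1)] and m = frac_map_frac[OF assms]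
 show ?thesis
 proof (rule alg_homI)
  fix U assume "U : car F"
  then obtain x y where U: "U = frac R x y" "x : car R" "y : nz" by (metis carrier_frac)
  then show "frac_map R f U : car F" using m[of x y] fD(2) by (simp add: frac_closed)
  fix V assume "V : car F"
  then obtain u v where V: "V = frac R u v" "u : car R" "v : nz" by (metis carrier_frac)
  note n = U V m nz_mult[of y v] fD
  show "frac_map R f (U *\<^sub>F V) = frac_map R f U *\<^sub>F frac_map R f V"
   "frac_map R f (U +\<^sub>F V) = frac_map R f U +\<^sub>F frac_map R f V"
   using U V m(2)[of y y] m(2)[of v v] nz_mult[of y v] by (simp_all add: m(1) frac_mult frac_add fD)
 next
  show "frac_map R f 1\<^sub>F = 1\<^sub>F" by (simp add: F_one m(1) fD)
 next
  fix c U assume c: "c : car k" "U : car F"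
  then obtain x y where U: "U = frac R x y" "x : car R" "y : nz" by (metis carrier_frac)
  then show "frac_map R f (c \<odot>\<^sub>F U) = c \<odot>\<^sub>F frac_map R f U"
   using c m(2)[of y y] by (simp add: frac_smult m(1) fD)
 qed
qed

lemma frac_map_of_base:
 assumes "f : alg_hom k R R" "inj_on f (car R)" "x : car R"
 shows "frac_map R f (of_base R x) = of_base R (f x)"
 using frac_map_frac(1)[OF assms nz_one] alg_homD(5)[OF assms(1)] by (simp add: of_base_def)

lemma frac_map_aut:
 assumes f: "f : alg_hom k R R" and g: "g : alg_hom k R R"
  and fg: "\<And>x. x : car R ==> f (g x) = x" "\<And>x. x : car R ==> g (f x) = x"
 shows "restrict (frac_map R f) (car F) : car (alg_aut k F)"
proof (rule alg_aut_memI[where g = "frac_map R g"])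
 have inj: "inj_on f (car R)" "inj_on g (car R)" using fg by (auto intro: inj_on_inverseI)
 note mf = frac_map_frac[OF f inj(1)] and mg = frac_map_frac[OF g inj(2)]
 note hf = alg_homD[OF frac_map_hom[OF f inj(1)]] and hg = alg_homD[OF frac_map_hom[OF g inj(2)]]
 interpret F: algebra k F by (rule algebra_F)
 show "restrict (frac_map R f) (car F) : alg_hom k F F"
  by (rule alg_homI) (simp_all add: hf)
 fix U assume U: "U : car F"
 then obtain x y where V: "U = frac R x y" "x : car R" "y : nz" by (metis carrier_frac)
 show "frac_map R g U : car F" using hg(2) U .
 show "restrict (frac_map R f) (car F) (frac_map R g U) = U"
  using U V hg(2)[OF U] mg(2)[of y y] alg_homD(2)[OF g] fg(1) by (simp add: mg(1) mf(1))
 show "frac_map R g (restrict (frac_map R f) (car F) U) = U"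
  using U V mf(2)[of y y] alg_homD(2)[OF f] fg(2) by (simp add: mg(1) mf(1))
qed simp

text \<open>A homomorphism of the field sends a nonzero denominator to something nonzero, so its
  value at a quotient is determined by its values at numerator and denominator.\<close>

lemma frac_ext:
 assumes f: "f : ring_hom F F" and g: "g : ring_hom F F"
  and eq: "\<And>x. x : car R ==> f (of_base R x) = g (of_base R x)" and U: "U : car F"
 shows "f U = g U"
proof -
 interpret F: field F by (rule field_F)
 interpret f: ring_hom_ring F F f using f by (simp add: ring_hom_ringI2 F.ring_axioms)
 interpret g: ring_hom_ring F F g using g by (simp add: ring_hom_ringI2 F.ring_axioms)
 obtain x y where V: "U = frac R x y" "x : car R" "y : nz" using U by (metis carrier_frac)
 note o = alg_homD(2)[OF of_base_hom]
 let ?x = "of_base R x" and ?y = "of_base R y"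
 have y: "?x : car F" "?y : car F" "?y : Units F" "inv\<^bsub>F\<^esub> ?y : car F"
  using frac_as_quotient(2)[OF V(2,3)] o V by (auto simp: F.field_Units)
 have u: "U = ?x *\<^sub>F inv\<^bsub>F\<^esub> ?y" using frac_as_quotient V by simp
 have *: "h U *\<^sub>F h ?y = h ?x" "h ?y ~= 0\<^sub>F" if h: "ring_hom_ring F F h" for h
 proof -
  interpret h: ring_hom_ring F F h by (rule h)
  have "U *\<^sub>F ?y = ?x" using y by (simp add: u F.m_assoc)
  then show "h U *\<^sub>F h ?y = h ?x" using h.hom_mult[OF U y(2)] by simp
  have "h ?y *\<^sub>F h (inv\<^bsub>F\<^esub> ?y) = 1\<^sub>F" using h.hom_mult[OF y(2,4)] y by simp
  then show "h ?y ~= 0\<^sub>F" using y by auto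
 qed
 have "f U *\<^sub>F f ?y = g U *\<^sub>F f ?y"
  using *(1)[OF f.ring_hom_ring_axioms] *(1)[OF g.ring_hom_ring_axioms] eq V by auto
 then show ?thesis
  using *(2)[OF f.ring_hom_ring_axioms] y U F.m_rcancel[of "f ?y" "f U" "g U"] by simp
qed

end

section \<open>Additive spans\<close>

context ring
begin

text \<open>Only the additive group generated. Coefficients are always written into the generating
  set, which makes sense for noncommutative coefficients and for coefficients on both sides.\<close>

abbreviation span where "span \<equiv> generate (add_monoid R)"

lemma span_simps:
 "Y \<subseteq> car R ==> span Y \<subseteq> car R"
 "y : Y ==> y : span Y"
 "\<zero> : span Y"
 "[|a : span Y; b : span Y|] ==> a \<oplus> b : span Y"
 using add.generate_incl[of Y] generate.one[of "add_monoid R" Y] generate.incl[of y Y "add_monoid R"]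
  generate.eng[of a "add_monoid R" Y b] by auto

lemma span_subgroup: "Y \<subseteq> car R ==> subgroup (span Y) (add_monoid R)"
 by (rule add.generate_is_subgroup)

lemma span_minimal: "[|Y \<subseteq> H; subgroup H (add_monoid R)|] ==> span Y \<subseteq> H"
 by (rule add.generate_subgroup_incl)

lemma span_mono: "Y \<subseteq> Z ==> span Y \<subseteq> span Z"
 by (rule add.mono_generate)

lemma span_induct [consumes 2, case_names zero base neg add]:
 assumes "y : span Y" "Y \<subseteq> car R" "P \<zero>" "\<And>y. y : Y ==> P y"
  "\<And>y. [|y : car R; P y|] ==> P (\<ominus> y)"
  "\<And>y z. [|y : car R; z : car R; P y; P z|] ==> P (y \<oplus> z)"
 shows "P y"
proof -
 have "P y & y : car R"
  using assms(1)
 proof (induction y rule: generate.induct)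
  case (inv h)
  then show ?case using assms(2,4,5) by (auto simp: a_inv_def[symmetric])
 qed (use assms in auto)
 then show ?thesis ..
qed

lemma sum_mem:
 assumes "subgroup H (add_monoid R)" "\<And>i. i : I ==> f i : H"
 shows "finsum R f I : H"
proof -
 have H: "H \<subseteq> car R" "\<zero> : H" "\<And>a b. [|a : H; b : H|] ==> a \<oplus> b : H"
  using subgroup.subset[OF assms(1)] subgroup.one_closed[OF assms(1)] subgroup.m_closed[OF assms(1)] by auto
 show ?thesis using assms(2)
 proof (induction I rule: infinite_finite_induct)
  case (insert i I)
  then have "f i : car R" "f : I \<rightarrow> car R" using H by auto
  with insert H show ?case by simp
 qed (use H in auto)
qed

lemma subgroup_left:
 assumes "subgroup H (add_monoid R)" "a : car R"
 shows "subgroup {x \<in> car R. a \<otimes> x : H} (add_monoid R)"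
 by (rule add.subgroupI)
  (use assms subgroup.one_closed[OF assms(1)] subgroup.m_closed[OF assms(1)] subgroup.m_inv_closed[OF assms(1)]
   in "auto simp: r_minus r_distr a_inv_def[symmetric] intro: zero_closed")

lemma subgroup_right:
 assumes "subgroup H (add_monoid R)" "a : car R"
 shows "subgroup {x \<in> car R. x \<otimes> a : H} (add_monoid R)"
 by (rule add.subgroupI)
  (use assms subgroup.one_closed[OF assms(1)] subgroup.m_closed[OF assms(1)] subgroup.m_inv_closed[OF assms(1)]
   in "auto simp: l_minus l_distr a_inv_def[symmetric] intro: zero_closed")

text \<open>One factor at a time, through the subgroups \<open>subgroup_left\<close> and
  \<open>subgroup_right\<close>.\<close>

lemma span_mult:
 assumes H: "subgroup H (add_monoid R)" and Y: "Y \<subseteq> car R" and Z: "Z \<subseteq> car R"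
  and YZ: "\<And>y z. [|y : Y; z : Z|] ==> y \<otimes> z : H"
  and "a : span Y" "b : span Z"
 shows "a \<otimes> b : H"
proof -
 have 1: "y \<otimes> b : H" if "y : Y" for y
 proof -
  have "span Z \<subseteq> {x \<in> car R. y \<otimes> x : H}"
   by (rule span_minimal) (use that YZ Y Z subgroup_left[OF H, of y] in auto)
  then show ?thesis using assms by blast
 qed
 have "b : car R" using assms span_simps(1) by blast
 then have "span Y \<subseteq> {x \<in> car R. x \<otimes> b : H}"
  by (intro span_minimal subgroup_right H) (use 1 Y in auto)
 then show ?thesis using assms by blast
qed

lemma subring_subgroup: "subring H R ==> subgroup H (add_monoid R)"
 by (rule subring.axioms)

section \<open>Ring extensions generated by integral elements\<close>

lemma centralizer_subring:
 assumes "Y \<subseteq> car R" shows "subring {z \<in> car R. ALL y:Y. z \<otimes> y = y \<otimes> z} R"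
proof (rule subringI)
 fix h1 h2 assume h: "h1 : {z \<in> car R. ALL y:Y. z \<otimes> y = y \<otimes> z}" "h2 : {z \<in> car R. ALL y:Y. z \<otimes> y = y \<otimes> z}"
 have "h1 \<otimes> h2 \<otimes> y = y \<otimes> (h1 \<otimes> h2)" if "y : Y" for y
 proof -
  have y: "y : car R" using that assms by auto
  have "h1 \<otimes> h2 \<otimes> y = h1 \<otimes> (y \<otimes> h2)" using h y that by (simp add: m_assoc)
  also have "\<dots> = y \<otimes> (h1 \<otimes> h2)" using h y that by (simp add: m_assoc[symmetric])
  finally show ?thesis .
 qed
 then show "h1 \<otimes> h2 : {z \<in> car R. ALL y:Y. z \<otimes> y = y \<otimes> z}" using h by auto
 show "h1 \<oplus> h2 : {z \<in> car R. ALL y:Y. z \<otimes> y = y \<otimes> z}"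
  using h assms by (auto simp: l_distr r_distr subset_iff)
qed (use assms in "auto simp: l_minus r_minus subset_iff")

lemma generate_ring_commute:
 assumes Y: "Y \<subseteq> car R" and x: "x : car R" "\<And>y. y : Y ==> x \<otimes> y = y \<otimes> x"
  and a: "a : generate_ring R Y"
 shows "x \<otimes> a = a \<otimes> x"
proof -
 have "generate_ring R Y \<subseteq> {z \<in> car R. ALL y:{x}. z \<otimes> y = y \<otimes> z}"
  by (rule generate_ring_min_subring1[OF Y centralizer_subring]) (use Y x in auto)
 then show ?thesis using a by auto
qed

inductive_set monomials :: "'a set => 'a set" for J where
 one: "\<one> : monomials J"
| mult: "[|m : monomials J; x : J|] ==> m \<otimes> x : monomials J"

lemma monomials_closed: "[|m : monomials J; J \<subseteq> car R|] ==> m : car R"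
 by (induction m rule: monomials.induct) auto

lemma monomials_mono: "m : monomials J ==> J \<subseteq> J' ==> m : monomials J'"
 by (induction m rule: monomials.induct) (auto intro: monomials.intros)

lemma monomials_pow:
 assumes "m : monomials J" "x : J" "J \<subseteq> car R" shows "m \<otimes> x [^] (i::nat) : monomials J"
proof (induction i)
 case 0
 then show ?case using assms monomials_closed by simp
next
 case (Suc i)
 have "m \<otimes> x [^] Suc i = (m \<otimes> x [^] i) \<otimes> x" using assms monomials_closed[OF assms(1,3)] by (auto simp: m_assoc)
 then show ?case using Suc assms by (auto intro: monomials.intros)
qed

text \<open>A monic equation of degree \<open>N\<close>, solved for the top power. Signs are
  absorbed by the additive span, and no polynomial ring is involved.\<close>

definition integral_over :: "'a set => 'a => bool" where
 "integral_over E x \<longleftrightarrow> (\<exists>N::nat. x [^] N : span {e \<otimes> x [^] i | e i. e : E & i < N})"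

text \<open>One integral element is adjoined at a time, and over the ring already built its powers
  below \<open>N\<close> suffice. The module generators are recorded as monomials in
  \<open>J\<close> because elements of the base ring will have to be moved past them.\<close>

lemma generate_ring_integral:
 assumes E: "subring E R" and "finite J" and "J \<subseteq> car R"
  and "\<And>x y. [|x : E \<union> J; y : J|] ==> x \<otimes> y = y \<otimes> x"
  and "\<And>x. x : J ==> integral_over E x"
 shows "\<exists>B. finite B & B \<subseteq> monomials J & generate_ring R (E \<union> J) = span {e \<otimes> b | e b. e : E & b : B}"
 using assms(2-)
proof (induction J)
 case empty
 have EC: "E \<subseteq> car R" using subringE(1)[OF E] .
 have "{e \<otimes> b |e b. e : E & b : {\<one>}} = E" using EC by force
 moreover have "span E = E"
  using span_minimal[OF subset_refl subring_subgroup[OF E]] span_simps(2) by blast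
 moreover have "generate_ring R (E \<union> {}) = E" using generate_ringI[OF EC E] by auto
 ultimately show ?case by (intro exI[of _ "{\<one>}"]) (auto intro: monomials.one)
next
 case (insert x J)
 have EC: "E \<subseteq> car R" using subringE(1)[OF E] .
 have x: "x : car R" and J: "J \<subseteq> car R" using insert by auto
 have "\<And>a b. [|a : E \<union> J; b : J|] ==> a \<otimes> b = b \<otimes> a" "\<And>a. a : J ==> integral_over E a"
  using insert.prems by auto
 then obtain B where B: "finite B" "B \<subseteq> monomials J"
  and gen: "generate_ring R (E \<union> J) = span {e \<otimes> b | e b. e : E & b : B}"
  using insert.IH J by blast
 let ?A = "generate_ring R (E \<union> J)"
 have A: "subring ?A R" by (rule generate_ring_is_subring) (use EC J in auto)
 note AD = subringE[OF A]
 have BC: "B \<subseteq> car R" using B monomials_closed[OF _ J] by auto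
 have incl: "E \<union> J \<subseteq> ?A" using generate_ringE(2)[of "E \<union> J"] EC J by blast
 obtain N :: nat where N: "x [^] N : span {e \<otimes> x [^] i | e i. e : E & i < N}"
  using insert.prems(3)[of x] unfolding integral_over_def by blast
 have xA: "x \<otimes> a = a \<otimes> x" if "a : ?A" for a
 proof (rule generate_ring_commute[OF _ x _ that])
  show "x \<otimes> y = y \<otimes> x" if "y : E \<union> J" for y using insert.prems(2)[of y x] that by simp
 qed (use EC J in auto)
 let ?B' = "{b \<otimes> x [^] i | b i. b : B & i < N}"
 have B'_eq: "?B' = (%(b, i). b \<otimes> x [^] i) ` (B \<times> {..<N})" by auto
 have finB': "finite ?B'" unfolding B'_eq using B by simp
 have B'mono: "?B' \<subseteq> monomials (insert x J)"
 proof
  fix y assume "y : ?B'"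
  then obtain b i where "b : B" "y = b \<otimes> x [^] (i::nat)" by blast
  then show "y : monomials (insert x J)"
   using monomials_pow[of b "insert x J" x i] monomials_mono[of b J] B(2) insert.prems(1) by auto
 qed
 let ?W = "span {a \<otimes> x [^] i | a i. a : ?A & i < N}"
 have Wc: "{a \<otimes> x [^] i | a i. a : ?A & i < N} \<subseteq> car R" using AD(1) x by auto
 have W: "subgroup ?W (add_monoid R)" by (rule span_subgroup[OF Wc])
 have WA: "a \<otimes> w : ?W" if "a : ?A" "w : ?W" for a w
 proof (rule span_mult[OF W, of "{a}"])
  fix y z assume "y : {a}" "z : {a \<otimes> x [^] i | a i. a : ?A & i < N}"
  then obtain c i where "y = a" "z = c \<otimes> x [^] i" "c : ?A" "i < N" by blast
  moreover from this have "y \<otimes> z = (a \<otimes> c) \<otimes> x [^] i"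
   using subsetD[OF AD(1) that(1)] subsetD[OF AD(1), of c] x by (simp add: m_assoc)
  ultimately show "y \<otimes> z : ?W" using AD(6)[of a c] that by (auto intro!: span_simps(2))
 qed (use that AD(1) Wc span_simps(2)[of a "{a}"] in auto)
 have WN: "x [^] N : ?W"
 proof -
  have "{e \<otimes> x [^] i | e i. e : E & i < N} \<subseteq> {a \<otimes> x [^] i | a i. a : ?A & i < N}" using incl by blast
  then show ?thesis using N span_mono by blast
 qed
 have Wx: "x \<otimes> w : ?W" if "w : ?W" for w
 proof (rule span_mult[OF W, of "{x}"])
  fix y z assume "y : {x}" "z : {a \<otimes> x [^] i | a i. a : ?A & i < N}"
  then obtain c i where c: "y = x" "z = c \<otimes> x [^] i" "c : ?A" "i < N" by blast
  have cc: "c : car R" using c AD(1) by blast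
  have "x \<otimes> x [^] i = x [^] i \<otimes> x" using x by (metis nat_pow_Suc nat_pow_Suc2)
  then have "y \<otimes> z = c \<otimes> x [^] Suc i"
   using c xA[of c] cc x m_assoc[of x c "x [^] i"] m_assoc[of c x "x [^] i"] by simp
  then show "y \<otimes> z : ?W"
  proof (cases "Suc i < N")
   case True
   then show ?thesis unfolding \<open>y \<otimes> z = _\<close> by (intro span_simps(2)) (use c in blast)
  next
   case False
   then have "Suc i = N" using c by simp
   then show ?thesis using \<open>y \<otimes> z = _\<close> WA[OF c(3) WN] by simp
  qed
 qed (use that x Wc span_simps(2)[of x "{x}"] in auto)
 \<comment> \<open>The elements that multiply \<open>?W\<close> into itself form a subring
   containing all generators. Applied to 1, they put the generated ring inside
   \<open>?W\<close>.\<close>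
 let ?St = "{r \<in> car R. ALL w:?W. r \<otimes> w : ?W}"
 have WC: "?W \<subseteq> car R" using span_simps(1)[OF Wc] .
 have St: "subring ?St R"
 proof (rule subringI)
  fix h assume "h : ?St"
  then show "\<ominus> h : ?St"
   using subgroup.m_inv_closed[OF W] WC by (auto simp: l_minus a_inv_def[symmetric] subset_iff)
 next
  fix h1 h2 assume h: "h1 : ?St" "h2 : ?St"
  then show "h1 \<otimes> h2 : ?St" using WC by (auto simp: m_assoc subset_iff)
  show "h1 \<oplus> h2 : ?St" using h WC by (auto simp: l_distr subset_iff intro!: span_simps(4))
 qed (use WC in auto)
 have "generate_ring R (E \<union> insert x J) \<subseteq> ?St"
  by (rule generate_ring_min_subring1[OF _ St]) (use EC J x WA Wx incl in auto)
 then have sub0: "r : car R" "w : ?W ==> r \<otimes> w : ?W" if "r : generate_ring R (E \<union> insert x J)" for r w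
  using that by blast+
 \<comment> \<open>For \<open>N = 0\<close> there are no generators, and \<open>WN\<close> itself
   places 1 in their span.\<close>
 have one: "\<one> : ?W"
 proof (cases "N = 0")
  case True
  then show ?thesis using WN by simp
 next
  case False
  then have "\<one> \<otimes> x [^] (0::nat) : {a \<otimes> x [^] i | a i. a : ?A & i < N}" using AD(3) by blast
  then have "\<one> \<otimes> x [^] (0::nat) : ?W" by (rule span_simps(2))
  then show ?thesis by simp
 qed
 have sub1: "generate_ring R (E \<union> insert x J) \<subseteq> ?W"
 proof
  fix r assume r: "r : generate_ring R (E \<union> insert x J)"
  have "r \<otimes> \<one> : ?W" by (rule sub0(2)[OF r one])
  then show "r : ?W" using sub0(1)[OF r] by simp
 qed
 let ?V = "span {e \<otimes> b | e b. e : E & b : ?B'}"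
 have B'C: "?B' \<subseteq> car R" using BC x by auto
 have Vc: "{e \<otimes> b | e b. e : E & b : ?B'} \<subseteq> car R" using EC B'C by fastforce
 have V: "subgroup ?V (add_monoid R)" by (rule span_subgroup[OF Vc])
 have sub2: "?W \<subseteq> ?V"
 proof (rule span_minimal[OF _ V], rule subsetI)
  fix y assume "y : {a \<otimes> x [^] i | a i. a : ?A & i < N}"
  then obtain a i where a: "y = a \<otimes> x [^] i" "a : ?A" "i < N" by blast
  show "y : ?V" unfolding a(1)
  proof (rule span_mult[OF V, of "{e \<otimes> b | e b. e : E & b : B}" "{x [^] i}"])
   show "a : span {e \<otimes> b | e b. e : E & b : B}" using a(2) gen by simp
   fix c z assume "c : {e \<otimes> b | e b. e : E & b : B}" "z : {x [^] i}"
   then obtain e b where "c = e \<otimes> b" "e : E" "b : B" "z = x [^] i" by blast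
   moreover from this have "c \<otimes> z = e \<otimes> (b \<otimes> x [^] i)" using EC BC x by (auto simp: m_assoc subset_iff)
   ultimately show "c \<otimes> z : ?V" using a(3) by (intro span_simps(2)) blast
  qed (use EC BC x span_simps(2) in auto)
 qed
 have gs: "subring (generate_ring R (E \<union> insert x J)) R"
  by (rule generate_ring_is_subring) (use EC J x in auto)
 have sub3: "?V \<subseteq> generate_ring R (E \<union> insert x J)"
 proof (rule span_minimal[OF _ subring_subgroup[OF gs]], rule subsetI)
  have incl': "E \<union> insert x J \<subseteq> generate_ring R (E \<union> insert x J)"
   using generate_ringE(2)[of "E \<union> insert x J"] EC J x by blast
  have mon: "m : generate_ring R (E \<union> insert x J)" if "m : monomials (insert x J)" for m
   using that by (induction m rule: monomials.induct) (use subringE(3,6)[OF gs] incl' in auto)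
  fix y assume "y : {e \<otimes> b | e b. e : E & b : ?B'}"
  then show "y : generate_ring R (E \<union> insert x J)"
   using mon B'mono incl' subringE(6)[OF gs] by blast
 qed
 show ?case using finB' B'mono sub1 sub2 sub3 by (intro exI[of _ ?B']) blast
qed

end

section \<open>Elementary symmetric functions\<close>

context cring
begin

text \<open>Vieta's expansion: a subset of \<open>insert j I\<close> either avoids \<open>j\<close>
  and gains a power of \<open>x\<close>, or contains \<open>j\<close> and gains the factor
  \<open>- y j\<close>.\<close>

lemma prod_diff_expand:
 assumes "finite I" "x : car R" "y : I \<rightarrow> car R"
 shows "(\<Otimes>i\<in>I. x \<ominus> y i) = (\<Oplus>T\<in>Pow I. (\<Otimes>i\<in>T. \<ominus> y i) \<otimes> x [^] (card I - card T))"
 using assms(1,3)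
proof (induction I)
 case (insert j I)
 let ?t = "%I T. (\<Otimes>i\<in>T. \<ominus> y i) \<otimes> x [^] (card I - card T)"
 have yj: "y j : car R" and y: "y : I \<rightarrow> car R" using insert by auto
 have Tc: "(\<Otimes>i\<in>T. \<ominus> y i) : car R" if "T \<subseteq> I" for T
  using that y by (intro finprod_closed) auto
 have fin: "finite T" if "T \<subseteq> I" for T using that insert finite_subset by blast
 have "(\<Otimes>i\<in>insert j I. x \<ominus> y i) = (x \<ominus> y j) \<otimes> (\<Oplus>T\<in>Pow I. ?t I T)"
  using insert assms(2) by (subst finprod_insert) auto
 also have "\<dots> = x \<otimes> (\<Oplus>T\<in>Pow I. ?t I T) \<oplus> (\<ominus> y j) \<otimes> (\<Oplus>T\<in>Pow I. ?t I T)"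
  using Tc assms(2) yj by (subst a_minus_def, subst l_distr) auto
 also have "x \<otimes> (\<Oplus>T\<in>Pow I. ?t I T) = (\<Oplus>T\<in>Pow I. ?t (insert j I) T)"
 proof -
  have "x \<otimes> (\<Oplus>T\<in>Pow I. ?t I T) = (\<Oplus>T\<in>Pow I. x \<otimes> ?t I T)"
   using Tc assms(2) by (intro finsum_rdistr) (auto simp: insert)
  also have "\<dots> = (\<Oplus>T\<in>Pow I. ?t (insert j I) T)"
  proof (rule finsum_cong')
   fix T assume T: "T : Pow I"
   have "card (insert j I) - card T = Suc (card I - card T)"
    using T insert card_mono[of I T] by (simp add: Suc_diff_le)
   then show "x \<otimes> ?t I T = ?t (insert j I) T" using T Tc[of T] assms(2) by (simp add: m_ac)
  qed (use Tc assms(2) in auto)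
  finally show ?thesis .
 qed
 also have "(\<ominus> y j) \<otimes> (\<Oplus>T\<in>Pow I. ?t I T) = (\<Oplus>T\<in>insert j ` Pow I. ?t (insert j I) T)"
 proof -
  have inj: "inj_on (insert j) (Pow I)" using insert(2) by (auto simp: inj_on_def)
  have *: "(\<ominus> y j) \<otimes> ?t I T = ?t (insert j I) (insert j T)" if T: "T : Pow I" for T
  proof -
   have "j \<notin> T" "finite T" using T insert fin by auto
   then have "(\<Otimes>i\<in>insert j T. \<ominus> y i) = (\<ominus> y j) \<otimes> (\<Otimes>i\<in>T. \<ominus> y i)"
    using T y yj by (subst finprod_insert) auto
   moreover have "card (insert j I) - card (insert j T) = card I - card T"
    using \<open>j \<notin> T\<close> \<open>finite T\<close> insert by simp
   ultimately show ?thesis using Tc[of T] T yj assms(2) by (simp add: m_assoc)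
  qed
  have "(\<ominus> y j) \<otimes> (\<Oplus>T\<in>Pow I. ?t I T) = (\<Oplus>T\<in>Pow I. (\<ominus> y j) \<otimes> ?t I T)"
   using Tc assms(2) yj by (intro finsum_rdistr) (auto simp: insert)
  also have "\<dots> = (\<Oplus>T\<in>Pow I. ?t (insert j I) (insert j T))"
   by (rule finsum_cong') (use * Tc assms(2) yj in "auto simp flip: *")
  also have "\<dots> = (\<Oplus>T\<in>insert j ` Pow I. ?t (insert j I) T)"
   by (rule finsum_reindex[symmetric]) (use inj Tc assms(2) yj in "auto simp flip: *")
  finally show ?thesis .
 qed
 also have "(\<Oplus>T\<in>Pow I. ?t (insert j I) T) \<oplus> (\<Oplus>T\<in>insert j ` Pow I. ?t (insert j I) T) =
   (\<Oplus>T\<in>Pow (insert j I). ?t (insert j I) T)"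
  unfolding Pow_insert
 proof (rule finsum_Un_disjoint[symmetric])
  show "Pow I \<inter> insert j ` Pow I = {}" using insert by auto
  show "?t (insert j I) : insert j ` Pow I \<rightarrow> car R"
   using y yj assms(2) by (auto intro!: m_closed finprod_closed)
 qed (use insert Tc assms(2) in auto)
 finally show ?case .
qed simp

text \<open>Up to the sign (-1)^j the usual elementary symmetric function: the coefficient of
  X^(n-j) in the product of the X - y_i, with n the size of \<open>I\<close>.\<close>

definition elem_sym :: "('i => 'a) => 'i set => nat => 'a" where
 "elem_sym y I j = (\<Oplus>T\<in>{T. T \<subseteq> I & card T = j}. \<Otimes>i\<in>T. \<ominus> y i)"

lemma elem_sym_closed: "y : I \<rightarrow> car R ==> elem_sym y I j : car R"
 unfolding elem_sym_def by (intro finsum_closed) (auto intro!: finprod_closed)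

text \<open>Setting X = y_j in the product of the X - y_i gives zero. The empty subset contributes
  the top power, and all other subsets contribute lower ones.\<close>

lemma elem_sym_root:
 assumes I: "finite I" and y: "y : I \<rightarrow> car R" and j: "j : I"
 shows "y j [^] card I : span {e \<otimes> y j [^] i | e i. e : elem_sym y I ` {1..card I} & i < card I}"
proof -
 let ?x = "y j" and ?n = "card I"
 have x: "?x : car R" using y j by auto
 let ?Y = "{e \<otimes> y j [^] i | e i. e : elem_sym y I ` {1..card I} & i < card I}"
 have Y: "?Y \<subseteq> car R" using elem_sym_closed[OF y] x by auto
 have Pc: "(\<Otimes>i\<in>T. \<ominus> y i) : car R" if "T \<subseteq> I" for T
  using that y by (intro finprod_closed) auto
 have "(\<Otimes>i\<in>I. ?x \<ominus> y i) = (?x \<ominus> y j) \<otimes> (\<Otimes>i\<in>I - {j}. ?x \<ominus> y i)"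
  using finprod_insert[of "I - {j}" j "%i. ?x \<ominus> y i"] I j y by (auto simp: insert_absorb)
 moreover have "(\<Otimes>i\<in>I - {j}. ?x \<ominus> y i) : car R" using x y by (intro finprod_closed) auto
 ultimately have z: "(\<Otimes>i\<in>I. ?x \<ominus> y i) = \<zero>" using x by (simp add: a_minus_def r_neg)
 have Pow: "Pow I = (\<Union>i\<in>{..?n}. {T. T \<subseteq> I & card T = i})" using card_mono[OF I] by auto
 have "\<zero> = (\<Oplus>i\<in>{..?n}. \<Oplus>T\<in>{T. T \<subseteq> I & card T = i}. (\<Otimes>i\<in>T. \<ominus> y i) \<otimes> ?x [^] (?n - card T))"
  unfolding z[symmetric] prod_diff_expand[OF I x y] Pow
  by (rule add.finprod_UN_disjoint) (use I Pc x in "auto simp: pairwise_def disjnt_def")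
 also have "\<dots> = (\<Oplus>i\<in>{..?n}. elem_sym y I i \<otimes> ?x [^] (?n - i))"
 proof (rule finsum_cong')
  fix i
  have "(\<Oplus>T\<in>{T. T \<subseteq> I & card T = i}. (\<Otimes>i\<in>T. \<ominus> y i) \<otimes> ?x [^] (?n - card T)) =
   (\<Oplus>T\<in>{T. T \<subseteq> I & card T = i}. (\<Otimes>i\<in>T. \<ominus> y i) \<otimes> ?x [^] (?n - i))"
   by (rule finsum_cong') (use Pc x in auto)
  then show "(\<Oplus>T\<in>{T. T \<subseteq> I & card T = i}. (\<Otimes>i\<in>T. \<ominus> y i) \<otimes> ?x [^] (?n - card T)) =
   elem_sym y I i \<otimes> ?x [^] (?n - i)"
   unfolding elem_sym_def using I Pc x by (subst finsum_ldistr) auto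
 qed (use elem_sym_closed[OF y] x in auto)
 also have "{..?n} = insert 0 {1..?n}" by auto
 also have "(\<Oplus>i\<in>insert 0 {1..?n}. elem_sym y I i \<otimes> ?x [^] (?n - i)) =
  ?x [^] ?n \<oplus> (\<Oplus>i\<in>{1..?n}. elem_sym y I i \<otimes> ?x [^] (?n - i))"
 proof (subst finsum_insert)
  have "{T. T \<subseteq> I & card T = 0} = {{}}" using I finite_subset by (auto simp: card_eq_0_iff)
  then have "elem_sym y I 0 = \<one>" by (simp add: elem_sym_def)
  then show "elem_sym y I 0 \<otimes> ?x [^] (?n - 0) \<oplus> (\<Oplus>i\<in>{1..?n}. elem_sym y I i \<otimes> ?x [^] (?n - i)) =
   ?x [^] ?n \<oplus> (\<Oplus>i\<in>{1..?n}. elem_sym y I i \<otimes> ?x [^] (?n - i))" using x by simp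
 qed (use elem_sym_closed[OF y] x in auto)
 finally have eq: "?x [^] ?n \<oplus> (\<Oplus>i\<in>{1..?n}. elem_sym y I i \<otimes> ?x [^] (?n - i)) = \<zero>" by simp
 have mem: "(\<Oplus>i\<in>{1..?n}. elem_sym y I i \<otimes> ?x [^] (?n - i)) : span ?Y"
  by (rule sum_mem[OF span_subgroup[OF Y]], rule span_simps(2)) fastforce
 have "?x [^] ?n = \<ominus> (\<Oplus>i\<in>{1..?n}. elem_sym y I i \<otimes> ?x [^] (?n - i))"
  using eq x mem span_simps(1)[OF Y] by (intro minus_equality[symmetric]) auto
 then show ?thesis using mem subgroup.m_inv_closed[OF span_subgroup[OF Y]] by (simp add: a_inv_def)
qed

text \<open>Since \<open>h\<close> permutes the \<open>y i\<close> through \<tau>, it permutes the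
  summands, which are indexed by the subsets of size \<open>j\<close>.\<close>

lemma elem_sym_invariant:
 assumes h: "h : ring_hom R R" and I: "finite I" and y: "y : I \<rightarrow> car R"
  and \<tau>: "bij_betw \<tau> I I" and hy: "\<And>i. i : I ==> h (y i) = y (\<tau> i)"
 shows "h (elem_sym y I j) = elem_sym y I j"
proof -
 interpret h: ring_hom_cring R R h by unfold_locales (rule h)
 have \<tau>I: "\<tau> i : I" if "i : I" for i using \<tau> that bij_betwE by blast
 have inj: "inj_on \<tau> T" if "T \<subseteq> I" for T using \<tau> that inj_on_subset by (auto simp: bij_betw_def)
 have Pc: "(\<Otimes>i\<in>T. \<ominus> y i) : car R" if "T \<subseteq> I" for T
  using that y by (intro finprod_closed) auto
 have hP: "h (\<Otimes>i\<in>T. \<ominus> y i) = (\<Otimes>i\<in>\<tau> ` T. \<ominus> y i)" if T: "T \<subseteq> I" for T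
 proof -
  have "h (\<Otimes>i\<in>T. \<ominus> y i) = (\<Otimes>i\<in>T. h (\<ominus> y i))"
   using T y by (subst h.hom_finprod) (auto simp: o_def)
  also have "\<dots> = (\<Otimes>i\<in>T. \<ominus> y (\<tau> i))"
  proof (rule finprod_cong')
   fix i assume "i : T"
   then have "i : I" "y i : car R" using T y by auto
   then show "h (\<ominus> y i) = \<ominus> y (\<tau> i)" using hy by simp
  qed (use T y \<tau>I in auto)
  also have "\<dots> = (\<Otimes>i\<in>\<tau> ` T. \<ominus> y i)"
   by (rule finprod_reindex[symmetric, OF _ inj[OF T]]) (use T y \<tau>I in auto)
  finally show ?thesis .
 qed
 let ?S = "{T. T \<subseteq> I & card T = j}"
 have bij: "bij_betw ((`) \<tau>) ?S ?S"
 proof (rule bij_betw_byWitness[where f' = "(`) (inv_into I \<tau>)"])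
  have im: "\<tau> ` I = I" and injI: "inj_on \<tau> I" using \<tau> by (auto simp: bij_betw_def)
  show "ALL T:?S. inv_into I \<tau> ` \<tau> ` T = T" using inv_into_image_cancel[OF injI] by auto
  show "ALL T:?S. \<tau> ` inv_into I \<tau> ` T = T" using image_inv_into_cancel[OF im] by auto
  show "(`) \<tau> ` ?S \<subseteq> ?S"
  proof
   fix U assume "U : (`) \<tau> ` ?S"
   then obtain T where T: "T \<subseteq> I" "card T = j" "U = \<tau> ` T" by auto
   then show "U : ?S" using card_image[OF inj[OF T(1)]] \<tau>I by auto
  qed
  show "(`) (inv_into I \<tau>) ` ?S \<subseteq> ?S"
  proof
   fix U assume "U : (`) (inv_into I \<tau>) ` ?S"
   then obtain T where T: "T \<subseteq> I" "card T = j" "U = inv_into I \<tau> ` T" by auto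
   have "inj_on (inv_into I \<tau>) T" using inj_on_inv_into[of T \<tau> I] T im by auto
   then show "U : ?S" using T im inv_into_into[of _ \<tau> I] card_image[of "inv_into I \<tau>" T] by auto
  qed
 qed
 have "h (elem_sym y I j) = (\<Oplus>T\<in>?S. h (\<Otimes>i\<in>T. \<ominus> y i))"
  unfolding elem_sym_def by (subst h.hom_finsum) (auto simp: o_def intro!: Pc)
 also have "\<dots> = (\<Oplus>T\<in>?S. \<Otimes>i\<in>\<tau> ` T. \<ominus> y i)"
  by (rule finsum_cong') (use hP Pc \<tau>I in "auto intro!: Pc")
 also have "\<dots> = (\<Oplus>T\<in>(`) \<tau> ` ?S. \<Otimes>i\<in>T. \<ominus> y i)"
  by (rule finsum_reindex[symmetric]) (use bij \<tau>I in "auto simp: bij_betw_def intro!: Pc")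
 also have "\<dots> = elem_sym y I j" unfolding elem_sym_def using bij by (simp add: bij_betw_def)
 finally show ?thesis .
qed

section \<open>The ascending chain condition\<close>

text \<open>An ideal of the subring \<open>E\<close>, described inside the ambient ring so that
  ideals of different subrings can be compared directly.\<close>

definition rel_ideal :: "'a set => 'a set => bool" where
 "rel_ideal E I \<longleftrightarrow> I \<subseteq> E & \<zero> : I & (ALL a:I. ALL b:I. a \<oplus> b : I) & (ALL e:E. ALL a:I. e \<otimes> a : I)"

definition acc :: "'a set => bool" where
 "acc E \<longleftrightarrow> (\<forall>I::nat => 'a set. (\<forall>m. rel_ideal E (I m)) --> (\<forall>m. I m \<subseteq> I (Suc m)) --> (\<exists>N. \<forall>m\<ge>N. I m = I N))"

lemma rel_ideal_minus:
 assumes "subring E R" "rel_ideal E I" "a : I" "b : I" shows "a \<ominus> b : I"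
proof -
 have "b : car R" using assms subringE(1) unfolding rel_ideal_def by blast
 then have "a \<ominus> b = a \<oplus> (\<ominus> \<one>) \<otimes> b" by (simp add: a_minus_def l_minus)
 moreover have "\<ominus> \<one> : E" using subringE(3,5)[OF assms(1)] by simp
 ultimately show ?thesis using assms unfolding rel_ideal_def by auto
qed

text \<open>Values at \<open>x\<close> of polynomials of degree less than \<open>d\<close> over
  \<open>E\<close>. As \<open>x\<close> may be algebraic, these are values and not polynomials, and
  a leading coefficient is not determined by the value.\<close>

primrec bounded_degree :: "'a set => 'a => nat => 'a set" where
 "bounded_degree E x 0 = {\<zero>}"
| "bounded_degree E x (Suc d) = {r \<otimes> x [^] d \<oplus> v | r v. r : E & v : bounded_degree E x d}"

text \<open>Hilbert's argument with leading coefficients, for a possibly algebraic \<open>x\<close>: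
  to \<open>I\<close> and \<open>d\<close> belongs the ideal of those \<open>r\<close> for which r
  x^d plus something of lower degree lies in \<open>I\<close>. It grows with \<open>I\<close> and
  with \<open>d\<close>.\<close>

lemma hilbert_basis:
 assumes E: "subring E R" and x: "x : car R" and acc: "acc E"
 shows "acc (generate_ring R (insert x E))"
proof -
 note ED = subringE[OF E]
 let ?V = "bounded_degree E x" and ?Q = "generate_ring R (insert x E)"
 have VC: "?V d \<subseteq> car R" for d
  by (induction d) (use ED(1) x in auto)
 have V0: "\<zero> : ?V d" for d
 proof (induction d)
  case (Suc d)
  have "\<zero> = \<zero> \<otimes> x [^] d \<oplus> \<zero>" using x by simp
  then show ?case using Suc ED(2) by auto
 qed simp
 have Vsuc: "?V d \<subseteq> ?V (Suc d)" for d
 proof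
  fix v assume "v : ?V d"
  moreover from this have "v = \<zero> \<otimes> x [^] d \<oplus> v" using x subsetD[OF VC] by simp
  ultimately show "v : ?V (Suc d)" using ED(2) by auto
 qed
 have Vadd: "a \<oplus> b : ?V d" if "a : ?V d" "b : ?V d" for a b d
  using that
 proof (induction d arbitrary: a b)
  case (Suc d)
  then obtain r v r' v' where *: "a = r \<otimes> x [^] d \<oplus> v" "b = r' \<otimes> x [^] d \<oplus> v'" "r : E" "r' : E"
   "v : ?V d" "v' : ?V d" by auto
  have c: "r : car R" "r' : car R" "v : car R" "v' : car R" using * ED(1) VC by auto
  then have "a \<oplus> b = (r \<oplus> r') \<otimes> x [^] d \<oplus> (v \<oplus> v')" using * x by (simp add: l_distr a_ac)
  then show ?case using Suc.IH[of v v'] * ED(7) by auto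
 qed simp
 have Vmult: "e \<otimes> a : ?V d" if "e : E" "a : ?V d" for e a d
  using that
 proof (induction d arbitrary: a)
  case (Suc d)
  then obtain r v where *: "a = r \<otimes> x [^] d \<oplus> v" "r : E" "v : ?V d" by auto
  have c: "r : car R" "v : car R" "e : car R" using * ED(1) VC Suc by auto
  then have "e \<otimes> a = (e \<otimes> r) \<otimes> x [^] d \<oplus> e \<otimes> v" using * x by (simp add: r_distr m_ac)
  then show ?case using Suc.IH[of v] Suc.prems * ED(6) by auto
 qed (use ED(1) in auto)
 have Vx: "x \<otimes> a : ?V (Suc d)" if "a : ?V d" for a d
  using that
 proof (induction d arbitrary: a)
  case 0
  then show ?case using V0[of 1] x by simp
 next
  case (Suc d)
  then obtain r v where *: "a = r \<otimes> x [^] d \<oplus> v" "r : E" "v : ?V d" by auto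
  have c: "r : car R" "v : car R" using * ED(1) VC by auto
  then have "x \<otimes> a = r \<otimes> x [^] Suc d \<oplus> x \<otimes> v" using * x by (simp add: r_distr m_ac)
  moreover have "x \<otimes> v : ?V (Suc d)" using Suc.IH * by blast
  ultimately show ?case using * by auto
 qed
 let ?U = "\<Union>d. ?V d"
 have Vmono: "?V d \<subseteq> ?V d'" if "d \<le> d'" for d d' using lift_Suc_mono_le[of ?V, OF Vsuc that] .
 have Uadd: "a \<oplus> b : ?U" if "a : ?U" "b : ?U" for a b
 proof -
  from that obtain d d' where "a : ?V d" "b : ?V d'" by blast
  then have "a : ?V (max d d')" "b : ?V (max d d')" using Vmono by (meson max.cobounded1 max.cobounded2 subsetD)+
  then show ?thesis using Vadd by blast
 qed
 \<comment> \<open>The sets of bounded degree exhaust the generated ring, because their union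
   contains 1 and is closed under addition and under multiplication by \<open>E\<close> and by
   \<open>x\<close>.\<close>
 have UQ: "?Q \<subseteq> ?U"
 proof -
  let ?St = "{r \<in> car R. ALL w:?U. r \<otimes> w : ?U}"
  have UC: "?U \<subseteq> car R" using VC by auto
  have minus: "\<ominus> a : ?U" if a: "a : ?U" for a
  proof -
   obtain d where "a : ?V d" using a by blast
   then have "\<ominus> \<one> \<otimes> a : ?V d" "a : car R" using Vmult[of "\<ominus> \<one>" a d] ED(3,5) VC by auto
   then show ?thesis by (auto simp: l_minus)
  qed
  have St: "subring ?St R"
  proof (rule subringI)
   fix h assume h: "h : ?St"
   have "\<ominus> h \<otimes> w : ?U" if w: "w : ?U" for w
   proof -
    have "\<ominus> h \<otimes> w = \<ominus> (h \<otimes> w)" using h w UC by (intro l_minus) auto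
    moreover have "h \<otimes> w : ?U" using h w by blast
    from minus[OF this] show ?thesis unfolding \<open>\<ominus> h \<otimes> w = \<ominus> (h \<otimes> w)\<close> .
   qed
   then show "\<ominus> h : ?St" using h by blast
  next
   fix h1 h2 assume h: "h1 : ?St" "h2 : ?St"
   have "h1 \<otimes> h2 \<otimes> w : ?U" "(h1 \<oplus> h2) \<otimes> w : ?U" if w: "w : ?U" for w
   proof -
    have c: "w : car R" "h1 : car R" "h2 : car R" using h w UC by auto
    have m: "h1 \<otimes> w : ?U" "h2 \<otimes> w : ?U" "h1 \<otimes> (h2 \<otimes> w) : ?U" using h w by blast+
    show "h1 \<otimes> h2 \<otimes> w : ?U" using m(3) unfolding m_assoc[OF c(2,3,1)] .
    show "(h1 \<oplus> h2) \<otimes> w : ?U" using Uadd[OF m(1,2)] unfolding l_distr[OF c(2,3,1)] .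
   qed
   then show "h1 \<otimes> h2 : ?St" "h1 \<oplus> h2 : ?St" using h by blast+
  next
   have "\<one> \<otimes> w : ?U" if w: "w : ?U" for w
    using subsetD[OF UC w] w by (simp only: l_one)
   then show "\<one> : ?St" by blast
  qed blast
  have "x : ?St" using x Vx by blast
  moreover have "E \<subseteq> ?St" using ED(1) Vmult by blast
  ultimately have s1: "?Q \<subseteq> ?St"
   by (intro generate_ring_min_subring1 St) (use x ED(1) in auto)
  have one: "\<one> : ?U"
  proof -
   have "\<one> : ?V 1" using ED(3) by (auto intro!: exI[of _ \<one>])
   then show ?thesis by blast
  qed
  show ?thesis
  proof
   fix r assume "r : ?Q"
   then have r: "r : ?St" by (rule subsetD[OF s1])
   then have "r \<otimes> \<one> : ?U" using one by blast
   moreover have "r \<otimes> \<one> = r" using r by simp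
   ultimately show "r : ?U" by (simp only:)
  qed
 qed
 have Q: "subring ?Q R" by (rule generate_ring_is_subring) (use x ED(1) in auto)
 have incl: "insert x E \<subseteq> ?Q" using generate_ringE(2)[of "insert x E"] x ED(1) by blast
 let ?L = "%I d. {r \<in> E. EX v:?V d. r \<otimes> x [^] d \<oplus> v : I}"
 have L_ideal: "rel_ideal E (?L I d)" if I: "rel_ideal ?Q I" for I d
  unfolding rel_ideal_def
 proof (intro conjI ballI)
  have "\<zero> \<otimes> x [^] d \<oplus> \<zero> : I" using I x by (simp add: rel_ideal_def)
  then show "\<zero> : ?L I d" using V0 ED(2) by blast
  fix a assume "a : ?L I d"
  then obtain v where a: "a : E" "v : ?V d" "a \<otimes> x [^] d \<oplus> v : I" by blast
  have ac: "a : car R" "v : car R" using a ED(1) VC by auto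
  {
   fix b assume "b : ?L I d"
   then obtain w where b: "b : E" "w : ?V d" "b \<otimes> x [^] d \<oplus> w : I" by blast
   have bc: "b : car R" "w : car R" using b ED(1) VC by auto
   have "(a \<otimes> x [^] d \<oplus> v) \<oplus> (b \<otimes> x [^] d \<oplus> w) : I" using a b I unfolding rel_ideal_def by blast
   moreover have "(a \<otimes> x [^] d \<oplus> v) \<oplus> (b \<otimes> x [^] d \<oplus> w) = (a \<oplus> b) \<otimes> x [^] d \<oplus> (v \<oplus> w)"
    using ac bc x by (simp add: l_distr a_ac)
   ultimately show "a \<oplus> b : ?L I d" using a b ED(7) Vadd by auto
  next
   fix e assume e: "e : E"
   have ec: "e : car R" using e ED(1) by auto
   have "e \<otimes> (a \<otimes> x [^] d \<oplus> v) : I" using a e I incl unfolding rel_ideal_def by blast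
   moreover have "e \<otimes> (a \<otimes> x [^] d \<oplus> v) = (e \<otimes> a) \<otimes> x [^] d \<oplus> e \<otimes> v"
    using ac ec x by (simp add: r_distr m_assoc)
   ultimately show "e \<otimes> a : ?L I d" using a e ED(6) Vmult by auto
  }
 qed auto
 have L_suc: "?L I d \<subseteq> ?L I (Suc d)" if I: "rel_ideal ?Q I" for I d
 proof
  fix a assume "a : ?L I d"
  then obtain v where a: "a : E" "v : ?V d" "a \<otimes> x [^] d \<oplus> v : I" by blast
  have ac: "a : car R" "v : car R" using a ED(1) VC by auto
  have "x \<otimes> (a \<otimes> x [^] d \<oplus> v) : I" using a I incl unfolding rel_ideal_def by blast
  moreover have "x \<otimes> (a \<otimes> x [^] d \<oplus> v) = a \<otimes> x [^] Suc d \<oplus> x \<otimes> v"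
   using ac x by (simp add: r_distr m_ac)
  ultimately show "a : ?L I (Suc d)" using a Vx[OF a(2)] by auto
 qed
 \<comment> \<open>From an element of \<open>J\<close> one subtracts an element of \<open>I\<close>
   with the same leading coefficient; the difference lies in \<open>J\<close> and has lower
   degree.\<close>
 have L_eq: "I = J" if I: "rel_ideal ?Q I" and J: "rel_ideal ?Q J" and "I \<subseteq> J" and L: "\<And>d. ?L I d = ?L J d" for I J
 proof -
  have "y : I" if "y : ?V d" "y : J" for y d
   using that
  proof (induction d arbitrary: y)
   case 0
   then show ?case using I by (simp add: rel_ideal_def)
  next
   case (Suc d)
   then obtain r v where y: "y = r \<otimes> x [^] d \<oplus> v" "r : E" "v : ?V d" by auto
   then have "r : ?L J d" using Suc by blast
   then obtain w where w: "w : ?V d" "r \<otimes> x [^] d \<oplus> w : I" using L[of d] by blast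
   have c: "r : car R" "v : car R" "w : car R" using y w ED(1) VC by auto
   have "y \<ominus> (r \<otimes> x [^] d \<oplus> w) = v \<oplus> \<ominus> \<one> \<otimes> w"
   proof -
    have "y \<ominus> (r \<otimes> x [^] d \<oplus> w) = (r \<otimes> x [^] d \<oplus> \<ominus> (r \<otimes> x [^] d)) \<oplus> (v \<oplus> \<ominus> w)"
     using c x unfolding y(1) a_minus_def by (simp add: minus_add a_ac)
    then show ?thesis using c x by (simp add: r_neg l_minus)
   qed
   moreover have "v \<oplus> \<ominus> \<one> \<otimes> w : ?V d" using Vadd[OF y(3) Vmult[OF _ w(1)]] ED(3,5) by simp
   moreover have "y \<ominus> (r \<otimes> x [^] d \<oplus> w) : J"
    using rel_ideal_minus[OF Q J] Suc.prems w \<open>I \<subseteq> J\<close> by blast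
   ultimately have "y \<ominus> (r \<otimes> x [^] d \<oplus> w) : I" using Suc.IH by metis
   then have "(y \<ominus> (r \<otimes> x [^] d \<oplus> w)) \<oplus> (r \<otimes> x [^] d \<oplus> w) : I"
    using w I unfolding rel_ideal_def by blast
   moreover have "(y \<ominus> (r \<otimes> x [^] d \<oplus> w)) \<oplus> (r \<otimes> x [^] d \<oplus> w) = y"
    using c x unfolding y(1) by (simp add: a_minus_def a_assoc l_neg)
   ultimately show ?case by simp
  qed
  moreover have "\<exists>d. y : ?V d" if "y : J" for y
  proof -
   have "y : ?Q" using J that by (auto simp: rel_ideal_def)
   then have "y : ?U" by (rule subsetD[OF UQ])
   then show ?thesis by blast
  qed
  ultimately have "J \<subseteq> I" by (meson subsetI)
  then show ?thesis using \<open>I \<subseteq> J\<close> by (rule subset_antisym[rotated])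
 qed
 show ?thesis
  unfolding acc_def
 proof (intro allI impI)
  fix I :: "nat => 'a set"
  assume I: "\<forall>m. rel_ideal ?Q (I m)" and chain: "\<forall>m. I m \<subseteq> I (Suc m)"
  have Imono: "I m \<subseteq> I m'" if "m \<le> m'" for m m' using lift_Suc_mono_le[of I] chain that by blast
  have Lmono: "?L (I m) d \<subseteq> ?L (I m') d'" if "m \<le> m'" "d \<le> d'" for m m' d d'
  proof -
   have "?L (I m) d \<subseteq> ?L (I m') d" using Imono[OF that(1)] by blast
   also have "?L (I m') d \<subseteq> ?L (I m') d'"
    using lift_Suc_mono_le[of "?L (I m')", OF L_suc that(2)] I by blast
   finally show ?thesis .
  qed
  have acc': "\<exists>N. \<forall>m\<ge>N. A m = A N" if "\<And>m. rel_ideal E (A m)" "\<And>m. A m \<subseteq> A (Suc m)" for A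
   using acc that unfolding acc_def by blast
  define L where "L m d = ?L (I m) d" for m d
  have Li: "rel_ideal E (L m d)" for m d unfolding L_def by (rule L_ideal[OF I[rule_format]])
  have Lm: "L m d \<subseteq> L m' d'" if "m \<le> m'" "d \<le> d'" for m m' d d' unfolding L_def by (rule Lmono[OF that])
  \<comment> \<open>On the diagonal the degree and the index of the ideal grow together, so one
    application of the chain condition controls all large degrees at once.\<close>
  obtain D where D: "\<And>m. m \<ge> D ==> L m m = L D D"
   using acc'[of "%m. L m m"] Li Lm[OF le_SucI[OF order_refl] le_SucI[OF order_refl]] by blast
  have "\<exists>N. \<forall>m\<ge>N. L m d = L N d" for d
   by (rule acc') (use Li Lm[OF le_SucI[OF order_refl] order_refl] in blast)+
  then obtain N where N: "\<And>d m. m \<ge> N d ==> L m d = L (N d) d" by metis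
  \<comment> \<open>Degrees up to \<open>D\<close> are finitely many, each with its own bound
    \<open>N d\<close>; larger degrees are governed by \<open>D\<close> itself.\<close>
  define M where "M = max D (Max (N ` {..D}))"
  have MD: "M \<ge> D" by (simp add: M_def)
  have MN: "M \<ge> N d" if "d \<le> D" for d using that by (simp add: M_def le_max_iff_disj)
  have "I m = I M" if m: "m \<ge> M" for m
  proof (rule L_eq[symmetric])
   fix d
   have "L M d = L m d"
   proof (cases "d \<le> D")
    case True
    then show ?thesis using N[of d m] N[of d M] MN m by (metis order_trans)
   next
    case False
    \<comment> \<open>For \<open>d > D\<close>, monotonicity squeezes this ideal between two members
      of the stable diagonal.\<close>
    have "L m' d = L D D" if m': "m' \<ge> D" for m'
    proof
     have "L m' d \<subseteq> L (max m' d) (max m' d)" by (rule Lm) auto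
     also have "\<dots> = L D D" using m' by (intro D) simp
     finally show "L m' d \<subseteq> L D D" .
     show "L D D \<subseteq> L m' d" using False m' by (intro Lm) auto
    qed
    then show ?thesis using MD m by simp
   qed
   then show "?L (I M) d = ?L (I m) d" unfolding L_def .
  qed (use I Imono m in auto)
  then show "\<exists>N. \<forall>m\<ge>N. I m = I N" by blast
 qed
qed

text \<open>If the union of a nonempty chain of ideals is not a member, every member has a strictly
  larger one above it. Iterating such a choice would contradict \<open>acc\<close>.\<close>

lemma acc_imp_noetherian:
 assumes E: "subring E R" and acc: "acc E" shows "noetherian_ring (R\<lparr>carrier := E\<rparr>)"
proof -
 interpret E: ring "R\<lparr>carrier := E\<rparr>" by (rule subring_is_ring[OF E])
 have rel: "rel_ideal E I" if "ideal I (R\<lparr>carrier := E\<rparr>)" for I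
 proof -
  interpret I: ideal I "R\<lparr>carrier := E\<rparr>" by fact
  show ?thesis unfolding rel_ideal_def
   using I.a_subset I.zero_closed I.a_closed I.I_l_closed by auto
 qed
 show ?thesis
 proof (rule E.trivial_ideal_chain_imp_noetherian, rule ccontr)
  fix C assume C: "C ~= {}" "subset.chain {I. ideal I (R\<lparr>carrier := E\<rparr>)} C" "\<Union>C \<notin> C"
  have "EX J:C. I \<subset> J" if I: "I : C" for I
  proof (rule ccontr)
   assume no: "\<not> (EX J:C. I \<subset> J)"
   have "J \<subseteq> I" if J: "J : C" for J
   proof -
    have "I \<subseteq> J \<or> J \<subseteq> I" using C(2) I J unfolding subset_chain_def by simp
    then show ?thesis using no J by (metis psubsetI subset_refl)
   qed
   then have "\<Union>C = I" using I by (intro subset_antisym Union_least Union_upper)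
   then show False using C(3) I by simp
  qed
  then obtain f where f: "\<And>I. I : C ==> f I : C & I \<subset> f I" by metis
  obtain I0 where I0: "I0 : C" using C(1) by blast
  define I where "I m = (f ^^ m) I0" for m
  have IC: "I m : C" for m by (induction m) (use I0 f in "auto simp: I_def")
  have step: "I m \<subset> I (Suc m)" for m using f[OF IC[of m]] by (simp add: I_def)
  have "rel_ideal E (I m)" for m
  proof (rule rel)
   show "ideal (I m) (R\<lparr>carrier := E\<rparr>)" using C(2) IC[of m] unfolding subset_chain_def by auto
  qed
  then obtain N where "\<forall>m\<ge>N. I m = I N" using acc step unfolding acc_def by blast
  then show False using step[of N] by (metis le_SucI order_refl psubset_eq)
 qed
qed

end

section \<open>Finite groups acting on a field\<close>

text \<open>\<open>T\<close> stands for the tensor power of \<open>D\<close> inside its field of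
  fractions \<open>L\<close>, and \<open>G\<close> for the given permutations as automorphisms of
  \<open>L\<close>.\<close>

locale galois_data =
 fixes k :: "('k, 'x) ring_scheme" and L :: "('k, 'l, 'y) module_scheme"
  and T :: "'l set" and G :: "('l => 'l) set"
 assumes field_k: "field k" and algebra_L: "algebra k L" and field_L: "field L"
  and T_subring: "subring T L" and scalars_T: "scalars k L \<subseteq> T"
  and T_fin_gen: "\<exists>Y. finite Y & Y \<subseteq> T & generate_ring L (scalars k L \<union> Y) = T"
  and T_frac: "fractions_in L T = car L"
  and G_subgroup: "subgroup G (alg_aut k L)" and G_finite: "finite G"
  and G_T: "[|g : G; t : T|] ==> g t : T"
  and char_zero: "\<And>m::nat. m > 0 ==> [m] \<cdot>\<^sub>k 1\<^sub>k ~= 0\<^sub>k"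
begin

sublocale k: field k by (rule field_k)
sublocale L: field L by (rule field_L)
sublocale N: nc_algebra k L by (rule algebra.nc_algebra[OF algebra_L])
sublocale A: group "alg_aut k L" by (rule N.group_alg_aut)

lemmas T_simps = subringE[OF T_subring]

lemma G_carrier: "g : G ==> g : car (alg_aut k L)"
 using subgroup.subset[OF G_subgroup] by auto

lemma G_hom: "g : G ==> g : alg_hom k L L"
 using G_carrier by (simp add: carrier_alg_aut)

lemmas gD = alg_homD[OF G_hom]

lemma g_zero: "g : G ==> g 0\<^sub>L = 0\<^sub>L"
 using ring_hom_zero_neg(1)[OF gD(1) L.ring_axioms L.ring_axioms] .

lemma g_neg: "g : G ==> x : car L ==> g (\<ominus>\<^sub>L x) = \<ominus>\<^sub>L g x"
 using ring_hom_zero_neg(2)[OF gD(1) L.ring_axioms L.ring_axioms] .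

lemma g_nonzero:
 assumes g: "g : G" and x: "x : car L" "x ~= 0\<^sub>L"
 shows "g x ~= 0\<^sub>L"
proof
 assume "g x = 0\<^sub>L"
 then have "g x = g 0\<^sub>L" using g_zero[OF g] by simp
 moreover have "inj_on g (car L)"
  using G_carrier[OF g] by (simp add: carrier_alg_aut bij_betw_def)
 ultimately show False using inj_onD[of g "car L" x "0\<^sub>L"] x by simp
qed

lemma G_mult: "[|g : G; h : G|] ==> g *\<^sub>(alg_aut k L) h : G"
 by (rule subgroup.m_closed[OF G_subgroup])

lemma G_mult_apply: "[|g : G; h : G; x : car L|] ==> (g *\<^sub>(alg_aut k L) h) x = g (h x)"
 using N.alg_aut_mult_apply G_carrier by simp

lemma G_one: "\<one>\<^bsub>alg_aut k L\<^esub> : G" "x : car L ==> \<one>\<^bsub>alg_aut k L\<^esub> x = x"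
 using subgroup.one_closed[OF G_subgroup] by (auto simp: alg_aut_one)

lemma G_bij: assumes h: "h : G" shows "bij_betw (%g. h *\<^sub>(alg_aut k L) g) G G"
proof (rule bij_betw_byWitness[where f' = "%g. inv\<^bsub>alg_aut k L\<^esub> h *\<^sub>(alg_aut k L) g"])
 have i: "inv\<^bsub>alg_aut k L\<^esub> h : G" using subgroup.m_inv_closed[OF G_subgroup h] .
 show "ALL g:G. inv\<^bsub>alg_aut k L\<^esub> h *\<^sub>(alg_aut k L) (h *\<^sub>(alg_aut k L) g) = g"
  "ALL g:G. h *\<^sub>(alg_aut k L) (inv\<^bsub>alg_aut k L\<^esub> h *\<^sub>(alg_aut k L) g) = g"
  using h G_carrier by (auto simp: A.m_assoc[symmetric])
qed (use h G_mult subgroup.m_inv_closed[OF G_subgroup h] in auto)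

lemma G_inv: "g : G ==> inv\<^bsub>alg_aut k L\<^esub> g : G"
 by (rule subgroup.m_inv_closed[OF G_subgroup])

section \<open>Fixed field, invariant ring and trace\<close>

definition fixed_field where "fixed_field = {x \<in> car L. ALL g:G. g x = x}"

definition \<Gamma> where "\<Gamma> = {t \<in> T. ALL g:G. g t = t}"

definition tr where "tr x = (\<Oplus>\<^sub>L g\<in>G. g x)"

lemma fixedD: "[|x : fixed_field; g : G|] ==> g x = x"
 by (simp add: fixed_field_def)

lemma fixed_subring: "subring fixed_field L"
proof (rule L.subringI)
 fix x y assume x: "x : fixed_field" and y: "y : fixed_field"
 then have c: "x : car L" "y : car L" by (auto simp: fixed_field_def)
 have "g (x *\<^sub>L y) = x *\<^sub>L y" "g (x +\<^sub>L y) = x +\<^sub>L y" if g: "g : G" for g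
  using gD(3,4)[OF g c] fixedD[OF x g] fixedD[OF y g] by simp_all
 then show "x *\<^sub>L y : fixed_field" "x +\<^sub>L y : fixed_field" using c by (auto simp: fixed_field_def)
next
 fix x assume x: "x : fixed_field"
 then have c: "x : car L" by (auto simp: fixed_field_def)
 have "g (\<ominus>\<^sub>L x) = \<ominus>\<^sub>L x" if g: "g : G" for g
  using g_neg[OF g c] fixedD[OF x g] by simp
 then show "\<ominus>\<^sub>L x : fixed_field" using c by (auto simp: fixed_field_def)
next
 show "1\<^sub>L : fixed_field" using gD(5) by (auto simp: fixed_field_def)
qed (auto simp: fixed_field_def)

lemma \<Gamma>_eq: "\<Gamma> = fixed_field \<inter> T"
 using T_simps(1) by (auto simp: \<Gamma>_def fixed_field_def)

lemma \<Gamma>_subring: "subring \<Gamma> L"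
 unfolding \<Gamma>_eq by (rule L.subring_inter[OF fixed_subring T_subring])

lemmas \<Gamma>_simps = subringE[OF \<Gamma>_subring] and fixed_simps = subringE[OF fixed_subring]

lemma \<Gamma>_T: "\<Gamma> \<subseteq> T" by (auto simp: \<Gamma>_def)

lemma scalars_\<Gamma>: "scalars k L \<subseteq> \<Gamma>"
proof
 fix x assume x: "x : scalars k L"
 then obtain c where c: "c : car k" "x = c \<odot>\<^sub>L 1\<^sub>L" by (auto simp: scalars_def)
 have "g x = x" if g: "g : G" for g using gD(5)[OF g] gD(6)[OF g c(1) L.one_closed] c by simp
 then show "x : \<Gamma>" using x scalars_T by (auto simp: \<Gamma>_def)
qed

lemma tr_closed: "x : car L ==> tr x : car L"
 unfolding tr_def using gD(2) by (intro L.finsum_closed) auto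

lemma tr_fixed: assumes x: "x : car L" shows "tr x : fixed_field"
proof -
 have "h (tr x) = tr x" if h: "h : G" for h
 proof -
  have "h (tr x) = (\<Oplus>\<^sub>L g\<in>G. h (g x))"
   unfolding tr_def
   by (rule ring_hom_zero_neg(4)[OF gD(1)[OF h] L.ring_axioms L.ring_axioms]) (use x gD in auto)
  also have "\<dots> = (\<Oplus>\<^sub>L g\<in>G. (h *\<^sub>(alg_aut k L) g) x)"
   by (rule L.finsum_cong') (use x h gD(2) G_mult_apply in auto)
  also have "\<dots> = (\<Oplus>\<^sub>L g\<in>(%g. h *\<^sub>(alg_aut k L) g) ` G. g x)"
   by (rule L.finsum_reindex[symmetric]) (use G_bij[OF h] x gD(2) G_mult h in "auto simp: bij_betw_def")
  also have "\<dots> = tr x" unfolding tr_def using G_bij[OF h] by (simp add: bij_betw_def)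
  finally show ?thesis .
 qed
 then show ?thesis using tr_closed x by (simp add: fixed_field_def)
qed

lemma tr_T: "t : T ==> tr t : \<Gamma>"
 using tr_fixed T_simps(1) L.sum_mem[OF L.subring_subgroup[OF T_subring], of G "%g. g t"] G_T
 by (auto simp: \<Gamma>_eq tr_def)

lemma tr_add: "[|x : car L; y : car L|] ==> tr (x +\<^sub>L y) = tr x +\<^sub>L tr y"
proof -
 assume "x : car L" "y : car L"
 moreover from this have "(\<Oplus>\<^sub>L g\<in>G. g (x +\<^sub>L y)) = (\<Oplus>\<^sub>L g\<in>G. g x +\<^sub>L g y)"
  by (intro L.finsum_cong') (auto simp: gD)
 ultimately show ?thesis unfolding tr_def by (simp add: L.finsum_addf gD Pi_def)
qed

lemma tr_mult: assumes "a : fixed_field" "x : car L" shows "tr (a *\<^sub>L x) = a *\<^sub>L tr x"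
proof -
 have a: "a : car L" using assms by (simp add: fixed_field_def)
 have "tr (a *\<^sub>L x) = (\<Oplus>\<^sub>L g\<in>G. a *\<^sub>L g x)"
  unfolding tr_def
 proof (rule L.finsum_cong')
  fix g assume g: "g : G"
  show "g (a *\<^sub>L x) = a *\<^sub>L g x" using gD(3)[OF g a assms(2)] fixedD[OF assms(1) g] by simp
 qed (use assms a gD(2) in auto)
 also have "\<dots> = a *\<^sub>L tr x"
  unfolding tr_def by (rule L.finsum_rdistr[symmetric]) (use assms a gD(2) G_finite in auto)
 finally show ?thesis .
qed

lemma card_G: "card G > 0"
 using G_one(1) G_finite by (auto simp: card_gt_0_iff)

lemma add_pow_smult: "x : car L ==> [m] \<cdot>\<^sub>L x = ([m] \<cdot>\<^sub>k 1\<^sub>k) \<odot>\<^sub>L x" for m :: nat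
 by (induction m) (auto simp: N.smult_l_distr)

text \<open>The scalar 1/|G|, available by \<open>char_zero\<close>. It lies in
  \<open>scalars k L\<close>, hence in \<Gamma>, so averaging does not lead out of \<Gamma>.\<close>

definition inv_card where "inv_card = inv\<^bsub>k\<^esub> ([card G] \<cdot>\<^sub>k 1\<^sub>k) \<odot>\<^sub>L 1\<^sub>L"

lemma inv_card: "inv_card : scalars k L" "x : car L ==> inv_card *\<^sub>L ([card G] \<cdot>\<^sub>L x) = x"
proof -
 let ?c = "[card G] \<cdot>\<^sub>k 1\<^sub>k"
 have c: "?c : Units k" using char_zero[OF card_G] by (simp add: k.field_Units)
 then show "inv_card : scalars k L" by (auto simp: inv_card_def scalars_def)
 assume x: "x : car L"
 have "inv_card *\<^sub>L ([card G] \<cdot>\<^sub>L x) = inv\<^bsub>k\<^esub> ?c \<odot>\<^sub>L (?c \<odot>\<^sub>L x)"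
  using c x by (simp add: inv_card_def add_pow_smult N.smult_mult_left)
 also have "\<dots> = x" using c x by (simp add: N.smult_assoc1[symmetric])
 finally show "inv_card *\<^sub>L ([card G] \<cdot>\<^sub>L x) = x" .
qed

lemma tr_of_fixed: assumes "x : fixed_field" shows "inv_card *\<^sub>L tr x = x"
proof -
 have x: "x : car L" using assms by (simp add: fixed_field_def)
 have "tr x = (\<Oplus>\<^sub>L g\<in>G. x)"
  unfolding tr_def by (rule L.finsum_cong') (use assms in "auto simp: fixed_field_def")
 then show ?thesis using inv_card(2) x L.add.finprod_const[OF x, of G] by simp
qed

lemma prod_mem:
 assumes "subring H L" "\<And>i. i : I ==> f i : H" shows "finprod L f I : H"
proof -
 have H: "H \<subseteq> car L" "1\<^sub>L : H" "\<And>a b. [|a : H; b : H|] ==> a *\<^sub>L b : H"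
  using subringE[OF assms(1)] by auto
 show ?thesis using assms(2)
 proof (induction I rule: infinite_finite_induct)
  case (insert i I)
  then have "f i : car L" "f : I \<rightarrow> car L" using H by auto
  with insert H show ?case by simp
 qed (use H in auto)
qed

text \<open>The norm of a denominator \<open>b\<close>, that is the product of all
  \<open>g b\<close>, is invariant, and it is a multiple of \<open>b\<close> inside
  \<open>T\<close>.\<close>

lemma denominator:
 assumes x: "x : car L"
 shows "EX \<gamma>:\<Gamma>. \<gamma> ~= 0\<^sub>L & x *\<^sub>L \<gamma> : T"
proof -
 have "x : fractions_in L T" using x T_frac by simp
 then obtain a b where ab: "x = a *\<^sub>L inv\<^bsub>L\<^esub> b" "a : T" "b : T" "b ~= 0\<^sub>L"
  by (auto simp: fractions_in_def)
 have c: "a : car L" "b : car L" "b : Units L" using ab T_simps(1) L.field_Units by auto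
 let ?e = "\<one>\<^bsub>alg_aut k L\<^esub>"
 define N where "N = (\<Otimes>\<^sub>L g\<in>G. g b)"
 define b' where "b' = (\<Otimes>\<^sub>L g\<in>G - {?e}. g b)"
 have b': "b' : T" unfolding b'_def by (rule prod_mem[OF T_subring]) (use G_T ab in auto)
 have "N = ?e b *\<^sub>L b'"
  unfolding N_def b'_def
  using L.finprod_insert[of "G - {?e}" ?e "%g. g b"] G_finite G_one(1) gD(2) c by (simp add: insert_absorb Pi_def)
 then have N: "N = b *\<^sub>L b'" using G_one(2) c by simp
 have "h N = N" if h: "h : G" for h
 proof -
  interpret h: ring_hom_cring L L h by unfold_locales (rule gD(1)[OF h])
  have "h N = (\<Otimes>\<^sub>L g\<in>G. h (g b))"
   unfolding N_def by (subst h.hom_finprod) (use c gD in "auto simp: o_def")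
  also have "\<dots> = (\<Otimes>\<^sub>L g\<in>G. (h *\<^sub>(alg_aut k L) g) b)"
   by (rule L.finprod_cong') (use c h gD(2) G_mult_apply in auto)
  also have "\<dots> = (\<Otimes>\<^sub>L g\<in>(%g. h *\<^sub>(alg_aut k L) g) ` G. g b)"
   by (rule L.finprod_reindex[symmetric]) (use G_bij[OF h] c gD(2) G_mult h in "auto simp: bij_betw_def")
  also have "\<dots> = N" unfolding N_def using G_bij[OF h] by (simp add: bij_betw_def)
  finally show ?thesis .
 qed
 moreover have "N : T" using N ab b' T_simps(6) by simp
 ultimately have "N : \<Gamma>" by (simp add: \<Gamma>_def)
 moreover have "N ~= 0\<^sub>L"
 proof -
  have "(\<Otimes>\<^sub>L g\<in>I. g b) ~= 0\<^sub>L & (\<Otimes>\<^sub>L g\<in>I. g b) : car L" if "finite I" "I \<subseteq> G" for I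
   using that
  proof (induction I)
   case (insert g I)
   then have g: "g b : car L" "g b ~= 0\<^sub>L" "(%g. g b) : I \<rightarrow> car L"
    using gD(2) g_nonzero c ab by auto
   then show ?case using insert L.integral by (auto simp: L.integral_iff)
  qed auto
  then show ?thesis unfolding N_def using G_finite by blast
 qed
 moreover have "x *\<^sub>L N = a *\<^sub>L b'"
 proof -
  have b'c: "b' : car L" using b' T_simps(1) by auto
  have "x *\<^sub>L N = a *\<^sub>L (inv\<^bsub>L\<^esub> b *\<^sub>L b) *\<^sub>L b'"
   unfolding ab(1) N using c b'c by (simp add: L.m_assoc del: L.Units_l_inv)
  then show ?thesis using c b'c by simp
 qed
 ultimately show ?thesis using ab b' T_simps(6) by auto
qed

text \<open>Once the denominator of an invariant element is chosen invariant, the numerator is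
  invariant as well.\<close>

lemma fractions_\<Gamma>: "fractions_in L \<Gamma> = fixed_field"
proof (intro equalityI subsetI)
 fix x assume "x : fractions_in L \<Gamma>"
 then obtain a b where ab: "x = a *\<^sub>L inv\<^bsub>L\<^esub> b" "a : \<Gamma>" "b : \<Gamma>" "b ~= 0\<^sub>L"
  by (auto simp: fractions_in_def)
 have c: "a : car L" "b : car L" "b : Units L" using ab \<Gamma>_simps(1) L.field_Units by auto
 have x: "x : car L" "x *\<^sub>L b = a" using c by (auto simp: ab(1) L.m_assoc)
 have "g x = x" if g: "g : G" for g
 proof -
  have "g b = b" using ab(3) g by (simp add: \<Gamma>_def)
  then have "g x *\<^sub>L b = g (x *\<^sub>L b)" using gD(3)[OF g x(1) c(2)] by simp
  also have "\<dots> = x *\<^sub>L b" using x ab(2) g by (simp add: \<Gamma>_def)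
  finally show ?thesis using L.m_rcancel[of b "g x" x] ab(4) c x gD(2) g by simp
 qed
 then show "x : fixed_field" using x by (simp add: fixed_field_def)
next
 fix x assume x: "x : fixed_field"
 then have xc: "x : car L" by (simp add: fixed_field_def)
 obtain \<gamma> where \<gamma>: "\<gamma> : \<Gamma>" "\<gamma> ~= 0\<^sub>L" "x *\<^sub>L \<gamma> : T" using denominator[OF xc] by blast
 have \<gamma>c: "\<gamma> : car L" "\<gamma> : Units L" using \<gamma> \<Gamma>_simps(1) L.field_Units by auto
 have "x *\<^sub>L \<gamma> : \<Gamma>" unfolding \<Gamma>_eq using \<gamma> x fixed_simps(6) by (auto simp: \<Gamma>_eq)
 moreover have "x = x *\<^sub>L \<gamma> *\<^sub>L inv\<^bsub>L\<^esub> \<gamma>" using \<gamma>c xc by (simp add: L.m_assoc)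
 ultimately show "x : fractions_in L \<Gamma>" using \<gamma> unfolding fractions_in_def by blast
qed

lemma fixed_subfield: "subfield fixed_field L"
proof (rule L.subfieldI'[OF fixed_subring])
 fix x assume x: "x : fixed_field - {0\<^sub>L}"
 then have xu: "x : car L" "x : Units L" by (auto simp: fixed_field_def L.field_Units)
 have "g (inv\<^bsub>L\<^esub> x) = inv\<^bsub>L\<^esub> x" if g: "g : G" for g
 proof -
  have "g (inv\<^bsub>L\<^esub> x) *\<^sub>L x = g (inv\<^bsub>L\<^esub> x *\<^sub>L x)"
   using fixedD[of x g] g x gD(3)[OF g, of "inv\<^bsub>L\<^esub> x" x] xu by (simp del: L.Units_l_inv)
  also have "\<dots> = inv\<^bsub>L\<^esub> x *\<^sub>L x" using xu gD(5)[OF g] by simp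
  finally show ?thesis using L.m_rcancel[of x "g (inv\<^bsub>L\<^esub> x)" "inv\<^bsub>L\<^esub> x"] x xu gD(2)[OF g] by simp
 qed
 then show "inv\<^bsub>L\<^esub> x : fixed_field" using xu by (simp add: fixed_field_def)
qed

text \<open>\<open>t\<close> is a root of the product of the X - g(t), whose coefficients are
  symmetric in the conjugates of \<open>t\<close> and lie in \<open>T\<close>.\<close>

lemma T_integral: assumes t: "t : T" shows "L.integral_over \<Gamma> t"
proof -
 have tc: "t : car L" using t T_simps(1) by auto
 let ?y = "%g. g t"
 have y: "?y : G \<rightarrow> car L" using gD(2) tc by auto
 have e: "L.elem_sym ?y G j : \<Gamma>" for j
 proof -
  have "L.elem_sym ?y G j : T"
   unfolding L.elem_sym_def
   by (intro L.sum_mem[OF L.subring_subgroup[OF T_subring]] prod_mem[OF T_subring] T_simps(5) G_T[OF _ t]) auto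
  moreover have "h (L.elem_sym ?y G j) = L.elem_sym ?y G j" if h: "h : G" for h
   by (rule L.elem_sym_invariant[OF gD(1)[OF h] G_finite y G_bij[OF h]]) (use h tc G_mult_apply in auto)
  ultimately show ?thesis by (simp add: \<Gamma>_def)
 qed
 have "t [^]\<^sub>L card G : L.span {e *\<^sub>L t [^]\<^sub>L i | e i. e : L.elem_sym ?y G ` {1..card G} & i < card G}"
  using L.elem_sym_root[OF G_finite y G_one(1)] G_one(2)[OF tc] by simp
 moreover have "L.span {e *\<^sub>L t [^]\<^sub>L i | e i. e : L.elem_sym ?y G ` {1..card G} & i < card G}
   \<subseteq> L.span {e *\<^sub>L t [^]\<^sub>L i | e i. e : \<Gamma> & i < card G}"
  by (rule L.span_mono) (use e in blast)
 ultimately show ?thesis unfolding L.integral_over_def by blast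
qed

text \<open>Noether's argument: \<open>T\<close> is finitely generated as a ring over \<Gamma> by
  integral elements, hence finite as a module.\<close>

lemma T_finite: "\<exists>B. finite B & B \<subseteq> T & T = L.span {e *\<^sub>L b | e b. e : \<Gamma> & b : B}"
proof -
 obtain Y where Y: "finite Y" "Y \<subseteq> T" "generate_ring L (scalars k L \<union> Y) = T"
  using T_fin_gen by blast
 have YL: "Y \<subseteq> car L" and \<Gamma>L: "\<Gamma> \<subseteq> car L" using Y(2) T_simps(1) \<Gamma>_simps(1) by auto
 have "\<exists>B. finite B & B \<subseteq> L.monomials Y &
   generate_ring L (\<Gamma> \<union> Y) = L.span {e *\<^sub>L b | e b. e : \<Gamma> & b : B}"
 proof (rule L.generate_ring_integral[OF \<Gamma>_subring Y(1) YL])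
  show "x *\<^sub>L y = y *\<^sub>L x" if "x : \<Gamma> \<union> Y" "y : Y" for x y
   using that YL \<Gamma>L by (intro L.m_comm) auto
  show "L.integral_over \<Gamma> x" if "x : Y" for x using T_integral that Y by auto
 qed
 then obtain B where B: "finite B" "B \<subseteq> L.monomials Y"
   "generate_ring L (\<Gamma> \<union> Y) = L.span {e *\<^sub>L b | e b. e : \<Gamma> & b : B}" by blast
 have "generate_ring L (\<Gamma> \<union> Y) = T"
 proof
  show "generate_ring L (\<Gamma> \<union> Y) \<subseteq> T"
   by (rule L.generate_ring_min_subring1[OF _ T_subring]) (use YL \<Gamma>L Y \<Gamma>_T in auto)
  have "generate_ring L (scalars k L \<union> Y) \<subseteq> generate_ring L (\<Gamma> \<union> Y)"
   by (rule L.mono_generate_ring) (use scalars_\<Gamma> YL \<Gamma>L in auto)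
  then show "T \<subseteq> generate_ring L (\<Gamma> \<union> Y)" using Y by simp
 qed
 moreover have "m : T" if "m : L.monomials Y" for m
  using that by (induction m rule: L.monomials.induct) (use T_simps Y in auto)
 ultimately show ?thesis using B by blast
qed

text \<open>Module generators of \<open>T\<close> over \<Gamma> span \<open>L\<close> over the fixed
  field, since denominators can be taken in \<Gamma>.\<close>

lemma finite_dim: "L.finite_dimension fixed_field (car L)"
proof -
 obtain B where B: "finite B" "B \<subseteq> T" "T = L.span {e *\<^sub>L b | e b. e : \<Gamma> & b : B}"
  using T_finite by blast
 obtain Us where Us: "set Us = B" using finite_list[OF B(1)] by blast
 have UsL: "set Us \<subseteq> car L" using Us B T_simps(1) by auto
 let ?S = "L.Span fixed_field Us"
 note Sp = L.Span_subgroup_props[OF fixed_subfield UsL]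
 have Sg: "subgroup ?S (add_monoid L)" by (rule L.Span_is_add_subgroup[OF fixed_subfield UsL])
 have "L.span {e *\<^sub>L b | e b. e : \<Gamma> & b : B} \<subseteq> ?S"
 proof (rule L.span_minimal[OF _ Sg], rule subsetI)
  fix y assume "y : {e *\<^sub>L b | e b. e : \<Gamma> & b : B}"
  then obtain e b where y: "y = e *\<^sub>L b" "e : \<Gamma>" "b : B" by blast
  have "b : ?S" using L.Span_base_incl[OF fixed_subfield UsL] y Us by auto
  then show "y : ?S" using L.Span_smult_closed[OF fixed_subfield UsL, of e b] y by (auto simp: \<Gamma>_eq)
 qed
 then have TS: "T \<subseteq> ?S" using equalityD1[OF B(3)] by (rule order_trans[rotated])
 have "car L \<subseteq> ?S"
 proof
  fix x assume x: "x : car L"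
  obtain \<gamma> where \<gamma>: "\<gamma> : \<Gamma>" "\<gamma> ~= 0\<^sub>L" "x *\<^sub>L \<gamma> : T" using denominator[OF x] by blast
  have \<gamma>c: "\<gamma> : car L" "\<gamma> : Units L" using \<gamma> \<Gamma>_simps(1) L.field_Units by auto
  have "inv\<^bsub>L\<^esub> \<gamma> : fixed_field" using L.subfield_m_inv(1)[OF fixed_subfield, of \<gamma>] \<gamma> by (auto simp: \<Gamma>_eq)
  then have "inv\<^bsub>L\<^esub> \<gamma> *\<^sub>L (x *\<^sub>L \<gamma>) : ?S"
   using L.Span_smult_closed[OF fixed_subfield UsL _ subsetD[OF TS \<gamma>(3)]] by simp
  moreover have "inv\<^bsub>L\<^esub> \<gamma> *\<^sub>L (x *\<^sub>L \<gamma>) = x"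
  proof -
   have "inv\<^bsub>L\<^esub> \<gamma> *\<^sub>L (x *\<^sub>L \<gamma>) = x *\<^sub>L (\<gamma> *\<^sub>L inv\<^bsub>L\<^esub> \<gamma>)"
    using \<gamma>c x by (simp add: L.m_ac del: L.Units_r_inv)
   then show ?thesis using \<gamma>c x by simp
  qed
  ultimately show "x : ?S" by simp
 qed
 then have "?S = car L" using Sp(1) by blast
 then show ?thesis using L.Span_finite_dimension[OF fixed_subfield UsL] by simp
qed

section \<open>Independence of automorphisms and Artin's theorem\<close>

lemma dedekind:
 assumes "finite \<Phi>" "\<And>f. f : \<Phi> ==> f : ring_hom L L"
  and "\<And>f g. [|f : \<Phi>; g : \<Phi>; f ~= g|] ==> EX x:car L. f x ~= g x"
  and "\<And>f. f : \<Phi> ==> c f : car L"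
  and "\<And>x. x : car L ==> (\<Oplus>\<^sub>L f\<in>\<Phi>. c f *\<^sub>L f x) = 0\<^sub>L"
  and "f : \<Phi>"
 shows "c f = 0\<^sub>L"
 using assms
proof (induction \<Phi> arbitrary: c f)
 case (insert h \<Phi>)
 have hom: "f x : car L" "f (x *\<^sub>L y) = f x *\<^sub>L f y" "f 1\<^sub>L = 1\<^sub>L"
  if "f : insert h \<Phi>" "x : car L" "y : car L" for f x y
  using insert.prems(1)[OF that(1)] that by (auto simp: ring_hom_def)
 have cc: "c f : car L" if "f : insert h \<Phi>" for f using insert.prems(3) that by blast
 have zero: "c f = 0\<^sub>L" if f: "f : \<Phi>" for f
 proof -
  have "f ~= h" using f insert by blast
  then obtain y where y: "y : car L" "f y ~= h y" using insert.prems(2)[of f h] f by blast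
  \<comment> \<open>The relation at \<open>x\<close>, multiplied by \<open>h y\<close>, is
    subtracted from the relation at \<open>y x\<close>. This cancels the term of \<open>h\<close>,
    and \<open>y\<close> is chosen to tell \<open>f\<close> from \<open>h\<close>.\<close>
  define d where "d f = c f *\<^sub>L (f y \<ominus>\<^sub>L h y)" for f
  have "d f = 0\<^sub>L"
  proof (rule insert.IH[OF _ _ _ _ f])
   show "f : ring_hom L L" if "f : \<Phi>" for f using insert.prems that by blast
   show "EX x:car L. f x ~= g x" if "f : \<Phi>" "g : \<Phi>" "f ~= g" for f g using insert.prems(2) that by blast
   show "d f : car L" if "f : \<Phi>" for f
    unfolding d_def using cc[of f] hom(1)[of f y] hom(1)[of h y] that y by simp
   fix x assume x: "x : car L"
   have s1: "c h *\<^sub>L h x +\<^sub>L (\<Oplus>\<^sub>L f\<in>\<Phi>. c f *\<^sub>L f x) = 0\<^sub>L"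
    using insert.prems(4)[OF x] insert.hyps cc hom(1) x by (simp add: Pi_def)
   have s2: "c h *\<^sub>L h (y *\<^sub>L x) +\<^sub>L (\<Oplus>\<^sub>L f\<in>\<Phi>. c f *\<^sub>L f (y *\<^sub>L x)) = 0\<^sub>L"
    using insert.prems(4)[of "y *\<^sub>L x"] insert.hyps cc hom(1) x y by (simp add: Pi_def)
   let ?A = "\<Oplus>\<^sub>L f\<in>\<Phi>. c f *\<^sub>L f x" and ?B = "\<Oplus>\<^sub>L f\<in>\<Phi>. c f *\<^sub>L f (y *\<^sub>L x)"
   have fin: "?A : car L" "?B : car L" "h y : car L" "h x : car L" "c h : car L"
    using cc hom(1) x y by (auto intro!: L.finsum_closed)
   have "(\<Oplus>\<^sub>L f\<in>\<Phi>. d f *\<^sub>L f x) =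
    (\<Oplus>\<^sub>L f\<in>\<Phi>. c f *\<^sub>L f (y *\<^sub>L x) +\<^sub>L (\<ominus>\<^sub>L h y) *\<^sub>L (c f *\<^sub>L f x))"
   proof (rule L.finsum_cong')
    fix f assume f: "f : \<Phi>"
    have "c f : car L" "f x : car L" "f y : car L" "f (y *\<^sub>L x) = f y *\<^sub>L f x"
     using f cc hom x y by auto
    then show "d f *\<^sub>L f x = c f *\<^sub>L f (y *\<^sub>L x) +\<^sub>L (\<ominus>\<^sub>L h y) *\<^sub>L (c f *\<^sub>L f x)"
     using fin by (simp add: d_def a_minus_def L.r_distr L.l_distr L.m_ac L.l_minus L.r_minus)
   qed (use cc hom(1) x y fin in auto)
   also have "\<dots> = ?B +\<^sub>L (\<Oplus>\<^sub>L f\<in>\<Phi>. (\<ominus>\<^sub>L h y) *\<^sub>L (c f *\<^sub>L f x))"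
    by (rule L.finsum_addf) (use cc hom(1) x y fin in auto)
   also have "(\<Oplus>\<^sub>L f\<in>\<Phi>. (\<ominus>\<^sub>L h y) *\<^sub>L (c f *\<^sub>L f x)) = (\<ominus>\<^sub>L h y) *\<^sub>L ?A"
    by (rule L.finsum_rdistr[symmetric]) (use cc hom(1) x y fin insert.hyps in auto)
   also have "?A = \<ominus>\<^sub>L (c h *\<^sub>L h x)"
    by (rule L.minus_equality[symmetric]) (use s1 fin in "auto simp: L.a_comm")
   also have "?B = \<ominus>\<^sub>L (c h *\<^sub>L h (y *\<^sub>L x))"
    by (rule L.minus_equality[symmetric]) (use s2 fin hom x y in "auto simp: L.a_comm")
   also have "\<ominus>\<^sub>L (c h *\<^sub>L h (y *\<^sub>L x)) +\<^sub>L (\<ominus>\<^sub>L h y) *\<^sub>L (\<ominus>\<^sub>L (c h *\<^sub>L h x)) = 0\<^sub>L"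
    using fin hom(2)[of h y x] x y by (simp add: L.l_minus L.r_minus L.m_ac L.l_neg)
   finally show "(\<Oplus>\<^sub>L f\<in>\<Phi>. d f *\<^sub>L f x) = 0\<^sub>L" .
  qed
  moreover have "f y \<ominus>\<^sub>L h y ~= 0\<^sub>L" "f y \<ominus>\<^sub>L h y : car L"
   using y f hom(1)[of f y] hom(1)[of h y] by auto
  ultimately show ?thesis using L.integral cc[of f] f unfolding d_def by blast
 qed
 have "c h *\<^sub>L h 1\<^sub>L +\<^sub>L (\<Oplus>\<^sub>L f\<in>\<Phi>. c f *\<^sub>L f 1\<^sub>L) = 0\<^sub>L"
 proof -
  have "h 1\<^sub>L : car L" "(%f. c f *\<^sub>L f 1\<^sub>L) : \<Phi> \<rightarrow> car L"
   using hom(1)[OF _ L.one_closed L.one_closed] cc by auto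
  then show ?thesis using insert.prems(4)[OF L.one_closed] insert.hyps cc[of h] by simp
 qed
 moreover have "(\<Oplus>\<^sub>L f\<in>\<Phi>. c f *\<^sub>L f 1\<^sub>L) = (\<Oplus>\<^sub>L f\<in>\<Phi>. 0\<^sub>L)"
 proof (rule L.finsum_cong'[OF refl])
  fix f assume f: "f : \<Phi>"
  have "f 1\<^sub>L : car L" using hom(1)[of f "1\<^sub>L" "1\<^sub>L"] f by simp
  then show "c f *\<^sub>L f 1\<^sub>L = 0\<^sub>L" using zero[OF f] by simp
 qed simp
 ultimately have "c h = 0\<^sub>L" using hom(3)[of h "1\<^sub>L" "1\<^sub>L"] cc[of h] by simp
 then show ?case using zero[of f] insert.prems(5) by (cases "f = h") simp_all
qed simp

text \<open>Artin's theorem: an automorphism \<open>\<tau>\<close> over the fixed field leaves the trace invariant, so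
 the characters in \<open>\<tau>G\<close> and \<open>G\<close> are dependent, whence \<open>\<tau>G\<close> meets \<open>G\<close>.\<close>

lemma galois_group: "G = {g \<in> ring_iso L L \<inter> extensional (car L). ALL x:fixed_field. g x = x}"
proof (intro equalityI subsetI)
 fix g assume "g : G"
 then show "g : {g \<in> ring_iso L L \<inter> extensional (car L). ALL x:fixed_field. g x = x}"
  using G_carrier[of g] gD(1)[of g] by (auto simp: carrier_alg_aut ring_iso_def fixed_field_def)
next
 fix \<tau> assume "\<tau> : {g \<in> ring_iso L L \<inter> extensional (car L). ALL x:fixed_field. g x = x}"
 then have \<tau>: "\<tau> : ring_hom L L" "bij_betw \<tau> (car L) (car L)" "\<tau> : extensional (car L)"
  and fix_\<tau>: "\<And>x. x : fixed_field ==> \<tau> x = x" by (auto simp: ring_iso_def)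
 have \<tau>D: "\<tau> x : car L" "\<tau> (x *\<^sub>L y) = \<tau> x *\<^sub>L \<tau> y" "\<tau> (x +\<^sub>L y) = \<tau> x +\<^sub>L \<tau> y" "\<tau> 1\<^sub>L = 1\<^sub>L"
  if "x : car L" "y : car L" for x y using \<tau>(1) that by (auto simp: ring_hom_def)
 have "\<tau> (c \<odot>\<^sub>L x) = c \<odot>\<^sub>L \<tau> x" if c: "c : car k" and x: "x : car L" for c x
 proof -
  have "c \<odot>\<^sub>L 1\<^sub>L : fixed_field" using c scalars_\<Gamma> by (auto simp: scalars_def \<Gamma>_eq)
  then have "\<tau> ((c \<odot>\<^sub>L 1\<^sub>L) *\<^sub>L x) = (c \<odot>\<^sub>L 1\<^sub>L) *\<^sub>L \<tau> x"
   using c x by (simp add: \<tau>D fix_\<tau>)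
  then show ?thesis using c x \<tau>D(1)[OF x x] by (simp add: N.smult_mult_left)
 qed
 then have \<tau>a: "\<tau> : car (alg_aut k L)"
  using \<tau> by (auto simp: carrier_alg_aut alg_hom_def)
 show "\<tau> : G"
 proof (rule ccontr)
  assume no: "\<tau> \<notin> G"
  let ?\<tau>G = "(%g. \<tau> *\<^sub>(alg_aut k L) g) ` G"
  have disj: "?\<tau>G \<inter> G = {}"
  proof (rule ccontr)
   assume "?\<tau>G \<inter> G ~= {}"
   then obtain g where g: "g : G" "\<tau> *\<^sub>(alg_aut k L) g : G" by blast
   then have "(\<tau> *\<^sub>(alg_aut k L) g) *\<^sub>(alg_aut k L) inv\<^bsub>alg_aut k L\<^esub> g : G"
    using G_mult G_inv by blast
   then show False using no g \<tau>a G_carrier by (simp add: A.m_assoc)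
  qed
  have carr: "f : car (alg_aut k L)" if "f : ?\<tau>G \<union> G" for f
   using that \<tau>a G_carrier by auto
  have hom: "f : ring_hom L L" if "f : ?\<tau>G \<union> G" for f
   using carr[OF that] by (simp add: carrier_alg_aut alg_hom_def)
  have fc: "f x : car L" if "f : ?\<tau>G \<union> G" "x : car L" for f x
   using hom[OF that(1)] that(2) by (auto simp: ring_hom_def)
  \<comment> \<open>With these coefficients the sum at \<open>x\<close> is \<tau>(tr x) - tr
    x.\<close>
  let ?c = "%f. if f : G then \<ominus>\<^sub>L 1\<^sub>L else 1\<^sub>L"
  have e: "\<one>\<^bsub>alg_aut k L\<^esub> : ?\<tau>G \<union> G" using G_one by blast
  have "?c \<one>\<^bsub>alg_aut k L\<^esub> = 0\<^sub>L"
  proof (rule dedekind[where \<Phi> = "?\<tau>G \<union> G" and c = ?c and f = "\<one>\<^bsub>alg_aut k L\<^esub>"])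
   show "EX x:car L. f x ~= g x" if "f : ?\<tau>G \<union> G" "g : ?\<tau>G \<union> G" "f ~= g" for f g
    using N.alg_aut_eqI[OF carr carr] that by blast
   fix x assume x: "x : car L"
   have inj: "inj_on (%g. \<tau> *\<^sub>(alg_aut k L) g) G"
    using \<tau>a G_carrier by (auto simp: inj_on_def)
   have "(\<Oplus>\<^sub>L f\<in>?\<tau>G \<union> G. ?c f *\<^sub>L f x) = (\<Oplus>\<^sub>L f\<in>?\<tau>G. ?c f *\<^sub>L f x) +\<^sub>L (\<Oplus>\<^sub>L f\<in>G. ?c f *\<^sub>L f x)"
    by (rule L.finsum_Un_disjoint) (use G_finite disj fc x in auto)
   also have "(\<Oplus>\<^sub>L f\<in>?\<tau>G. ?c f *\<^sub>L f x) = (\<Oplus>\<^sub>L f\<in>?\<tau>G. f x)"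
   proof (rule L.finsum_cong')
    fix f assume "f : ?\<tau>G"
    then show "?c f *\<^sub>L f x = f x" using disj fc[of f x] x by auto
   qed (use fc x in auto)
   also have "\<dots> = (\<Oplus>\<^sub>L g\<in>G. (\<tau> *\<^sub>(alg_aut k L) g) x)"
    by (rule L.finsum_reindex[OF _ inj]) (use fc x in auto)
   also have "\<dots> = (\<Oplus>\<^sub>L g\<in>G. \<tau> (g x))"
    by (rule L.finsum_cong') (use x gD(2) \<tau>D(1) N.alg_aut_mult_apply[OF \<tau>a G_carrier] in auto)
   also have "\<dots> = \<tau> (tr x)"
    unfolding tr_def
    by (rule ring_hom_zero_neg(4)[OF \<tau>(1) L.ring_axioms L.ring_axioms, symmetric]) (use x gD(2) in auto)
   also have "\<dots> = tr x" using fix_\<tau> tr_fixed x by blast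
   also have "(\<Oplus>\<^sub>L f\<in>G. ?c f *\<^sub>L f x) = (\<Oplus>\<^sub>L f\<in>G. (\<ominus>\<^sub>L 1\<^sub>L) *\<^sub>L f x)"
    by (rule L.finsum_cong') (use x gD(2) in auto)
   also have "\<dots> = (\<ominus>\<^sub>L 1\<^sub>L) *\<^sub>L tr x"
    unfolding tr_def by (rule L.finsum_rdistr[symmetric]) (use x gD(2) G_finite in auto)
   also have "tr x +\<^sub>L (\<ominus>\<^sub>L 1\<^sub>L) *\<^sub>L tr x = 0\<^sub>L"
    using tr_closed[OF x] by (simp add: L.l_minus L.r_neg)
   finally show "(\<Oplus>\<^sub>L f\<in>?\<tau>G \<union> G. ?c f *\<^sub>L f x) = 0\<^sub>L" .
  qed (use G_finite hom e in auto)
  then have "\<ominus>\<^sub>L 1\<^sub>L = 0\<^sub>L" using G_one(1) by simp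
  then have "\<ominus>\<^sub>L (\<ominus>\<^sub>L 1\<^sub>L) = 0\<^sub>L" by simp
  then show False by simp
 qed
qed

lemma galois: "finite_galois_extension L (fractions_in L \<Gamma>) G"
 unfolding finite_galois_extension_def fractions_\<Gamma>
 using field_L fixed_subfield finite_dim galois_group by (auto simp: fixed_field_def)

section \<open>The invariant ring is Noetherian\<close>

lemma acc_scalars: "L.acc (scalars k L)"
proof -
 have zero_or_all: "I = {0\<^sub>L} \<or> I = scalars k L" if I: "L.rel_ideal (scalars k L) I" for I
 proof (cases "I \<subseteq> {0\<^sub>L}")
  case True
  then show ?thesis using I by (auto simp: L.rel_ideal_def)
 next
  case False
  then obtain a where a: "a : I" "a ~= 0\<^sub>L" by blast
  then obtain c where c: "c : car k" "a = c \<odot>\<^sub>L 1\<^sub>L" using I by (auto simp: L.rel_ideal_def scalars_def)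
  have "c ~= 0\<^sub>k"
  proof
   assume "c = 0\<^sub>k"
   then show False using a(2) c(2) by simp
  qed
  then have cu: "c : Units k" using c(1) k.field_Units by blast
  have "e : I" if e: "e : scalars k L" for e
  proof -
   obtain d where d: "d : car k" "e = d \<odot>\<^sub>L 1\<^sub>L" using e by (auto simp: scalars_def)
   let ?q = "(d *\<^sub>k inv\<^bsub>k\<^esub> c) \<odot>\<^sub>L 1\<^sub>L"
   have "?q *\<^sub>L a = (d *\<^sub>k inv\<^bsub>k\<^esub> c *\<^sub>k c) \<odot>\<^sub>L 1\<^sub>L"
    using c d cu by (simp add: N.smult_mult_left N.smult_assoc1[symmetric] del: k.Units_l_inv)
   also have "d *\<^sub>k inv\<^bsub>k\<^esub> c *\<^sub>k c = d" using c d cu by (simp add: k.m_assoc)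
   finally have "?q *\<^sub>L a = e" using d by simp
   moreover have "?q : scalars k L" using c d cu by (auto simp: scalars_def)
   ultimately show ?thesis using I a by (auto simp: L.rel_ideal_def)
  qed
  then show ?thesis using I by (auto simp: L.rel_ideal_def)
 qed
 show ?thesis
  unfolding L.acc_def
 proof (intro allI impI)
  fix I :: "nat => 'l set"
  assume I: "\<forall>m. L.rel_ideal (scalars k L) (I m)" and chain: "\<forall>m. I m \<subseteq> I (Suc m)"
  have mono: "I m \<subseteq> I m'" if "m \<le> m'" for m m' using lift_Suc_mono_le[of I] chain that by blast
  show "\<exists>N. \<forall>m\<ge>N. I m = I N"
  proof (cases "\<exists>N. I N = scalars k L")
   case True
   then obtain N where N: "I N = scalars k L" by blast
   have "I m = I N" if "m \<ge> N" for m
    using mono[OF that] N I unfolding L.rel_ideal_def by blast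
   then show ?thesis by blast
  next
   case False
   then have "I m = {0\<^sub>L}" for m using zero_or_all I by blast
   then show ?thesis by simp
  qed
 qed
qed

text \<open>\<open>hilbert_basis\<close> is applied for each generator in turn, from the field of
  scalars upward.\<close>

lemma acc_T: "L.acc T"
proof -
 obtain Y where Y: "finite Y" "Y \<subseteq> T" "generate_ring L (scalars k L \<union> Y) = T"
  using T_fin_gen by blast
 have SL: "scalars k L \<subseteq> car L" using scalars_T T_simps(1) by blast
 have "L.acc (generate_ring L (scalars k L \<union> Z))" if "finite Z" "Z \<subseteq> car L" for Z
  using that
 proof (induction Z)
  case empty
  have "generate_ring L (scalars k L \<union> {}) = scalars k L"
   using L.generate_ringI[OF SL N.scalars_subring] by auto
  then show ?case using acc_scalars by simp
 next
  case (insert z Z)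
  let ?E = "generate_ring L (scalars k L \<union> Z)" and ?E' = "generate_ring L (scalars k L \<union> insert z Z)"
  have c: "scalars k L \<union> Z \<subseteq> car L" "scalars k L \<union> insert z Z \<subseteq> car L" using SL insert by auto
  have E: "subring ?E L" and E': "subring ?E' L" using L.generate_ring_is_subring c by auto
  have incl: "scalars k L \<union> Z \<subseteq> ?E" "scalars k L \<union> insert z Z \<subseteq> ?E'"
   using L.generate_ringE(2)[OF c(1) refl] L.generate_ringE(2)[OF c(2) refl] .
  have zE: "insert z ?E \<subseteq> car L" using insert subringE(1)[OF E] by auto
  have "generate_ring L (insert z ?E) = ?E'"
  proof
   have "?E \<subseteq> ?E'" by (rule L.mono_generate_ring) (use c in auto)
   then show "generate_ring L (insert z ?E) \<subseteq> ?E'"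
    by (intro L.generate_ring_min_subring1[OF zE E']) (use incl in auto)
   show "?E' \<subseteq> generate_ring L (insert z ?E)"
    by (rule L.generate_ring_min_subring1[OF c(2) L.generate_ring_is_subring[OF zE]])
     (use incl L.generate_ringE(2)[OF zE refl] in auto)
  qed
  then show ?case using L.hilbert_basis[OF E, of z] insert by simp
 qed
 then show ?thesis using Y T_simps(1) by (metis order_trans)
qed

text \<open>An ideal \<open>J\<close> of \<Gamma> is recovered from its extension to
  \<open>T\<close>: the trace maps the extension back into \<open>J\<close>, because tr(t j) = tr(t)
  j, and on \<Gamma> the trace is multiplication by |G|. So the chain condition descends from
  \<open>T\<close>.\<close>

lemma acc_\<Gamma>: "L.acc \<Gamma>"
 unfolding L.acc_def
proof (intro allI impI)
 fix J :: "nat => 'l set"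
 assume J: "\<forall>m. L.rel_ideal \<Gamma> (J m)" and chain: "\<forall>m. J m \<subseteq> J (Suc m)"
 let ?I = "%m. L.span {t *\<^sub>L j | t j. t : T & j : J m}"
 have Jc: "J m \<subseteq> \<Gamma>" for m using J by (auto simp: L.rel_ideal_def)
 have c: "{t *\<^sub>L j | t j. t : T & j : J m} \<subseteq> T" for m
  using Jc \<Gamma>_T T_simps(6) by blast
 have cL: "{t *\<^sub>L j | t j. t : T & j : J m} \<subseteq> car L" for m by (rule order_trans[OF c T_simps(1)])
 have I: "L.rel_ideal T (?I m)" for m
  unfolding L.rel_ideal_def
 proof (intro conjI ballI)
  show "?I m \<subseteq> T" by (rule L.span_minimal[OF c L.subring_subgroup[OF T_subring]])
  show "0\<^sub>L : ?I m" by (rule L.span_simps(3))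
  show "a +\<^sub>L b : ?I m" if "a : ?I m" "b : ?I m" for a b using that by (rule L.span_simps(4))
  fix e a assume e: "e : T" and a: "a : ?I m"
  have ec: "e : car L" using e T_simps(1) by auto
  show "e *\<^sub>L a : ?I m"
  proof (rule L.span_mult[OF L.span_subgroup[OF cL] _ cL, of "{e}"])
   fix y z assume "y : {e}" "z : {t *\<^sub>L j | t j. t : T & j : J m}"
   then obtain t j where tj: "y = e" "z = t *\<^sub>L j" "t : T" "j : J m" by blast
   have "t : car L" "j : car L" using tj T_simps(1) Jc \<Gamma>_simps(1) by auto
   then have "y *\<^sub>L z = (e *\<^sub>L t) *\<^sub>L j" using tj ec by (simp add: L.m_assoc)
   then show "y *\<^sub>L z : ?I m" using tj e T_simps(6)[of e t] by (intro L.span_simps(2)) blast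
  qed (use ec a L.span_simps(2) in auto)
 qed
 have tr_J: "tr a : J m" if "a : ?I m" for a m
  using that cL[of m]
 proof (induction a rule: L.span_induct)
  case zero
  have "tr 0\<^sub>L = (\<Oplus>\<^sub>L g\<in>G. 0\<^sub>L)" unfolding tr_def by (rule L.finsum_cong') (use g_zero in auto)
  then show ?case using J by (simp add: L.rel_ideal_def)
 next
  case (base a)
  then obtain t j where tj: "a = t *\<^sub>L j" "t : T" "j : J m" by blast
  have jc: "t : car L" "j : car L" "j : fixed_field" using tj T_simps(1) Jc \<Gamma>_simps(1) by (auto simp: \<Gamma>_eq)
  then have "tr a = tr t *\<^sub>L j" using tr_mult[of j t] tr_closed[of t] by (simp add: tj(1) L.m_comm)
  then show ?case using tr_T[OF tj(2)] tj J by (auto simp: L.rel_ideal_def)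
 next
  case (neg y)
  have "tr y +\<^sub>L tr (\<ominus>\<^sub>L y) = tr 0\<^sub>L" using neg tr_add[of y "\<ominus>\<^sub>L y"] by (simp add: L.r_neg)
  moreover have "tr 0\<^sub>L = 0\<^sub>L" using tr_add[of "0\<^sub>L" "0\<^sub>L"] tr_closed[of "0\<^sub>L"]
   by (metis L.add.r_cancel_one' L.r_zero L.zero_closed)
  ultimately have "tr (\<ominus>\<^sub>L y) = 0\<^sub>L \<ominus>\<^sub>L tr y"
   using neg tr_closed[of y] tr_closed[of "\<ominus>\<^sub>L y"]
   by (simp add: a_minus_def) (metis L.a_comm L.minus_equality L.a_inv_closed)
  then show ?case
   using L.rel_ideal_minus[OF \<Gamma>_subring, of "J m" "0\<^sub>L" "tr y"] J neg by (auto simp: L.rel_ideal_def)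
 next
  case (add y z)
  then show ?case using tr_add J by (auto simp: L.rel_ideal_def)
 qed
 have I_\<Gamma>: "a : J m" if "a : ?I m" "a : \<Gamma>" for a m
 proof -
  have "inv_card *\<^sub>L tr a : J m"
   using tr_J[OF that(1)] inv_card(1) scalars_\<Gamma> J unfolding L.rel_ideal_def by blast
  then show ?thesis using tr_of_fixed[of a] that(2) by (simp add: \<Gamma>_eq)
 qed
 have J_I: "J m \<subseteq> ?I m" for m
 proof
  fix a assume "a : J m"
  moreover from this have "a = 1\<^sub>L *\<^sub>L a" using subsetD[OF \<Gamma>_simps(1) subsetD[OF Jc]] by simp
  ultimately show "a : ?I m" using T_simps(3) by (intro L.span_simps(2)) blast
 qed
 have mono: "J m \<subseteq> J m'" if "m \<le> m'" for m m' using lift_Suc_mono_le[of J] chain that by blast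
 have "?I m \<subseteq> ?I (Suc m)" for m by (rule L.span_mono) (use chain in blast)
 then have "\<exists>N. \<forall>m\<ge>N. ?I m = ?I N"
  using acc_T[unfolded L.acc_def, rule_format, of ?I] I by simp
 then obtain N where N: "\<forall>m\<ge>N. ?I m = ?I N" by (rule exE)
 have "J m = J N" if m: "m \<ge> N" for m
 proof
  show "J N \<subseteq> J m" using mono m .
  show "J m \<subseteq> J N"
  proof
   fix a assume a: "a : J m"
   then have "a : ?I m" by (rule subsetD[OF J_I])
   then have "a : ?I N" by (simp only: N[rule_format, OF m])
   then show "a : J N" by (rule I_\<Gamma>) (rule subsetD[OF Jc a])
  qed
 qed
 then show "\<exists>N. \<forall>m\<ge>N. J m = J N" by blast
qed

lemma noetherian_\<Gamma>: "noetherian_domain (L\<lparr>carrier := \<Gamma>\<rparr>)"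
 using L.acc_imp_noetherian[OF \<Gamma>_subring acc_\<Gamma>] L.subring_is_domain[OF \<Gamma>_subring]
 by (simp add: noetherian_domain_def)

end

section \<open>Symmetric generators of a commutative subring\<close>

text \<open>The commuting \<open>x i\<close> generate a commutative ring, in which each is a root of
  a monic polynomial with its lower coefficients in \<open>E\<close>; hence finiteness over the ring
  generated by \<open>E\<close>. An endomorphism that permutes the \<open>x i\<close> fixes these
  coefficients.\<close>

lemma (in ring) symmetric_generators:
 assumes I: "finite I" and x: "x : I \<rightarrow> car R"
  and comm: "ALL i:I. ALL j:I. x i \<otimes> x j = x j \<otimes> x i"
 obtains E B where "finite E" "E \<subseteq> generate_ring R (x ` I)" "finite B" "B \<subseteq> monomials (x ` I)"
  and "generate_ring R (x ` I) = span {e \<otimes> b | e b. e : generate_ring R E & b : B}"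
  and "ALL a:generate_ring R (x ` I). ALL b:generate_ring R (x ` I). a \<otimes> b = b \<otimes> a"
  and "ALL h:ring_hom R R. \<forall>\<tau>. bij_betw \<tau> I I --> (ALL i:I. h (x i) = x (\<tau> i)) --> (ALL e:E. h e = e)"
proof -
 let ?C = "generate_ring R (x ` I)"
 have xI: "x ` I \<subseteq> car R" using x by auto
 have C: "subring ?C R" by (rule generate_ring_is_subring[OF xI])
 note CR = subringE(1)[OF C]
 have xC: "x ` I \<subseteq> ?C" by (rule generate_ringE(2)[OF xI refl])
 have comm1: "x i \<otimes> a = a \<otimes> x i" if i: "i : I" and a: "a : ?C" for i a
  by (rule generate_ring_commute[OF xI _ _ a]) (use i x comm in auto)
 have commC: "a \<otimes> b = b \<otimes> a" if a: "a : ?C" and b: "b : ?C" for a b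
  by (rule generate_ring_commute[OF xI _ _ b]) (use comm1[OF _ a] a CR in auto)
 let ?R = "R\<lparr>carrier := ?C\<rparr>"
 \<comment> \<open>\<open>elem_sym\<close> belongs to commutative rings, so the work is done in the
   generated subring; its powers and additive spans agree with those of the ambient ring.\<close>
 interpret C: cring ?R
  by (intro cring.intro subring_is_ring[OF C] comm_monoid.intro comm_monoid_axioms.intro
    ring.is_monoid) (use commC in auto)
 have xC': "x : I \<rightarrow> car ?R" using xC by auto
 let ?n = "card I"
 define E where "E = C.elem_sym x I ` {1..?n}"
 have E: "finite E" "E \<subseteq> ?C" using C.elem_sym_closed[OF xC'] by (auto simp: E_def)
 have ER: "E \<subseteq> car R" using E CR by blast
 let ?G = "generate_ring R E"
 have G: "subring ?G R" by (rule generate_ring_is_subring[OF ER])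
 have GC: "?G \<subseteq> ?C" by (rule generate_ring_min_subring1[OF ER C E(2)])
 have root: "integral_over ?G y" if "y : x ` I" for y
 proof -
  obtain j where j: "j : I" "y = x j" using \<open>y : x ` I\<close> by blast
  have yR: "y : car R" using j x by auto
  let ?Z = "{e \<otimes> y [^] i | e i. e : E & i < ?n}" and ?Z' = "{e \<otimes> y [^] i | e i. e : ?G & i < ?n}"
  have pw: "y [^]\<^bsub>?R\<^esub> i = y [^] i" for i :: nat by (simp add: nat_pow_def)
  have "y [^] ?n : C.span ?Z"
   using C.elem_sym_root[OF I xC' j(1)] by (simp add: E_def j(2)[symmetric] pw)
  also have "C.span ?Z = span ?Z"
  proof -
   have "y [^] i : ?C" for i :: nat
    using C.nat_pow_closed[of y i] j xC pw by auto
   then have "?Z \<subseteq> ?C" using E(2) subringE(6)[OF C] by blast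
   from add.generate_consistent[OF this subring_subgroup[OF C]] show ?thesis by simp
  qed
  also have "span ?Z \<subseteq> span ?Z'"
   by (rule span_mono) (use generate_ringE(2)[OF ER refl] in blast)
  finally show ?thesis unfolding integral_over_def by blast
 qed
 have "\<exists>B. finite B & B \<subseteq> monomials (x ` I) &
   generate_ring R (?G \<union> x ` I) = span {e \<otimes> b | e b. e : ?G & b : B}"
 proof (rule generate_ring_integral[OF G _ xI])
  show "a \<otimes> b = b \<otimes> a" if "a : ?G \<union> x ` I" "b : x ` I" for a b
   using commC that GC xC by blast
 qed (use I root in auto)
 then obtain B where B: "finite B" "B \<subseteq> monomials (x ` I)"
   "generate_ring R (?G \<union> x ` I) = span {e \<otimes> b | e b. e : ?G & b : B}" by blast
 have GxR: "?G \<union> x ` I \<subseteq> car R" using subringE(1)[OF G] xI by blast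
 have "generate_ring R (?G \<union> x ` I) = ?C"
 proof
  show "generate_ring R (?G \<union> x ` I) \<subseteq> ?C"
   by (rule generate_ring_min_subring1[OF GxR C]) (use GC xC in blast)
  show "?C \<subseteq> generate_ring R (?G \<union> x ` I)"
   by (rule mono_generate_ring) (use GxR in auto)
 qed
 then have B3: "?C = span {e \<otimes> b | e b. e : ?G & b : B}" using B(3) by simp
 have inv: "h e = e"
  if h: "h : ring_hom R R" and \<tau>: "bij_betw \<tau> I I" "ALL i:I. h (x i) = x (\<tau> i)" and e: "e : E" for h \<tau> e
 proof -
  interpret h: ring_hom_ring R R h
   by (intro ring_hom_ringI2 ring_axioms h)
  \<comment> \<open>Invariance of \<open>elem_sym\<close> is available inside the subring only, so
    \<open>h\<close> must first be seen to map the subring into itself.\<close>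
  have D: "subring {a \<in> car R. h a : ?C} R"
   by (rule subringI) (use subringE[OF C] in auto)
  have "?C \<subseteq> {a \<in> car R. h a : ?C}"
   by (rule generate_ring_min_subring1[OF xI D]) (use x xC \<tau> bij_betwE[OF \<tau>(1)] in auto)
  then have "h : ring_hom ?R ?R"
   using CR by (intro ring_hom_memI) (auto simp: subset_iff)
  then show ?thesis
   using C.elem_sym_invariant[OF _ I xC' \<tau>(1)] \<tau>(2) e by (auto simp: E_def)
 qed
 have "ALL a:?C. ALL b:?C. a \<otimes> b = b \<otimes> a" using commC by blast
 moreover have "ALL h:ring_hom R R. \<forall>\<tau>. bij_betw \<tau> I I --> (ALL i:I. h (x i) = x (\<tau> i)) --> (ALL e:E. h e = e)"
  using inv by blast
 ultimately show ?thesis by (rule that[OF E B(1,2) B3])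
qed

section \<open>Skew monoid rings over Galois extensions\<close>

text \<open>\<open>M\<close> is the group Z^n, kept abstract. Torsion-freeness is what keeps its
  action apart from the finite group \<open>G\<close>.\<close>

locale galois_skew = galois_data k L T G
 for k :: "('k, 'x) ring_scheme" and L :: "('k, 'l, 'y) module_scheme"
  and T :: "'l set" and G :: "('l => 'l) set" +
 fixes M :: "('m, 'z) monoid_scheme" and act :: "'m => 'l => 'l"
 assumes group_M: "group M"
  and act_hom: "act : hom M (alg_aut k L)" and act_inj: "inj_on act (car M)"
  and torsion_free: "\<And>m j. [|m : car M; (j::nat) > 0; m [^]\<^sub>M j = 1\<^sub>M|] ==> m = 1\<^sub>M"
  and act_T: "[|m : car M; t : T|] ==> act m t : T"
  and conj_stable: "[|g : G; m : car M|] ==>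
   g *\<^sub>(alg_aut k L) act m *\<^sub>(alg_aut k L) inv\<^bsub>alg_aut k L\<^esub> g : act ` car M"
begin

sublocale M: group M by (rule group_M)

lemma act_aut: "m : car M ==> act m : car (alg_aut k L)"
 using act_hom by (auto simp: hom_def)

lemma act_mult: "[|m : car M; m' : car M|] ==> act (m *\<^sub>M m') = act m *\<^sub>(alg_aut k L) act m'"
 using act_hom by (auto simp: hom_def)

lemma act_hom_group: "group_hom M (alg_aut k L) act"
 by (intro group_hom.intro group_M A.group_axioms group_hom_axioms.intro act_hom)

lemma act_one: "act 1\<^sub>M = \<one>\<^bsub>alg_aut k L\<^esub>"
 using group_hom.hom_one[OF act_hom_group] .

sublocale W: skew_ring k L M act
proof (intro skew_ring.intro skew_ring_axioms.intro N.nc_algebra_axioms M.is_monoid)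
 show "act m : alg_hom k L L" if "m : car M" for m
  using act_aut[OF that] by (simp add: carrier_alg_aut)
 show "act (m *\<^sub>M m') x = act m (act m' x)"
  if "m : car M" "m' : car M" "x : car L" for m m' x
  using act_mult[OF that(1,2)] N.alg_aut_mult_apply[OF act_aut act_aut] that by simp
 show "act 1\<^sub>M x = x" if "x : car L" for x
  using that by (simp add: act_one alg_aut_one)
qed

abbreviation S where "S \<equiv> skew_monoid_ring L M act"

abbreviation \<iota> where "\<iota> \<equiv> single L 1\<^sub>M"

lemma ring_S: "ring S" by (rule W.ring_S)

lemma \<iota>_simps:
 "x : car L ==> \<iota> x : car S"
 "[|x : car L; y : car L|] ==> \<iota> (x *\<^sub>L y) = \<iota> x *\<^sub>S \<iota> y"
 "[|x : car L; y : car L|] ==> \<iota> (x +\<^sub>L y) = \<iota> x +\<^sub>S \<iota> y"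
 "\<iota> 1\<^sub>L = 1\<^sub>S" "\<iota> 0\<^sub>L = 0\<^sub>S" "x : car L ==> \<iota> (\<ominus>\<^sub>L x) = \<ominus>\<^sub>S \<iota> x"
 using ring_hom_closed[OF W.single_ring_hom] ring_hom_mult[OF W.single_ring_hom]
  ring_hom_add[OF W.single_ring_hom] ring_hom_one[OF W.single_ring_hom]
  ring_hom_zero_neg(1,2)[OF W.single_ring_hom L.ring_axioms ring_S] by auto

text \<open>\<open>cnj g m\<close> is the element of the monoid acting as $g m g^{-1}$.\<close>

definition cnj where
 "cnj g m = the_inv_into (car M) act (g *\<^sub>(alg_aut k L) act m *\<^sub>(alg_aut k L) inv\<^bsub>alg_aut k L\<^esub> g)"

lemma cnj:
 assumes "g : G" "m : car M"
 shows "cnj g m : car M"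
  and "act (cnj g m) = g *\<^sub>(alg_aut k L) act m *\<^sub>(alg_aut k L) inv\<^bsub>alg_aut k L\<^esub> g"
 using the_inv_into_into[OF act_inj conj_stable[OF assms] subset_refl]
  f_the_inv_into_f[OF act_inj conj_stable[OF assms]] by (auto simp: cnj_def)

lemma cnj_unique:
 assumes "m' : car M" "act m' = g *\<^sub>(alg_aut k L) act m *\<^sub>(alg_aut k L) inv\<^bsub>alg_aut k L\<^esub> g"
 shows "cnj g m = m'"
 using the_inv_into_f_f[OF act_inj assms(1)] by (simp add: cnj_def assms(2))

lemma cnj_mult:
 assumes g: "g : G" and m: "m : car M" "m' : car M"
 shows "cnj g (m *\<^sub>M m') = cnj g m *\<^sub>M cnj g m'"
proof (rule cnj_unique)
 note c = G_carrier[OF g] act_aut[OF m(1)] act_aut[OF m(2)]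
 have "inv\<^bsub>alg_aut k L\<^esub> g *\<^sub>(alg_aut k L) (g *\<^sub>(alg_aut k L) (act m' *\<^sub>(alg_aut k L) inv\<^bsub>alg_aut k L\<^esub> g))
   = act m' *\<^sub>(alg_aut k L) inv\<^bsub>alg_aut k L\<^esub> g"
  using c by (simp add: A.m_assoc[symmetric])
 then show "act (cnj g m *\<^sub>M cnj g m') =
   g *\<^sub>(alg_aut k L) act (m *\<^sub>M m') *\<^sub>(alg_aut k L) inv\<^bsub>alg_aut k L\<^esub> g"
  using cnj[OF g] m c by (simp add: act_mult A.m_assoc)
qed (use cnj[OF g] m in auto)

lemma cnj_comp:
 assumes g: "g : G" and h: "h : G" and m: "m : car M"
 shows "cnj (g *\<^sub>(alg_aut k L) h) m = cnj g (cnj h m)"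
 by (rule cnj_unique) (use cnj[OF g] cnj[OF h] m G_carrier[OF g] G_carrier[OF h] act_aut[OF m] in
  \<open>auto simp: A.m_assoc A.inv_mult_group\<close>)

lemma cnj_one: "m : car M ==> cnj \<one>\<^bsub>alg_aut k L\<^esub> m = m"
 by (rule cnj_unique) (use act_aut in auto)

lemma cnj_inv:
 assumes g: "g : G" and m: "m : car M"
 shows "cnj g (cnj (inv\<^bsub>alg_aut k L\<^esub> g) m) = m" "cnj (inv\<^bsub>alg_aut k L\<^esub> g) (cnj g m) = m"
 using cnj_comp[OF g G_inv[OF g] m] cnj_comp[OF G_inv[OF g] g m] cnj_one[OF m] G_carrier[OF g] by auto

lemma cnj_M_one: assumes g: "g : G" shows "cnj g 1\<^sub>M = 1\<^sub>M"
 by (rule cnj_unique) (use G_carrier[OF g] in "auto simp: act_one")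

lemma act_cnj:
 assumes g: "g : G" and m: "m : car M" and x: "x : car L"
 shows "act (cnj g m) (g x) = g (act m x)"
proof -
 note c = G_carrier[OF g] act_aut[OF m] G_carrier[OF G_inv[OF g]]
 have "act (cnj g m) (g x) = g (act m ((inv\<^bsub>alg_aut k L\<^esub> g) (g x)))"
  unfolding cnj(2)[OF g m]
  using N.alg_aut_mult_apply[OF A.m_closed[OF c(1,2)] c(3) gD(2)[OF g x]]
   N.alg_aut_mult_apply[OF c(1,2) gD(2)[OF G_inv[OF g] gD(2)[OF g x]]] by simp
 then show ?thesis using N.alg_aut_inv_apply(2)[OF c(1) x] by simp
qed

abbreviation conj where "conj \<equiv> skew_conj k L M act"

lemma conj_apply:
 assumes "g : G" "m : car M" shows "conj g u m = g (u (cnj (inv\<^bsub>alg_aut k L\<^esub> g) m))"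
 using assms G_carrier by (simp add: skew_conj_def cnj_def)

lemma conj_outside: "m \<notin> car M ==> conj g u m = 0\<^sub>L"
 by (simp add: skew_conj_def)

lemma conj_closed: assumes g: "g : G" and u: "u : car S" shows "conj g u : car S"
proof (rule W.carrierI)
 fix m assume m: "m : car M"
 show "conj g u m : car L"
  using W.carrierD(2)[OF u] gD(2)[OF g] by (simp add: conj_apply[OF g m])
next
 have "{m. conj g u m ~= 0\<^sub>L} \<subseteq> cnj g ` {m. u m ~= 0\<^sub>L}"
 proof
  fix m assume "m : {m. conj g u m ~= 0\<^sub>L}"
  then have nz: "conj g u m ~= 0\<^sub>L" by simp
  then have m: "m : car M" using conj_outside by blast
  have "u (cnj (inv\<^bsub>alg_aut k L\<^esub> g) m) ~= 0\<^sub>L"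
   using nz g_zero[OF g] by (auto simp: conj_apply[OF g m])
  then show "m : cnj g ` {m. u m ~= 0\<^sub>L}" using cnj_inv(1)[OF g m] by force
 qed
 then show "finite {m. conj g u m ~= 0\<^sub>L}" using W.carrierD(4)[OF u] finite_surj by blast
qed (rule conj_outside)

lemma conj_single:
 assumes g: "g : G" and m: "m : car M" and x: "x : car L"
 shows "conj g (single L m x) = single L (cnj g m) (g x)"
proof
 fix p
 show "conj g (single L m x) p = single L (cnj g m) (g x) p"
 proof (cases "p : car M")
  case True
  have "cnj (inv\<^bsub>alg_aut k L\<^esub> g) p = m \<longleftrightarrow> p = cnj g m"
   using cnj_inv[OF g True] cnj_inv[OF g m] by auto
  then show ?thesis using g_zero[OF g] by (simp add: conj_apply[OF g True] single_def)
 next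
  case False
  then show ?thesis using cnj(1)[OF g m] conj_outside by (auto simp: single_def)
 qed
qed

lemma conj_add:
 assumes g: "g : G" and u: "u : car S" and v: "v : car S"
 shows "conj g (u +\<^sub>S v) = conj g u +\<^sub>S conj g v"
proof
 fix m
 show "conj g (u +\<^sub>S v) m = (conj g u +\<^sub>S conj g v) m"
  using gD(4)[OF g W.carrierD(2)[OF u] W.carrierD(2)[OF v]]
  by (cases "m : car M") (simp_all add: conj_apply[OF g] conj_outside W.add_apply)
qed

lemma conj_hom: assumes g: "g : G" shows "conj g : ring_hom S S"
proof (rule W.additive_hom_mult[OF ring_S conj_closed[OF g] conj_add[OF g]])
 fix p q a b
 assume p: "p : car M" "q : car M" and a: "a : car L" "b : car L"
 have pb: "act p b : car L" using p a by simp
 show "conj g (single L (p *\<^sub>M q) (a *\<^sub>L act p b)) = conj g (single L p a) *\<^sub>S conj g (single L q b)"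
  using p a pb cnj(1)[OF g] gD(2)[OF g] gD(3)[OF g a(1) pb] act_cnj[OF g p(1) a(2)]
  by (simp add: conj_single[OF g] W.single_mult cnj_mult[OF g])
next
 show "conj g 1\<^sub>S = 1\<^sub>S"
  using gD(5)[OF g] cnj_M_one[OF g] by (simp add: W.one_eq conj_single[OF g])
qed

lemma conj_comp:
 assumes g: "g : G" and h: "h : G" and u: "u : car S"
 shows "conj (g *\<^sub>(alg_aut k L) h) u = conj g (conj h u)"
proof
 fix m
 show "conj (g *\<^sub>(alg_aut k L) h) u m = conj g (conj h u) m"
 proof (cases "m : car M")
  case True
  have "inv\<^bsub>alg_aut k L\<^esub> (g *\<^sub>(alg_aut k L) h) = inv\<^bsub>alg_aut k L\<^esub> h *\<^sub>(alg_aut k L) inv\<^bsub>alg_aut k L\<^esub> g"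
   using g h G_carrier by (simp add: A.inv_mult_group)
  then show ?thesis
   using True cnj(1)[OF G_inv[OF g] True] G_mult_apply[OF g h W.carrierD(2)[OF u]]
   by (simp add: conj_apply[OF g] conj_apply[OF h] conj_apply[OF G_mult[OF g h]]
     cnj_comp[OF G_inv[OF h] G_inv[OF g]])
 qed (simp add: conj_outside)
qed

lemmas conjD = ring_hom_closed[OF conj_hom] ring_hom_mult[OF conj_hom] ring_hom_add[OF conj_hom]
 ring_hom_one[OF conj_hom] ring_hom_zero_neg(1)[OF conj_hom ring_S ring_S]
 ring_hom_zero_neg(2)[OF conj_hom ring_S ring_S]

abbreviation Inv where "Inv \<equiv> skew_invariants k L M act G"

lemma Inv_iff: "u : Inv \<longleftrightarrow> u : car S & (ALL g:G. conj g u = u)"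
 by (simp add: skew_invariants_def)

lemma InvD: "u : Inv ==> u : car S" "[|u : Inv; g : G|] ==> conj g u = u"
 by (auto simp: Inv_iff)

lemma Inv_subring: "subring Inv S"
proof (rule W.SA.A.subringI)
 show "Inv \<subseteq> car S" using InvD by blast
 show "1\<^sub>S : Inv" using conjD(4) by (simp add: Inv_iff)
 show "\<ominus>\<^sub>S u : Inv" if "u : Inv" for u using that conjD(6) by (simp add: Inv_iff)
 fix u v assume "u : Inv" "v : Inv"
 then show "u *\<^sub>S v : Inv" "u +\<^sub>S v : Inv" using conjD(2,3) by (simp_all add: Inv_iff)
qed

lemmas Inv_simps = subringE[OF Inv_subring]

lemma \<iota>_fixed: "x : fixed_field ==> \<iota> x : Inv"
 using conj_single[of _ "1\<^sub>M" x] cnj_M_one by (auto simp: Inv_iff fixed_field_def)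

text \<open>The quotient of \<open>m\<close> by \<open>m'\<close> fixes the fixed field pointwise,
  so \<open>galois_group\<close> puts its action into the finite group \<open>G\<close>.
  Faithfulness and torsion-freeness then make it trivial.\<close>

lemma separating:
 assumes m: "m : car M" "m' : car M" and eq: "\<And>x. x : fixed_field ==> act m x = act m' x"
 shows "m = m'"
proof -
 let ?d = "inv\<^bsub>M\<^esub> m' *\<^sub>M m"
 have d: "?d : car M" using m by simp
 have "act ?d x = x" if x: "x : fixed_field" for x
 proof -
  have xL: "x : car L" using x by (simp add: fixed_field_def)
  have "act ?d x = act (inv\<^bsub>M\<^esub> m') (act m' x)" using m xL by (simp add: W.act_mult eq[OF x])
  also have "\<dots> = x" using m xL W.act_mult[of "inv\<^bsub>M\<^esub> m'" m' x] W.act_one by simp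
  finally show ?thesis .
 qed
 then have "act ?d : {g \<in> ring_iso L L \<inter> extensional (car L). ALL x:fixed_field. g x = x}"
  using act_aut[OF d] by (auto simp: carrier_alg_aut alg_hom_def ring_iso_def)
 then have dG: "act ?d : G" by (rule equalityD2[OF galois_group, THEN subsetD])
 interpret GG: group "(alg_aut k L)\<lparr>carrier := G\<rparr>"
  by (rule A.subgroup_imp_group[OF G_subgroup])
 have "act ?d [^]\<^bsub>alg_aut k L\<^esub> card G = \<one>\<^bsub>alg_aut k L\<^esub>"
  using GG.pow_order_eq_1[of "act ?d"] dG by (simp add: order_def A.nat_pow_consistent[symmetric])
 then have "act (?d [^]\<^sub>M card G) = act 1\<^sub>M"
  using group_hom.hom_nat_pow[OF act_hom_group d] act_one by simp
 then have "?d [^]\<^sub>M card G = 1\<^sub>M"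
  using inj_onD[OF act_inj] M.nat_pow_closed[OF d] M.one_closed by blast
 then have "?d = 1\<^sub>M" using torsion_free[OF d card_G] by blast
 then have "m' *\<^sub>M ?d = m'" using m by simp
 then show ?thesis using m by (simp add: M.m_assoc[symmetric])
qed

definition Tr where "Tr u = (\<Oplus>\<^sub>S g\<in>G. conj g u)"

lemma Tr_closed: "u : car S ==> Tr u : car S"
 unfolding Tr_def using conj_closed by (intro W.Sa.finsum_closed) auto

lemma Tr_Inv: assumes u: "u : car S" shows "Tr u : Inv"
proof -
 have "conj h (Tr u) = Tr u" if h: "h : G" for h
 proof -
  have "conj h (Tr u) = (\<Oplus>\<^sub>S g\<in>G. conj h (conj g u))"
   unfolding Tr_def
   by (rule ring_hom_zero_neg(4)[OF conj_hom[OF h] ring_S ring_S]) (use u conj_closed in auto)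
  also have "\<dots> = (\<Oplus>\<^sub>S g\<in>G. conj (h *\<^sub>(alg_aut k L) g) u)"
   by (rule W.Sa.finsum_cong') (use u h conj_closed conj_comp G_mult in auto)
  also have "\<dots> = (\<Oplus>\<^sub>S g\<in>(%g. h *\<^sub>(alg_aut k L) g) ` G. conj g u)"
   by (rule W.Sa.finsum_reindex[symmetric])
    (use G_bij[OF h] u conj_closed G_mult h in "auto simp: bij_betw_def")
  also have "\<dots> = Tr u" unfolding Tr_def using G_bij[OF h] by (simp add: bij_betw_def)
  finally show ?thesis .
 qed
 then show ?thesis using Tr_closed u by (simp add: Inv_iff)
qed

lemma Tr_add:
 assumes "u : car S" "v : car S" shows "Tr (u +\<^sub>S v) = Tr u +\<^sub>S Tr v"
proof -
 have "Tr (u +\<^sub>S v) = (\<Oplus>\<^sub>S g\<in>G. conj g u +\<^sub>S conj g v)"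
  unfolding Tr_def by (rule W.Sa.finsum_cong') (use assms conj_add conj_closed in auto)
 also have "\<dots> = Tr u +\<^sub>S Tr v"
  unfolding Tr_def by (rule W.Sa.finsum_addf) (use assms conj_closed in auto)
 finally show ?thesis .
qed

text \<open>Conjugation fixes the outer factors. Both sides are treated because finite generation
  works with products \<open>c w c'\<close>.\<close>

lemma Tr_mult:
 assumes c: "c : Inv" "c' : Inv" and w: "w : car S"
 shows "Tr (c *\<^sub>S w *\<^sub>S c') = c *\<^sub>S Tr w *\<^sub>S c'"
proof -
 note cc = InvD(1)[OF c(1)] InvD(1)[OF c(2)]
 have "Tr (c *\<^sub>S w *\<^sub>S c') = (\<Oplus>\<^sub>S g\<in>G. c *\<^sub>S conj g w *\<^sub>S c')"
  unfolding Tr_def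
 proof (rule W.Sa.finsum_cong'[OF refl])
  fix g assume g: "g : G"
  show "conj g (c *\<^sub>S w *\<^sub>S c') = c *\<^sub>S conj g w *\<^sub>S c'"
   using conjD(2)[OF g, of "c *\<^sub>S w" c'] conjD(2)[OF g, of c w] cc w InvD(2)[OF c(1) g] InvD(2)[OF c(2) g]
   by simp
 qed (use cc w conj_closed in auto)
 also have "\<dots> = (\<Oplus>\<^sub>S g\<in>G. c *\<^sub>S conj g w) *\<^sub>S c'"
  by (rule W.SA.A.finsum_ldistr[symmetric]) (use cc w conj_closed G_finite in auto)
 also have "(\<Oplus>\<^sub>S g\<in>G. c *\<^sub>S conj g w) = c *\<^sub>S Tr w"
  unfolding Tr_def by (rule W.SA.A.finsum_rdistr[symmetric]) (use cc w conj_closed G_finite in auto)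
 finally show ?thesis .
qed

lemma add_pow_\<iota>: "u : car S ==> [m] \<cdot>\<^sub>S u = \<iota> ([m] \<cdot>\<^sub>L 1\<^sub>L) *\<^sub>S u" for m :: nat
 by (induction m) (auto simp: \<iota>_simps W.SA.A.l_distr)

lemma Tr_of_Inv: assumes u: "u : Inv" shows "\<iota> inv_card *\<^sub>S Tr u = u"
proof -
 note uc = InvD(1)[OF u]
 let ?c = "[card G] \<cdot>\<^sub>L 1\<^sub>L"
 have L: "inv_card : car L" "?c : car L" using inv_card(1) scalars_T T_simps(1) by auto
 have "Tr u = (\<Oplus>\<^sub>S g\<in>G. u)"
  unfolding Tr_def by (rule W.Sa.finsum_cong'[OF refl]) (simp_all add: uc InvD(2)[OF u])
 also have "\<dots> = [card G] \<cdot>\<^sub>S u" using W.Sa.add.finprod_const[OF uc, of G] by simp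
 finally have "\<iota> inv_card *\<^sub>S Tr u = \<iota> inv_card *\<^sub>S (\<iota> ?c *\<^sub>S u)"
  by (simp only: add_pow_\<iota>[OF uc])
 also have "\<dots> = \<iota> (inv_card *\<^sub>L ?c) *\<^sub>S u"
  using W.SA.A.m_assoc[OF \<iota>_simps(1) \<iota>_simps(1) uc] L \<iota>_simps(2)[OF L] by simp
 also have "\<dots> = u"
  using inv_card(2)[OF L.one_closed] uc \<iota>_simps(4) by simp
 finally show ?thesis .
qed

text \<open>Conjugation carries the coefficient at \<open>m\<close> to g m g^{-1}, and this element
  sends g(x) to g(m(x)). For invariant \<open>u\<close> and \<open>x\<close> the value is therefore
  invariant.\<close>

lemma skew_eval_conj:
 assumes g: "g : G" and u: "u : car S" and x: "x : car L"
 shows "skew_eval L act (conj g u) (g x) = g (skew_eval L act u x)"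
proof -
 let ?P = "{m. u m ~= 0\<^sub>L}"
 have P: "finite ?P" "?P \<subseteq> car M" using W.carrierD(4,5)[OF u] by auto
 have uc: "u m : car L" for m using W.carrierD(2)[OF u] .
 have inj: "inj_on (cnj g) ?P" 
  by (rule inj_on_inverseI[where g = "cnj (inv\<^bsub>alg_aut k L\<^esub> g)"]) (rule cnj_inv(2)[OF g subsetD[OF P(2)]])
 have gx: "g x : car L" using gD(2)[OF g x] .
 have sub: "{m. conj g u m ~= 0\<^sub>L} \<subseteq> cnj g ` ?P"
 proof
  fix m assume "m : {m. conj g u m ~= 0\<^sub>L}"
  then have nz: "conj g u m ~= 0\<^sub>L" by simp
  then have m: "m : car M" using conj_outside by blast
  have "u (cnj (inv\<^bsub>alg_aut k L\<^esub> g) m) ~= 0\<^sub>L"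
   using nz g_zero[OF g] by (auto simp: conj_apply[OF g m])
  then show "m : cnj g ` ?P" using cnj_inv(1)[OF g m] by force
 qed
 have "skew_eval L act (conj g u) (g x) = (\<Oplus>\<^sub>L m\<in>cnj g ` ?P. conj g u m *\<^sub>L act m (g x))"
  by (rule W.skew_eval_eq[OF conj_closed[OF g u] gx]) (use P sub cnj(1)[OF g] in auto)
 also have "\<dots> = (\<Oplus>\<^sub>L m\<in>?P. conj g u (cnj g m) *\<^sub>L act (cnj g m) (g x))"
  by (rule L.finsum_reindex[OF _ inj])
   (use W.carrierD(2)[OF conj_closed[OF g u]] P gx cnj(1)[OF g] in "auto simp: subset_iff")
 also have "\<dots> = (\<Oplus>\<^sub>L m\<in>?P. g (u m *\<^sub>L act m x))"
 proof (rule L.finsum_cong'[OF refl])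
  fix m assume "m : ?P"
  then have m: "m : car M" using P by blast
  then have "act m x : car L" using x by simp
  then show "conj g u (cnj g m) *\<^sub>L act (cnj g m) (g x) = g (u m *\<^sub>L act m x)"
   using gD(3)[OF g uc] by (simp add: conj_apply[OF g cnj(1)[OF g m]] cnj_inv(2)[OF g m] act_cnj[OF g m x])
 qed (use P x uc gD(2)[OF g] in "auto simp: subset_iff")
 also have "\<dots> = g (skew_eval L act u x)"
  unfolding skew_eval_def
  by (rule ring_hom_zero_neg(4)[OF gD(1)[OF g] L.ring_axioms L.ring_axioms, symmetric])
   (use P x uc in "auto simp: subset_iff")
 finally show ?thesis .
qed

end

section \<open>Invariants of an order in a skew monoid ring\<close>

text \<open>\<open>B\<close> is the image of the tensor power of \<open>A\<close>;
  \<open>x i\<close> and \<open>y i\<close> are the images of X_i^+ and X_i^-. \<open>B_span\<close>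
  orders products as coefficient, plus-monomial, minus-monomial. Coefficients are moved past the
  first kind only, hence exchange rules for \<open>x\<close>.\<close>

locale galois_order_data = galois_skew k L T G M act
 for k :: "('k, 'x) ring_scheme" and L :: "('k, 'l, 'y) module_scheme"
  and T :: "'l set" and G :: "('l => 'l) set"
  and M :: "('m, 'z) monoid_scheme" and act :: "'m => 'l => 'l" +
 fixes B :: "('m => 'l) set" and I :: "'i set" and x y :: "'i => 'm => 'l"
 assumes B_subring: "subring B (skew_monoid_ring L M act)"
  and B_coef: "u : B ==> u m : T"
  and \<iota>_B: "t : T ==> single L 1\<^sub>M t : B"
  and B_dense: "m : car M ==> EX s:T. s ~= 0\<^sub>L & single L m s : B"
  and B_conj: "[|g : G; u : B|] ==> skew_conj k L M act g u : B"
  and finite_I: "finite I" and xB: "x : I \<rightarrow> B" and yB: "y : I \<rightarrow> B"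
  and x_comm: "ALL i:I. ALL j:I. x i \<otimes>\<^bsub>skew_monoid_ring L M act\<^esub> x j = x j \<otimes>\<^bsub>skew_monoid_ring L M act\<^esub> x i"
  and y_comm: "ALL i:I. ALL j:I. y i \<otimes>\<^bsub>skew_monoid_ring L M act\<^esub> y j = y j \<otimes>\<^bsub>skew_monoid_ring L M act\<^esub> y i"
  and x_left: "[|i : I; t : T|] ==> \<exists>t'\<in>T. x i \<otimes>\<^bsub>skew_monoid_ring L M act\<^esub> single L 1\<^sub>M t =
     single L 1\<^sub>M t' \<otimes>\<^bsub>skew_monoid_ring L M act\<^esub> x i"
  and x_right: "[|i : I; t : T|] ==> \<exists>t'\<in>T. single L 1\<^sub>M t \<otimes>\<^bsub>skew_monoid_ring L M act\<^esub> x i =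
     x i \<otimes>\<^bsub>skew_monoid_ring L M act\<^esub> single L 1\<^sub>M t'"
  and permuted: "g : G ==> \<exists>\<tau>. bij_betw \<tau> I I & (ALL i:I. skew_conj k L M act g (x i) = x (\<tau> i)) &
     (ALL i:I. skew_conj k L M act g (y i) = y (\<tau> i))"
  and B_span: "B \<subseteq> generate (add_monoid (skew_monoid_ring L M act))
     {single L 1\<^sub>M t \<otimes>\<^bsub>skew_monoid_ring L M act\<^esub> p \<otimes>\<^bsub>skew_monoid_ring L M act\<^esub> q | t p q. t : T &
      p : ring.monomials (skew_monoid_ring L M act) (x ` I) &
      q : ring.monomials (skew_monoid_ring L M act) (y ` I)}"
begin

section \<open>Denominators and the Galois property of the invariants\<close>

lemmas B_simps = subringE[OF B_subring]

definition U where "U = B \<inter> Inv"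

lemma U_subring: "subring U S"
 unfolding U_def by (rule W.SA.A.subring_inter[OF B_subring Inv_subring])

lemmas U_simps = subringE[OF U_subring]

lemma \<Gamma>_carrier: "\<gamma> : \<Gamma> ==> \<gamma> : car L" using \<Gamma>_simps(1) by blast

lemma T_carrier: "t : T ==> t : car L" using T_simps(1) by blast

lemma \<iota>_\<Gamma>_U: "\<gamma> : \<Gamma> ==> \<iota> \<gamma> : U"
 using \<iota>_B \<iota>_fixed by (auto simp: U_def \<Gamma>_eq)

lemma quotient_denominator:
 assumes c: "c : car L" and s: "s : car L" "s ~= 0\<^sub>L"
 shows "EX \<gamma>:\<Gamma>. \<gamma> ~= 0\<^sub>L & (EX t:T. c *\<^sub>L \<gamma> = s *\<^sub>L t)"
proof -
 have su: "s : Units L" using s L.field_Units by auto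
 then have q: "inv\<^bsub>L\<^esub> s *\<^sub>L c : car L" using c by simp
 obtain \<gamma> where \<gamma>: "\<gamma> : \<Gamma>" "\<gamma> ~= 0\<^sub>L" "inv\<^bsub>L\<^esub> s *\<^sub>L c *\<^sub>L \<gamma> : T" using denominator[OF q] by blast
 have "s *\<^sub>L (inv\<^bsub>L\<^esub> s *\<^sub>L c *\<^sub>L \<gamma>) = (s *\<^sub>L inv\<^bsub>L\<^esub> s) *\<^sub>L (c *\<^sub>L \<gamma>)"
  using su s c \<Gamma>_carrier[OF \<gamma>(1)] by (simp add: L.m_assoc del: L.Units_r_inv)
 also have "\<dots> = c *\<^sub>L \<gamma>" using su c \<Gamma>_carrier[OF \<gamma>(1)] by simp
 finally show ?thesis using \<gamma> by metis
qed

text \<open>A coefficient standing to the right of \<open>m\<close> is twisted by \<open>m\<close>,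
  so the denominator is chosen for coefficients pulled back by the inverse of \<open>m\<close>. For
  sums the two denominators are multiplied.\<close>

lemma right_denominator:
 assumes "u : car S"
 shows "EX \<gamma>:\<Gamma>. \<gamma> ~= 0\<^sub>L & u *\<^sub>S \<iota> \<gamma> : B"
 using assms
proof (induction u rule: W.skew_induct)
 case zero
 have "0\<^sub>S *\<^sub>S \<iota> 1\<^sub>L : B" using B_simps(2) \<iota>_simps(1) by simp
 then show ?case using \<Gamma>_simps(3) L.one_not_zero by blast
next
 case (single m c)
 obtain s where s: "s : T" "s ~= 0\<^sub>L" "single L m s : B" using B_dense[OF single(1)] by blast
 let ?i = "act (inv\<^bsub>M\<^esub> m)"
 have im: "inv\<^bsub>M\<^esub> m : car M" using single(1) by simp
 have i: "?i z : car L" "act m (?i z) = z" if "z : car L" for z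
  using that im single(1) W.act_mult[of m "inv\<^bsub>M\<^esub> m" z] W.act_one[OF that] by auto
 have sc: "s : car L" using T_carrier[OF s(1)] .
 have "?i s ~= 0\<^sub>L"
 proof
  assume "?i s = 0\<^sub>L"
  then have "s = act m 0\<^sub>L" using i(2)[OF sc] by simp
  then show False using s(2) single(1) by simp
 qed
 then obtain \<gamma> t where \<gamma>: "\<gamma> : \<Gamma>" "\<gamma> ~= 0\<^sub>L" "t : T" "?i c *\<^sub>L \<gamma> = ?i s *\<^sub>L t"
  using quotient_denominator[OF i(1)[OF single(2)] i(1)[OF sc]] by blast
 note cc = \<Gamma>_carrier[OF \<gamma>(1)] T_carrier[OF \<gamma>(3)]
 have "c *\<^sub>L act m \<gamma> = act m (?i c *\<^sub>L \<gamma>)" using i single cc by simp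
 also have "\<dots> = s *\<^sub>L act m t" using i single cc sc by (simp add: \<gamma>(4))
 finally have "single L m c *\<^sub>S \<iota> \<gamma> = single L m s *\<^sub>S \<iota> t"
  using single cc sc by (simp add: W.single_mult)
 also have "\<dots> : B" using B_simps(6)[OF s(3) \<iota>_B[OF \<gamma>(3)]] .
 finally show ?case using \<gamma> by blast
next
 case (add u v)
 then obtain \<gamma> \<delta> where g: "\<gamma> : \<Gamma>" "\<gamma> ~= 0\<^sub>L" "u *\<^sub>S \<iota> \<gamma> : B" "\<delta> : \<Gamma>" "\<delta> ~= 0\<^sub>L" "v *\<^sub>S \<iota> \<delta> : B" by blast
 note c = \<Gamma>_carrier[OF g(1)] \<Gamma>_carrier[OF g(4)]
 have "(u +\<^sub>S v) *\<^sub>S \<iota> (\<gamma> *\<^sub>L \<delta>) = u *\<^sub>S \<iota> (\<gamma> *\<^sub>L \<delta>) +\<^sub>S v *\<^sub>S \<iota> (\<delta> *\<^sub>L \<gamma>)"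
  using add.hyps c by (simp add: W.SA.A.l_distr \<iota>_simps(1) L.m_comm)
 also have "\<dots> = (u *\<^sub>S \<iota> \<gamma>) *\<^sub>S \<iota> \<delta> +\<^sub>S (v *\<^sub>S \<iota> \<delta>) *\<^sub>S \<iota> \<gamma>"
  using add.hyps c by (simp add: \<iota>_simps(1,2) W.SA.A.m_assoc)
 also have "\<dots> : B"
  by (rule B_simps(7)[OF B_simps(6)[OF g(3) \<iota>_B[OF subsetD[OF \<Gamma>_T g(4)]]]
     B_simps(6)[OF g(6) \<iota>_B[OF subsetD[OF \<Gamma>_T g(1)]]]])
 finally have "(u +\<^sub>S v) *\<^sub>S \<iota> (\<gamma> *\<^sub>L \<delta>) : B" .
 moreover have "\<gamma> *\<^sub>L \<delta> : \<Gamma>" using \<Gamma>_simps(6) g by blast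
 moreover have "\<gamma> *\<^sub>L \<delta> ~= 0\<^sub>L" using L.integral c g(2,5) by blast
 ultimately show ?case by blast
qed

text \<open>No twist occurs here: multiplication from the left reaches the coefficient before
  \<open>m\<close> acts.\<close>

lemma left_denominator:
 assumes "u : car S"
 shows "EX \<gamma>:\<Gamma>. \<gamma> ~= 0\<^sub>L & \<iota> \<gamma> *\<^sub>S u : B"
 using assms
proof (induction u rule: W.skew_induct)
 case zero
 have "\<iota> 1\<^sub>L *\<^sub>S 0\<^sub>S : B" using B_simps(2) \<iota>_simps(1) by simp
 then show ?case using \<Gamma>_simps(3) L.one_not_zero by blast
next
 case (single m c)
 obtain s where s: "s : T" "s ~= 0\<^sub>L" "single L m s : B" using B_dense[OF single(1)] by blast
 have sc: "s : car L" using T_carrier[OF s(1)] .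
 obtain \<gamma> t where \<gamma>: "\<gamma> : \<Gamma>" "\<gamma> ~= 0\<^sub>L" "t : T" "c *\<^sub>L \<gamma> = s *\<^sub>L t"
  using quotient_denominator[OF single(2) sc s(2)] by blast
 note cc = \<Gamma>_carrier[OF \<gamma>(1)] T_carrier[OF \<gamma>(3)]
 have "\<gamma> *\<^sub>L c = t *\<^sub>L s" using \<gamma>(4) cc sc single by (simp add: L.m_comm)
 then have "\<iota> \<gamma> *\<^sub>S single L m c = \<iota> t *\<^sub>S single L m s"
  using single cc sc by (simp add: W.single_mult W.act_one)
 also have "\<dots> : B" using B_simps(6)[OF \<iota>_B[OF \<gamma>(3)] s(3)] .
 finally show ?case using \<gamma> by blast
next
 case (add u v)
 then obtain \<gamma> \<delta> where g: "\<gamma> : \<Gamma>" "\<gamma> ~= 0\<^sub>L" "\<iota> \<gamma> *\<^sub>S u : B" "\<delta> : \<Gamma>" "\<delta> ~= 0\<^sub>L" "\<iota> \<delta> *\<^sub>S v : B" by blast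
 note c = \<Gamma>_carrier[OF g(1)] \<Gamma>_carrier[OF g(4)]
 have "\<iota> (\<gamma> *\<^sub>L \<delta>) *\<^sub>S (u +\<^sub>S v) = \<iota> (\<delta> *\<^sub>L \<gamma>) *\<^sub>S u +\<^sub>S \<iota> (\<gamma> *\<^sub>L \<delta>) *\<^sub>S v"
  using add.hyps c by (simp add: W.SA.A.r_distr \<iota>_simps(1) L.m_comm)
 also have "\<dots> = \<iota> \<delta> *\<^sub>S (\<iota> \<gamma> *\<^sub>S u) +\<^sub>S \<iota> \<gamma> *\<^sub>S (\<iota> \<delta> *\<^sub>S v)"
  using add.hyps c by (simp add: \<iota>_simps(1,2) W.SA.A.m_assoc)
 also have "\<dots> : B"
  by (rule B_simps(7)[OF B_simps(6)[OF \<iota>_B[OF subsetD[OF \<Gamma>_T g(4)]] g(3)]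
     B_simps(6)[OF \<iota>_B[OF subsetD[OF \<Gamma>_T g(1)]] g(6)]])
 finally have "\<iota> (\<gamma> *\<^sub>L \<delta>) *\<^sub>S (u +\<^sub>S v) : B" .
 moreover have "\<gamma> *\<^sub>L \<delta> : \<Gamma>" using \<Gamma>_simps(6) g by blast
 moreover have "\<gamma> *\<^sub>L \<delta> ~= 0\<^sub>L" using L.integral c g(2,5) by blast
 ultimately show ?case by blast
qed

lemma inverse_fixed:
 assumes "\<gamma> : \<Gamma>" "\<gamma> ~= 0\<^sub>L"
 shows "inv\<^bsub>L\<^esub> \<gamma> : fixed_field" "inv\<^bsub>L\<^esub> \<gamma> : car L" "\<gamma> *\<^sub>L inv\<^bsub>L\<^esub> \<gamma> = 1\<^sub>L" "inv\<^bsub>L\<^esub> \<gamma> *\<^sub>L \<gamma> = 1\<^sub>L"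
 using L.subfield_m_inv[OF fixed_subfield, of \<gamma>] assms fixed_simps(1) by (auto simp: \<Gamma>_eq)

text \<open>For invariant \<open>u\<close> a right denominator \<gamma> is invariant too, so u
  \<gamma> lies in \<open>U\<close>, and multiplying by the inverse of \<gamma>, which is in the
  fixed field, returns \<open>u\<close>.\<close>

lemma UK: "W.SA.A.span (U <#>\<^sub>S \<iota> ` fractions_in L \<Gamma>) = Inv"
 unfolding fractions_\<Gamma>
proof
 have "U <#>\<^sub>S \<iota> ` fixed_field \<subseteq> Inv"
  unfolding set_mult_def using Inv_simps(6) \<iota>_fixed by (auto simp: U_def)
 then show "W.SA.A.span (U <#>\<^sub>S \<iota> ` fixed_field) \<subseteq> Inv"
  by (rule W.SA.A.span_minimal[OF _ W.SA.A.subring_subgroup[OF Inv_subring]])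
 show "Inv \<subseteq> W.SA.A.span (U <#>\<^sub>S \<iota> ` fixed_field)"
 proof
  fix u assume u: "u : Inv"
  note uc = InvD(1)[OF u]
  obtain \<gamma> where \<gamma>: "\<gamma> : \<Gamma>" "\<gamma> ~= 0\<^sub>L" "u *\<^sub>S \<iota> \<gamma> : B" using right_denominator[OF uc] by blast
  note i = inverse_fixed[OF \<gamma>(1,2)]
  have "u *\<^sub>S \<iota> \<gamma> : Inv" using Inv_simps(6)[OF u] \<iota>_\<Gamma>_U[OF \<gamma>(1)] by (simp add: U_def)
  then have "u *\<^sub>S \<iota> \<gamma> : U" using \<gamma> by (simp add: U_def)
  moreover have "u = (u *\<^sub>S \<iota> \<gamma>) *\<^sub>S \<iota> (inv\<^bsub>L\<^esub> \<gamma>)"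
   using uc i \<Gamma>_carrier[OF \<gamma>(1)] by (simp add: W.SA.A.m_assoc \<iota>_simps(1) \<iota>_simps(2)[symmetric] \<iota>_simps(4))
  ultimately have "u : U <#>\<^sub>S \<iota> ` fixed_field" unfolding set_mult_def using i(1) by blast
  then show "u : W.SA.A.span (U <#>\<^sub>S \<iota> ` fixed_field)" by (rule W.SA.A.span_simps(2))
 qed
qed

lemma KU: "W.SA.A.span (\<iota> ` fractions_in L \<Gamma> <#>\<^sub>S U) = Inv"
 unfolding fractions_\<Gamma>
proof
 have "\<iota> ` fixed_field <#>\<^sub>S U \<subseteq> Inv"
  unfolding set_mult_def using Inv_simps(6) \<iota>_fixed by (auto simp: U_def)
 then show "W.SA.A.span (\<iota> ` fixed_field <#>\<^sub>S U) \<subseteq> Inv"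
  by (rule W.SA.A.span_minimal[OF _ W.SA.A.subring_subgroup[OF Inv_subring]])
 show "Inv \<subseteq> W.SA.A.span (\<iota> ` fixed_field <#>\<^sub>S U)"
 proof
  fix u assume u: "u : Inv"
  note uc = InvD(1)[OF u]
  obtain \<gamma> where \<gamma>: "\<gamma> : \<Gamma>" "\<gamma> ~= 0\<^sub>L" "\<iota> \<gamma> *\<^sub>S u : B" using left_denominator[OF uc] by blast
  note i = inverse_fixed[OF \<gamma>(1,2)]
  have "\<iota> \<gamma> *\<^sub>S u : Inv" using Inv_simps(6)[OF _ u] \<iota>_\<Gamma>_U[OF \<gamma>(1)] by (simp add: U_def)
  then have "\<iota> \<gamma> *\<^sub>S u : U" using \<gamma> by (simp add: U_def)
  moreover have "u = \<iota> (inv\<^bsub>L\<^esub> \<gamma>) *\<^sub>S (\<iota> \<gamma> *\<^sub>S u)"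
   using uc i \<Gamma>_carrier[OF \<gamma>(1)]
   by (simp add: W.SA.A.m_assoc[symmetric] \<iota>_simps(1) \<iota>_simps(2)[symmetric] \<iota>_simps(4))
  ultimately have "u : \<iota> ` fixed_field <#>\<^sub>S U" unfolding set_mult_def using i(1) by blast
  then show "u : W.SA.A.span (\<iota> ` fixed_field <#>\<^sub>S U)" by (rule W.SA.A.span_simps(2))
 qed
qed

lemma principal:
 assumes u: "u : U" and \<gamma>: "\<gamma> : \<Gamma>" shows "skew_eval L act u \<gamma> : \<Gamma>"
proof -
 have uB: "u : B" and ui: "u : Inv" using u by (auto simp: U_def)
 note uc = InvD(1)[OF ui]
 have "skew_eval L act u \<gamma> : T"
  unfolding skew_eval_def
 proof (rule L.sum_mem[OF L.subring_subgroup[OF T_subring]])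
  fix m assume "m : {m. u m ~= 0\<^sub>L}"
  then have "m : car M" using W.carrierD(5)[OF uc] by blast
  then show "u m *\<^sub>L act m \<gamma> : T" using T_simps(6) B_coef[OF uB] act_T \<gamma> \<Gamma>_T by blast
 qed
 moreover have "g (skew_eval L act u \<gamma>) = skew_eval L act u \<gamma>" if g: "g : G" for g
 proof -
  have "g \<gamma> = \<gamma>" using \<gamma> g by (simp add: \<Gamma>_def)
  then show ?thesis
   using skew_eval_conj[OF g uc \<Gamma>_carrier[OF \<gamma>]] InvD(2)[OF ui g] by simp
 qed
 ultimately show ?thesis by (simp add: \<Gamma>_def)
qed

section \<open>Finite generation of the invariants\<close>

lemma monomials_shift:
 assumes "p : W.SA.A.monomials (x ` I)"
 shows "ALL t:T. \<exists>t'\<in>T. p *\<^sub>S \<iota> t = \<iota> t' *\<^sub>S p" and "ALL t:T. \<exists>t'\<in>T. \<iota> t *\<^sub>S p = p *\<^sub>S \<iota> t'"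
proof -
 have xS: "x i : car S" if "i : I" for i using xB B_simps(1) that by auto
 have xI: "x ` I \<subseteq> car S" using xS by blast
 have tS: "\<iota> t : car S" if "t : T" for t using \<iota>_simps(1) T_carrier that by blast
 have "(ALL t:T. \<exists>t'\<in>T. p *\<^sub>S \<iota> t = \<iota> t' *\<^sub>S p) & (ALL t:T. \<exists>t'\<in>T. \<iota> t *\<^sub>S p = p *\<^sub>S \<iota> t')"
  using assms
 proof (induction p rule: W.SA.A.monomials.induct)
  case one
  have "\<exists>t'\<in>T. 1\<^sub>S *\<^sub>S \<iota> t = \<iota> t' *\<^sub>S 1\<^sub>S" "\<exists>t'\<in>T. \<iota> t *\<^sub>S 1\<^sub>S = 1\<^sub>S *\<^sub>S \<iota> t'" if "t : T" for t
   using tS[OF that] that by (auto intro!: bexI[of _ t])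
  then show ?case by blast
 next
  case (mult p z)
  then obtain i where i: "i : I" "z = x i" by blast
  have pS: "p : car S" using W.SA.A.monomials_closed[OF mult.hyps(1) xI] .
  have zS: "z : car S" using xS i by simp
  have "\<exists>t'\<in>T. p *\<^sub>S z *\<^sub>S \<iota> t = \<iota> t' *\<^sub>S (p *\<^sub>S z)" if t: "t : T" for t
  proof -
   obtain t1 where t1: "t1 : T" "z *\<^sub>S \<iota> t = \<iota> t1 *\<^sub>S z" using x_left[OF i(1) t] i(2) by blast
   obtain t2 where t2: "t2 : T" "p *\<^sub>S \<iota> t1 = \<iota> t2 *\<^sub>S p" using mult.IH t1 by blast
   have "p *\<^sub>S z *\<^sub>S \<iota> t = p *\<^sub>S (\<iota> t1 *\<^sub>S z)"
    using pS zS tS[OF t] by (simp add: W.SA.A.m_assoc t1(2))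
   also have "\<dots> = (p *\<^sub>S \<iota> t1) *\<^sub>S z" using pS zS tS[OF t1(1)] by (simp add: W.SA.A.m_assoc)
   also have "\<dots> = \<iota> t2 *\<^sub>S (p *\<^sub>S z)" using pS zS tS[OF t2(1)] by (simp add: W.SA.A.m_assoc t2(2))
   finally show ?thesis using t2(1) by blast
  qed
  moreover have "\<exists>t'\<in>T. \<iota> t *\<^sub>S (p *\<^sub>S z) = p *\<^sub>S z *\<^sub>S \<iota> t'" if t: "t : T" for t
  proof -
   obtain t1 where t1: "t1 : T" "\<iota> t *\<^sub>S p = p *\<^sub>S \<iota> t1" using mult.IH t by blast
   obtain t2 where t2: "t2 : T" "\<iota> t1 *\<^sub>S z = z *\<^sub>S \<iota> t2" using x_right[OF i(1) t1(1)] i(2) by blast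
   have "\<iota> t *\<^sub>S (p *\<^sub>S z) = (\<iota> t *\<^sub>S p) *\<^sub>S z"
    using pS zS tS[OF t] by (simp add: W.SA.A.m_assoc)
   also have "\<dots> = p *\<^sub>S (\<iota> t1 *\<^sub>S z)" using pS zS tS[OF t1(1)] by (simp add: W.SA.A.m_assoc t1(2))
   also have "\<dots> = p *\<^sub>S z *\<^sub>S \<iota> t2" using pS zS tS[OF t2(1)] by (simp add: W.SA.A.m_assoc t2(2))
   finally show ?thesis using t2(1) by blast
  qed
  ultimately show ?case by blast
 qed
 then show "ALL t:T. \<exists>t'\<in>T. p *\<^sub>S \<iota> t = \<iota> t' *\<^sub>S p" and "ALL t:T. \<exists>t'\<in>T. \<iota> t *\<^sub>S p = p *\<^sub>S \<iota> t'"
  by blast+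
qed

text \<open>\<open>B\<close> is spanned by \<open>c w c'\<close> with \<open>c\<close>, \<open>c'\<close> in an invariant subring \<open>C\<close> and \<open>w\<close> in a
 finite set, and averaging \<open>c w c'\<close> gives \<open>c Tr(w) c'\<close>. Here \<open>C\<close> is generated by \<open>\<Gamma>\<close> and the
 elementary symmetric functions of the \<open>x i\<close> and of the \<open>y i\<close>.\<close>

lemma U_fin_gen: "fin_gen_ring_over S (\<iota> ` \<Gamma>) U"
proof -
 have xS: "x : I \<rightarrow> car S" and yS: "y : I \<rightarrow> car S" using xB yB B_simps(1) by auto
 obtain Ex Bx where Ex: "finite Ex" "Ex \<subseteq> generate_ring S (x ` I)" "finite Bx"
   "Bx \<subseteq> W.SA.A.monomials (x ` I)"
   "generate_ring S (x ` I) = W.SA.A.span {e *\<^sub>S b | e b. e : generate_ring S Ex & b : Bx}"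
   "ALL a:generate_ring S (x ` I). ALL b:generate_ring S (x ` I). a *\<^sub>S b = b *\<^sub>S a"
   "ALL h:ring_hom S S. \<forall>\<tau>. bij_betw \<tau> I I --> (ALL i:I. h (x i) = x (\<tau> i)) --> (ALL e:Ex. h e = e)"
  by (rule W.SA.A.symmetric_generators[OF finite_I xS x_comm]) (rule that)
 obtain Ey By where Ey: "finite Ey" "Ey \<subseteq> generate_ring S (y ` I)" "finite By"
   "By \<subseteq> W.SA.A.monomials (y ` I)"
   "generate_ring S (y ` I) = W.SA.A.span {e *\<^sub>S b | e b. e : generate_ring S Ey & b : By}"
   "ALL a:generate_ring S (y ` I). ALL b:generate_ring S (y ` I). a *\<^sub>S b = b *\<^sub>S a"
   "ALL h:ring_hom S S. \<forall>\<tau>. bij_betw \<tau> I I --> (ALL i:I. h (y i) = y (\<tau> i)) --> (ALL e:Ey. h e = e)"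
  by (rule W.SA.A.symmetric_generators[OF finite_I yS y_comm]) (rule that)
 obtain BT where BT: "finite BT" "BT \<subseteq> T" "T = L.span {e *\<^sub>L b | e b. e : \<Gamma> & b : BT}"
  using T_finite by blast
 have xI: "x ` I \<subseteq> car S" "x ` I \<subseteq> B" and yI: "y ` I \<subseteq> car S" "y ` I \<subseteq> B"
  using xS yS xB yB by auto
 have gx: "subring (generate_ring S (x ` I)) S" "generate_ring S (x ` I) \<subseteq> B"
  using W.SA.A.generate_ring_is_subring[OF xI(1)]
   W.SA.A.generate_ring_min_subring1[OF xI(1) B_subring xI(2)] by auto
 have gy: "subring (generate_ring S (y ` I)) S" "generate_ring S (y ` I) \<subseteq> B"
  using W.SA.A.generate_ring_is_subring[OF yI(1)]
   W.SA.A.generate_ring_min_subring1[OF yI(1) B_subring yI(2)] by auto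
 have mon: "m : generate_ring S Y" if "m : W.SA.A.monomials Y" "Y \<subseteq> car S" for m Y
  using that(1)
 proof (induction m rule: W.SA.A.monomials.induct)
  case one
  show ?case using subringE(3)[OF W.SA.A.generate_ring_is_subring[OF that(2)]] .
 next
  case (mult m z)
  then show ?case
   using subringE(6)[OF W.SA.A.generate_ring_is_subring[OF that(2)]]
    subsetD[OF W.SA.A.generate_ringE(2)[OF that(2) refl]] by simp
 qed
 have Bx: "b : generate_ring S (x ` I)" if "b : Bx" for b
  using mon[OF subsetD[OF Ex(4) that] xI(1)] .
 have By: "b : generate_ring S (y ` I)" if "b : By" for b
  using mon[OF subsetD[OF Ey(4) that] yI(1)] .
 \<comment> \<open>Conjugation by \<open>g\<close> is a ring endomorphism that permutes the
   \<open>x i\<close> and the \<open>y i\<close>, hence fixes their symmetric functions.\<close>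
 have ExU: "Ex \<subseteq> U" and EyU: "Ey \<subseteq> U"
 proof -
  have "conj g e = e" if g: "g : G" and e: "e : Ex" for g e
  proof -
   obtain \<tau> where "bij_betw \<tau> I I" "ALL i:I. conj g (x i) = x (\<tau> i)" using permuted[OF g] by blast
   then show ?thesis using bspec[OF Ex(7) conj_hom[OF g]] e by blast
  qed
  moreover have "conj g e = e" if g: "g : G" and e: "e : Ey" for g e
  proof -
   obtain \<tau> where "bij_betw \<tau> I I" "ALL i:I. conj g (y i) = y (\<tau> i)" using permuted[OF g] by blast
   then show ?thesis using bspec[OF Ey(7) conj_hom[OF g]] e by blast
  qed
  ultimately show "Ex \<subseteq> U" "Ey \<subseteq> U"
   using Ex(2) Ey(2) gx(2) gy(2) B_simps(1) by (auto simp: U_def Inv_iff subset_iff)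
 qed
 let ?C = "generate_ring S (\<iota> ` \<Gamma> \<union> Ex \<union> Ey)"
 \<comment> \<open>The middle factors combine module generators of \<open>T\<close> over \<Gamma>
   with those of the plus-ring and of the minus-ring over their symmetric subrings.\<close>
 define W where "W = (%(t, b, b'). \<iota> t *\<^sub>S b *\<^sub>S b') ` (BT \<times> Bx \<times> By)"
 have WI: "\<iota> t *\<^sub>S b *\<^sub>S b' : W" if "t : BT" "b : Bx" "b' : By" for t b b'
  unfolding W_def using that by (force intro: image_eqI[where x = "(t, b, b')"])
 have finW: "finite W" unfolding W_def using BT Ex Ey by simp
 have WB: "W \<subseteq> B"
 proof
  fix w assume "w : W"
  then obtain t b b' where w: "w = \<iota> t *\<^sub>S b *\<^sub>S b'" "t : BT" "b : Bx" "b' : By"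
   by (auto simp: W_def)
  have "\<iota> t : B" "b : B" "b' : B"
   using \<iota>_B[OF subsetD[OF BT(2) w(2)]] subsetD[OF gx(2) Bx[OF w(3)]] subsetD[OF gy(2) By[OF w(4)]] .
  then show "w : B" using B_simps(6) w(1) by simp
 qed
 have WS: "W \<subseteq> car S" using order_trans[OF WB B_simps(1)] .
 have \<Gamma>U: "\<iota> ` \<Gamma> \<subseteq> U" using \<iota>_\<Gamma>_U by blast
 have CU: "\<iota> ` \<Gamma> \<union> Ex \<union> Ey \<subseteq> U" using \<Gamma>U ExU EyU by simp
 have CS: "\<iota> ` \<Gamma> \<union> Ex \<union> Ey \<subseteq> car S" using order_trans[OF CU U_simps(1)] .
 have C: "subring ?C S" "?C \<subseteq> U" "\<iota> ` \<Gamma> \<union> Ex \<union> Ey \<subseteq> ?C"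
  using W.SA.A.generate_ring_is_subring[OF CS] W.SA.A.generate_ring_min_subring1[OF CS U_subring CU]
   W.SA.A.generate_ringE(2)[OF CS refl] .
 have ExS: "Ex \<subseteq> car S" and EyS: "Ey \<subseteq> car S" using CS by auto
 have ExC: "generate_ring S Ex \<subseteq> ?C" and EyC: "generate_ring S Ey \<subseteq> ?C"
  by (rule W.SA.A.generate_ring_min_subring1[OF ExS C(1)], use C(3) in simp)
   (rule W.SA.A.generate_ring_min_subring1[OF EyS C(1)], use C(3) in simp)
 have Ey_y: "generate_ring S Ey \<subseteq> generate_ring S (y ` I)"
  by (rule W.SA.A.generate_ring_min_subring1[OF EyS gy(1) Ey(2)])
 define Z where "Z = {c *\<^sub>S w *\<^sub>S c' | c w c'. c : ?C & w : W & c' : ?C}"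
 have ZI: "c *\<^sub>S w *\<^sub>S c' : Z" if "c : ?C" "w : W" "c' : ?C" for c w c'
  unfolding Z_def using that by blast
 have CcS: "c : car S" if "c : ?C" for c using subsetD[OF subringE(1)[OF C(1)] that] .
 have ZS: "Z \<subseteq> car S"
  unfolding Z_def using CcS WS by auto
 note Zsub = W.SA.A.span_subgroup[OF ZS] and Zsp = W.SA.A.span_simps(1,3,4)[where Y = Z]
 \<comment> \<open>Expanding \<open>t\<close> over \<Gamma> gives a coefficient that joins
   \<open>e\<close> in \<open>?C\<close> and leaves a member of \<open>W\<close> in the
   middle.\<close>
 have core: "e *\<^sub>S \<iota> t *\<^sub>S (b *\<^sub>S b') *\<^sub>S e' : W.SA.A.span Z"
  if e: "e : ?C" "e' : ?C" and b: "b : Bx" "b' : By" and t: "t : T" for e e' b b' t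
 proof -
  have c: "e : car S" "e' : car S" "b : car S" "b' : car S"
   using CcS[OF e(1)] CcS[OF e(2)] subsetD[OF subringE(1)[OF gx(1)] Bx[OF b(1)]]
    subsetD[OF subringE(1)[OF gy(1)] By[OF b(2)]] .
  have YL: "{e *\<^sub>L b | e b. e : \<Gamma> & b : BT} \<subseteq> car L"
   using \<Gamma>_carrier T_carrier BT(2) by auto
  from t have "t : L.span {e *\<^sub>L b | e b. e : \<Gamma> & b : BT}" by (rule equalityD1[OF BT(3), THEN subsetD])
  then show ?thesis using YL
  proof (induction t rule: L.span_induct)
   case zero
   show ?case using c Zsp(2) by (simp add: \<iota>_simps(5))
  next
   case (base t)
   then obtain \<gamma> s where \<gamma>: "t = \<gamma> *\<^sub>L s" "\<gamma> : \<Gamma>" "s : BT" by blast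
   note cc = \<iota>_simps(1)[OF \<Gamma>_carrier[OF \<gamma>(2)]] \<iota>_simps(1)[OF T_carrier[OF subsetD[OF BT(2) \<gamma>(3)]]]
   have "e *\<^sub>S \<iota> t *\<^sub>S (b *\<^sub>S b') *\<^sub>S e' = (e *\<^sub>S \<iota> \<gamma>) *\<^sub>S (\<iota> s *\<^sub>S b *\<^sub>S b') *\<^sub>S e'"
    using c cc \<Gamma>_carrier[OF \<gamma>(2)] T_carrier[OF subsetD[OF BT(2) \<gamma>(3)]]
    by (simp add: \<gamma>(1) \<iota>_simps(2) W.SA.A.m_assoc)
   also have "\<dots> : Z"
    by (rule ZI[OF subringE(6)[OF C(1) e(1) subsetD[OF C(3)]] WI[OF \<gamma>(3) b] e(2)]) (use \<gamma>(2) in blast)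
   finally show ?case by (rule W.SA.A.span_simps(2))
  next
   case (neg t)
   have "e *\<^sub>S \<iota> (\<ominus>\<^sub>L t) *\<^sub>S (b *\<^sub>S b') *\<^sub>S e' = \<ominus>\<^sub>S (e *\<^sub>S \<iota> t *\<^sub>S (b *\<^sub>S b') *\<^sub>S e')"
    using c \<iota>_simps(1)[OF neg(1)] by (simp add: \<iota>_simps(6)[OF neg(1)] W.SA.A.l_minus W.SA.A.r_minus)
   then show ?case using subgroup.m_inv_closed[OF Zsub neg(2)] by (simp add: a_inv_def)
  next
   case (add t t')
   have "e *\<^sub>S \<iota> (t +\<^sub>L t') *\<^sub>S (b *\<^sub>S b') *\<^sub>S e' =
     (e *\<^sub>S \<iota> t *\<^sub>S (b *\<^sub>S b') *\<^sub>S e') +\<^sub>S (e *\<^sub>S \<iota> t' *\<^sub>S (b *\<^sub>S b') *\<^sub>S e')"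
    using c \<iota>_simps(1)[OF add(1)] \<iota>_simps(1)[OF add(2)]
    by (simp add: \<iota>_simps(3)[OF add(1,2)] W.SA.A.l_distr W.SA.A.r_distr)
   then show ?case using Zsp(3)[OF add(3,4)] by simp
  qed
 qed
 have B_Z: "B \<subseteq> W.SA.A.span Z"
 proof (rule order_trans[OF B_span W.SA.A.span_minimal[OF _ Zsub]], rule subsetI)
  fix u assume "u : {\<iota> t *\<^sub>S p *\<^sub>S q | t p q. t : T & p : W.SA.A.monomials (x ` I) & q : W.SA.A.monomials (y ` I)}"
  then obtain t p q where u: "u = \<iota> t *\<^sub>S p *\<^sub>S q" "t : T" "p : W.SA.A.monomials (x ` I)"
    "q : W.SA.A.monomials (y ` I)" by blast
  \<comment> \<open>The coefficient is pushed to the right of all of \<open>p\<close>, so that in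
    the expansion of \<open>p\<close> the symmetric factor \<open>e\<close> comes to stand at the
    far left.\<close>
  obtain t1 where t1: "t1 : T" "\<iota> t *\<^sub>S p = p *\<^sub>S \<iota> t1" using monomials_shift(2)[OF u(3)] u(2) by blast
  have t1S: "\<iota> t1 : car S" using \<iota>_simps(1)[OF T_carrier[OF t1(1)]] .
  have P: "p : W.SA.A.span {e *\<^sub>S b | e b. e : generate_ring S Ex & b : Bx}"
   using mon[OF u(3) xI(1)] unfolding Ex(5) .
  have Q: "q : W.SA.A.span {e *\<^sub>S b | e b. e : generate_ring S Ey & b : By}"
   using mon[OF u(4) yI(1)] unfolding Ey(5) .
  have PS: "{e *\<^sub>S b | e b. e : generate_ring S Ex & b : Bx} \<subseteq> car S"
   
   using CcS[OF subsetD[OF ExC]] subsetD[OF subringE(1)[OF gx(1)] Bx] by auto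
  have QS: "{e *\<^sub>S b | e b. e : generate_ring S Ey & b : By} \<subseteq> car S"
   
   using CcS[OF subsetD[OF EyC]] subsetD[OF subringE(1)[OF gy(1)] By] by auto
  have step: "z *\<^sub>S v : W.SA.A.span Z"
   if z: "z : {e *\<^sub>S b *\<^sub>S \<iota> t1 | e b. e : generate_ring S Ex & b : Bx}"
    and v: "v : {e *\<^sub>S b | e b. e : generate_ring S Ey & b : By}" for z v
  proof -
   obtain e b where z: "z = e *\<^sub>S b *\<^sub>S \<iota> t1" "e : generate_ring S Ex" "b : Bx" using z by blast
   obtain e' b' where v: "v = e' *\<^sub>S b'" "e' : generate_ring S Ey" "b' : By" using v by blast
   \<comment> \<open>Now the coefficient returns to the left, but only past \<open>b\<close>, which
     is possible because \<open>Bx\<close> consists of monomials.\<close>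
   obtain t2 where t2: "t2 : T" "b *\<^sub>S \<iota> t1 = \<iota> t2 *\<^sub>S b"
    using monomials_shift(1)[OF subsetD[OF Ex(4) z(3)]] t1(1) by blast
   have c: "e : car S" "e' : car S" "b : car S" "b' : car S" "\<iota> t2 : car S"
    using CcS[OF subsetD[OF ExC z(2)]] CcS[OF subsetD[OF EyC v(2)]]
     subsetD[OF subringE(1)[OF gx(1)] Bx[OF z(3)]] subsetD[OF subringE(1)[OF gy(1)] By[OF v(3)]]
     \<iota>_simps(1)[OF T_carrier[OF t2(1)]] .
   \<comment> \<open>Inside the commutative ring of the \<open>y i\<close> the symmetric factor
     moves to the far right, into the second \<open>?C\<close>.\<close>
   have v': "v = b' *\<^sub>S e'" using Ey(6) subsetD[OF Ey_y v(2)] By[OF v(3)] v(1) by blast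
   have "z = e *\<^sub>S (\<iota> t2 *\<^sub>S b)" using z(1) c t1S by (simp add: W.SA.A.m_assoc t2(2))
   then have "z *\<^sub>S v = e *\<^sub>S \<iota> t2 *\<^sub>S (b *\<^sub>S b') *\<^sub>S e'"
    using c v' by (simp add: W.SA.A.m_assoc)
   then show ?thesis
    using core[OF subsetD[OF ExC z(2)] subsetD[OF EyC v(2)] z(3) v(3) t2(1)] by simp
  qed
  have P'S: "{e *\<^sub>S b *\<^sub>S \<iota> t1 | e b. e : generate_ring S Ex & b : Bx} \<subseteq> car S"
   using PS t1S by auto
  have "p *\<^sub>S \<iota> t1 : W.SA.A.span {e *\<^sub>S b *\<^sub>S \<iota> t1 | e b. e : generate_ring S Ex & b : Bx}"
  proof (rule W.SA.A.span_mult[OF W.SA.A.span_subgroup[OF P'S] PS, of "{\<iota> t1}"])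
   show "\<iota> t1 : W.SA.A.span {\<iota> t1}" by (rule W.SA.A.span_simps(2)) simp
   fix y z assume "y : {e *\<^sub>S b | e b. e : generate_ring S Ex & b : Bx}" "z : {\<iota> t1}"
   then show "y *\<^sub>S z : W.SA.A.span {e *\<^sub>S b *\<^sub>S \<iota> t1 | e b. e : generate_ring S Ex & b : Bx}"
    by (intro W.SA.A.span_simps(2)) blast
  qed (use t1S P in auto)
  then have "(p *\<^sub>S \<iota> t1) *\<^sub>S q : W.SA.A.span Z"
   using W.SA.A.span_mult[OF Zsub P'S QS step _ Q] by blast
  then show "u : W.SA.A.span Z" by (simp add: u(1) t1(2))
 qed
 let ?Y = "Ex \<union> Ey \<union> Tr ` W"
 have TrU: "Tr w : U" if w: "w : W" for w
 proof -
  have "Tr w : B"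
   unfolding Tr_def
   by (rule W.SA.A.sum_mem[OF W.SA.A.subring_subgroup[OF B_subring]])
    (use B_conj WB w in blast)
  then show ?thesis using Tr_Inv WS w by (auto simp: U_def)
 qed
 have YU: "\<iota> ` \<Gamma> \<union> ?Y \<subseteq> U" using CU TrU by blast
 have YS: "\<iota> ` \<Gamma> \<union> ?Y \<subseteq> car S" using order_trans[OF YU U_simps(1)] .
 let ?H = "generate_ring S (\<iota> ` \<Gamma> \<union> ?Y)"
 have H: "subring ?H S" "\<iota> ` \<Gamma> \<union> ?Y \<subseteq> ?H" "?H \<subseteq> U"
  using W.SA.A.generate_ring_is_subring[OF YS] W.SA.A.generate_ringE(2)[OF YS refl]
   W.SA.A.generate_ring_min_subring1[OF YS U_subring YU] .
 have CH: "?C \<subseteq> ?H" by (rule W.SA.A.generate_ring_min_subring1[OF CS H(1)]) (use H(2) in blast)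
 have Tr_Z: "Tr u : ?H" if "u : W.SA.A.span Z" for u
  using that ZS
 proof (induction u rule: W.SA.A.span_induct)
  case zero
  have "Tr 0\<^sub>S = (\<Oplus>\<^sub>S g\<in>G. 0\<^sub>S)"
   unfolding Tr_def by (rule W.Sa.finsum_cong'[OF refl]) (use conjD(5) in auto)
  then show ?case using subringE(2)[OF H(1)] by simp
 next
  case (base u)
  then obtain c w c' where u: "u = c *\<^sub>S w *\<^sub>S c'" "c : ?C" "w : W" "c' : ?C" unfolding Z_def by blast
  have "c : Inv" "c' : Inv" using subsetD[OF C(2) u(2)] subsetD[OF C(2) u(4)] by (auto simp: U_def)
  then have "Tr u = c *\<^sub>S Tr w *\<^sub>S c'" unfolding u(1) by (rule Tr_mult) (use WS u(3) in blast)
  moreover have "Tr w : ?H" by (rule subsetD[OF H(2)]) (use u(3) in blast)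
  ultimately show ?case
   using subringE(6)[OF H(1) subringE(6)[OF H(1) subsetD[OF CH u(2)]] subsetD[OF CH u(4)]] by simp
 next
  case (neg u)
  have "Tr u +\<^sub>S Tr (\<ominus>\<^sub>S u) = Tr (u +\<^sub>S \<ominus>\<^sub>S u)" using neg(1) Tr_add by simp
  also have "\<dots> = 0\<^sub>S"
  proof -
   have "Tr 0\<^sub>S = (\<Oplus>\<^sub>S g\<in>G. 0\<^sub>S)"
    unfolding Tr_def by (rule W.Sa.finsum_cong'[OF refl]) (use conjD(5) in auto)
   then show ?thesis using neg(1) by (simp add: W.Sa.r_neg)
  qed
  finally have "Tr (\<ominus>\<^sub>S u) = \<ominus>\<^sub>S Tr u"
   using W.Sa.minus_equality[of "Tr (\<ominus>\<^sub>S u)" "Tr u"] Tr_closed neg(1) W.Sa.a_comm by simp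
  then show ?case using subringE(5)[OF H(1) neg(2)] by simp
 next
  case (add u v)
  then show ?case using Tr_add subringE(7)[OF H(1)] by simp
 qed
 have "U \<subseteq> ?H"
 proof
  fix u assume u: "u : U"
  then have uB: "u : B" "u : Inv" by (auto simp: U_def)
  \<comment> \<open>Averaging reproduces an invariant element, and the factor 1/|G| already lies in
    the base ring.\<close>
  have "\<iota> inv_card : ?H" by (rule subsetD[OF H(2)]) (use inv_card(1) scalars_\<Gamma> in blast)
  then have "\<iota> inv_card *\<^sub>S Tr u : ?H"
   using subringE(6)[OF H(1) _ Tr_Z[OF subsetD[OF B_Z uB(1)]]] by blast
  then show "u : ?H" using Tr_of_Inv[OF uB(2)] by simp
 qed
 then have "?H = U" using H(3) by blast
 moreover have "finite ?Y" using Ex(1) Ey(1) finW by simp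
 moreover have "?Y \<subseteq> U" using YU by blast
 ultimately show ?thesis unfolding fin_gen_ring_over_def by (intro exI[of _ ?Y] conjI)
qed

theorem principal_galois_order: "principal_galois_order k L G M act \<Gamma> U"
proof (intro principal_galois_order.intro galois_ring.intro principal_galois_order_axioms.intro)
 show "m = m'" if "m : car M" "m' : car M"
  "\<And>x. x : fractions_in L \<Gamma> ==> act m x = act m' x" for m m'
  using separating[OF that(1,2)] that(3) fractions_\<Gamma> by blast
qed (use field_k algebra_L \<Gamma>_subring scalars_\<Gamma> noetherian_\<Gamma> galois M.is_monoid act_hom act_inj
  conj_stable U_subring \<iota>_\<Gamma>_U U_fin_gen UK KU principal in "auto simp: U_def")

end

section \<open>Generalized Weyl algebras of rank one\<close>

lemma monoid_words: "monoid (words Y)"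
 by (rule monoidI) (auto simp: words_def)

lemma words_simps:
 "car (words Y) = lists (Coef ` Y \<union> {XPlus, XMinus})" "\<one>\<^bsub>words Y\<^esub> = []" "u \<otimes>\<^bsub>words Y\<^esub> v = u @ v"
 by (simp_all add: words_def)

locale weyl_data =
 fixes k :: "('k, 'x) ring_scheme" and D :: "('k, 'd, 'y) module_scheme" and a :: 'd and \<sigma> :: "'d => 'd"
 assumes algebra_D: "algebra k D" and \<sigma>: "\<sigma> : car (alg_aut k D)" and a: "a : car D"
begin

sublocale D: nc_algebra k D by (rule algebra.nc_algebra[OF algebra_D])

abbreviation \<tau> where "\<tau> \<equiv> inv\<^bsub>alg_aut k D\<^esub> \<sigma>"

abbreviation W where "W \<equiv> monoid_algebra k (words (car D))"

abbreviation e where "e w \<equiv> single k w 1\<^sub>k"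

abbreviation Q where "Q \<equiv> gwa k D a \<sigma>"

abbreviation gen where "gen \<equiv> gwa_gen k D a \<sigma>"

abbreviation cf where "cf d \<equiv> gwa_gen k D a \<sigma> (Coef d)"

abbreviation xp where "xp \<equiv> gwa_gen k D a \<sigma> XPlus"

abbreviation xm where "xm \<equiv> gwa_gen k D a \<sigma> XMinus"

lemma \<tau>: "\<tau> : car (alg_aut k D)"
 by (rule group.inv_closed[OF D.group_alg_aut \<sigma>])

lemma \<sigma>_simps:
 "d : car D ==> \<sigma> d : car D" "d : car D ==> \<tau> d : car D"
 "d : car D ==> \<sigma> (\<tau> d) = d" "d : car D ==> \<tau> (\<sigma> d) = d"
 using \<sigma> \<tau> alg_homD(2) D.alg_aut_inv_apply[OF \<sigma>] by (auto simp: carrier_alg_aut)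

lemma cring_k: "cring k" by (rule D.R.cring_axioms)

sublocale W: nc_algebra k W by (rule nc_algebra_monoid_algebra[OF cring_k monoid_words])

lemmas W_simps = monoid_algebra_simps[OF cring_k monoid_words]

definition is_word where "is_word w \<longleftrightarrow> w : lists (Coef ` car D \<union> {XPlus, XMinus})"

lemma is_word_simps [simp]:
 "is_word []" "is_word (g # w) \<longleftrightarrow> (g : Coef ` car D \<union> {XPlus, XMinus}) & is_word w"
 by (auto simp: is_word_def)

lemma e_closed [simp]: "is_word w ==> e w : car W"
 by (rule W_simps(1)) (simp_all add: is_word_def words_simps)

lemma e_mult: "[|is_word w; is_word w'|] ==> e w *\<^sub>W e w' = e (w @ w')"
 using W_simps(3) by (simp add: is_word_def words_simps)

lemma e_one: "1\<^sub>W = e []" using W_simps(2) by (simp add: words_simps)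

lemma relations_carrier: "gwa_relations k D a \<sigma> \<subseteq> car W"
 unfolding gwa_relations_def Let_def by (intro Un_least) (auto simp: \<sigma>_simps a)

lemma ideal_gwa: "ideal (gwa_ideal k D a \<sigma>) W"
 unfolding gwa_ideal_def by (rule W.A.genideal_ideal[OF relations_carrier])

sublocale Q: nc_algebra k Q unfolding gwa_def by (rule W.nc_algebra_quot[OF ideal_gwa])

definition proj where "proj u = gwa_ideal k D a \<sigma> +>\<^sub>W u"

lemma proj_hom: "proj : alg_hom k W Q"
 using W.quot_proj[OF ideal_gwa] by (simp add: proj_def[abs_def] gwa_def)

lemmas projD = alg_homD[OF proj_hom]

lemma proj_eq:
 assumes "u \<ominus>\<^sub>W v : gwa_relations k D a \<sigma>" "u : car W" "v : car W"
 shows "proj u = proj v"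
 unfolding proj_def using W.coset_eq_iff[OF ideal_gwa assms(2,3)]
  subsetD[OF W.A.genideal_self[OF relations_carrier] assms(1)] by (simp add: gwa_ideal_def)

lemma gen_proj: "gen g = proj (e [g])"
 by (simp add: gwa_gen_def proj_def)

lemma gen_closed: "d : car D ==> cf d : car Q" "xp : car Q" "xm : car Q"
 using projD(2) by (simp_all add: gen_proj)

lemma proj_e_mult: "[|is_word w; is_word w'|] ==> proj (e w) *\<^sub>Q proj (e w') = proj (e (w @ w'))"
 using projD(3)[of "e w" "e w'"] by (simp add: e_mult)

lemma proj_e_Cons: "is_word (g # w) ==> proj (e (g # w)) = gen g *\<^sub>Q proj (e w)"
 using proj_e_mult[of "[g]" w] by (simp add: gen_proj)

lemma proj_e_Nil: "proj (e []) = 1\<^sub>Q"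
 using projD(5) by (simp add: e_one)

lemma cf_hom: "cf : alg_hom k D Q"
proof (rule alg_homI)
 fix x y assume xy: "x : car D" "y : car D"
 have "proj (e [Coef (x +\<^sub>D y)]) = proj (e [Coef x] +\<^sub>W e [Coef y])"
  by (rule proj_eq) (use xy in "auto simp: gwa_relations_def Let_def")
 then show "cf (x +\<^sub>D y) = cf x +\<^sub>Q cf y" using xy projD(4) by (simp add: gen_proj)
 have "proj (e [Coef (x *\<^sub>D y)]) = proj (e [Coef x, Coef y])"
  by (rule proj_eq) (use xy in "auto simp: gwa_relations_def Let_def")
 then show "cf (x *\<^sub>D y) = cf x *\<^sub>Q cf y" using xy by (simp add: gen_proj proj_e_mult)
next
 have "proj (e [Coef 1\<^sub>D]) = proj (e [])"
  by (rule proj_eq) (auto simp: gwa_relations_def Let_def)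
 then show "cf 1\<^sub>D = 1\<^sub>Q" by (simp add: gen_proj proj_e_Nil)
next
 fix c x assume c: "c : car k" and x: "x : car D"
 have "proj (e [Coef (c \<odot>\<^sub>D x)]) = proj (c \<odot>\<^sub>W e [Coef x])"
  by (rule proj_eq) (use c x in "auto simp: gwa_relations_def Let_def")
 then show "cf (c \<odot>\<^sub>D x) = c \<odot>\<^sub>Q cf x" using c x projD(6) by (simp add: gen_proj)
qed (use gen_closed in auto)

lemmas cfD = alg_homD[OF cf_hom]

lemma gwa_rules:
 "d : car D ==> xp *\<^sub>Q cf d = cf (\<sigma> d) *\<^sub>Q xp"
 "d : car D ==> xm *\<^sub>Q cf d = cf (\<tau> d) *\<^sub>Q xm"
 "xm *\<^sub>Q xp = cf a" "xp *\<^sub>Q xm = cf (\<sigma> a)"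
proof -
 show "xp *\<^sub>Q cf d = cf (\<sigma> d) *\<^sub>Q xp" "xm *\<^sub>Q cf d = cf (\<tau> d) *\<^sub>Q xm" if d: "d : car D"
 proof -
  have "proj (e [XPlus, Coef d]) = proj (e [Coef (\<sigma> d), XPlus])"
   by (rule proj_eq) (use d \<sigma>_simps in "auto simp: gwa_relations_def Let_def")
  then show "xp *\<^sub>Q cf d = cf (\<sigma> d) *\<^sub>Q xp" using d \<sigma>_simps by (simp add: gen_proj proj_e_mult)
  have "proj (e [XMinus, Coef d]) = proj (e [Coef (\<tau> d), XMinus])"
   by (rule proj_eq, unfold gwa_relations_def Let_def, rule UnI1, rule UnI2, rule CollectI, rule exI[of _ d])
    (simp_all add: d \<sigma>_simps)
  then show "xm *\<^sub>Q cf d = cf (\<tau> d) *\<^sub>Q xm" using d \<sigma>_simps by (simp add: gen_proj proj_e_mult)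
 qed
 have "proj (e [XMinus, XPlus]) = proj (e [Coef a])"
  by (rule proj_eq) (use a in "auto simp: gwa_relations_def Let_def")
 then show "xm *\<^sub>Q xp = cf a" by (simp add: gen_proj proj_e_mult)
 have "proj (e [XPlus, XMinus]) = proj (e [Coef (\<sigma> a)])"
  by (rule proj_eq) (use a \<sigma>_simps in "auto simp: gwa_relations_def Let_def")
 then show "xp *\<^sub>Q xm = cf (\<sigma> a)" by (simp add: gen_proj proj_e_mult)
qed

text \<open>Words are evaluated letter by letter, and the hypotheses on \<open>f\<close>,
  \<open>u\<close> and \<open>v\<close> say that the defining relations go to zero.\<close>

lemma gwa_lift:
 assumes B: "nc_algebra k B" and f: "f : alg_hom k D B"
  and uv: "u : car B" "v : car B"
  and uf: "\<And>d. d : car D ==> u *\<^sub>B f d = f (\<sigma> d) *\<^sub>B u"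
  and vf: "\<And>d. d : car D ==> v *\<^sub>B f d = f (\<tau> d) *\<^sub>B v"
  and vu: "v *\<^sub>B u = f a" "u *\<^sub>B v = f (\<sigma> a)"
 shows "EX h:alg_hom k Q B. (ALL d:car D. h (cf d) = f d) & h xp = u & h xm = v"
proof -
 interpret B: nc_algebra k B by (rule B)
 note fD = alg_homD[OF f]
 define val where "val g = (case g of Coef d => f d | XPlus => u | XMinus => v)" for g
 define H where "H w = list_prod B w val" for w
 have val: "val g : car B" if "g : Coef ` car D \<union> {XPlus, XMinus}" for g
  using that fD(2) uv by (auto simp: val_def)
 have H: "H w : car B" if "is_word w" for w
  unfolding H_def using that val by (intro B.A.list_prod_closed) (auto simp: is_word_def)
 have Happ: "H (w @ w') = H w *\<^sub>B H w'" if w: "is_word w" "is_word w'" for w w'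
  using w(1)
 proof (induction w)
  case Nil
  then show ?case using H[OF w(2)] by (simp add: H_def)
 next
  case (Cons g w)
  then have "is_word w" "val g : car B" using val by auto
  then show ?case using Cons.IH H[OF w(2)] H[of w] by (simp add: H_def B.A.m_assoc)
 qed
 have "H : hom (words (car D)) B" "H \<one>\<^bsub>words (car D)\<^esub> = 1\<^sub>B"
  using H Happ by (auto simp: hom_def words_simps is_word_def) (simp add: H_def)
 from monoid_algebra_hom[OF cring_k monoid_words B this]
 obtain h where h: "h : alg_hom k W B" and he: "\<And>w. is_word w ==> h (e w) = H w"
  by (auto simp: words_simps is_word_def)
 note hD = alg_homD[OF h]
 have diff: "h (x \<ominus>\<^sub>W y) = 0\<^sub>B" if "x : car W" "y : car W" "h x = h y" for x y
  using ring_hom_zero_neg(3)[OF hD(1) W.A.ring_axioms B.A.ring_axioms that(1,2)] that hD(2)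
  by (simp add: a_minus_def B.A.r_neg)
 have H1: "H [g] = val g" if "is_word [g]" for g using that val by (simp add: H_def)
 have H2: "H [g, g'] = val g *\<^sub>B val g'" if "is_word [g, g']" for g g' using that val by (simp add: H_def)
 have kill: "h r = 0\<^sub>B" if "r : gwa_relations k D a \<sigma>" for r
  using that unfolding gwa_relations_def Let_def
  apply (elim UnE)
     apply (auto intro!: diff simp: he hD H1 H2 fD val_def \<sigma>_simps a uf vf vu)
  apply (simp add: H_def)
  done
 from W.quot_hom[OF B h relations_carrier kill, folded gwa_ideal_def gwa_def]
 obtain g where g: "g : alg_hom k Q B" "\<And>x. x : car W ==> g (gwa_ideal k D a \<sigma> +>\<^sub>W x) = h x" by blast
 have "g (gen z) = val z" if "is_word [z]" for z
  using g(2)[OF e_closed[OF that]] he[OF that] H1[OF that] by (simp add: gwa_gen_def)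
 then show ?thesis using g(1) by (intro bexI[of _ g]) (auto simp: val_def)
qed

text \<open>\<open>nat\<close> truncates negative numbers to 0, so at most one of the two powers is
  nontrivial: a power of X^+ for positive \<open>j\<close>, of X^- for negative
  \<open>j\<close>.\<close>

definition normal where "normal j = xp [^]\<^sub>Q nat j *\<^sub>Q xm [^]\<^sub>Q nat (- j)" for j :: int

lemma normal_closed: "normal j : car Q"
 using gen_closed by (simp add: normal_def)

definition normals where "normals = {cf d *\<^sub>Q normal j | d j. d : car D}"

lemma normals_carrier: "normals \<subseteq> car Q"
 using normal_closed gen_closed by (auto simp: normals_def)

lemma normal_pos: "normal (int m) = xp [^]\<^sub>Q m" and normal_neg: "normal (- int m) = xm [^]\<^sub>Q m"
 using gen_closed by (simp_all add: normal_def)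

text \<open>For a negative exponent the new letter meets an X^-, and the pair collapses to the
  coefficient \<sigma>(a).\<close>

lemma xp_normal: "EX d:car D. xp *\<^sub>Q normal j = cf d *\<^sub>Q normal (j + 1)"
proof (cases "j \<ge> 0")
 case True
 then obtain m where j: "j = int m" using nonneg_int_cases by blast
 have "xp *\<^sub>Q normal j = normal (int (Suc m))"
  by (simp only: j normal_pos Q.A.nat_pow_Suc2[OF gen_closed(2)])
 then have "xp *\<^sub>Q normal j = cf 1\<^sub>D *\<^sub>Q normal (int (Suc m))"
  by (simp only: cfD(5) Q.A.l_one[OF normal_closed])
 then show ?thesis using j by (intro bexI[of _ "1\<^sub>D"]) (auto simp: add.commute)
next
 case False
 then have "nat (- j) > 0" by simp
 then obtain m where "nat (- j) = Suc m" using gr0_implies_Suc by blast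
 then have j: "j = - int (Suc m)" by linarith
 have p: "xm [^]\<^sub>Q m : car Q" using gen_closed by simp
 have "xp *\<^sub>Q normal j = (xp *\<^sub>Q xm) *\<^sub>Q xm [^]\<^sub>Q m"
  unfolding j normal_neg using gen_closed p Q.A.nat_pow_Suc2[of xm m]
  by (simp add: Q.A.m_assoc del: Q.A.nat_pow_Suc)
 also have "\<dots> = cf (\<sigma> a) *\<^sub>Q normal (- int m)" by (simp add: gwa_rules normal_neg)
 finally show ?thesis using j \<sigma>_simps(1)[OF a] by (intro bexI[of _ "\<sigma> a"]) auto
qed

lemma xm_normal: "EX d:car D. xm *\<^sub>Q normal j = cf d *\<^sub>Q normal (j - 1)"
proof (cases "j \<le> 0")
 case True
 then have "- j \<ge> 0" by simp
 then obtain m where "- j = int m" using nonneg_int_cases by blast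
 then have j: "j = - int m" by simp
 have "xm *\<^sub>Q normal j = normal (- int (Suc m))"
  by (simp only: j normal_neg Q.A.nat_pow_Suc2[OF gen_closed(3)])
 then have "xm *\<^sub>Q normal j = cf 1\<^sub>D *\<^sub>Q normal (- int (Suc m))"
  by (simp only: cfD(5) Q.A.l_one[OF normal_closed])
 moreover have "- int (Suc m) = j - 1" using j by linarith
 ultimately have "xm *\<^sub>Q normal j = cf 1\<^sub>D *\<^sub>Q normal (j - 1)" by (simp only:)
 then show ?thesis by (rule bexI) (rule D.A.one_closed)
next
 case False
 then have "nat j > 0" by simp
 then obtain m where "nat j = Suc m" using gr0_implies_Suc by blast
 then have j: "j = int (Suc m)" by linarith
 have p: "xp [^]\<^sub>Q m : car Q" using gen_closed by simp
 have "xm *\<^sub>Q normal j = (xm *\<^sub>Q xp) *\<^sub>Q xp [^]\<^sub>Q m"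
  unfolding j normal_pos using gen_closed p Q.A.nat_pow_Suc2[of xp m]
  by (simp add: Q.A.m_assoc del: Q.A.nat_pow_Suc)
 also have "\<dots> = cf a *\<^sub>Q normal (int m)" by (simp add: gwa_rules normal_pos)
 finally show ?thesis using j a by (intro bexI[of _ a]) auto
qed

lemma gen_normals:
 assumes g: "is_word [g]" and v: "v : normals" shows "gen g *\<^sub>Q v : normals"
proof -
 obtain d j where v: "v = cf d *\<^sub>Q normal j" "d : car D" using v by (auto simp: normals_def)
 note c = gen_closed(1)[OF v(2)] normal_closed[of j] gen_closed(2,3)
 have nI: "cf d *\<^sub>Q normal j : normals" if "d : car D" for d j
  using that by (auto simp: normals_def)
 have step: "cf d *\<^sub>Q z : normals" if d: "d : car D" and z: "EX d:car D. z = cf d *\<^sub>Q normal j" for d z j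
 proof -
  obtain d' where d': "d' : car D" "z = cf d' *\<^sub>Q normal j" using z by blast
  then have "cf d *\<^sub>Q z = cf (d *\<^sub>D d') *\<^sub>Q normal j"
   using d gen_closed(1) normal_closed by (simp add: cfD(3) Q.A.m_assoc)
  then show ?thesis using nI d d' by simp
 qed
 from g consider d' where "g = Coef d'" "d' : car D" | "g = XPlus" | "g = XMinus" by auto
 then show ?thesis
 proof cases
  case 1
  then show ?thesis using step[of d' v j] v by blast
 next
  case 2
  have "xp *\<^sub>Q v = xp *\<^sub>Q cf d *\<^sub>Q normal j" using c by (simp add: v(1) Q.A.m_assoc)
  also have "\<dots> = cf (\<sigma> d) *\<^sub>Q (xp *\<^sub>Q normal j)"
   using c gen_closed(1)[OF \<sigma>_simps(1)[OF v(2)]] by (simp add: gwa_rules(1)[OF v(2)] Q.A.m_assoc)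
  finally show ?thesis using step[OF \<sigma>_simps(1)[OF v(2)] xp_normal] 2 by simp
 next
  case 3
  have "xm *\<^sub>Q v = xm *\<^sub>Q cf d *\<^sub>Q normal j" using c by (simp add: v(1) Q.A.m_assoc)
  also have "\<dots> = cf (\<tau> d) *\<^sub>Q (xm *\<^sub>Q normal j)"
   using c gen_closed(1)[OF \<sigma>_simps(2)[OF v(2)]] by (simp add: gwa_rules(2)[OF v(2)] Q.A.m_assoc)
  finally show ?thesis using step[OF \<sigma>_simps(2)[OF v(2)] xm_normal] 3 by simp
 qed
qed

text \<open>A letter times a normal form is a single normal form and not a sum, so every word is
  one, by induction on its length. Linear independence is left to the image in the skew
  ring.\<close>

lemma span_normals: "x : car Q ==> x : Q.A.span normals"
proof -
 note Ssub = Q.A.span_subgroup[OF normals_carrier]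
 have word: "proj (e w) : normals" if "is_word w" for w
  using that
 proof (induction w)
  case Nil
  have "1\<^sub>Q = cf 1\<^sub>D *\<^sub>Q normal 0" by (simp add: normal_def cfD(5))
  then show ?case using D.A.one_closed by (auto simp: proj_e_Nil normals_def)
 next
  case (Cons g w)
  then show ?case using gen_normals[of g] by (simp add: proj_e_Cons del: Un_iff insert_iff)
 qed
 have "proj u : Q.A.span normals" if "u : car W" for u
  using cring_k monoid_words that
 proof (induction u rule: monoid_algebra_induct)
  case zero
  have "proj 0\<^sub>W = 0\<^sub>Q" using ring_hom_zero_neg(1)[OF projD(1) W.A.ring_axioms Q.A.ring_axioms] .
  then show ?case using Q.A.span_simps(3) by simp
 next
  case (single w c)
  have w: "is_word w" using single by (simp add: is_word_def words_simps)
  have "proj (single k w c) = c \<odot>\<^sub>Q proj (e w)"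
   using W_simps(4)[OF single] projD(6)[OF single(2) e_closed[OF w]] by simp
  also have "\<dots> = cf (c \<odot>\<^sub>D 1\<^sub>D) *\<^sub>Q proj (e w)"
   using single(2) projD(2)[OF e_closed[OF w]] by (simp add: cfD(5,6) Q.smult_mult_left)
  also have "\<dots> : normals" by (rule gen_normals[OF _ word[OF w]]) (use single(2) in auto)
  finally show ?case by (rule Q.A.span_simps(2))
 next
  case (add u v)
  then show ?case using projD(4) Q.A.span_simps(4) by simp
 qed
 moreover assume "x : car Q"
 then obtain u where "u : car W" "x = proj u"
  using W.quot_surj[OF ideal_gwa] unfolding gwa_def proj_def by blast
 ultimately show ?thesis by blast
qed

end

section \<open>Factors of tensor powers\<close>

lemma ring_hom_list_prod:
 assumes h: "h : ring_hom R S" and R: "ring R" and f: "\<And>i. i : set xs ==> f i : car R"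
 shows "h (list_prod R xs f) = list_prod S xs (%i. h (f i))"
 using f
proof (induction xs)
 case Nil
 show ?case using ring_hom_one[OF h] by simp
next
 case (Cons i xs)
 then have "f i : car R" "list_prod R xs f : car R"
  by (auto intro!: ring.list_prod_closed[OF R])
 then show ?case using Cons ring_hom_mult[OF h] by simp
qed

lemma alg_hom_compose:
 assumes f: "f : alg_hom k R S" and g: "g : alg_hom k S U" shows "(%x. g (f x)) : alg_hom k R U"
 by (rule alg_homI) (simp_all add: alg_homD[OF f] alg_homD[OF g])

context nc_algebra
begin

lemma tuple_one: "(\<lambda>i\<in>{1..n}. 1\<^sub>A) : car (tuples n A)" by simp

lemma single_tuple: "b : car A ==> (\<lambda>j\<in>{1..n}. if j = i then b else 1\<^sub>A) : car (tuples n A)"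
 by auto

lemma single_tuple_upd:
 "i : {1..n} ==> (\<lambda>j\<in>{1..n}. if j = i then b else 1\<^sub>A) = (\<lambda>j\<in>{1..n}. 1\<^sub>A)(i := b)"
 by auto

lemma in_factor_hom:
 assumes i: "i : {1..n}" shows "in_factor k n A i : alg_hom k A (tensor_power k n A)"
proof (rule alg_homI)
 fix x y assume xy: "x : car A" "y : car A"
 have "(\<lambda>j\<in>{1..n}. if j = i then x *\<^sub>A y else 1\<^sub>A) =
  (\<lambda>j\<in>{1..n}. if j = i then x else 1\<^sub>A) \<otimes>\<^bsub>tuples n A\<^esub> (\<lambda>j\<in>{1..n}. if j = i then y else 1\<^sub>A)"
  by auto
 then show "in_factor k n A i (x *\<^sub>A y) =
   in_factor k n A i x \<otimes>\<^bsub>tensor_power k n A\<^esub> in_factor k n A i y"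
  using pureD(3)[OF single_tuple[OF xy(1)] single_tuple[OF xy(2)]] by (simp only: in_factor_pure)
 show "in_factor k n A i (x +\<^sub>A y) =
   in_factor k n A i x \<oplus>\<^bsub>tensor_power k n A\<^esub> in_factor k n A i y"
  unfolding in_factor_pure single_tuple_upd[OF i] by (rule pureD(4)[OF tuple_one i xy])
next
 fix x assume "x : car A"
 then show "in_factor k n A i x : car (tensor_power k n A)"
  unfolding in_factor_pure by (rule pureD(1)[OF single_tuple])
 fix c assume "c : car k"
 then show "in_factor k n A i (c \<odot>\<^sub>A x) = c \<odot>\<^bsub>tensor_power k n A\<^esub> in_factor k n A i x"
  unfolding in_factor_pure single_tuple_upd[OF i] by (rule pureD(5)[OF tuple_one i _ \<open>x : car A\<close>])
next
 have "(\<lambda>j\<in>{1..n}. if j = i then 1\<^sub>A else 1\<^sub>A) = (\<lambda>j\<in>{1..n}. 1\<^sub>A)" by auto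
 then show "in_factor k n A i 1\<^sub>A = \<one>\<^bsub>tensor_power k n A\<^esub>"
  using pureD(2)[where n = n] by (simp only: in_factor_pure)
qed

text \<open>The list is kept general for the induction; positions not yet reached hold 1.\<close>

lemma pure_list_prod_partial:
 assumes "distinct xs" "set xs \<subseteq> {1..n}" and x: "x : car (tuples n A)"
 shows "list_prod (tensor_power k n A) xs (%i. in_factor k n A i (x i)) =
  pure k n A (\<lambda>j\<in>{1..n}. if j : set xs then x j else 1\<^sub>A)"
 using assms(1,2)
proof (induction xs)
 case Nil
 have "(\<lambda>j\<in>{1..n}. if j : set [] then x j else 1\<^sub>A) = (\<lambda>j\<in>{1..n}. 1\<^sub>A)" by auto
 then show ?case using pureD(2)[where n = n] by (simp only: list_prod_simps)
next
 case (Cons i xs)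
 have xj: "x j : car A" if "j : {1..n}" for j using x that by auto
 have c: "(\<lambda>j\<in>{1..n}. if j = i then x i else 1\<^sub>A) : car (tuples n A)"
  "(\<lambda>j\<in>{1..n}. if j : set xs then x j else 1\<^sub>A) : car (tuples n A)"
  using xj Cons.prems by auto
 have e: "(\<lambda>j\<in>{1..n}. if j : set (i # xs) then x j else 1\<^sub>A) =
  (\<lambda>j\<in>{1..n}. if j = i then x i else 1\<^sub>A) \<otimes>\<^bsub>tuples n A\<^esub> (\<lambda>j\<in>{1..n}. if j : set xs then x j else 1\<^sub>A)"
  using Cons.prems xj by (auto simp: fun_eq_iff)
 have ih: "list_prod (tensor_power k n A) xs (%i. in_factor k n A i (x i)) =
   pure k n A (\<lambda>j\<in>{1..n}. if j : set xs then x j else 1\<^sub>A)"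
  by (rule Cons.IH) (use Cons.prems in auto)
 show ?case
  by (simp only: ih e pureD(3)[OF c] list_prod_simps) (simp only: in_factor_pure)
qed

lemma pure_list_prod:
 assumes x: "x : car (tuples n A)"
 shows "pure k n A x = list_prod (tensor_power k n A) [1..<Suc n] (%i. in_factor k n A i (x i))"
proof -
 have "(\<lambda>j\<in>{1..n}. if j : set [1..<Suc n] then x j else 1\<^sub>A) = x"
 proof
  fix j
  show "(\<lambda>j\<in>{1..n}. if j : set [1..<Suc n] then x j else 1\<^sub>A) j = x j"
   using x by (cases "j : {1..n}") (auto simp: PiE_iff extensional_def)
 qed
 moreover have "set [1..<Suc n] \<subseteq> {1..n}" by auto
 ultimately show ?thesis using pure_list_prod_partial[OF distinct_upt _ x] by (simp only:)
qed

lemma tensor_perm_hom: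
 assumes p: "p permutes {1..n}"
 shows "tensor_perm k n A p : alg_hom k (tensor_power k n A) (tensor_power k n A)"
  and "x : car (tuples n A) ==> tensor_perm k n A p (pure k n A x) = pure k n A (x \<circ> inv_into UNIV p)"
 unfolding tensor_perm_def
 using tensor_map_hom[OF nc_algebra_axioms nc_algebra_axioms multilinear_perm(2,1)[OF nc_algebra_axioms p]] by auto

lemma tensor_perm_in_factor:
 assumes p: "p permutes {1..n}" and b: "b : car A"
 shows "tensor_perm k n A p (in_factor k n A i b) = in_factor k n A (p i) b"
proof -
 have "(\<lambda>j\<in>{1..n}. if j = i then b else 1\<^sub>A) \<circ> inv_into UNIV p = (\<lambda>j\<in>{1..n}. if j = p i then b else 1\<^sub>A)"
 proof
  fix j
  have "inv_into UNIV p j : {1..n} \<longleftrightarrow> j : {1..n}"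
   using permutes_in_image[OF permutes_inv[OF p]] by (simp add: inv_def)
  moreover have "inv_into UNIV p j = i \<longleftrightarrow> j = p i"
   using permutes_inv_eq[OF p] by (auto simp: inv_def)
  ultimately show "((\<lambda>j\<in>{1..n}. if j = i then b else 1\<^sub>A) \<circ> inv_into UNIV p) j = (\<lambda>j\<in>{1..n}. if j = p i then b else 1\<^sub>A) j"
   by simp
 qed
 then show ?thesis using tensor_perm_hom(2)[OF p single_tuple[OF b]] by (simp only: in_factor_pure)
qed

end

section \<open>Shifts and permutations of the field of fractions\<close>

locale gwa_power = affine_domain k D n + weyl_data k D a \<sigma>
 for k :: "('k, 'x) ring_scheme" and D :: "('k, 'd, 'y) module_scheme" and n a \<sigma> +
 assumes char_zero: "\<And>m :: nat. m > 0 ==> [m] \<cdot>\<^sub>k 1\<^sub>k ~= 0\<^sub>k"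
  and infinite_order: "\<And>m :: nat. m > 0 ==> \<sigma> [^]\<^bsub>alg_aut k D\<^esub> m ~= \<one>\<^bsub>alg_aut k D\<^esub>"
  and a_nonzero: "a ~= 0\<^sub>D"
begin

abbreviation pw where "pw j \<equiv> \<sigma> [^]\<^bsub>alg_aut k D\<^esub> (j :: int)"

sublocale DA: group "alg_aut k D" by (rule D.group_alg_aut)

lemma algebra_T: "algebra k T"
 by (rule nc_algebra_imp_algebra[OF T.nc_algebra_axioms]) (rule domain.axioms(1)[OF domain_T])

sublocale TD: algebra_domain k T
 by (intro algebra_domain.intro algebra_T domain_T)

abbreviation F where "F \<equiv> tensor_field k n D"

abbreviation ob where "ob \<equiv> of_base T"

abbreviation Z where "Z \<equiv> int_vectors n"

lemmas obD = alg_homD[OF TD.of_base_hom]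

lemma Z_simps:
 "car Z = (\<Pi>\<^sub>E i\<in>{1..n}. UNIV)" "1\<^sub>Z = (\<lambda>i\<in>{1..n}. 0)" "\<nu> *\<^sub>Z \<beta> = (\<lambda>i\<in>{1..n}. \<nu> i + \<beta> i)"
 by (simp_all add: int_vectors_def)

lemma group_Z: "group Z" unfolding int_vectors_def by simp

sublocale Z: group Z by (rule group_Z)

lemma inv_Z: "\<nu> : car Z ==> inv\<^bsub>Z\<^esub> \<nu> = (\<lambda>i\<in>{1..n}. - \<nu> i)"
 by (rule Z.inv_equality) (auto simp: Z_simps)

section \<open>Action of integer vectors on the tensor power and its fractions\<close>

definition sh where
 "sh \<nu> = tensor_map k n D (%x. \<lambda>i\<in>{1..n}. (pw (\<nu> i :: int)) (x i))"

lemma pow_aut: "pw (j :: int) : car (alg_aut k D)"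
 using \<sigma> by simp

lemma pow_hom: "pw (j :: int) : alg_hom k D D"
 using pow_aut by (simp add: carrier_alg_aut)

lemmas powD = alg_homD[OF pow_hom]

lemma sh_hom: "sh \<nu> : alg_hom k T T"
 and sh_pure: "x : car (tuples n D) ==> sh \<nu> (pure k n D x) =
   pure k n D (\<lambda>i\<in>{1..n}. (pw (\<nu> i :: int)) (x i))"
proof -
 note m = multilinear_factorwise[where f = "%i. pw (\<nu> i :: int)" and n = n,
   OF D.nc_algebra_axioms D.nc_algebra_axioms pow_hom]
 show "sh \<nu> : alg_hom k T T"
  "x : car (tuples n D) ==> sh \<nu> (pure k n D x) =
   pure k n D (\<lambda>i\<in>{1..n}. (pw (\<nu> i :: int)) (x i))"
  unfolding sh_def using tensor_map_hom[OF D.nc_algebra_axioms D.nc_algebra_axioms m(2,1)] by auto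
qed

lemmas shD = alg_homD[OF sh_hom]

lemma sh_tuple: "x : car (tuples n D) ==>
  (\<lambda>i\<in>{1..n}. (pw (\<nu> i :: int)) (x i)) : car (tuples n D)"
 using powD(2) by auto

lemma T_id_hom: "(%t. t) : alg_hom k T T"
 by (rule alg_homI) auto

lemma sh_mult:
 assumes t: "t : car T" shows "sh (\<nu> *\<^sub>Z \<beta>) t = sh \<nu> (sh \<beta> t)"
proof (rule alg_hom_tensor_eqI[OF T.nc_algebra_axioms sh_hom alg_hom_compose[OF sh_hom sh_hom] _ t])
 fix x assume x: "x : car (tuples n D)"
 have "(\<lambda>i\<in>{1..n}. (pw ((\<nu> *\<^sub>Z \<beta>) i :: int)) (x i)) =
  (\<lambda>i\<in>{1..n}. (pw (\<nu> i)) ((\<lambda>i\<in>{1..n}. (pw (\<beta> i)) (x i)) i))"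
 proof (rule restrict_ext)
  fix i assume i: "i : {1..n}"
  then have "x i : car D" using x by auto
  then show "(pw ((\<nu> *\<^sub>Z \<beta>) i :: int)) (x i) =
    (pw (\<nu> i)) ((\<lambda>i\<in>{1..n}. (pw (\<beta> i)) (x i)) i)"
   using i \<sigma> D.alg_aut_mult_apply[OF pow_aut pow_aut] by (simp add: Z_simps DA.int_pow_mult[symmetric])
 qed
 then show "sh (\<nu> *\<^sub>Z \<beta>) (pure k n D x) = sh \<nu> (sh \<beta> (pure k n D x))"
  using x sh_tuple by (simp only: sh_pure)
qed

lemma sh_one:
 assumes t: "t : car T" shows "sh 1\<^sub>Z t = t"
proof (rule alg_hom_tensor_eqI[OF T.nc_algebra_axioms sh_hom T_id_hom _ t])
 fix x assume x: "x : car (tuples n D)"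
 have "(\<lambda>i\<in>{1..n}. (pw (1\<^sub>Z i :: int)) (x i)) = x"
 proof
  fix i show "(\<lambda>i\<in>{1..n}. (pw (1\<^sub>Z i :: int)) (x i)) i = x i"
   using x by (cases "i : {1..n}") (auto simp: Z_simps alg_aut_one PiE_iff extensional_def)
 qed
 then show "sh 1\<^sub>Z (pure k n D x) = pure k n D x" using sh_pure[OF x] by simp
qed

lemma sh_in_factor:
 assumes d: "d : car D" and i: "i : {1..n}"
 shows "sh \<nu> (in_factor k n D i d) = in_factor k n D i ((pw (\<nu> i)) d)"
proof -
 have "(\<lambda>j\<in>{1..n}. (pw (\<nu> j)) ((\<lambda>j\<in>{1..n}. if j = i then d else 1\<^sub>D) j)) =
  (\<lambda>j\<in>{1..n}. if j = i then (pw (\<nu> i)) d else 1\<^sub>D)"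
  by (rule restrict_ext) (simp add: powD(5))
 then show ?thesis using sh_pure[OF D.single_tuple[OF d, where n = n and i = i], of \<nu>] by (simp only: in_factor_pure)
qed

abbreviation act where "act \<equiv> shift_act k n D \<sigma>"

lemma act_eq: "act \<nu> = restrict (frac_map T (sh \<nu>)) (car F)"
 by (simp add: shift_act_def sh_def)

lemma inj_of_inverse:
 "(\<And>t. t : car T ==> g (f t) = t) ==> inj_on f (car T)"
 by (rule inj_on_inverseI)

lemma sh_inverse:
 assumes \<nu>: "\<nu> : car Z" and t: "t : car T"
 shows "sh \<nu> (sh (inv\<^bsub>Z\<^esub> \<nu>) t) = t" "sh (inv\<^bsub>Z\<^esub> \<nu>) (sh \<nu> t) = t"
 using sh_mult[OF t, of \<nu> "inv\<^bsub>Z\<^esub> \<nu>"] sh_mult[OF t, of "inv\<^bsub>Z\<^esub> \<nu>" \<nu>] sh_one[OF t] \<nu> by simp_all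

lemma act_aut: "\<nu> : car Z ==> act \<nu> : car (alg_aut k F)"
 unfolding act_eq by (rule TD.frac_map_aut[OF sh_hom sh_hom]) (use sh_inverse in auto)

lemma ob_F: "t : car T ==> ob t : car F" by (rule obD(2))

lemma act_ob: assumes "\<nu> : car Z" "t : car T" shows "act \<nu> (ob t) = ob (sh \<nu> t)"
 unfolding act_eq
 using TD.frac_map_of_base[OF sh_hom inj_of_inverse[where g = "sh (inv\<^bsub>Z\<^esub> \<nu>)"] assms(2)] sh_inverse[OF assms(1)]
  ob_F[OF assms(2)] by simp

sublocale FA: nc_algebra k F by (rule algebra.nc_algebra[OF TD.algebra_F])
sublocale FG: group "alg_aut k F" by (rule FA.group_alg_aut)

lemma aut_eqI:
 assumes "f : car (alg_aut k F)" "g : car (alg_aut k F)" "\<And>t. t : car T ==> f (ob t) = g (ob t)"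
 shows "f = g"
proof (rule FA.alg_aut_eqI[OF assms(1,2)])
 have h: "f : ring_hom F F" "g : ring_hom F F" using assms(1,2) by (simp_all add: carrier_alg_aut alg_hom_def)
 show "f z = g z" if "z : car F" for z
  using TD.frac_ext[OF h _ that] assms(3) by blast
qed

lemma act_hom: "act : hom Z (alg_aut k F)"
proof (rule homI)
 fix \<nu> \<beta> assume ab: "\<nu> : car Z" "\<beta> : car Z"
 note c = act_aut[OF ab(1)] act_aut[OF ab(2)]
 show "act (\<nu> *\<^sub>Z \<beta>) = act \<nu> *\<^sub>(alg_aut k F) act \<beta>"
 proof (rule aut_eqI)
  fix t assume t: "t : car T"
  show "act (\<nu> *\<^sub>Z \<beta>) (ob t) = (act \<nu> *\<^sub>(alg_aut k F) act \<beta>) (ob t)"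
   using FA.alg_aut_mult_apply[OF c ob_F[OF t]] ab shD(2)[OF t]
   by (simp add: act_ob t sh_mult[OF t] del: mult_product_group)
 qed (use act_aut ab c in auto)
qed (rule act_aut)

text \<open>Equal powers with different exponents would make a positive power of \<sigma>
  trivial.\<close>

lemma pow_injective:
 assumes eq: "pw (i::int) = pw (j::int)" shows "i = j"
proof -
 have le: "\<not> i < j" if e: "pw (i::int) = pw (j::int)" for i j
 proof
  assume "i < j"
  then obtain m :: nat where m: "j - i = int m" "m > 0" by (metis diff_gt_0_iff_gt pos_int_cases)
  have "pw (j - i) = \<one>\<^bsub>alg_aut k D\<^esub>"
   using DA.int_pow_diff[OF \<sigma>, of j i] e pow_aut[of j] by (simp add: DA.r_inv)
  then show False using infinite_order[OF m(2)] m(1) by (simp add: int_pow_int)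
 qed
 show ?thesis using le[OF eq] le[OF eq[symmetric]] by simp
qed

text \<open>Testing on elements placed in a single factor isolates each power of \<sigma>, since
  \<open>in_factor\<close> is injective.\<close>

lemma act_inj: "inj_on act (car Z)"
proof (rule inj_onI)
 fix \<nu> \<beta> assume ab: "\<nu> : car Z" "\<beta> : car Z" and eq: "act \<nu> = act \<beta>"
 have "\<nu> i = \<beta> i" if i: "i : {1..n}" for i
 proof (rule pow_injective, rule D.alg_aut_eqI[OF pow_aut pow_aut])
  fix d assume d: "d : car D"
  note c = alg_homD(2)[OF D.in_factor_hom[OF i]]
  have "ob (sh \<nu> (in_factor k n D i d)) = ob (sh \<beta> (in_factor k n D i d))"
   using act_ob[OF ab(1) c[OF d]] act_ob[OF ab(2) c[OF d]] eq by simp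
  then have "sh \<nu> (in_factor k n D i d) = sh \<beta> (in_factor k n D i d)"
   by (rule inj_onD[OF TD.of_base_inj _ shD(2)[OF c[OF d]] shD(2)[OF c[OF d]]])
  then show "(pw (\<nu> i)) d = (pw (\<beta> i)) d"
   using in_factor_inj[OF i powD(2)[OF d] powD(2)[OF d]] by (simp add: sh_in_factor[OF d i])
 qed
 then show "\<nu> = \<beta>" using ab by (intro PiE_ext[of _ "{1..n}" "%_. UNIV"]) (simp_all add: Z_simps)
qed

section \<open>Action of permutations and its relation to the shifts\<close>

abbreviation pm where "pm \<equiv> tensor_perm k n D"

lemmas pm_hom = D.tensor_perm_hom(1)[where n = n] and pm_pure = D.tensor_perm_hom(2)[where n = n]

lemma perm_tuple: "p permutes {1..n} ==> x : car (tuples n D) ==> x \<circ> inv_into UNIV p : car (tuples n D)"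
 by (rule multilinear_perm(2)[OF D.nc_algebra_axioms])

lemma pm_comp:
 assumes p: "p permutes {1..n}" and q: "q permutes {1..n}" and t: "t : car T"
 shows "pm (p \<circ> q) t = pm p (pm q t)"
proof (rule alg_hom_tensor_eqI[OF T.nc_algebra_axioms pm_hom[OF permutes_compose[OF q p]]
   alg_hom_compose[OF pm_hom[OF q] pm_hom[OF p]] _ t])
 fix x assume x: "x : car (tuples n D)"
 have "inv_into UNIV (p \<circ> q) = inv_into UNIV q \<circ> inv_into UNIV p"
  using o_inv_distrib[OF permutes_bij[OF p] permutes_bij[OF q]] .
 then show "pm (p \<circ> q) (pure k n D x) = pm p (pm q (pure k n D x))"
  using x perm_tuple[OF q x] by (simp add: pm_pure[OF permutes_compose[OF q p]] pm_pure[OF p] pm_pure[OF q] o_assoc)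
qed

lemma pm_id: assumes t: "t : car T" shows "pm id t = t"
proof (rule alg_hom_tensor_eqI[OF T.nc_algebra_axioms pm_hom[OF permutes_id] T_id_hom _ t])
 fix x assume "x : car (tuples n D)"
 then show "pm id (pure k n D x) = pure k n D x" using pm_pure[OF permutes_id] by simp
qed

lemma pm_inverse:
 assumes p: "p permutes {1..n}" and t: "t : car T"
 shows "pm p (pm (inv_into UNIV p) t) = t" "pm (inv_into UNIV p) (pm p t) = t"
 using pm_comp[OF p permutes_inv[OF p] t] pm_comp[OF permutes_inv[OF p] p t] pm_id[OF t]
  permutes_inv_o[OF p] by simp_all

abbreviation pa where "pa \<equiv> perm_act k n D"

lemma pa_aut: "p permutes {1..n} ==> pa p : car (alg_aut k F)"
 unfolding perm_act_def
 by (rule TD.frac_map_aut[OF pm_hom pm_hom[OF permutes_inv]]) (use pm_inverse in auto)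

lemma pa_ob: assumes p: "p permutes {1..n}" and t: "t : car T" shows "pa p (ob t) = ob (pm p t)"
 unfolding perm_act_def
 using TD.frac_map_of_base[OF pm_hom[OF p] inj_of_inverse[where g = "pm (inv_into UNIV p)"] t]
  pm_inverse[OF p] ob_F[OF t] by simp

lemma pa_hom: "pa : hom (sym_group n) (alg_aut k F)"
proof (rule homI)
 fix p q assume "p : car (sym_group n)" "q : car (sym_group n)"
 then have p: "p permutes {1..n}" and q: "q permutes {1..n}" by (simp_all add: sym_group_carrier)
 show "pa (p \<otimes>\<^bsub>sym_group n\<^esub> q) = pa p *\<^sub>(alg_aut k F) pa q"
 proof (rule aut_eqI)
  fix t assume t: "t : car T"
  show "pa (p \<otimes>\<^bsub>sym_group n\<^esub> q) (ob t) = (pa p *\<^sub>(alg_aut k F) pa q) (ob t)"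
   using FA.alg_aut_mult_apply[OF pa_aut[OF p] pa_aut[OF q] ob_F[OF t]] alg_homD(2)[OF pm_hom[OF q] t]
   by (simp add: sym_group_mult pa_ob[OF p] pa_ob[OF q] pa_ob[OF permutes_compose[OF q p]] t pm_comp[OF p q t])
 qed (use pa_aut p q permutes_compose[OF q p] FG.m_closed in "auto simp: sym_group_mult")
qed (use pa_aut in "simp add: sym_group_carrier")

lemma perm_Z: assumes p: "p permutes {1..n}" and \<nu>: "\<nu> : car Z" shows "\<nu> \<circ> inv_into UNIV p : car Z"
proof -
 have "(\<nu> \<circ> inv_into UNIV p) j = undefined" if "j \<notin> {1..n}" for j
  using that \<nu> permutes_not_in[OF permutes_inv[OF p] that] by (simp add: Z_simps PiE_iff extensional_def)
 then show ?thesis by (auto simp: Z_simps PiE_iff extensional_def)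
qed

lemma perm_shift:
 assumes p: "p permutes {1..n}" and t: "t : car T"
 shows "pm p (sh \<nu> t) = sh (\<nu> \<circ> inv_into UNIV p) (pm p t)"
proof (rule alg_hom_tensor_eqI[OF T.nc_algebra_axioms alg_hom_compose[OF sh_hom pm_hom[OF p]]
   alg_hom_compose[OF pm_hom[OF p] sh_hom] _ t])
 fix x assume x: "x : car (tuples n D)"
 have "(\<lambda>i\<in>{1..n}. (pw (\<nu> i)) (x i)) \<circ> inv_into UNIV p =
  (\<lambda>i\<in>{1..n}. (pw ((\<nu> \<circ> inv_into UNIV p) i)) ((x \<circ> inv_into UNIV p) i))"
 proof
  fix j
  have "inv_into UNIV p j : {1..n} \<longleftrightarrow> j : {1..n}"
   using permutes_in_image[OF permutes_inv[OF p]] by simp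
  then show "((\<lambda>i\<in>{1..n}. (pw (\<nu> i)) (x i)) \<circ> inv_into UNIV p) j =
   (\<lambda>i\<in>{1..n}. (pw ((\<nu> \<circ> inv_into UNIV p) i)) ((x \<circ> inv_into UNIV p) i)) j" by simp
 qed
 then show "pm p (sh \<nu> (pure k n D x)) = sh (\<nu> \<circ> inv_into UNIV p) (pm p (pure k n D x))"
  using sh_pure[OF x, of \<nu>] pm_pure[OF p sh_tuple[OF x]] pm_pure[OF p x] sh_pure[OF perm_tuple[OF p x]] by simp
qed

text \<open>Conjugation by a permutation moves the exponents to their new positions. An automorphism
  of \<open>F\<close> is determined on the base ring, and there the claim is
  \<open>perm_shift\<close>.\<close>

lemma perm_act_shift:
 assumes p: "p permutes {1..n}" and \<nu>: "\<nu> : car Z"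
 shows "pa p *\<^sub>(alg_aut k F) act \<nu> *\<^sub>(alg_aut k F) inv\<^bsub>alg_aut k F\<^esub> (pa p) = act (\<nu> \<circ> inv_into UNIV p)"
proof -
 note c = pa_aut[OF p] act_aut[OF \<nu>] act_aut[OF perm_Z[OF p \<nu>]]
 have "pa p *\<^sub>(alg_aut k F) act \<nu> = act (\<nu> \<circ> inv_into UNIV p) *\<^sub>(alg_aut k F) pa p"
 proof (rule aut_eqI)
  fix t assume t: "t : car T"
  show "(pa p *\<^sub>(alg_aut k F) act \<nu>) (ob t) = (act (\<nu> \<circ> inv_into UNIV p) *\<^sub>(alg_aut k F) pa p) (ob t)"
   using FA.alg_aut_mult_apply[OF c(1,2) ob_F[OF t]] FA.alg_aut_mult_apply[OF c(3,1) ob_F[OF t]]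
    alg_homD(2)[OF pm_hom[OF p] t] shD(2)[OF t, of \<nu>]
   by (simp add: act_ob[OF \<nu>] act_ob[OF perm_Z[OF p \<nu>]] pa_ob[OF p] t perm_shift[OF p t])
 qed (use c in auto)
 then show ?thesis using c by (simp add: FG.m_assoc)
qed

lemma Z_pow: "i : {1..n} ==> (\<nu> [^]\<^sub>Z m) i = int m * \<nu> i" for m :: nat
 by (induction m) (auto simp: Z_simps algebra_simps)

lemma torsion_free:
 assumes \<nu>: "\<nu> : car Z" and "(j::nat) > 0" "\<nu> [^]\<^sub>Z j = 1\<^sub>Z" shows "\<nu> = 1\<^sub>Z"
proof -
 have "\<nu> i = 0" if i: "i : {1..n}" for i
 proof -
  have "int j * \<nu> i = 0" using Z_pow[OF i, of \<nu> j] i by (simp add: assms(3) Z_simps)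
  then show ?thesis using assms(2) by simp
 qed
 then show ?thesis using \<nu> by (auto simp: Z_simps fun_eq_iff PiE_iff extensional_def)
qed

section \<open>The tensor power as a subring of its field of fractions\<close>

lemma base_subring: "subring (ob ` car T) F"
proof -
 interpret h: ring_hom_ring T F ob
  by (intro ring_hom_ringI2 T.A.ring_axioms FA.A.ring_axioms obD(1))
 show ?thesis using h.img_is_subring[OF T.A.carrier_is_subring] .
qed

lemma base_scalars: "scalars k F \<subseteq> ob ` car T"
proof
 fix z assume "z : scalars k F"
 then obtain c where c: "c : car k" "z = c \<odot>\<^sub>F 1\<^sub>F" by (auto simp: scalars_def)
 then have "z = ob (c \<odot>\<^sub>T 1\<^sub>T)" using obD(5,6) by simp
 then show "z : ob ` car T" using c by blast
qed

text \<open>Generators of \<open>D\<close> are placed in each of the \<open>n\<close> factors. The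
  elements of \<open>D\<close> whose copy in factor \<open>i\<close> is reached form a subring, and
  pure tensors are products over the factors.\<close>

lemma base_fin_gen: "\<exists>Y. finite Y & Y \<subseteq> ob ` car T & generate_ring F (scalars k F \<union> Y) = ob ` car T"
proof -
 obtain Y where Y: "finite Y" "Y \<subseteq> car D" "generate_ring D (scalars k D \<union> Y) = car D"
  using fin_gen by (auto simp: fin_gen_ring_over_def)
 define Y' where "Y' = (%(i, d). ob (in_factor k n D i d)) ` ({1..n} \<times> Y)"
 have inT: "in_factor k n D i d : car T" if "i : {1..n}" "d : car D" for i d
  using alg_homD(2)[OF D.in_factor_hom[OF that(1)] that(2)] .
 have Y'T: "Y' \<subseteq> ob ` car T" using inT Y(2) by (auto simp: Y'_def)
 have gens: "scalars k F \<union> Y' \<subseteq> ob ` car T" using base_scalars Y'T by simp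
 have gensF: "scalars k F \<union> Y' \<subseteq> car F" using order_trans[OF gens subringE(1)[OF base_subring]] .
 let ?H = "generate_ring F (scalars k F \<union> Y')"
 have H: "subring ?H F" "scalars k F \<union> Y' \<subseteq> ?H"
  using FA.A.generate_ring_is_subring[OF gensF] FA.A.generate_ringE(2)[OF gensF refl] .
 have sc: "c \<odot>\<^sub>F 1\<^sub>F : ?H" if "c : car k" for c
  by (rule subsetD[OF H(2)]) (use that in "auto simp: scalars_def")
 have fac: "ob (in_factor k n D i d) : ?H" if i: "i : {1..n}" and d: "d : car D" for i d
 proof -
  have "(%d. ob (in_factor k n D i d)) : alg_hom k D F"
   by (rule alg_hom_compose[OF D.in_factor_hom[OF i] TD.of_base_hom])
  note fD = alg_homD[OF this]
  interpret h: ring_hom_ring D F "%d. ob (in_factor k n D i d)"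
   by (intro ring_hom_ringI2 D.A.ring_axioms FA.A.ring_axioms fD(1))
  let ?P = "{d \<in> car D. ob (in_factor k n D i d) : ?H}"
  have "subring ?P D"
   by (rule D.A.subringI) (use subringE[OF H(1)] in "auto simp: h.hom_add h.hom_mult h.hom_a_inv")
  moreover have "scalars k D \<union> Y \<subseteq> ?P"
  proof
   fix z assume z: "z : scalars k D \<union> Y"
   then have zD: "z : car D" using Y(2) by (auto simp: scalars_def)
   have "ob (in_factor k n D i z) : ?H"
   proof (cases "z : Y")
    case True
    then have "ob (in_factor k n D i z) : Y'" unfolding Y'_def using i by (intro image_eqI[where x = "(i, z)"]) auto
    then show ?thesis using H(2) by blast
   next
    case False
    then obtain c where c: "c : car k" "z = c \<odot>\<^sub>D 1\<^sub>D" using z by (auto simp: scalars_def)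
    then have "ob (in_factor k n D i z) = c \<odot>\<^sub>F 1\<^sub>F" using fD(5,6) by simp
    then show ?thesis using sc c by simp
   qed
   then show "z : ?P" using zD by simp
  qed
  ultimately have "car D \<subseteq> ?P"
   using D.A.generate_ring_min_subring1[of "scalars k D \<union> Y" ?P] Y(3) D.A.generate_ring_in_carrier
    subringE(1) by (metis (no_types, lifting) subset_trans)
  then show ?thesis using d by blast
 qed
 have "ob t : ?H" if t: "t : car T" for t
  using t
 proof (induction t rule: D.tensor_induct)
  case (pure c x)
  have pT: "pure k n D x : car T" by (rule D.pureD(1)[OF pure(2)])
  have xf: "in_factor k n D i (x i) : car T" "ob (in_factor k n D i (x i)) : ?H" if i: "i : {1..n}" for i
  proof -
   have "x i : car D" using pure(2) i by auto
   then show "in_factor k n D i (x i) : car T" "ob (in_factor k n D i (x i)) : ?H"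
    using inT[OF i] fac[OF i] by blast+
  qed
  have "ob (pure k n D x) = list_prod F [1..<Suc n] (%i. ob (in_factor k n D i (x i)))"
   unfolding D.pure_list_prod[OF pure(2)]
   by (rule ring_hom_list_prod[OF obD(1) T.A.ring_axioms]) (use xf in auto)
  also have "\<dots> : ?H"
  proof -
   have lp: "list_prod F xs (%i. ob (in_factor k n D i (x i))) : ?H" if "set xs \<subseteq> {1..n}" for xs
    using that
   proof (induction xs)
    case Nil
    show ?case using subringE(3)[OF H(1)] by simp
   next
    case (Cons i xs)
    then show ?case using subringE(6)[OF H(1)] xf(2)[of i] by simp
   qed
   show ?thesis by (rule lp) auto
  qed
  finally have "(c \<odot>\<^sub>F 1\<^sub>F) *\<^sub>F ob (pure k n D x) : ?H"
   using subringE(6)[OF H(1) sc[OF pure(1)]] by blast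
  then show ?case using obD(6)[OF pure(1) pT] ob_F[OF pT] pure(1) by (simp add: FA.smult_mult_left)
 next
  case (add s t)
  then show ?case using obD(4) subringE(7)[OF H(1)] by simp
 qed
 moreover have "?H \<subseteq> ob ` car T" by (rule FA.A.generate_ring_min_subring1[OF gensF base_subring gens])
 ultimately have "?H = ob ` car T" by blast
 moreover have "finite Y'" using Y(1) by (simp add: Y'_def)
 ultimately show ?thesis using Y'T by (intro exI[of _ Y'] conjI)
qed

lemma galois_skew:
 assumes H: "subgroup H (sym_group n)"
 shows "galois_skew k F (ob ` car T) (pa ` H) Z act"
proof -
 have Hp: "p permutes {1..n}" if "p : H" for p
  using subgroup.subset[OF H] that by (auto simp: sym_group_carrier)
 interpret P: group_hom "sym_group n" "alg_aut k F" pa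
  by (intro group_hom.intro group_hom_axioms.intro pa_hom FG.group_axioms sym_group_is_group)
 show ?thesis
 proof (intro galois_skew.intro galois_data.intro galois_skew_axioms.intro)
  show "finite (pa ` H)"
   using finite_subset[OF _ finite_permutations[of "{1..n}"], of H] Hp by auto
  show "g t : ob ` car T" if g: "g : pa ` H" and t: "t : ob ` car T" for g t
  proof -
   obtain p u where pu: "g = pa p" "p : H" "t = ob u" "u : car T" using g t by blast
   then have "g t = ob (pm p u)" using pa_ob[OF Hp] by simp
   then show ?thesis using alg_homD(2)[OF pm_hom[OF Hp[OF pu(2)]] pu(4)] by blast
  qed
  show "act \<nu> t : ob ` car T" if "\<nu> : car Z" "t : ob ` car T" for \<nu> t
   using that act_ob shD(2) by auto
  show "g *\<^sub>(alg_aut k F) act \<nu> *\<^sub>(alg_aut k F) inv\<^bsub>alg_aut k F\<^esub> g : act ` car Z"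
   if g: "g : pa ` H" and \<nu>: "\<nu> : car Z" for g \<nu>
  proof -
   obtain p where p: "g = pa p" "p : H" using g by blast
   then show ?thesis using perm_act_shift[OF Hp \<nu>] perm_Z[OF Hp \<nu>] by simp
  qed
 qed (fact k.field_axioms TD.algebra_F TD.field_F base_subring base_scalars base_fin_gen
   TD.fractions_in_F P.subgroup_img_is_subgroup[OF H] char_zero group_Z act_hom act_inj torsion_free)+
qed

end

section \<open>The embedding of the tensor power of a generalized Weyl algebra\<close>

lemma (in ring) preimage_subring:
 assumes h: "h : ring_hom R S" and S: "ring S" and K: "subring K S"
 shows "subring {x \<in> car R. h x : K} R"
proof -
 interpret h: ring_hom_ring R S h by (intro ring_hom_ringI2 ring_axioms S h)
 show ?thesis by (rule subringI) (use subringE[OF K] in auto)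
qed

lemma (in ring) list_prod_single:
 assumes "distinct xs" "i : set xs" "b : car R"
 shows "list_prod R xs (%j. if j = i then b else \<one>) = b"
 using assms(1,2)
proof (induction xs)
 case (Cons j xs)
 show ?case
 proof (cases "j = i")
  case True
  then have "list_prod R xs (%j. if j = i then b else \<one>) = \<one>" using Cons by (intro list_prod_one) auto
  then show ?thesis using True assms(3) by simp
 next
  case False
  then show ?thesis using Cons assms(3) by simp
 qed
qed simp

lemma (in ring) list_prod_subring:
 assumes "subring K R" "\<And>i. i : set xs ==> f i : K" shows "list_prod R xs f : K"
 using assms(2) by (induction xs) (use subringE(3,6)[OF assms(1)] in auto)

lemma (in ring) pow_subring:
 assumes "subring K R" "z : K" shows "z [^] (m::nat) : K"
 by (induction m) (use subringE(3,6)[OF assms(1)] assms(2) in auto)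

lemma (in ring) monomials_mult:
 assumes "p : monomials J" "q : monomials J" "J \<subseteq> car R" shows "p \<otimes> q : monomials J"
 using assms(2)
proof (induction q rule: monomials.induct)
 case one
 then show ?case using assms monomials_closed by simp
next
 case (mult m z)
 have "p \<otimes> (m \<otimes> z) = p \<otimes> m \<otimes> z"
  using assms monomials_closed mult.hyps by (subst m_assoc) auto
 then show ?case using mult by (simp add: monomials.mult)
qed

context weyl_data
begin

lemma normal_subring:
 assumes H: "subring H Q" and "xp : H" "xm : H" shows "normal j : H"
 unfolding normal_def using subringE(6)[OF H] Q.A.pow_subring[OF H] assms(2,3) by simp

lemma gwa_generated:
 assumes H: "subring H Q" and c: "\<And>d. d : car D ==> cf d : H" and x: "xp : H" "xm : H"
 shows "car Q \<subseteq> H"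
proof
 fix z assume "z : car Q"
 then have z: "z : Q.A.span normals" by (rule span_normals)
 have "normals \<subseteq> H"
  unfolding normals_def using subringE(6)[OF H] normal_subring[OF H x] c by blast
 then show "z : H" using Q.A.span_minimal[OF _ Q.A.subring_subgroup[OF H]] z by blast
qed

end

context gwa_power
begin

text \<open>Taken for the full symmetric group, so that the facts on conjugation hold for every
  permutation before a subgroup is fixed.\<close>

sublocale SG: galois_skew k F "ob ` car T" "pa ` car (sym_group n)" Z act
 by (rule galois_skew[OF group.subgroup_self[OF sym_group_is_group]])

abbreviation S where "S \<equiv> skew_monoid_ring F Z act"

abbreviation \<iota> where "\<iota> \<equiv> single F 1\<^sub>Z"

abbreviation \<epsilon> where "\<epsilon> \<equiv> unit_vector n"

abbreviation fac where "fac \<equiv> in_factor k n D"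

abbreviation fq where "fq \<equiv> in_factor k n Q"

abbreviation P where "P \<equiv> tensor_power k n Q"

lemmas facD = alg_homD[OF D.in_factor_hom[where n = n]]

lemma nc_S: "nc_algebra k S" by (rule SG.W.nc_algebra_S)

lemma nc_TQ: "nc_algebra k P" by (rule Q.nc_algebra_T)


sublocale P: nc_algebra k P by (rule nc_TQ)

lemma ring_S: "ring S" by (rule SG.W.ring_S)

lemma ring_TQ: "ring P" by (rule nc_algebra.axioms(1)[OF nc_TQ])

lemma \<epsilon>_Z: "\<epsilon> i : car Z" by (auto simp: unit_vector_def Z_simps)

lemma act_fac: "[|\<nu> : car Z; i : {1..n}; d : car D|] ==>
  act \<nu> (ob (fac i d)) = ob (fac i ((pw (\<nu> i)) d))"
 using act_ob[of \<nu> "fac i d"] facD(2)[of i d] sh_in_factor[of d i \<nu>] by simp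

lemma fac_F: "[|i : {1..n}; d : car D|] ==> ob (fac i d) : car F"
 using ob_F facD(2) by blast

lemma ob_fac_one: "i : {1..n} ==> ob (fac i 1\<^sub>D) = 1\<^sub>F"
 using facD(5) obD(5) by simp

lemma single_S: "[|\<nu> : car Z; x : car F|] ==> single F \<nu> x : car S"
 by (rule SG.W.single_closed)

lemmas single_mult = SG.W.single_mult

lemma act_F: "[|\<nu> : car Z; x : car F|] ==> act \<nu> x : car F"
 by (rule SG.W.act_simps(1))

lemma act_one_F: "x : car F ==> act 1\<^sub>Z x = x" by (rule SG.W.act_one)

lemma Z_comm: "\<nu> *\<^sub>Z \<beta> = \<beta> *\<^sub>Z \<nu>" by (auto simp: Z_simps)

lemma F_comm: "[|x : car F; y : car F|] ==> x *\<^sub>F y = y *\<^sub>F x"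
 using cring.cring_simprules(14)[OF TD.cring_F] .

lemma \<epsilon>_simps: "[|i : {1..n}; j : {1..n}|] ==> \<epsilon> i j = (if j = i then 1 else 0)"
 by (simp add: unit_vector_def)

lemma inv_\<epsilon>: "[|i : {1..n}; j : {1..n}|] ==> (inv\<^bsub>Z\<^esub> (\<epsilon> i)) j = (if j = i then - 1 else 0)"
 by (simp add: inv_Z[OF \<epsilon>_Z] \<epsilon>_simps)

lemma inv_\<epsilon>_Z: "inv\<^bsub>Z\<^esub> (\<epsilon> i) : car Z" using \<epsilon>_Z by simp

lemma pow_neg_one: "(pw (- 1 :: int)) = \<tau>"
 using DA.int_pow_neg[OF \<sigma>, of 1] DA.int_pow_1[OF \<sigma>] by simp

lemma act_\<epsilon>: assumes "i : {1..n}" "d : car D"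
 shows "act (\<epsilon> i) (ob (fac i d)) = ob (fac i (\<sigma> d))"
  and "act (inv\<^bsub>Z\<^esub> (\<epsilon> i)) (ob (fac i d)) = ob (fac i (\<tau> d))"
 using act_fac[OF \<epsilon>_Z assms] act_fac[OF inv_\<epsilon>_Z assms] assms DA.int_pow_1[OF \<sigma>]
 by (simp_all add: \<epsilon>_simps inv_\<epsilon> pow_neg_one del: DA.int_pow_1)

text \<open>Moving a coefficient of factor \<open>i\<close> past \<epsilon>_i applies \<sigma> to
  it. Placing \<open>a\<close> in front of the inverse of \<epsilon>_i therefore yields
  \<open>a\<close> for X^- X^+ and \<sigma>(a) for X^+ X^-.\<close>

lemma factor_hom:
 assumes i: "i : {1..n}"
 shows "EX h:alg_hom k Q S. (ALL d:car D. h (cf d) = \<iota> (ob (fac i d))) &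
  h xp = single F (\<epsilon> i) 1\<^sub>F & h xm = single F (inv\<^bsub>Z\<^esub> (\<epsilon> i)) (ob (fac i a))"
proof (rule gwa_lift[OF nc_S])
 have "\<iota> : alg_hom k F S"
  using SG.W.single_ring_hom SG.W.smult_single by (simp add: alg_hom_def)
 from alg_hom_compose[OF D.in_factor_hom[OF i] alg_hom_compose[OF TD.of_base_hom this]]
 show "(%d. \<iota> (ob (fac i d))) : alg_hom k D S" .
 note z = \<epsilon>_Z[of i] inv_\<epsilon>_Z[of i]
 have one: "1\<^sub>F : car F" by simp
 show "single F (\<epsilon> i) 1\<^sub>F : car S" by (rule single_S[OF z(1) one])
 show "single F (inv\<^bsub>Z\<^esub> (\<epsilon> i)) (ob (fac i a)) : car S" by (rule single_S[OF z(2) fac_F[OF i a]])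
 fix d assume d: "d : car D"
 note c = fac_F[OF i d] fac_F[OF i \<sigma>_simps(1)[OF d]] fac_F[OF i \<sigma>_simps(2)[OF d]] fac_F[OF i a]
 show "single F (\<epsilon> i) 1\<^sub>F *\<^sub>S \<iota> (ob (fac i d)) = \<iota> (ob (fac i (\<sigma> d))) *\<^sub>S single F (\<epsilon> i) 1\<^sub>F"
  using z one c by (simp add: single_mult act_\<epsilon>[OF i d] act_one_F)
 show "single F (inv\<^bsub>Z\<^esub> (\<epsilon> i)) (ob (fac i a)) *\<^sub>S \<iota> (ob (fac i d)) =
   \<iota> (ob (fac i (\<tau> d))) *\<^sub>S single F (inv\<^bsub>Z\<^esub> (\<epsilon> i)) (ob (fac i a))"
  using z c F_comm by (simp add: single_mult act_\<epsilon>[OF i d] act_one_F)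
next
 note z = \<epsilon>_Z[of i] inv_\<epsilon>_Z[of i]
 have one: "1\<^sub>F : car F" by simp
 note c = fac_F[OF i a] fac_F[OF i \<sigma>_simps(1)[OF a]]
 show "single F (inv\<^bsub>Z\<^esub> (\<epsilon> i)) (ob (fac i a)) *\<^sub>S single F (\<epsilon> i) 1\<^sub>F = \<iota> (ob (fac i a))"
  using z one c SG.W.act_simps(4)[OF z(2)] by (simp add: single_mult)
 show "single F (\<epsilon> i) 1\<^sub>F *\<^sub>S single F (inv\<^bsub>Z\<^esub> (\<epsilon> i)) (ob (fac i a)) = \<iota> (ob (fac i (\<sigma> a)))"
  using z one c by (simp add: single_mult act_\<epsilon>[OF i a])
qed

definition fi where
 "fi i = (SOME h. h : alg_hom k Q S & (ALL d:car D. h (cf d) = \<iota> (ob (fac i d))) &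
  h xp = single F (\<epsilon> i) 1\<^sub>F & h xm = single F (inv\<^bsub>Z\<^esub> (\<epsilon> i)) (ob (fac i a)))"

lemma fi:
 assumes "i : {1..n}"
 shows "fi i : alg_hom k Q S" and "d : car D ==> fi i (cf d) = \<iota> (ob (fac i d))"
  and "fi i xp = single F (\<epsilon> i) 1\<^sub>F" and "fi i xm = single F (inv\<^bsub>Z\<^esub> (\<epsilon> i)) (ob (fac i a))"
proof -
 have "\<exists>h. h : alg_hom k Q S & (ALL d:car D. h (cf d) = \<iota> (ob (fac i d))) &
  h xp = single F (\<epsilon> i) 1\<^sub>F & h xm = single F (inv\<^bsub>Z\<^esub> (\<epsilon> i)) (ob (fac i a))"
  using factor_hom[OF assms] by blast
 from someI_ex[OF this, folded fi_def]
 show "fi i : alg_hom k Q S" and "d : car D ==> fi i (cf d) = \<iota> (ob (fac i d))"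
  and "fi i xp = single F (\<epsilon> i) 1\<^sub>F" and "fi i xm = single F (inv\<^bsub>Z\<^esub> (\<epsilon> i)) (ob (fac i a))"
  by blast+
qed

lemmas fiD = alg_homD[OF fi(1)]

text \<open>A coefficient in factor \<open>j\<close> is untouched by a shift whose entry at
  \<open>j\<close> is 0.\<close>

lemma single_commute:
 assumes ij: "i : {1..n}" "j : {1..n}" and d: "d : car D" "d' : car D"
  and z: "\<nu> : car Z" "\<beta> : car Z" and 0: "\<nu> j = 0" "\<beta> i = 0"
 shows "single F \<nu> (ob (fac i d)) *\<^sub>S single F \<beta> (ob (fac j d')) =
  single F \<beta> (ob (fac j d')) *\<^sub>S single F \<nu> (ob (fac i d))"
 using act_fac[OF z(1) ij(2) d(2)] act_fac[OF z(2) ij(1) d(1)] fac_F[OF ij(1) d(1)] fac_F[OF ij(2) d(2)]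
  F_comm z by (simp add: single_mult 0 alg_aut_one d Z_comm)

text \<open>Each generator goes to some \<open>s\<^sub>i \<nu>\<close> with \<open>s\<close> and \<open>\<nu>\<close> supported in position \<open>i\<close>.\<close>

definition local_elements where
 "local_elements i = {single F \<nu> (ob (fac i d)) | \<nu> d.
  \<nu> : car Z & (ALL j:{1..n}. j ~= i --> \<nu> j = 0) & d : car D}"

lemma local_commute:
 assumes "i : {1..n}" "j : {1..n}" "i ~= j" "u : local_elements i" "v : local_elements j"
 shows "u *\<^sub>S v = v *\<^sub>S u"
proof -
 obtain \<nu> d where u: "u = single F \<nu> (ob (fac i d))" "\<nu> : car Z" "ALL j:{1..n}. j ~= i --> \<nu> j = 0" "d : car D"
  using assms(4) by (auto simp: local_elements_def)
 obtain \<beta> d' where v: "v = single F \<beta> (ob (fac j d'))" "\<beta> : car Z" "ALL i:{1..n}. i ~= j --> \<beta> i = 0" "d' : car D"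
  using assms(5) by (auto simp: local_elements_def)
 show ?thesis unfolding u(1) v(1)
  by (rule single_commute[OF assms(1,2) u(4) v(4) u(2) v(2)]) (use u(3) v(3) assms(1-3) in auto)
qed

lemma gens_local:
 assumes i: "i : {1..n}"
 shows "d : car D ==> fi i (cf d) : local_elements i" and "fi i xp : local_elements i"
  and "fi i xm : local_elements i"
proof -
 have I: "single F \<nu> (ob (fac i d)) : local_elements i"
  if "\<nu> : car Z" "ALL j:{1..n}. j ~= i --> \<nu> j = 0" "d : car D" for \<nu> d
  using that unfolding local_elements_def by blast
 show "fi i (cf d) : local_elements i" if "d : car D"
  unfolding fi(2)[OF i that] by (rule I[OF Z.one_closed _ that]) (simp add: Z_simps)
 show "fi i xm : local_elements i"
  unfolding fi(4)[OF i] by (rule I[OF inv_\<epsilon>_Z _ a]) (use i inv_\<epsilon> in simp)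
 show "fi i xp : local_elements i"
  unfolding fi(3)[OF i] ob_fac_one[OF i, symmetric] by (rule I[OF \<epsilon>_Z]) (use i \<epsilon>_simps in simp_all)
qed

lemma fi_centralizes:
 assumes i: "i : {1..n}" and v: "v : car S"
  and c: "\<And>d. d : car D ==> fi i (cf d) *\<^sub>S v = v *\<^sub>S fi i (cf d)"
  and x: "fi i xp *\<^sub>S v = v *\<^sub>S fi i xp" "fi i xm *\<^sub>S v = v *\<^sub>S fi i xm"
  and z: "z : car Q"
 shows "fi i z *\<^sub>S v = v *\<^sub>S fi i z"
proof -
 let ?K = "{w \<in> car S. ALL y:{v}. w *\<^sub>S y = y *\<^sub>S w}"
 let ?H = "{z \<in> car Q. fi i z : ?K}"
 have "subring ?H Q"
  by (rule Q.A.preimage_subring[OF fiD(1)[OF i] ring_S ring.centralizer_subring[OF ring_S]]) (use v in simp)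
 then have "car Q \<subseteq> ?H"
  by (rule gwa_generated) (use c x gen_closed fiD(2)[OF i] in auto)
 then show ?thesis using z by blast
qed

text \<open>Commutation spreads from generators to all of \<open>A\<close>, first in one factor and
  then in the other, because centralizers are subrings.\<close>

lemma fi_commute:
 assumes ij: "i : {1..n}" "j : {1..n}" "i ~= j" and z: "z : car Q" "w : car Q"
 shows "fi i z *\<^sub>S fi j w = fi j w *\<^sub>S fi i z"
proof -
 note li = gens_local[OF ij(1)] and lj = gens_local[OF ij(2)]
 have g: "fi i z *\<^sub>S v = v *\<^sub>S fi i z" if v: "v : local_elements j" "v : car S" for v
  by (rule fi_centralizes[OF ij(1) v(2) _ _ _ z(1)])
   (rule local_commute[OF ij _ v(1)], simp add: li)+
 have "fi j w *\<^sub>S fi i z = fi i z *\<^sub>S fi j w"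
  by (rule fi_centralizes[OF ij(2) fiD(2)[OF ij(1) z(1)] _ _ _ z(2)])
   (rule g[symmetric], simp add: lj, rule fiD(2)[OF ij(2)], simp add: gen_closed)+
 then show ?thesis by (rule sym)
qed

section \<open>The homomorphism on the tensor power and its spanning set\<close>

definition \<phi> where
 "\<phi> = (SOME f. f : alg_hom k P S & (ALL x:car (tuples n Q).
  f (pure k n Q x) = list_prod S [1..<Suc n] (%i. fi i (x i))))"

lemma \<phi>:
 shows "\<phi> : alg_hom k P S"
  and "x : car (tuples n Q) ==> \<phi> (pure k n Q x) = list_prod S [1..<Suc n] (%i. fi i (x i))"
proof -
 have "multilinear_hom k n Q S (%x. list_prod S [1..<Suc n] (%i. fi i (x i)))"
  by (rule multilinear_list_prod[OF Q.nc_algebra_axioms nc_S]) (simp_all only: fi(1) fi_commute)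
 then have "\<exists>f. f : alg_hom k P S & (ALL x:car (tuples n Q).
  f (pure k n Q x) = list_prod S [1..<Suc n] (%i. fi i (x i)))"
  using Q.tensor_lift[OF nc_S] by blast
 from someI_ex[OF this, folded \<phi>_def]
 show "\<phi> : alg_hom k P S"
  and "x : car (tuples n Q) ==> \<phi> (pure k n Q x) = list_prod S [1..<Suc n] (%i. fi i (x i))" by blast+
qed

lemmas \<phi>D = alg_homD[OF \<phi>(1)]

lemma \<phi>_factor:
 assumes i: "i : {1..n}" and b: "b : car Q"
 shows "\<phi> (fq i b) = fi i b"
proof -
 have "\<phi> (fq i b) =
   list_prod S [1..<Suc n] (%j. fi j ((\<lambda>j\<in>{1..n}. if j = i then b else 1\<^sub>Q) j))"
  unfolding in_factor_pure by (rule \<phi>(2)[OF Q.single_tuple[OF b]])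
 also have "\<dots> = list_prod S [1..<Suc n] (%j. if j = i then fi i b else 1\<^sub>S)"
  by (rule list_prod_cong) (use fiD(5) in auto)
 also have "\<dots> = fi i b"
  by (rule ring.list_prod_single[OF ring_S]) (use i fiD(2)[OF i b] in auto)
 finally show ?thesis .
qed

definition jj where "jj = tensor_map k n Q (%x. \<lambda>i\<in>{1..n}. cf (x i))"

lemma jj_hom: "jj : alg_hom k T P"
 and jj_pure: "x : car (tuples n D) ==> jj (pure k n D x) = pure k n Q (\<lambda>i\<in>{1..n}. cf (x i))"
proof -
 note m = multilinear_factorwise[where f = "%i. cf" and n = n, OF D.nc_algebra_axioms Q.nc_algebra_axioms cf_hom]
 show "jj : alg_hom k T P"
  "x : car (tuples n D) ==> jj (pure k n D x) = pure k n Q (\<lambda>i\<in>{1..n}. cf (x i))"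
  unfolding jj_def using tensor_map_hom[OF D.nc_algebra_axioms Q.nc_algebra_axioms m(2,1)] by auto
qed

lemmas jjD = alg_homD[OF jj_hom]

lemma \<iota>_hom: "\<iota> : alg_hom k F S"
 using SG.W.single_ring_hom SG.W.smult_single by (simp add: alg_hom_def)

lemma \<phi>_jj: assumes t: "t : car T" shows "\<phi> (jj t) = \<iota> (ob t)"
proof (rule alg_hom_tensor_eqI[OF nc_S alg_hom_compose[OF jj_hom \<phi>(1)] alg_hom_compose[OF TD.of_base_hom \<iota>_hom] _ t])
 fix x assume x: "x : car (tuples n D)"
 have xi: "x i : car D" if "i : {1..n}" for i using x that by auto
 have h: "(%t. \<iota> (ob t)) : ring_hom T S" using alg_hom_compose[OF TD.of_base_hom \<iota>_hom] by (rule alg_homD(1))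
 have "(\<lambda>i\<in>{1..n}. cf (x i)) : car (tuples n Q)" using xi gen_closed(1) by auto
 then have "\<phi> (jj (pure k n D x)) = list_prod S [1..<Suc n] (%i. fi i ((\<lambda>i\<in>{1..n}. cf (x i)) i))"
  using jj_pure[OF x] \<phi>(2) by simp
 also have "\<dots> = list_prod S [1..<Suc n] (%i. \<iota> (ob (fac i (x i))))"
  by (rule list_prod_cong) (use fi(2) xi in auto)
 also have "\<dots> = \<iota> (ob (list_prod T [1..<Suc n] (%i. fac i (x i))))"
  by (rule ring_hom_list_prod[OF h T.A.ring_axioms, symmetric]) (use facD(2) xi in auto)
 finally show "\<phi> (jj (pure k n D x)) = \<iota> (ob (pure k n D x))" by (simp only: D.pure_list_prod[OF x])
qed

definition E where "E \<nu> = pure k n Q (\<lambda>i\<in>{1..n}. normal (\<nu> i))" for \<nu> :: "nat => int"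

lemma E_tuple: "(\<lambda>i\<in>{1..n}. normal (\<nu> i)) : car (tuples n Q)"
 using normal_closed by auto

lemma E_closed: "E \<nu> : car P"
 unfolding E_def by (rule Q.pureD(1)[OF E_tuple])

definition V where "V = {jj u *\<^sub>P E \<nu> | u \<nu>. u : car T & \<nu> : car Z}"

lemma V_carrier: "V \<subseteq> car P"
 using jjD(2) E_closed by (auto simp: V_def)

lemma V_mult:
 assumes s: "s : car T" and z: "z : P.A.span V" shows "jj s *\<^sub>P z : P.A.span V"
proof (rule P.A.span_mult[OF P.A.span_subgroup[OF V_carrier] _ V_carrier, of "{jj s}"])
 show "jj s : P.A.span {jj s}" by (rule P.A.span_simps(2)) simp
 fix y z assume "y : {jj s}" "z : V"
 then obtain u \<nu> where u: "y = jj s" "z = jj u *\<^sub>P E \<nu>" "u : car T" "\<nu> : car Z" by (auto simp: V_def)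
 have "y *\<^sub>P z = jj (s *\<^sub>T u) *\<^sub>P E \<nu>"
  using u s jjD(2) E_closed by (simp add: jjD(3) P.A.m_assoc)
 moreover have "s *\<^sub>T u : car T" using s u by simp
 ultimately have "y *\<^sub>P z : V" unfolding V_def using u(4) by blast
 then show "y *\<^sub>P z : P.A.span V" by (rule P.A.span_simps(2))
qed (use s jjD(2) z in auto)

text \<open>Coefficient and power are separated in all factors at once, since tuples multiply
  componentwise.\<close>

lemma pure_normals:
 assumes v: "v : (\<Pi>\<^sub>E i\<in>{1..n}. normals)" shows "pure k n Q v : V"
proof -
 have "ALL i:{1..n}. \<exists>dj. fst dj : car D & v i = cf (fst dj) *\<^sub>Q normal (snd dj)"
 proof
  fix i assume "i : {1..n}"
  then have "v i : normals" using v by auto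
  then obtain d j where "v i = cf d *\<^sub>Q normal j" "d : car D" by (auto simp: normals_def)
  then show "\<exists>dj. fst dj : car D & v i = cf (fst dj) *\<^sub>Q normal (snd dj)"
   by (intro exI[of _ "(d, j)"]) simp
 qed
 from bchoice[OF this] obtain dj where
  dj: "\<And>i. i : {1..n} ==> fst (dj i) : car D & v i = cf (fst (dj i)) *\<^sub>Q normal (snd (dj i))" by blast
 let ?d = "\<lambda>i\<in>{1..n}. fst (dj i)" and ?\<nu> = "\<lambda>i\<in>{1..n}. snd (dj i)"
 have d: "?d : car (tuples n D)" using dj by auto
 have c: "(\<lambda>i\<in>{1..n}. cf (?d i)) : car (tuples n Q)" using dj gen_closed(1) by auto
 have "v = (\<lambda>i\<in>{1..n}. cf (?d i)) \<otimes>\<^bsub>tuples n Q\<^esub> (\<lambda>i\<in>{1..n}. normal (?\<nu> i))"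
 proof
  fix i show "v i = ((\<lambda>i\<in>{1..n}. cf (?d i)) \<otimes>\<^bsub>tuples n Q\<^esub> (\<lambda>i\<in>{1..n}. normal (?\<nu> i))) i"
   using dj v by (cases "i : {1..n}") (auto simp: PiE_iff extensional_def)
 qed
 then have "pure k n Q v = jj (pure k n D ?d) *\<^sub>P E ?\<nu>"
  using Q.pureD(3)[OF c E_tuple] jj_pure[OF d] by (simp only: E_def)
 moreover have "?\<nu> : car Z" by (auto simp: Z_simps)
 ultimately show ?thesis unfolding V_def using D.pureD(1)[OF d] by blast
qed

lemma span_V: assumes "t : car P" shows "t : P.A.span V"
 using assms
proof (induction t rule: Q.tensor_induct)
 case (pure c x)
 have "pure k n Q x : P.A.span (pure k n Q ` (\<Pi>\<^sub>E i\<in>{1..n}. normals))"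
  by (rule Q.pure_span[OF normals_carrier pure(2)]) (use pure(2) in "auto intro!: span_normals")
 then have 1: "pure k n Q x : P.A.span V"
  using P.A.span_mono[of "pure k n Q ` (\<Pi>\<^sub>E i\<in>{1..n}. normals)" V] pure_normals by blast
 have "c \<odot>\<^sub>P pure k n Q x = jj (c \<odot>\<^sub>T 1\<^sub>T) *\<^sub>P pure k n Q x"
  using pure(1) Q.pureD(1)[OF pure(2)] by (simp add: jjD(5,6) P.smult_mult_left)
 then show ?case using V_mult[OF _ 1, of "c \<odot>\<^sub>T 1\<^sub>T"] pure(1) by simp
next
 case (add s t)
 then show ?case by (intro P.A.span_simps(4))
qed

section \<open>Monomials and injectivity\<close>

definition mono where "mono \<nu> u \<longleftrightarrow> \<nu> : car Z & (EX s:ob ` car T. s ~= 0\<^sub>F & u = single F \<nu> s)"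

text \<open>The new coefficient s \<nu>(r) stays in the tensor power and is nonzero, because shifts
  are injective and \<open>F\<close> is a field.\<close>

lemma mono_mult:
 assumes "mono \<nu> u" "mono \<beta> v" shows "mono (\<nu> *\<^sub>Z \<beta>) (u *\<^sub>S v)"
proof -
 obtain s where s: "s : ob ` car T" "s ~= 0\<^sub>F" "u = single F \<nu> s" and \<nu>: "\<nu> : car Z"
  using assms(1) by (auto simp: mono_def)
 obtain r where r: "r : ob ` car T" "r ~= 0\<^sub>F" "v = single F \<beta> r" and \<beta>: "\<beta> : car Z"
  using assms(2) by (auto simp: mono_def)
 have c: "s : car F" "r : car F" "act \<nu> r : car F"
  using s(1) r(1) ob_F act_F[OF \<nu>] by auto
 have "act \<nu> r : ob ` car T" by (rule SG.act_T[OF \<nu> r(1)])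
 then have "s *\<^sub>F act \<nu> r : ob ` car T" using subringE(6)[OF base_subring s(1)] by blast
 moreover have "s *\<^sub>F act \<nu> r ~= 0\<^sub>F"
 proof -
  have "act \<nu> r ~= 0\<^sub>F"
  proof
   assume "act \<nu> r = 0\<^sub>F"
   then have "act \<nu> r = act \<nu> 0\<^sub>F" using SG.W.act_simps(6)[OF \<nu>] by simp
   moreover have "inj_on (act \<nu>) (car F)" using act_aut[OF \<nu>] by (simp add: carrier_alg_aut bij_betw_def)
   ultimately show False using inj_onD[of "act \<nu>" "car F" r "0\<^sub>F"] c r(2) by simp
  qed
  then show ?thesis using domain.integral[OF field.axioms(1)[OF TD.field_F] _ c(1,3)] s(2) by blast
 qed
 moreover have "u *\<^sub>S v = single F (\<nu> *\<^sub>Z \<beta>) (s *\<^sub>F act \<nu> r)"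
  unfolding s(3) r(3) by (rule single_mult[OF \<nu> \<beta> c(1,2)])
 ultimately show ?thesis unfolding mono_def using \<nu> \<beta> by blast
qed

lemma F_one_neq: "1\<^sub>F ~= 0\<^sub>F"
 using domain.one_not_zero[OF field.axioms(1)[OF TD.field_F]] .

lemma one_base: "1\<^sub>F : ob ` car T" by (rule subringE(3)[OF base_subring])

lemma mono_one: "mono 1\<^sub>Z 1\<^sub>S"
 unfolding mono_def using F_one_neq one_base SG.W.one_eq by blast

lemma mono_pow: "mono \<nu> u ==> mono (\<nu> [^]\<^sub>Z m) (u [^]\<^sub>S m)" for m :: nat
 by (induction m) (auto intro: mono_one mono_mult)

lemma fac_nonzero: assumes "i : {1..n}" shows "ob (fac i a) ~= 0\<^sub>F"
proof
 assume "ob (fac i a) = 0\<^sub>F"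
 moreover have "ob 0\<^sub>T = 0\<^sub>F" using ring_hom_zero_neg(1)[OF obD(1) T.A.ring_axioms FA.A.ring_axioms] .
 moreover have "fac i 0\<^sub>D = 0\<^sub>T" using ring_hom_zero_neg(1)[OF facD(1)[OF assms] D.A.ring_axioms T.A.ring_axioms] .
 ultimately have "fac i a = fac i 0\<^sub>D"
  using inj_onD[OF TD.of_base_inj, of "fac i a" "0\<^sub>T"] facD(2)[OF assms a] by simp
 then show False using in_factor_inj[OF assms a] a_nonzero by simp
qed

lemma mono_gens:
 assumes i: "i : {1..n}"
 shows "mono (\<epsilon> i) (fi i xp)" and "mono (inv\<^bsub>Z\<^esub> (\<epsilon> i)) (fi i xm)"
 unfolding mono_def fi(3,4)[OF i]
 using \<epsilon>_Z inv_\<epsilon>_Z F_one_neq one_base fac_nonzero[OF i] facD(2)[OF i a] by blast+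

lemma ring_hom_pow: "[|h : ring_hom Q S; z : car Q|] ==> h (z [^]\<^sub>Q m) = h z [^]\<^sub>S m" for m :: nat
 by (induction m) (auto simp: ring_hom_one ring_hom_mult)

lemma fi_normal:
 assumes i: "i : {1..n}"
 shows "fi i (normal j) = fi i xp [^]\<^sub>S nat j *\<^sub>S fi i xm [^]\<^sub>S nat (- j)"
 unfolding normal_def
 using fiD(3)[OF i, of "xp [^]\<^sub>Q nat j" "xm [^]\<^sub>Q nat (- j)"] gen_closed ring_hom_pow[OF fiD(1)[OF i]] by simp

lemma mono_normal:
 assumes i: "i : {1..n}"
 shows "mono (\<lambda>i'\<in>{1..n}. if i' = i then j else 0) (fi i (normal j))"
proof -
 have "(\<lambda>i'\<in>{1..n}. if i' = i then j else 0) = \<epsilon> i [^]\<^sub>Z nat j *\<^sub>Z (inv\<^bsub>Z\<^esub> (\<epsilon> i)) [^]\<^sub>Z nat (- j)"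
 proof
  fix i'
  show "(\<lambda>i'\<in>{1..n}. if i' = i then j else 0) i' = (\<epsilon> i [^]\<^sub>Z nat j *\<^sub>Z (inv\<^bsub>Z\<^esub> (\<epsilon> i)) [^]\<^sub>Z nat (- j)) i'"
   using i by (cases "i' : {1..n}") (auto simp: Z_simps(3) Z_pow \<epsilon>_simps inv_\<epsilon>)
 qed
 then show ?thesis
  unfolding fi_normal[OF i] using mono_mult[OF mono_pow mono_pow] mono_gens[OF i] by simp
qed

lemma \<phi>_E: "\<phi> (E \<nu>) = list_prod S [1..<Suc n] (%i. fi i (normal (\<nu> i)))"
proof -
 have "\<phi> (E \<nu>) = list_prod S [1..<Suc n] (%i. fi i ((\<lambda>i\<in>{1..n}. normal (\<nu> i)) i))"
  unfolding E_def by (rule \<phi>(2)[OF E_tuple])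
 also have "\<dots> = list_prod S [1..<Suc n] (%i. fi i (normal (\<nu> i)))"
  by (rule list_prod_cong) auto
 finally show ?thesis .
qed

text \<open>The exponents contributed by the factors sit in different positions and add up to \<nu>;
  a partial product covers the positions already met.\<close>

lemma mono_E: assumes \<nu>: "\<nu> : car Z" shows "mono \<nu> (\<phi> (E \<nu>))"
proof -
 have partial: "mono (\<lambda>i'\<in>{1..n}. if i' : set xs then \<nu> i' else 0) (list_prod S xs (%i. fi i (normal (\<nu> i))))"
  if "distinct xs" "set xs \<subseteq> {1..n}" for xs
  using that
 proof (induction xs)
  case Nil
  have "(\<lambda>i'\<in>{1..n}. if i' : set [] then \<nu> i' else 0) = 1\<^sub>Z" by (auto simp: Z_simps)
  then show ?case using mono_one by simp
 next
  case (Cons i xs)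
  have i: "i : {1..n}" using Cons.prems by simp
  have "(\<lambda>i'\<in>{1..n}. if i' : set (i # xs) then \<nu> i' else 0) =
   (\<lambda>i'\<in>{1..n}. if i' = i then \<nu> i else 0) *\<^sub>Z (\<lambda>i'\<in>{1..n}. if i' : set xs then \<nu> i' else 0)"
   using Cons.prems by (auto simp: Z_simps fun_eq_iff)
  moreover have "mono (\<lambda>i'\<in>{1..n}. if i' : set xs then \<nu> i' else 0) (list_prod S xs (%i. fi i (normal (\<nu> i))))"
   by (rule Cons.IH) (use Cons.prems in auto)
  ultimately show ?case
   using mono_mult[OF mono_normal[OF i, of "\<nu> i"]] by (simp only: list_prod_simps)
 qed
 have "set [1..<Suc n] \<subseteq> {1..n}" by auto
 from partial[OF distinct_upt this]
 have "mono (\<lambda>i'\<in>{1..n}. if i' : set [1..<Suc n] then \<nu> i' else 0) (\<phi> (E \<nu>))" unfolding \<phi>_E .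
 moreover have "(\<lambda>i'\<in>{1..n}. if i' : set [1..<Suc n] then \<nu> i' else 0) = \<nu>"
 proof
  fix i show "(\<lambda>i'\<in>{1..n}. if i' : set [1..<Suc n] then \<nu> i' else 0) i = \<nu> i"
   using \<nu> by (cases "i : {1..n}") (auto simp: Z_simps PiE_iff extensional_def)
 qed
 ultimately show ?thesis by (simp only:)
qed

text \<open>Terms with equal exponent are merged through their coefficients, so that each exponent
  occurs once.\<close>

lemma decomposition:
 assumes "t : car P"
 shows "\<exists>J u. finite J & J \<subseteq> car Z & u : J \<rightarrow> car T & t = (\<Oplus>\<^sub>P \<nu>\<in>J. jj (u \<nu>) *\<^sub>P E \<nu>)"
 using span_V[OF assms] V_carrier
proof (induction t rule: P.A.span_induct)
 case zero
 show ?case by (intro exI[of _ "{}"]) auto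
next
 case (base t)
 then obtain u \<nu> where u: "t = jj u *\<^sub>P E \<nu>" "u : car T" "\<nu> : car Z" by (auto simp: V_def)
 then show ?case
  using jjD(2)[OF u(2)] E_closed by (intro exI[of _ "{\<nu>}"] exI[of _ "%_. u"]) auto
next
 case (neg t)
 then obtain J u where J: "finite J" "J \<subseteq> car Z" "u : J \<rightarrow> car T"
   "t = (\<Oplus>\<^sub>P \<nu>\<in>J. jj (u \<nu>) *\<^sub>P E \<nu>)" by blast
 have c: "jj (u \<nu>) *\<^sub>P E \<nu> : car P" if "\<nu> : J" for \<nu> using J(3) that jjD(2) E_closed by auto
 have "\<ominus>\<^sub>P t = (\<ominus>\<^sub>P 1\<^sub>P) *\<^sub>P t" using neg(1) by (simp add: P.A.l_minus)
 also have "\<dots> = (\<Oplus>\<^sub>P \<nu>\<in>J. (\<ominus>\<^sub>P 1\<^sub>P) *\<^sub>P (jj (u \<nu>) *\<^sub>P E \<nu>))"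
  unfolding J(4) by (rule P.A.finsum_rdistr) (use c J(1) in auto)
 also have "\<dots> = (\<Oplus>\<^sub>P \<nu>\<in>J. jj (\<ominus>\<^sub>T u \<nu>) *\<^sub>P E \<nu>)"
 proof (rule P.A.finsum_cong'[OF refl])
  fix \<nu> assume "\<nu> : J"
  then have u: "u \<nu> : car T" using J(3) by auto
  show "(\<ominus>\<^sub>P 1\<^sub>P) *\<^sub>P (jj (u \<nu>) *\<^sub>P E \<nu>) = jj (\<ominus>\<^sub>T u \<nu>) *\<^sub>P E \<nu>"
   using jjD(2)[OF u] E_closed ring_hom_zero_neg(2)[OF jjD(1) T.A.ring_axioms ring_TQ u]
   by (simp add: P.A.l_minus)
 next
  have "jj (\<ominus>\<^sub>T u \<nu>) : car P" if "\<nu> : J" for \<nu>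
   using jjD(2)[OF T.A.a_inv_closed] J(3) that by auto
  then show "(%\<nu>. jj (\<ominus>\<^sub>T u \<nu>) *\<^sub>P E \<nu>) : J \<rightarrow> car P" using E_closed by auto
 qed
 finally show ?case using J by (intro exI[of _ J] exI[of _ "%\<nu>. \<ominus>\<^sub>T u \<nu>"]) auto
next
 case (add s t)
 then obtain J u J' u' where J: "finite J" "J \<subseteq> car Z" "u : J \<rightarrow> car T"
   "s = (\<Oplus>\<^sub>P \<nu>\<in>J. jj (u \<nu>) *\<^sub>P E \<nu>)"
  and J': "finite J'" "J' \<subseteq> car Z" "u' : J' \<rightarrow> car T"
   "t = (\<Oplus>\<^sub>P \<nu>\<in>J'. jj (u' \<nu>) *\<^sub>P E \<nu>)" by blast
 let ?u = "%\<nu>. if \<nu> : J then u \<nu> else 0\<^sub>T" and ?u' = "%\<nu>. if \<nu> : J' then u' \<nu> else 0\<^sub>T"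
 have uc: "?u \<nu> : car T" "?u' \<nu> : car T" for \<nu> using J(3) J'(3) by auto
 have jz: "jj 0\<^sub>T = 0\<^sub>P" using ring_hom_zero_neg(1)[OF jjD(1) T.A.ring_axioms ring_TQ] .
 have c: "jj (?u \<nu>) *\<^sub>P E \<nu> : car P" "jj (?u' \<nu>) *\<^sub>P E \<nu> : car P" for \<nu>
  using jjD(2)[OF uc(1)] jjD(2)[OF uc(2)] E_closed by auto
 have cJ: "jj (u \<nu>) *\<^sub>P E \<nu> : car P" if "\<nu> : J" for \<nu> using c(1)[of \<nu>] that by simp
 have cJ': "jj (u' \<nu>) *\<^sub>P E \<nu> : car P" if "\<nu> : J'" for \<nu> using c(2)[of \<nu>] that by simp
 have hs: "s = (\<Oplus>\<^sub>P \<nu>\<in>J \<union> J'. jj (?u \<nu>) *\<^sub>P E \<nu>)"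
  unfolding J(4) by (rule P.A.add.finprod_mono_neutral_cong_left)
   (use J(1) J'(1) c cJ cJ' E_closed in "auto simp: jz")
 have ht: "t = (\<Oplus>\<^sub>P \<nu>\<in>J \<union> J'. jj (?u' \<nu>) *\<^sub>P E \<nu>)"
  unfolding J'(4) by (rule P.A.add.finprod_mono_neutral_cong_left)
   (use J(1) J'(1) c cJ cJ' E_closed in "auto simp: jz")
 have "s +\<^sub>P t = (\<Oplus>\<^sub>P \<nu>\<in>J \<union> J'. (jj (?u \<nu>) *\<^sub>P E \<nu>) +\<^sub>P (jj (?u' \<nu>) *\<^sub>P E \<nu>))"
  by (subst hs, subst ht, rule P.A.finsum_addf[symmetric]) (simp_all add: Pi_iff c del: atLeastAtMost_iff)
 also have "\<dots> = (\<Oplus>\<^sub>P \<nu>\<in>J \<union> J'. jj (?u \<nu> +\<^sub>T ?u' \<nu>) *\<^sub>P E \<nu>)"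
 proof (rule P.A.finsum_cong'[OF refl])
  fix \<nu>
  show "(jj (?u \<nu>) *\<^sub>P E \<nu>) +\<^sub>P (jj (?u' \<nu>) *\<^sub>P E \<nu>) = jj (?u \<nu> +\<^sub>T ?u' \<nu>) *\<^sub>P E \<nu>"
   using jjD(2)[OF uc(1)[of \<nu>]] jjD(2)[OF uc(2)[of \<nu>]] E_closed
   by (simp only: jjD(4)[OF uc(1)[of \<nu>] uc(2)[of \<nu>]] P.A.l_distr)
 next
  show "(%\<nu>. jj (?u \<nu> +\<^sub>T ?u' \<nu>) *\<^sub>P E \<nu>) : J \<union> J' \<rightarrow> car P"
   using jjD(2)[OF T.A.a_closed[OF uc(1) uc(2)]] E_closed by blast
 qed
 finally have sum: "s +\<^sub>P t = (\<Oplus>\<^sub>P \<nu>\<in>J \<union> J'. jj (?u \<nu> +\<^sub>T ?u' \<nu>) *\<^sub>P E \<nu>)" .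
 have "finite (J \<union> J')" "J \<union> J' \<subseteq> car Z" using J(1,2) J'(1,2) by auto
 moreover have "(%\<nu>. ?u \<nu> +\<^sub>T ?u' \<nu>) : J \<union> J' \<rightarrow> car T"
  by (rule funcsetI) (rule T.A.a_closed[OF uc])
 ultimately show ?case
  using sum by (intro exI[of _ "J \<union> J'"] exI[of _ "%\<nu>. ?u \<nu> +\<^sub>T ?u' \<nu>"] conjI)
qed

text \<open>Exponents do not interfere: the coefficient of the image at \<beta> is the product of
  \<open>u \<beta>\<close> with the nonzero coefficient of \<open>\<phi> (E \<beta>)\<close>, so
  each \<open>u \<beta>\<close> vanishes.\<close>

lemma \<phi>_kernel:
 assumes t: "t : car P" and z: "\<phi> t = 0\<^sub>S" shows "t = 0\<^sub>P"
proof -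
 obtain J u where J: "finite J" "J \<subseteq> car Z" "u : J \<rightarrow> car T"
   "t = (\<Oplus>\<^sub>P \<nu>\<in>J. jj (u \<nu>) *\<^sub>P E \<nu>)" using decomposition[OF t] by blast
 have uc: "u \<nu> : car T" if "\<nu> : J" for \<nu> using J(3) that by auto
 have "ALL \<nu>:J. \<exists>s. s : ob ` car T & s ~= 0\<^sub>F & \<phi> (E \<nu>) = single F \<nu> s"
 proof
  fix \<nu> assume "\<nu> : J"
  from mono_E[OF subsetD[OF J(2) this]]
  show "\<exists>s. s : ob ` car T & s ~= 0\<^sub>F & \<phi> (E \<nu>) = single F \<nu> s" unfolding mono_def by blast
 qed
 from bchoice[OF this] obtain s where
  s: "\<And>\<nu>. \<nu> : J ==> s \<nu> : ob ` car T & s \<nu> ~= 0\<^sub>F & \<phi> (E \<nu>) = single F \<nu> (s \<nu>)" by blast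
 have sc: "s \<nu> : car F" if "\<nu> : J" for \<nu> using s[OF that] ob_F by auto
 have summand: "\<phi> (jj (u \<nu>) *\<^sub>P E \<nu>) = single F \<nu> (ob (u \<nu>) *\<^sub>F s \<nu>)" if \<nu>: "\<nu> : J" for \<nu>
 proof -
  have \<nu>Z: "\<nu> : car Z" using J(2) \<nu> by blast
  have "\<phi> (jj (u \<nu>) *\<^sub>P E \<nu>) = \<iota> (ob (u \<nu>)) *\<^sub>S single F \<nu> (s \<nu>)"
   using \<phi>D(3)[OF jjD(2)[OF uc[OF \<nu>]] E_closed] \<phi>_jj[OF uc[OF \<nu>]] s[OF \<nu>] by simp
  then show ?thesis
   using single_mult[OF Z.one_closed \<nu>Z ob_F[OF uc[OF \<nu>]] sc[OF \<nu>]] act_one_F[OF sc[OF \<nu>]] \<nu>Z by simp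
 qed
 have "\<phi> t = (\<Oplus>\<^sub>S \<nu>\<in>J. \<phi> (jj (u \<nu>) *\<^sub>P E \<nu>))"
  unfolding J(4)
  by (rule ring_hom_zero_neg(4)[OF \<phi>D(1) ring_TQ ring_S]) (use uc jjD(2) E_closed in auto)
 also have "\<dots> = (\<Oplus>\<^sub>S \<nu>\<in>J. single F \<nu> (ob (u \<nu>) *\<^sub>F s \<nu>))"
  by (rule SG.W.Sa.finsum_cong') (use summand single_S J(2) sc uc ob_F in auto)
 finally have \<phi>t: "\<phi> t = (\<Oplus>\<^sub>S \<nu>\<in>J. single F \<nu> (ob (u \<nu>) *\<^sub>F s \<nu>))" .
 have "u \<beta> = 0\<^sub>T" if \<beta>: "\<beta> : J" for \<beta>
 proof -
  have c: "ob (u \<nu>) *\<^sub>F s \<nu> : car F" if "\<nu> : J" for \<nu> using sc[OF that] ob_F[OF uc[OF that]] by simp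
  have "\<phi> t \<beta> = (\<Oplus>\<^sub>F \<nu>\<in>J. single F \<nu> (ob (u \<nu>) *\<^sub>F s \<nu>) \<beta>)"
   unfolding \<phi>t by (rule SG.W.finsum_apply) (use single_S J(2) c in auto)
  also have "\<dots> = (\<Oplus>\<^sub>F \<nu>\<in>J. if \<beta> = \<nu> then ob (u \<nu>) *\<^sub>F s \<nu> else 0\<^sub>F)"
   by (rule FA.A.finsum_cong') (use c in "auto simp: single_def")
  also have "\<dots> = ob (u \<beta>) *\<^sub>F s \<beta>"
   by (rule FA.A.add.finprod_singleton[OF \<beta> J(1)]) (use c in auto)
  finally have "ob (u \<beta>) *\<^sub>F s \<beta> = 0\<^sub>F" using z SG.W.zero_apply by simp
  then have "ob (u \<beta>) = 0\<^sub>F"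
   using domain.integral[OF field.axioms(1)[OF TD.field_F] _ ob_F[OF uc[OF \<beta>]] sc[OF \<beta>]] s[OF \<beta>] by blast
  moreover have "ob 0\<^sub>T = 0\<^sub>F" using ring_hom_zero_neg(1)[OF obD(1) T.A.ring_axioms FA.A.ring_axioms] .
  ultimately show ?thesis using inj_onD[OF TD.of_base_inj, of "u \<beta>" "0\<^sub>T"] uc[OF \<beta>] by simp
 qed
 moreover have jz: "jj 0\<^sub>T = 0\<^sub>P" using ring_hom_zero_neg(1)[OF jjD(1) T.A.ring_axioms ring_TQ] .
 ultimately have "t = (\<Oplus>\<^sub>P \<nu>\<in>J. 0\<^sub>P)"
  unfolding J(4) by (intro P.A.finsum_cong') (use E_closed in auto)
 then show ?thesis by simp
qed

lemma \<phi>_inj: "inj_on \<phi> (car P)"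
proof (rule inj_onI)
 fix s t assume st: "s : car P" "t : car P" "\<phi> s = \<phi> t"
 have "\<phi> (s \<ominus>\<^sub>P t) = \<phi> s \<ominus>\<^sub>S \<phi> t" by (rule ring_hom_zero_neg(3)[OF \<phi>D(1) ring_TQ ring_S st(1,2)])
 also have "\<dots> = 0\<^sub>S" using \<phi>D(2)[OF st(2)] st(3) by (simp add: a_minus_def SG.W.Sa.r_neg)
 finally have "s \<ominus>\<^sub>P t = 0\<^sub>P" using \<phi>_kernel[OF P.A.minus_closed[OF st(1,2)]] by simp
 then show "s = t" using st by simp
qed

lemma E_subring:
 assumes H: "subring H P"
  and x: "\<And>i. i : {1..n} ==> fq i xp : H" "\<And>i. i : {1..n} ==> fq i xm : H"
 shows "E \<nu> : H"
proof -
 have "fq i (normal j) : H" if i: "i : {1..n}" for i j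
 proof -
  have "subring {z \<in> car Q. fq i z : H} Q"
   by (rule Q.A.preimage_subring[OF alg_homD(1)[OF Q.in_factor_hom[OF i]] ring_TQ H])
  from normal_subring[OF this] show ?thesis using x[OF i] gen_closed by blast
 qed
 then show ?thesis
  unfolding E_def Q.pure_list_prod[OF E_tuple] by (intro P.A.list_prod_subring[OF H]) auto
qed

lemma TQ_generated:
 assumes H: "subring H P" and "\<And>u. u : car T ==> jj u : H"
  and x: "\<And>i. i : {1..n} ==> fq i xp : H" "\<And>i. i : {1..n} ==> fq i xm : H"
 shows "car P \<subseteq> H"
proof
 fix t assume "t : car P"
 then have t: "t : P.A.span V" by (rule span_V)
 have "V \<subseteq> H" unfolding V_def using subringE(6)[OF H] assms(2) E_subring[OF H x] by blast
 then show "t : H" using P.A.span_minimal[OF _ P.A.subring_subgroup[OF H]] t by blast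
qed

lemma ring_hom_TQ_eqI:
 assumes h: "h : ring_hom P S" "h' : ring_hom P S"
  and "\<And>u. u : car T ==> h (jj u) = h' (jj u)"
  and "\<And>i. i : {1..n} ==> h (fq i xp) = h' (fq i xp)"
  and "\<And>i. i : {1..n} ==> h (fq i xm) = h' (fq i xm)"
  and t: "t : car P"
 shows "h t = h' t"
proof -
 interpret h: ring_hom_ring P S h by (intro ring_hom_ringI2 ring_TQ ring_S h(1))
 interpret h': ring_hom_ring P S h' by (intro ring_hom_ringI2 ring_TQ ring_S h(2))
 have "subring {t \<in> car P. h t = h' t} P" by (rule P.A.subringI) auto
 then have "car P \<subseteq> {t \<in> car P. h t = h' t}"
  by (rule TQ_generated) (use assms(3-5) jjD(2) alg_homD(2)[OF Q.in_factor_hom] gen_closed in auto)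
 then show ?thesis using t by blast
qed

section \<open>Equivariance of the embedding\<close>

abbreviation pq where "pq \<equiv> tensor_perm k n Q"

lemma pq_jj:
 assumes p: "p permutes {1..n}" and t: "t : car T" shows "pq p (jj t) = jj (pm p t)"
proof (rule alg_hom_tensor_eqI[OF nc_TQ alg_hom_compose[OF jj_hom Q.tensor_perm_hom(1)[OF p]]
   alg_hom_compose[OF pm_hom[OF p] jj_hom] _ t])
 fix x assume x: "x : car (tuples n D)"
 have c: "(\<lambda>i\<in>{1..n}. cf (x i)) : car (tuples n Q)" using x gen_closed(1) by auto
 have "(\<lambda>i\<in>{1..n}. cf (x i)) \<circ> inv_into UNIV p = (\<lambda>i\<in>{1..n}. cf ((x \<circ> inv_into UNIV p) i))"
 proof
  fix j
  have "inv_into UNIV p j : {1..n} \<longleftrightarrow> j : {1..n}"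
   using permutes_in_image[OF permutes_inv[OF p]] by simp
  then show "((\<lambda>i\<in>{1..n}. cf (x i)) \<circ> inv_into UNIV p) j = (\<lambda>i\<in>{1..n}. cf ((x \<circ> inv_into UNIV p) i)) j" by simp
 qed
 then show "pq p (jj (pure k n D x)) = jj (pm p (pure k n D x))"
  using jj_pure[OF x] pm_pure[OF p x] jj_pure[OF perm_tuple[OF p x]] Q.tensor_perm_hom(2)[OF p c] by simp
qed

lemma perm_\<epsilon>: assumes p: "p permutes {1..n}" and i: "i : {1..n}"
 shows "\<epsilon> i \<circ> inv_into UNIV p = \<epsilon> (p i)"
proof
 fix j
 have "inv_into UNIV p j : {1..n} \<longleftrightarrow> j : {1..n}"
  using permutes_in_image[OF permutes_inv[OF p]] by simp
 moreover have "inv_into UNIV p j = i \<longleftrightarrow> j = p i" using permutes_inv_eq[OF p] by auto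
 ultimately show "(\<epsilon> i \<circ> inv_into UNIV p) j = \<epsilon> (p i) j" by (simp add: unit_vector_def)
qed

lemma perm_inv_\<epsilon>: assumes p: "p permutes {1..n}" and i: "i : {1..n}"
 shows "(inv\<^bsub>Z\<^esub> (\<epsilon> i)) \<circ> inv_into UNIV p = inv\<^bsub>Z\<^esub> (\<epsilon> (p i))"
proof
 fix j
 have "inv_into UNIV p j : {1..n} \<longleftrightarrow> j : {1..n}"
  using permutes_in_image[OF permutes_inv[OF p]] by simp
 moreover have "inv_into UNIV p j = i \<longleftrightarrow> j = p i" using permutes_inv_eq[OF p] by auto
 ultimately show "((inv\<^bsub>Z\<^esub> (\<epsilon> i)) \<circ> inv_into UNIV p) j = (inv\<^bsub>Z\<^esub> (\<epsilon> (p i))) j"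
  unfolding inv_Z[OF \<epsilon>_Z] by (simp add: unit_vector_def)
qed

lemma perm_in: "[|p permutes {1..n}; i : {1..n}|] ==> p i : {1..n}"
 using permutes_in_image[of p "{1..n}" i] by simp

abbreviation cj where "cj \<equiv> skew_conj k F Z act"

lemma cj_single:
 assumes p: "p permutes {1..n}" and \<nu>: "\<nu> : car Z" and z: "z : car F"
 shows "cj (pa p) (single F \<nu> z) = single F (\<nu> \<circ> inv_into UNIV p) (pa p z)"
proof -
 have g: "pa p : pa ` car (sym_group n)" using p by (simp add: sym_group_carrier)
 have "SG.cnj (pa p) \<nu> = \<nu> \<circ> inv_into UNIV p"
  by (rule SG.cnj_unique[OF perm_Z[OF p \<nu>]]) (rule perm_act_shift[OF p \<nu>, symmetric])
 then show ?thesis using SG.conj_single[OF g \<nu> z] by simp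
qed

lemma cj_gens:
 assumes p: "p permutes {1..n}" and i: "i : {1..n}"
 shows "cj (pa p) (fi i xp) = fi (p i) xp" and "cj (pa p) (fi i xm) = fi (p i) xm"
proof -
 note pi = perm_in[OF p i]
 have "pa p : alg_hom k F F" using pa_aut[OF p] by (simp add: carrier_alg_aut)
 then have "pa p 1\<^sub>F = 1\<^sub>F" by (rule alg_homD(5))
 then show "cj (pa p) (fi i xp) = fi (p i) xp"
  using cj_single[OF p \<epsilon>_Z, of "1\<^sub>F"] by (simp add: fi(3)[OF i] fi(3)[OF pi] perm_\<epsilon>[OF p i])
 have "pa p (ob (fac i a)) = ob (fac (p i) a)"
  using pa_ob[OF p facD(2)[OF i a]] D.tensor_perm_in_factor[OF p a] by simp
 then show "cj (pa p) (fi i xm) = fi (p i) xm"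
  using cj_single[OF p inv_\<epsilon>_Z fac_F[OF i a]] by (simp add: fi(4)[OF i] fi(4)[OF pi] perm_inv_\<epsilon>[OF p i])
qed

text \<open>Both sides are ring homomorphisms in \<open>t\<close>, so base elements and the X_i^+
  and X_i^- decide.\<close>

lemma equivariant:
 assumes p: "p permutes {1..n}" and t: "t : car P"
 shows "\<phi> (pq p t) = cj (pa p) (\<phi> t)"
proof (rule ring_hom_TQ_eqI[OF _ _ _ _ _ t])
 have g: "pa p : pa ` car (sym_group n)" using p by (simp add: sym_group_carrier)
 show "(%t. \<phi> (pq p t)) : ring_hom P S"
  by (rule alg_homD(1)[OF alg_hom_compose[OF Q.tensor_perm_hom(1)[OF p] \<phi>(1)]])
 show "(%t. cj (pa p) (\<phi> t)) : ring_hom P S"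
  using ring_hom_trans[OF \<phi>D(1) SG.conj_hom[OF g]] by (simp add: o_def)
next
 fix u assume u: "u : car T"
 note pu = alg_homD(2)[OF pm_hom[OF p] u]
 have "1\<^sub>Z \<circ> inv_into UNIV p = 1\<^sub>Z"
 proof
  fix j
  have "inv_into UNIV p j : {1..n} \<longleftrightarrow> j : {1..n}"
   using permutes_in_image[OF permutes_inv[OF p]] by simp
  then show "(1\<^sub>Z \<circ> inv_into UNIV p) j = 1\<^sub>Z j" by (simp add: Z_simps)
 qed
 then show "\<phi> (pq p (jj u)) = cj (pa p) (\<phi> (jj u))"
  using cj_single[OF p Z.one_closed ob_F[OF u]]
  by (simp add: pq_jj[OF p u] \<phi>_jj[OF pu] \<phi>_jj[OF u] pa_ob[OF p u])
next
 fix i assume i: "i : {1..n}"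
 note pi = perm_in[OF p i]
 show "\<phi> (pq p (fq i xp)) = cj (pa p) (\<phi> (fq i xp))"
  "\<phi> (pq p (fq i xm)) = cj (pa p) (\<phi> (fq i xm))"
  using gen_closed \<phi>_factor[OF i] \<phi>_factor[OF pi] Q.tensor_perm_in_factor[OF p] cj_gens[OF p i] by simp_all
qed

lemma embedding: "gwa_power_embedding k n D a \<sigma> \<phi>"
proof (rule gwa_power_embedding.intro, unfold shift_ring_def)
 show "\<phi> : ring_hom P S" by (rule \<phi>D(1))
 show "\<phi> (c \<odot>\<^sub>P t) = c \<odot>\<^sub>S \<phi> t" if "c : car k" "t : car P" for c t using \<phi>D(6) that .
 show "inj_on \<phi> (car P)" by (rule \<phi>_inj)
 show "\<phi> (tensor_map k n Q (%x. \<lambda>i\<in>{1..n}. cf (x i)) t) = \<iota> (ob t)" if "t : car T" for t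
  using \<phi>_jj[OF that] by (simp only: jj_def)
 show "\<phi> (fq i xp) = single F (\<epsilon> i) 1\<^sub>F" if "i : {1..n}" for i
  using \<phi>_factor[OF that gen_closed(2)] fi(3)[OF that] by simp
 show "\<phi> (fq i xm) = single F (inv\<^bsub>Z\<^esub> (\<epsilon> i)) (ob (fac i a))" if "i : {1..n}" for i
  using \<phi>_factor[OF that gen_closed(3)] fi(4)[OF that] by simp
 show "\<phi> (pq p t) = cj (pa p) (\<phi> t)" if "p permutes {1..n}" "t : car P" for p t
  using equivariant[OF that] .
qed

end

section \<open>Invariants of the tensor power\<close>

context gwa_power
begin

abbreviation px where "px i \<equiv> fi i xp"

abbreviation py where "py i \<equiv> fi i xm"

lemma px_S: "i : {1..n} ==> px i : car S" and py_S: "i : {1..n} ==> py i : car S"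
 using fiD(2) gen_closed by auto

text \<open>Powers of X_i^+ and X_j^- commute for different positions, so all plus-factors can be
  gathered on the left; within one position the order is already this one.\<close>

lemma \<phi>_E_split:
 "\<phi> (E \<nu>) = list_prod S [1..<Suc n] (%i. px i [^]\<^sub>S nat (\<nu> i)) \<otimes>\<^sub>S
  list_prod S [1..<Suc n] (%i. py i [^]\<^sub>S nat (- \<nu> i))"
proof -
 have "\<phi> (E \<nu>) = list_prod S [1..<Suc n] (%i. px i [^]\<^sub>S nat (\<nu> i) *\<^sub>S py i [^]\<^sub>S nat (- \<nu> i))"
  unfolding \<phi>_E by (rule list_prod_cong) (auto intro!: fi_normal)
 also have "\<dots> = list_prod S [1..<Suc n] (%i. px i [^]\<^sub>S nat (\<nu> i)) \<otimes>\<^sub>S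
  list_prod S [1..<Suc n] (%i. py i [^]\<^sub>S nat (- \<nu> i))"
 proof (rule ring.list_prod_mult[OF ring_S distinct_upt])
  fix i j assume "i : set [1..<Suc n]" "j : set [1..<Suc n]" and ne: "i ~= j"
  then have i: "i : {1..n}" and j: "j : {1..n}" by auto
  have p: "px i [^]\<^sub>S m = fi i (xp [^]\<^sub>Q m)" "py j [^]\<^sub>S m = fi j (xm [^]\<^sub>Q m)" for m :: nat
   using ring_hom_pow[OF fiD(1)[OF i] gen_closed(2)] ring_hom_pow[OF fiD(1)[OF j] gen_closed(3)] by simp_all
  show "px i [^]\<^sub>S nat (\<nu> i) *\<^sub>S py j [^]\<^sub>S nat (- \<nu> j) = py j [^]\<^sub>S nat (- \<nu> j) *\<^sub>S px i [^]\<^sub>S nat (\<nu> i)"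
   unfolding p by (rule fi_commute[OF i j ne]) (use gen_closed in simp_all)
 qed (use px_S py_S SG.W.SA.A.nat_pow_closed in auto)
 finally show ?thesis .
qed

lemma list_prod_monomial:
 assumes "\<And>i. i : {1..n} ==> f i : car S" "set xs \<subseteq> {1..n}"
 shows "list_prod S xs (%i. f i [^]\<^sub>S (m i :: nat)) : SG.W.SA.A.monomials (f ` {1..n})"
 using assms(2)
proof (induction xs)
 case Nil
 show ?case using SG.W.SA.A.monomials.one by simp
next
 case (Cons i xs)
 have fS: "f ` {1..n} \<subseteq> car S" using assms(1) by auto
 have fi: "f i : f ` {1..n}" using Cons.prems by auto
 have "1\<^sub>S *\<^sub>S f i [^]\<^sub>S m i : SG.W.SA.A.monomials (f ` {1..n})"
  by (rule SG.W.SA.A.monomials_pow[OF SG.W.SA.A.monomials.one fi fS])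
 then have "f i [^]\<^sub>S m i : SG.W.SA.A.monomials (f ` {1..n})"
  using subsetD[OF fS fi] by simp
 then show ?case using SG.W.SA.A.monomials_mult[OF _ _ fS] Cons by simp
qed

text \<open>The image of \<open>jj u\<close> times \<open>E \<nu>\<close> is a single coefficient
  from the tensor power at a single exponent. Statements on all of the image are reduced to these
  spanning elements.\<close>

lemma order_data:
 assumes H: "subgroup H (sym_group n)"
 shows "galois_order_data k F (ob ` car T) (pa ` H) Z act (\<phi> ` car P) {1..n} px py"
proof -
 interpret GS: galois_skew k F "ob ` car T" "pa ` H" Z act by (rule galois_skew[OF H])
 have Hp: "p permutes {1..n}" if "p : H" for p
  using subgroup.subset[OF H] that by (auto simp: sym_group_carrier)
 interpret \<phi>: ring_hom_ring P S \<phi> by (intro ring_hom_ringI2 ring_TQ ring_S \<phi>D(1))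
 note TF = SG.W.SA.A.subring_subgroup
 have px_B: "px i : \<phi> ` car P" and py_B: "py i : \<phi> ` car P" if i: "i : {1..n}" for i
  using imageI[OF alg_homD(2)[OF Q.in_factor_hom[OF i] gen_closed(2)], of \<phi>]
   imageI[OF alg_homD(2)[OF Q.in_factor_hom[OF i] gen_closed(3)], of \<phi>]
   \<phi>_factor[OF i gen_closed(2)] \<phi>_factor[OF i gen_closed(3)] by simp_all
 have V_form: "\<exists>u s \<nu>. \<phi> z = single F \<nu> (ob u *\<^sub>F s) & u : car T & \<nu> : car Z & s : ob ` car T"
  if z: "z : V" for z
 proof -
  obtain u \<nu> where u: "z = jj u *\<^sub>P E \<nu>" "u : car T" "\<nu> : car Z" using z by (auto simp: V_def)
  obtain s where s: "s : ob ` car T" "\<phi> (E \<nu>) = single F \<nu> s" using mono_E[OF u(3)] unfolding mono_def by blast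
  have sF: "s : car F" using s(1) ob_F by auto
  have "\<phi> z = \<iota> (ob u) *\<^sub>S single F \<nu> s"
   using \<phi>D(3)[OF jjD(2)[OF u(2)] E_closed] \<phi>_jj[OF u(2)] s(2) u(1) by simp
  also have "\<dots> = single F \<nu> (ob u *\<^sub>F s)"
   using single_mult[OF Z.one_closed u(3) ob_F[OF u(2)] sF] act_one_F[OF sF] u(3) by simp
  finally show ?thesis using u s by blast
 qed
 show ?thesis
 proof (rule galois_order_data.intro[OF GS.galois_skew_axioms galois_order_data_axioms.intro])
  show "subring (\<phi> ` car P) S" by (rule \<phi>.img_is_subring[OF P.A.carrier_is_subring])
  show "u m : ob ` car T" if u: "u : \<phi> ` car P" for u m
  proof -
   obtain t where t: "u = \<phi> t" "t : car P" using u by blast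
   have "\<phi> t m : ob ` car T" using span_V[OF t(2)] V_carrier
   proof (induction t rule: P.A.span_induct)
    case zero
    show ?case using subringE(2)[OF base_subring] by (simp add: SG.W.zero_apply)
   next
    case (base z)
    obtain w s \<nu> where w: "\<phi> z = single F \<nu> (ob w *\<^sub>F s)" "w : car T" "s : ob ` car T"
     using V_form[OF base] by blast
    have "ob w *\<^sub>F s : ob ` car T" using subringE(6)[OF base_subring _ w(3)] w(2) by blast
    then show ?case unfolding w(1) using subringE(2)[OF base_subring] by (simp add: single_def)
   next
    case (neg z)
    have "\<phi> (\<ominus>\<^sub>P z) m +\<^sub>F \<phi> z m = (\<phi> (\<ominus>\<^sub>P z) +\<^sub>S \<phi> z) m" by (simp add: SG.W.add_apply)
    also have "\<dots> = 0\<^sub>F" using neg(1) by (simp add: SG.W.Sa.l_neg SG.W.zero_apply)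
    finally have "\<ominus>\<^sub>F \<phi> z m = \<phi> (\<ominus>\<^sub>P z) m"
     by (rule FA.A.minus_equality) (rule SG.W.carrierD(2)[OF \<phi>D(2)], simp add: neg(1))+
    then show ?case using subringE(5)[OF base_subring neg(2)] by simp
   next
    case (add y z)
    then show ?case using subringE(7)[OF base_subring] by (simp add: \<phi>D(4) SG.W.add_apply)
   qed
   then show ?thesis using t by simp
  qed
  show "\<iota> t : \<phi> ` car P" if "t : ob ` car T" for t
   using that \<phi>_jj jjD(2) by (force intro: rev_image_eqI)
  show "EX s:ob ` car T. s ~= 0\<^sub>F & single F \<nu> s : \<phi> ` car P" if \<nu>: "\<nu> : car Z" for \<nu>
   using mono_E[OF \<nu>] E_closed[of \<nu>] unfolding mono_def by (metis imageI)
  show "cj g u : \<phi> ` car P" if "g : pa ` H" "u : \<phi> ` car P" for g u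
  proof -
   obtain p t where p: "g = pa p" "p : H" and t: "u = \<phi> t" "t : car P"
    using \<open>g : pa ` H\<close> \<open>u : \<phi> ` car P\<close> by blast
   have "pq p t : car P" by (rule alg_homD(2)[OF Q.tensor_perm_hom(1)[OF Hp[OF p(2)]] t(2)])
   then show ?thesis using equivariant[OF Hp[OF p(2)] t(2)] p(1) t(1) by (metis imageI)
  qed
  show "px : {1..n} \<rightarrow> \<phi> ` car P" "py : {1..n} \<rightarrow> \<phi> ` car P" using px_B py_B by auto
  show "ALL i:{1..n}. ALL j:{1..n}. px i *\<^sub>S px j = px j *\<^sub>S px i"
   "ALL i:{1..n}. ALL j:{1..n}. py i *\<^sub>S py j = py j *\<^sub>S py i"
   using fi_commute gen_closed by metis+
  show "\<exists>t'\<in>ob ` car T. px i *\<^sub>S \<iota> t = \<iota> t' *\<^sub>S px i"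
   "\<exists>t'\<in>ob ` car T. \<iota> t *\<^sub>S px i = px i *\<^sub>S \<iota> t'"
   if i: "i : {1..n}" and t: "t : ob ` car T" for i t
  proof -
   have tF: "t : car F" using t ob_F by auto
   have one: "1\<^sub>F : car F" by simp
   have left: "px i *\<^sub>S \<iota> r = \<iota> (act (\<epsilon> i) r) *\<^sub>S px i" if "r : car F" for r
    using that act_F[OF \<epsilon>_Z[of i] that] \<epsilon>_Z[of i] one act_one_F by (simp add: fi(3)[OF i] single_mult)
   show "\<exists>t'\<in>ob ` car T. px i *\<^sub>S \<iota> t = \<iota> t' *\<^sub>S px i"
    using left[OF tF] SG.act_T[OF \<epsilon>_Z t] by blast
   \<comment> \<open>For the converse exchange the coefficient is first shifted backwards.\<close>
   have r: "act (inv\<^bsub>Z\<^esub> (\<epsilon> i)) t : car F" using act_F[OF inv_\<epsilon>_Z tF] .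
   have "act (\<epsilon> i) (act (inv\<^bsub>Z\<^esub> (\<epsilon> i)) t) = t"
    using SG.W.act_mult[OF \<epsilon>_Z inv_\<epsilon>_Z tF, of i i] act_one_F[OF tF] \<epsilon>_Z[of i] by simp
   then show "\<exists>t'\<in>ob ` car T. \<iota> t *\<^sub>S px i = px i *\<^sub>S \<iota> t'"
    using left[OF r] SG.act_T[OF inv_\<epsilon>_Z t, of i] by (metis (no_types))
  qed
  show "\<exists>\<tau>. bij_betw \<tau> {1..n} {1..n} & (ALL i:{1..n}. cj g (px i) = px (\<tau> i)) &
    (ALL i:{1..n}. cj g (py i) = py (\<tau> i))" if g: "g : pa ` H" for g
  proof -
   obtain p where p: "g = pa p" "p : H" using g by blast
   then show ?thesis using cj_gens[OF Hp] permutes_imp_bij[OF Hp] by (intro exI[of _ p]) auto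
  qed
  let ?Y = "{\<iota> t *\<^sub>S p *\<^sub>S q | t p q. t : ob ` car T &
      p : SG.W.SA.A.monomials (px ` {1..n}) & q : SG.W.SA.A.monomials (py ` {1..n})}"
  have pxS: "px ` {1..n} \<subseteq> car S" and pyS: "py ` {1..n} \<subseteq> car S" using px_S py_S by auto
  have YS: "?Y \<subseteq> car S"
   using SG.W.SA.A.monomials_closed[OF _ pxS] SG.W.SA.A.monomials_closed[OF _ pyS] single_S[OF Z.one_closed ob_F] by auto
  show "\<phi> ` car P \<subseteq> SG.W.SA.A.span ?Y"
  proof
   fix w assume "w : \<phi> ` car P"
   then obtain t where t: "w = \<phi> t" "t : car P" by blast
   have "\<phi> t : SG.W.SA.A.span ?Y" using span_V[OF t(2)] V_carrier
   proof (induction t rule: P.A.span_induct)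
    case zero
    show ?case using SG.W.SA.A.span_simps(3) by simp
   next
    case (base z)
    then obtain u \<nu> where u: "z = jj u *\<^sub>P E \<nu>" "u : car T" "\<nu> : car Z" by (auto simp: V_def)
    let ?p = "list_prod S [1..<Suc n] (%i. px i [^]\<^sub>S nat (\<nu> i))"
     and ?q = "list_prod S [1..<Suc n] (%i. py i [^]\<^sub>S nat (- \<nu> i))"
    have sub: "set [1..<Suc n] \<subseteq> {1..n}" by auto
    have m: "?p : SG.W.SA.A.monomials (px ` {1..n})" "?q : SG.W.SA.A.monomials (py ` {1..n})"
     by (rule list_prod_monomial[OF px_S sub], assumption)
      (rule list_prod_monomial[OF py_S sub], assumption)
    have "\<phi> z = \<iota> (ob u) *\<^sub>S (?p *\<^sub>S ?q)"
     using \<phi>D(3)[OF jjD(2)[OF u(2)] E_closed] by (simp only: u(1) \<phi>_jj[OF u(2)] \<phi>_E_split)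
    also have "\<dots> = \<iota> (ob u) *\<^sub>S ?p *\<^sub>S ?q"
     by (rule SG.W.SA.A.m_assoc[symmetric, OF single_S[OF Z.one_closed ob_F[OF u(2)]]
        SG.W.SA.A.monomials_closed[OF m(1) pxS] SG.W.SA.A.monomials_closed[OF m(2) pyS]])
    finally show ?case using m u(2) by (intro SG.W.SA.A.span_simps(2)) blast
   next
    case (neg z)
    show ?case
     using subgroup.m_inv_closed[OF SG.W.SA.A.span_subgroup[OF YS] neg(2)]
     unfolding ring_hom_zero_neg(2)[OF \<phi>D(1) ring_TQ ring_S neg(1)] by (simp only: a_inv_def)
   next
    case (add y z)
    then show ?case using SG.W.SA.A.span_simps(4)[OF add(3,4)] by simp
   qed
   then show "w : SG.W.SA.A.span ?Y" using t by simp
  qed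
 qed simp
qed

text \<open>Injectivity of \<open>ob\<close> lets invariance under the automorphisms of
  \<open>F\<close> be tested on tensors.\<close>

lemma invariants_base:
 assumes H: "subgroup H (sym_group n)"
 shows "galois_data.\<Gamma> (ob ` car T) (pa ` H) = ob ` tensor_invariants k n D H"
proof -
 interpret GS: galois_skew k F "ob ` car T" "pa ` H" Z act by (rule galois_skew[OF H])
 have Hp: "p permutes {1..n}" if "p : H" for p
  using subgroup.subset[OF H] that by (auto simp: sym_group_carrier)
 have "(ALL g:pa ` H. g (ob t) = ob t) \<longleftrightarrow> (ALL p:H. pm p t = t)" if t: "t : car T" for t
 proof -
  have "pa p (ob t) = ob t \<longleftrightarrow> pm p t = t" if p: "p : H" for p
   unfolding pa_ob[OF Hp[OF p] t]
   using inj_on_eq_iff[OF TD.of_base_inj alg_homD(2)[OF pm_hom[OF Hp[OF p]] t] t] .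
  then show ?thesis by auto
 qed
 then show ?thesis unfolding GS.\<Gamma>_def tensor_invariants_def by auto
qed

text \<open>Equivariance and injectivity of \<phi> turn invariance under conjugation into invariance
  of tensors.\<close>

lemma invariants_order:
 assumes H: "subgroup H (sym_group n)"
 shows "\<phi> ` car P \<inter> skew_invariants k F Z act (pa ` H) = \<phi> ` tensor_invariants k n Q H"
proof -
 have Hp: "p permutes {1..n}" if "p : H" for p
  using subgroup.subset[OF H] that by (auto simp: sym_group_carrier)
 have "\<phi> t : skew_invariants k F Z act (pa ` H) \<longleftrightarrow> (ALL p:H. pq p t = t)" if t: "t : car P" for t
 proof -
  have "cj (pa p) (\<phi> t) = \<phi> t \<longleftrightarrow> pq p t = t" if p: "p : H" for p
   unfolding equivariant[OF Hp[OF p] t, symmetric]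
   using inj_on_eq_iff[OF \<phi>_inj alg_homD(2)[OF Q.tensor_perm_hom(1)[OF Hp[OF p]] t] t] .
  then show ?thesis using \<phi>D(2)[OF t] by (auto simp: skew_invariants_def)
 qed
 then show ?thesis unfolding tensor_invariants_def by auto
qed

lemma principal_order:
 assumes H: "subgroup H (sym_group n)"
 shows "principal_galois_order k F (pa ` H) Z act (ob ` tensor_invariants k n D H)
  (\<phi> ` tensor_invariants k n Q H)"
proof -
 interpret GO: galois_order_data k F "ob ` car T" "pa ` H" Z act "\<phi> ` car P" "{1..n}" px py
  by (rule order_data[OF H])
 show ?thesis
  using GO.principal_galois_order unfolding GO.U_def invariants_base[OF H] invariants_order[OF H] .
qed

end

theorem theorem4p12:
  fixes k :: "'k ring"
    and D :: "('k, 'd) module"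
    and a :: 'd
    and \<sigma> :: "'d \<Rightarrow> 'd"
    and n :: nat
    and G :: "(nat \<Rightarrow> nat) set"
  assumes "algebraically_closed k"
    and "\<And>m :: nat. m > 0 \<Longrightarrow> [m] \<cdot>\<^bsub>k\<^esub> \<one>\<^bsub>k\<^esub> \<noteq> \<zero>\<^bsub>k\<^esub>"
    and "algebra k D"
    and "domain D"
    and "fin_gen_ring_over D (scalars k D) (carrier D)"
    and "\<sigma> \<in> carrier (alg_aut k D)"
    and "\<And>m :: nat. m > 0 \<Longrightarrow> \<sigma> [^]\<^bsub>alg_aut k D\<^esub> m \<noteq> \<one>\<^bsub>alg_aut k D\<^esub>"
    and "a \<in> carrier D"
    and "\<And>d. \<lbrakk>d \<in> carrier D; a \<otimes>\<^bsub>D\<^esub> d = \<zero>\<^bsub>D\<^esub>\<rbrakk> \<Longrightarrow> d = \<zero>\<^bsub>D\<^esub>"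
    and "subgroup G (sym_group n)"
  shows "\<exists>\<phi>. gwa_power_embedding k n D a \<sigma> \<phi> \<and>
    principal_galois_order k (tensor_field k n D) (perm_act k n D ` G)
      (int_vectors n) (shift_act k n D \<sigma>)
      (of_base (tensor_power k n D) ` tensor_invariants k n D G)
      (\<phi> ` tensor_invariants k n (gwa k D a \<sigma>) G)"
proof -
  interpret D: domain D by fact
  \<comment> \<open>Regularity of \<open>a\<close>, tested on \<open>d = 1\<close>.\<close>
  have "a \<noteq> \<zero>\<^bsub>D\<^esub>" using assms(9)[OF D.one_closed] D.one_not_zero by auto
  note facts = assms this
  interpret gwa_power k D n a \<sigma>
    by (intro gwa_power.intro affine_domain.intro weyl_data.intro gwa_power_axioms.intro) (fact facts)+
  show ?thesis using embedding principal_order[OF assms(10)] by blast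
qed

end
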